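(* Let $M$ be a compact smooth manifold and let $E\to M$ be a Courant algebroid. Let $J_0$ and $J_1$ be two generalized complex structures on $E$ which are connected by a smooth family $t\mapsto J_t$ ($t\in[0,1]$) of generalized complex structures on $E$. Let $L_t\subset E\otimes\mathbb{C}$ be the $+i$-eigenbundle of $J_t$, let $d_{L_t}$ be the Lie algebroid differential of $L_t$, and let $\dot\omega_t\in\Gamma(\wedge^2L_t^* )$ be defined by $\dot\omega_t(v,w)=\langle v,\dot J_t w\rangle$ for $v,w\in\Gamma(L_t)$, where $\dot J_t=\frac{d}{dt}J_t$. Assume that there exists a smooth path $t\mapsto\beta_t\in\Gamma(L_t^* )$ such that $\dot\omega_t=d_{L_t}\beta_t$ for all $t\in[0,1]$. Then $J_0$ and $J_1$ are isomorphic.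
   Context: A Courant algebroid is a vector bundle $E\to M$ with a non-degenerate symmetric bilinear form $\langle\cdot,\cdot\rangle$, a skew-symmetric bracket $[\![\cdot,\cdot]\!]$ on $\Gamma(E)$ and a smooth bundle map $\rho:E\to TM$ (the anchor), such that, with $\mathcal{D}:C^\infty(M)\to\Gamma(E)$ defined by $\langle\mathcal{D}f,a\rangle=\frac12\rho(a)f$, one has for all $a,b,c\in\Gamma(E)$, $f,g\in C^\infty(M)$: (i) $\rho([\![a,b]\!])=[\rho(a),\rho(b)]$; (ii) $[\![[\![a,b]\!],c]\!]+[\![[\![b,c]\!],a]\!]+[\![[\![c,a]\!],b]\!]=\frac13\mathcal{D}\big(\langle[\![a,b]\!],c\rangle+\langle[\![b,c]\!],a\rangle+\langle[\![c,a]\!],b\rangle\big)$; (iii) $[\![a,fb]\!]=f[\![a,b]\!]+(\rho(a)f)b-\langle a,b\rangle\mathcal{D}f$; (iv) $\rho\circ\mathcal{D}=0$, i.e. $\langle\mathcal{D}f,\mathcal{D}g\rangle=0$; (v) $\rho(a)\langle b,c\rangle=\langle[\![a,b]\!]+\mathcal{D}\langle a,b\rangle,c\rangle+\langle b,[\![a,c]\!]+\mathcal{D}\langle a,c\rangle\rangle$. A generalized complex structure on $E$ is a vector bundle map $J:E\to E$ over $\mathrm{id}_M$ with $J^2=-\mathrm{id}$, orthogonal for $\langle\cdot,\cdot\rangle$, and integrable: $[\![Jx,Jy]\!]-[\![x,y]\!]-J([\![Jx,y]\!]+[\![x,Jy]\!])=0$ for all $x,y\in\Gamma(E)$. The structure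 of $E$ is extended $\mathbb{C}$-linearly to $E\otimes\mathbb{C}=L\oplus\overline L$, where $L$ (resp. $\overline L$) is the $+i$- (resp. $-i$-) eigenbundle of $J$. $L$ and $\overline L$ are isotropic and their spaces of sections are closed under the bracket, so $L$ is a complex Lie algebroid with anchor $\rho|_L$ and bracket $[\![\cdot,\cdot]\!]$; $d_L:\Gamma(\wedge^\bullet L^* )\to\Gamma(\wedge^{\bullet+1}L^* )$ is the usual Lie algebroid (Chevalley–Eilenberg) differential. The pairing identifies $L^*\simeq\overline L$; smoothness in $t$ of $\beta_t\in\Gamma(L_t^* )$ means smoothness of the corresponding sections of $\overline{L_t}\subset E\otimes\mathbb{C}$. An automorphism of the Courant algebroid $E$ is a vector bundle automorphism, covering a diffeomorphism of $M$, that preserves pairing, bracket and anchor. Two generalized complex structures $J_0,J_1$ on $E$ are isomorphic if there is a Courant algebroid automorphism $\phi$ with $\phi^{-1}\circ J_1\circ\phi=J_0$. *)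

theory Defs
  imports "HOL-Analysis.Analysis"
begin

section \<open>Smooth functions\<close>

fun C_k_on :: "nat \<Rightarrow> 'x::real_normed_vector set \<Rightarrow> ('x \<Rightarrow> 'y::real_normed_vector) \<Rightarrow> bool" where
  "C_k_on 0 S f \<longleftrightarrow> continuous_on S f"
| "C_k_on (Suc k) S f \<longleftrightarrow> (\<forall>x\<in>S. f differentiable (at x)) \<and>
     (\<forall>v. C_k_on k S (\<lambda>x. frechet_derivative f (at x) v))"

text \<open>Smoothness on an arbitrary set means local extendability to a \<open>C\<^sup>\<infinity>\<close> function on an open
  set.  On an open set this is ordinary smoothness; on \<open>[0,1] \<times> V\<close> with \<open>V\<close> open it is the
  usual smoothness up to the boundary.\<close>

definition smooth_on :: "'x::real_normed_vector set \<Rightarrow> ('x \<Rightarrow> 'y::real_normed_vector) \<Rightarrow> bool" where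
  "smooth_on S f \<longleftrightarrow>
     (\<forall>x\<in>S. \<exists>U g. open U \<and> x \<in> U \<and> (\<forall>k. C_k_on k U g) \<and> (\<forall>y\<in>S \<inter> U. f y = g y))"

section \<open>Smooth manifolds\<close>

text \<open>The underlying space of the manifold is a whole type \<open>'a\<close>; its smooth structure is given by a
  (not necessarily maximal) atlas of charts \<open>(U, \<phi>)\<close>.  The model space is a finite-dimensional normed
  space \<open>'m\<close>.  In contrast to \<open>euclidean_space\<close> this does not exclude the zero space, that is,
  manifolds of dimension 0.  Every finite-dimensional normed space is complete and has the
  Heine--Borel property, so the sort of \<open>'m\<close> is no restriction.\<close>

type_synonym ('a, 'm) atlas = "('a set \<times> ('a \<Rightarrow> 'm)) set"

definition smooth_manifold ::
    "('a::{t2_space, second_countable_topology}, 'm::{banach, heine_borel}) atlas \<Rightarrow> bool" where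
  "smooth_manifold A \<longleftrightarrow>
     (\<exists>B::'m set. finite B \<and> span B = UNIV) \<and>
     (\<forall>p. \<exists>(U, \<phi>)\<in>A. p \<in> U) \<and>
     (\<forall>(U, \<phi>)\<in>A. open U \<and> open (\<phi> ` U) \<and> homeomorphism U (\<phi> ` U) \<phi> (inv_into U \<phi>)) \<and>
     (\<forall>(U, \<phi>)\<in>A. \<forall>(V, \<psi>)\<in>A. smooth_on (\<phi> ` (U \<inter> V)) (\<psi> \<circ> inv_into U \<phi>))"

definition smooth_fun_on ::
    "('a, 'm::real_normed_vector) atlas \<Rightarrow> 'a set \<Rightarrow> ('a \<Rightarrow> real) \<Rightarrow> bool" where
  "smooth_fun_on A W f \<longleftrightarrow> (\<forall>(U, \<phi>)\<in>A. smooth_on (\<phi> ` (U \<inter> W)) (f \<circ> inv_into U \<phi>))"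

abbreviation smooth_fun :: "('a, 'm::real_normed_vector) atlas \<Rightarrow> ('a \<Rightarrow> real) \<Rightarrow> bool" where
  "smooth_fun A \<equiv> smooth_fun_on A UNIV"

text \<open>Joint smoothness of \<open>(t, p) \<mapsto> g t p\<close> on \<open>[0,1] \<times> W\<close>.\<close>

definition smooth_path_on ::
    "('a, 'm::real_normed_vector) atlas \<Rightarrow> 'a set \<Rightarrow> (real \<Rightarrow> 'a \<Rightarrow> real) \<Rightarrow> bool" where
  "smooth_path_on A W g \<longleftrightarrow>
     (\<forall>(U, \<phi>)\<in>A. smooth_on ({0..1} \<times> \<phi> ` (U \<inter> W)) (\<lambda>(t, x). g t (inv_into U \<phi> x)))"

definition smooth_map ::
    "('a::topological_space, 'm::real_normed_vector) atlas \<Rightarrow> ('a \<Rightarrow> 'a) \<Rightarrow> bool" where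
  "smooth_map A F \<longleftrightarrow> continuous_on UNIV F \<and>
     (\<forall>(U, \<phi>)\<in>A. \<forall>(V, \<psi>)\<in>A. smooth_on (\<phi> ` (U \<inter> F -` V)) (\<psi> \<circ> F \<circ> inv_into U \<phi>))"

definition diffeo :: "('a::topological_space, 'm::real_normed_vector) atlas \<Rightarrow> ('a \<Rightarrow> 'a) \<Rightarrow> bool" where
  "diffeo A F \<longleftrightarrow> bij F \<and> smooth_map A F \<and> smooth_map A (inv F)"

text \<open>Tangent vectors at \<open>p\<close> are the derivations at \<open>p\<close> of the algebra of smooth functions.  Their
  values on non-smooth functions are irrelevant.\<close>

definition tangent_vector ::
    "('a, 'm::real_normed_vector) atlas \<Rightarrow> 'a \<Rightarrow> (('a \<Rightarrow> real) \<Rightarrow> real) \<Rightarrow> bool" where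
  "tangent_vector A p D \<longleftrightarrow>
     (\<forall>f g. smooth_fun A f \<longrightarrow> smooth_fun A g \<longrightarrow>
        D (\<lambda>q. f q + g q) = D f + D g \<and>
        D (\<lambda>q. f q * g q) = f p * D g + g p * D f) \<and>
     (\<forall>c f. smooth_fun A f \<longrightarrow> D (\<lambda>q. c * f q) = c * D f)"

section \<open>Smooth vector bundles\<close>

text \<open>The fibre over \<open>p\<close> is a linear subspace \<open>fib E p\<close> of a vector space \<open>'v\<close>.  This is only a
  convenient way to equip each fibre with its own vector space structure (any family of
  finite-dimensional vector spaces embeds into its direct sum): fibres over different points are not
  related through \<open>'v\<close>, and the topology and smooth structure of the bundle come solely from the
  local trivializations, given as local frames \<open>(U, e)\<close>, where \<open>e i p\<close> for \<open>i < vb_rank E\<close>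
  is a basis of the fibre over \<open>p \<in> U\<close>.  The norm of \<open>'v\<close> is used only to differentiate curves
  inside a single fibre, which is finite-dimensional, so that the derivative does not depend on it.\<close>

record ('a, 'v) vbundle =
  vb_rank :: nat
  fib :: "'a \<Rightarrow> 'v set"
  frames :: "('a set \<times> (nat \<Rightarrow> 'a \<Rightarrow> 'v)) set"

definition coord :: "nat \<Rightarrow> (nat \<Rightarrow> 'a \<Rightarrow> 'v::real_vector) \<Rightarrow> 'a \<Rightarrow> 'v \<Rightarrow> nat \<Rightarrow> real" where
  "coord r e p x i = representation ((\<lambda>j. e j p) ` {..<r}) x (e i p)"

definition vector_bundle ::
    "('a::topological_space, 'm::real_normed_vector) atlas \<Rightarrow> ('a, 'v::real_vector, 'z) vbundle_scheme \<Rightarrow> bool" where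
  "vector_bundle A E \<longleftrightarrow>
     (\<forall>p. subspace (fib E p)) \<and>
     (\<forall>p. \<exists>(U, e)\<in>frames E. p \<in> U) \<and>
     (\<forall>(U, e)\<in>frames E. open U \<and>
        (\<forall>p\<in>U. inj_on (\<lambda>i. e i p) {..<vb_rank E} \<and>
                independent ((\<lambda>i. e i p) ` {..<vb_rank E}) \<and>
                span ((\<lambda>i. e i p) ` {..<vb_rank E}) = fib E p)) \<and>
     (\<forall>(U, e)\<in>frames E. \<forall>(V, h)\<in>frames E. \<forall>i<vb_rank E. \<forall>j<vb_rank E.
        smooth_fun_on A (U \<inter> V) (\<lambda>p. coord (vb_rank E) h p (e i p) j))"

definition sections ::
    "('a, 'm::real_normed_vector) atlas \<Rightarrow> ('a, 'v::real_vector, 'z) vbundle_scheme \<Rightarrow> ('a \<Rightarrow> 'v) set" where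
  "sections A E = {s. (\<forall>p. s p \<in> fib E p) \<and>
     (\<forall>(U, e)\<in>frames E. \<forall>i<vb_rank E. smooth_fun_on A U (\<lambda>p. coord (vb_rank E) e p (s p) i))}"

definition smooth_section_path ::
    "('a, 'm::real_normed_vector) atlas \<Rightarrow> ('a, 'v::real_vector, 'z) vbundle_scheme \<Rightarrow>
      (real \<Rightarrow> 'a \<Rightarrow> 'v) \<Rightarrow> bool" where
  "smooth_section_path A E s \<longleftrightarrow>
     (\<forall>t\<in>{0..1}. \<forall>p. s t p \<in> fib E p) \<and>
     (\<forall>(U, e)\<in>frames E. \<forall>i<vb_rank E.
        smooth_path_on A U (\<lambda>t p. coord (vb_rank E) e p (s t p) i))"

definition linear_between :: "'v::real_vector set \<Rightarrow> 'w::real_vector set \<Rightarrow> ('v \<Rightarrow> 'w) \<Rightarrow> bool" where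
  "linear_between V W f \<longleftrightarrow> (\<forall>x\<in>V. f x \<in> W) \<and>
     (\<forall>x\<in>V. \<forall>y\<in>V. f (x + y) = f x + f y) \<and> (\<forall>c. \<forall>x\<in>V. f (c *\<^sub>R x) = c *\<^sub>R f x)"

definition bundle_endo ::
    "('a, 'm::real_normed_vector) atlas \<Rightarrow> ('a, 'v::real_vector, 'z) vbundle_scheme \<Rightarrow>
      ('a \<Rightarrow> 'v \<Rightarrow> 'v) \<Rightarrow> bool" where
  "bundle_endo A E J \<longleftrightarrow>
     (\<forall>p. linear_between (fib E p) (fib E p) (J p)) \<and>
     (\<forall>(U, e)\<in>frames E. \<forall>i<vb_rank E. \<forall>j<vb_rank E.
        smooth_fun_on A U (\<lambda>p. coord (vb_rank E) e p (J p (e i p)) j))"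

definition smooth_endo_path ::
    "('a, 'm::real_normed_vector) atlas \<Rightarrow> ('a, 'v::real_vector, 'z) vbundle_scheme \<Rightarrow>
      (real \<Rightarrow> 'a \<Rightarrow> 'v \<Rightarrow> 'v) \<Rightarrow> bool" where
  "smooth_endo_path A E J \<longleftrightarrow>
     (\<forall>t\<in>{0..1}. bundle_endo A E (J t)) \<and>
     (\<forall>(U, e)\<in>frames E. \<forall>i<vb_rank E. \<forall>j<vb_rank E.
        smooth_path_on A U (\<lambda>t p. coord (vb_rank E) e p (J t p (e i p)) j))"

text \<open>A vector bundle automorphism \<open>\<phi>\<close> covering the diffeomorphism \<open>F\<close>.\<close>

definition bundle_auto ::
    "('a::topological_space, 'm::real_normed_vector) atlas \<Rightarrow> ('a, 'v::real_vector, 'z) vbundle_scheme \<Rightarrow>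
      ('a \<Rightarrow> 'a) \<Rightarrow> ('a \<Rightarrow> 'v \<Rightarrow> 'v) \<Rightarrow> bool" where
  "bundle_auto A E F \<phi> \<longleftrightarrow> diffeo A F \<and>
     (\<forall>p. linear_between (fib E p) (fib E (F p)) (\<phi> p) \<and>
          bij_betw (\<phi> p) (fib E p) (fib E (F p))) \<and>
     (\<forall>(U, e)\<in>frames E. \<forall>(V, h)\<in>frames E. \<forall>i<vb_rank E. \<forall>j<vb_rank E.
        smooth_fun_on A (U \<inter> F -` V) (\<lambda>p. coord (vb_rank E) h (F p) (\<phi> p (e i p)) j))"

definition pushforward :: "('a \<Rightarrow> 'a) \<Rightarrow> ('a \<Rightarrow> 'v \<Rightarrow> 'v) \<Rightarrow> ('a \<Rightarrow> 'v) \<Rightarrow> 'a \<Rightarrow> 'v" where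
  "pushforward F \<phi> s = (\<lambda>q. \<phi> (inv F q) (s (inv F q)))"

section \<open>Courant algebroids\<close>

text \<open>\<open>anchor E p x\<close> is the tangent vector \<open>\<rho>(x)\<close> at \<open>p\<close>, acting on functions.\<close>

record ('a, 'v) courant = "('a, 'v) vbundle" +
  pairing :: "'a \<Rightarrow> 'v \<Rightarrow> 'v \<Rightarrow> real"
  bracket :: "('a \<Rightarrow> 'v) \<Rightarrow> ('a \<Rightarrow> 'v) \<Rightarrow> 'a \<Rightarrow> 'v"
  anchor :: "'a \<Rightarrow> 'v \<Rightarrow> ('a \<Rightarrow> real) \<Rightarrow> real"

definition smooth_metric ::
    "('a, 'm::real_normed_vector) atlas \<Rightarrow> ('a, 'v::real_vector, 'z) courant_scheme \<Rightarrow> bool" where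
  "smooth_metric A E \<longleftrightarrow>
     (\<forall>p. \<forall>x\<in>fib E p. linear_between (fib E p) UNIV (pairing E p x)) \<and>
     (\<forall>p. \<forall>x\<in>fib E p. \<forall>y\<in>fib E p. pairing E p x y = pairing E p y x) \<and>
     (\<forall>p. \<forall>x\<in>fib E p. (\<forall>y\<in>fib E p. pairing E p x y = 0) \<longrightarrow> x = 0) \<and>
     (\<forall>(U, e)\<in>frames E. \<forall>i<vb_rank E. \<forall>j<vb_rank E.
        smooth_fun_on A U (\<lambda>p. pairing E p (e i p) (e j p)))"

definition smooth_anchor ::
    "('a, 'm::real_normed_vector) atlas \<Rightarrow> ('a, 'v::real_vector, 'z) courant_scheme \<Rightarrow> bool" where
  "smooth_anchor A E \<longleftrightarrow>
     (\<forall>p. \<forall>x\<in>fib E p. tangent_vector A p (anchor E p x)) \<and>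
     (\<forall>p f. smooth_fun A f \<longrightarrow> linear_between (fib E p) UNIV (\<lambda>x. anchor E p x f)) \<and>
     (\<forall>(U, e)\<in>frames E. \<forall>i<vb_rank E. \<forall>f. smooth_fun A f \<longrightarrow>
        smooth_fun_on A U (\<lambda>p. anchor E p (e i p) f))"

definition skew_bracket ::
    "('a, 'm::real_normed_vector) atlas \<Rightarrow> ('a, 'v::real_vector, 'z) courant_scheme \<Rightarrow> bool" where
  "skew_bracket A E \<longleftrightarrow>
     (\<forall>a\<in>sections A E. \<forall>b\<in>sections A E. bracket E a b \<in> sections A E \<and>
        (\<forall>p. bracket E a b p = - bracket E b a p)) \<and>
     (\<forall>a\<in>sections A E. \<forall>b\<in>sections A E. \<forall>c\<in>sections A E. \<forall>p.
        bracket E a (\<lambda>q. b q + c q) p = bracket E a b p + bracket E a c p) \<and>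
     (\<forall>a\<in>sections A E. \<forall>b\<in>sections A E. \<forall>k::real. \<forall>p.
        bracket E a (\<lambda>q. k *\<^sub>R b q) p = k *\<^sub>R bracket E a b p)"

definition Dop :: "('a, 'v, 'z) courant_scheme \<Rightarrow> ('a \<Rightarrow> real) \<Rightarrow> 'a \<Rightarrow> 'v" where
  "Dop E f p = (THE d. d \<in> fib E p \<and> (\<forall>x\<in>fib E p. pairing E p d x = 1/2 * anchor E p x f))"

definition lie_der :: "('a, 'v, 'z) courant_scheme \<Rightarrow> ('a \<Rightarrow> 'v) \<Rightarrow> ('a \<Rightarrow> real) \<Rightarrow> 'a \<Rightarrow> real" where
  "lie_der E a f = (\<lambda>p. anchor E p (a p) f)"

definition pair_sec :: "('a, 'v, 'z) courant_scheme \<Rightarrow> ('a \<Rightarrow> 'v) \<Rightarrow> ('a \<Rightarrow> 'v) \<Rightarrow> 'a \<Rightarrow> real" where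
  "pair_sec E a b = (\<lambda>p. pairing E p (a p) (b p))"

definition courant_algebroid ::
    "('a::topological_space, 'm::real_normed_vector) atlas \<Rightarrow> ('a, 'v::real_vector, 'z) courant_scheme \<Rightarrow> bool" where
  "courant_algebroid A E \<longleftrightarrow>
     vector_bundle A E \<and> smooth_metric A E \<and> smooth_anchor A E \<and> skew_bracket A E \<and>
     (\<forall>a\<in>sections A E. \<forall>b\<in>sections A E. \<forall>f. smooth_fun A f \<longrightarrow>
        (\<forall>p. lie_der E (bracket E a b) f p
              = lie_der E a (lie_der E b f) p - lie_der E b (lie_der E a f) p)) \<and>
     (\<forall>a\<in>sections A E. \<forall>b\<in>sections A E. \<forall>c\<in>sections A E. \<forall>p.
        bracket E (bracket E a b) c p + bracket E (bracket E b c) a p + bracket E (bracket E c a) b p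
        = (1/3) *\<^sub>R Dop E (\<lambda>q. pair_sec E (bracket E a b) c q + pair_sec E (bracket E b c) a q
                              + pair_sec E (bracket E c a) b q) p) \<and>
     (\<forall>a\<in>sections A E. \<forall>b\<in>sections A E. \<forall>f. smooth_fun A f \<longrightarrow>
        (\<forall>p. bracket E a (\<lambda>q. f q *\<^sub>R b q) p
              = f p *\<^sub>R bracket E a b p + lie_der E a f p *\<^sub>R b p - pair_sec E a b p *\<^sub>R Dop E f p)) \<and>
     (\<forall>f g. smooth_fun A f \<longrightarrow> smooth_fun A g \<longrightarrow> (\<forall>p. anchor E p (Dop E f p) g = 0)) \<and>
     (\<forall>a\<in>sections A E. \<forall>b\<in>sections A E. \<forall>c\<in>sections A E. \<forall>p.
        lie_der E a (pair_sec E b c) p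
        = pairing E p (bracket E a b p + Dop E (pair_sec E a b) p) (c p)
          + pairing E p (b p) (bracket E a c p + Dop E (pair_sec E a c) p))"

definition courant_auto ::
    "('a::topological_space, 'm::real_normed_vector) atlas \<Rightarrow> ('a, 'v::real_vector, 'z) courant_scheme \<Rightarrow>
      ('a \<Rightarrow> 'a) \<Rightarrow> ('a \<Rightarrow> 'v \<Rightarrow> 'v) \<Rightarrow> bool" where
  "courant_auto A E F \<phi> \<longleftrightarrow> bundle_auto A E F \<phi> \<and>
     (\<forall>p. \<forall>x\<in>fib E p. \<forall>y\<in>fib E p. pairing E (F p) (\<phi> p x) (\<phi> p y) = pairing E p x y) \<and>
     (\<forall>a\<in>sections A E. \<forall>b\<in>sections A E.
        bracket E (pushforward F \<phi> a) (pushforward F \<phi> b) = pushforward F \<phi> (bracket E a b)) \<and>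
     (\<forall>p. \<forall>x\<in>fib E p. \<forall>f. smooth_fun A f \<longrightarrow> anchor E (F p) (\<phi> p x) f = anchor E p x (f \<circ> F))"

section \<open>Generalized complex structures\<close>

definition gen_complex ::
    "('a, 'm::real_normed_vector) atlas \<Rightarrow> ('a, 'v::real_vector, 'z) courant_scheme \<Rightarrow>
      ('a \<Rightarrow> 'v \<Rightarrow> 'v) \<Rightarrow> bool" where
  "gen_complex A E J \<longleftrightarrow> bundle_endo A E J \<and>
     (\<forall>p. \<forall>x\<in>fib E p. J p (J p x) = - x) \<and>
     (\<forall>p. \<forall>x\<in>fib E p. \<forall>y\<in>fib E p. pairing E p (J p x) (J p y) = pairing E p x y) \<and>
     (\<forall>x\<in>sections A E. \<forall>y\<in>sections A E. \<forall>p.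
        bracket E (\<lambda>q. J q (x q)) (\<lambda>q. J q (y q)) p - bracket E x y p
        - J p (bracket E (\<lambda>q. J q (x q)) y p + bracket E x (\<lambda>q. J q (y q)) p) = 0)"

definition gen_complex_isomorphic ::
    "('a::topological_space, 'm::real_normed_vector) atlas \<Rightarrow> ('a, 'v::real_vector, 'z) courant_scheme \<Rightarrow>
      ('a \<Rightarrow> 'v \<Rightarrow> 'v) \<Rightarrow> ('a \<Rightarrow> 'v \<Rightarrow> 'v) \<Rightarrow> bool" where
  "gen_complex_isomorphic A E J\<^sub>0 J\<^sub>1 \<longleftrightarrow>
     (\<exists>F \<phi>. courant_auto A E F \<phi> \<and>
        (\<forall>p. \<forall>x\<in>fib E p. inv_into (fib E p) (\<phi> p) (J\<^sub>1 (F p) (\<phi> p x)) = J\<^sub>0 p x))"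

section \<open>Complexification\<close>

text \<open>The pair \<open>(x, y)\<close> stands for \<open>x + i y\<close> in the complexified fibre, whose underlying set is
  \<open>fib E p \<times> fib E p\<close>.\<close>

definition cscale :: "complex \<Rightarrow> 'v::real_vector \<times> 'v \<Rightarrow> 'v \<times> 'v" where
  "cscale c w = (Re c *\<^sub>R fst w - Im c *\<^sub>R snd w, Re c *\<^sub>R snd w + Im c *\<^sub>R fst w)"

definition pairing_C :: "('a, 'v, 'z) courant_scheme \<Rightarrow> 'a \<Rightarrow> 'v \<times> 'v \<Rightarrow> 'v \<times> 'v \<Rightarrow> complex" where
  "pairing_C E p v w =
     Complex (pairing E p (fst v) (fst w) - pairing E p (snd v) (snd w))
             (pairing E p (fst v) (snd w) + pairing E p (snd v) (fst w))"

definition bracket_C ::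
    "('a, 'v::real_vector, 'z) courant_scheme \<Rightarrow> ('a \<Rightarrow> 'v \<times> 'v) \<Rightarrow> ('a \<Rightarrow> 'v \<times> 'v) \<Rightarrow> 'a \<Rightarrow> 'v \<times> 'v" where
  "bracket_C E v w = (\<lambda>p.
     (bracket E (fst \<circ> v) (fst \<circ> w) p - bracket E (snd \<circ> v) (snd \<circ> w) p,
      bracket E (fst \<circ> v) (snd \<circ> w) p + bracket E (snd \<circ> v) (fst \<circ> w) p))"

definition anchor_C :: "('a, 'v, 'z) courant_scheme \<Rightarrow> 'a \<Rightarrow> 'v \<times> 'v \<Rightarrow> ('a \<Rightarrow> complex) \<Rightarrow> complex" where
  "anchor_C E p v h =
     Complex (anchor E p (fst v) (Re \<circ> h) - anchor E p (snd v) (Im \<circ> h))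
             (anchor E p (fst v) (Im \<circ> h) + anchor E p (snd v) (Re \<circ> h))"

definition eigenbundle ::
    "('a, 'v::real_vector, 'z) courant_scheme \<Rightarrow> ('a \<Rightarrow> 'v \<Rightarrow> 'v) \<Rightarrow> complex \<Rightarrow> 'a \<Rightarrow> ('v \<times> 'v) set" where
  "eigenbundle E J c p = {w \<in> fib E p \<times> fib E p. map_prod (J p) (J p) w = cscale c w}"

abbreviation Lbun :: "('a, 'v::real_vector, 'z) courant_scheme \<Rightarrow> ('a \<Rightarrow> 'v \<Rightarrow> 'v) \<Rightarrow> 'a \<Rightarrow> ('v \<times> 'v) set" where
  "Lbun E J \<equiv> eigenbundle E J \<i>"

abbreviation Lbar :: "('a, 'v::real_vector, 'z) courant_scheme \<Rightarrow> ('a \<Rightarrow> 'v \<Rightarrow> 'v) \<Rightarrow> 'a \<Rightarrow> ('v \<times> 'v) set" where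
  "Lbar E J \<equiv> eigenbundle E J (- \<i>)"

definition L_sections ::
    "('a, 'm::real_normed_vector) atlas \<Rightarrow> ('a, 'v::real_vector, 'z) courant_scheme \<Rightarrow>
      ('a \<Rightarrow> 'v \<Rightarrow> 'v) \<Rightarrow> ('a \<Rightarrow> 'v \<times> 'v) set" where
  "L_sections A E J = {v. fst \<circ> v \<in> sections A E \<and> snd \<circ> v \<in> sections A E \<and> (\<forall>p. v p \<in> Lbun E J p)}"

definition complex_linear_on :: "('v::real_vector \<times> 'v) set \<Rightarrow> ('v \<times> 'v \<Rightarrow> complex) \<Rightarrow> bool" where
  "complex_linear_on S \<xi> \<longleftrightarrow>
     (\<forall>v\<in>S. \<forall>w\<in>S. \<xi> (v + w) = \<xi> v + \<xi> w) \<and> (\<forall>c. \<forall>v\<in>S. \<xi> (cscale c v) = c * \<xi> v)"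

text \<open>A smooth path \<open>t \<mapsto> \<beta> t\<close> of sections of the duals of the \<open>+i\<close>-eigenbundles of \<open>J t\<close>: the sections
  \<open>b t\<close> of the conjugate bundles that represent \<open>\<beta> t\<close> via the pairing are jointly smooth.\<close>

definition smooth_dual_path ::
    "('a, 'm::real_normed_vector) atlas \<Rightarrow> ('a, 'v::real_vector, 'z) courant_scheme \<Rightarrow>
      (real \<Rightarrow> 'a \<Rightarrow> 'v \<Rightarrow> 'v) \<Rightarrow> (real \<Rightarrow> 'a \<Rightarrow> 'v \<times> 'v \<Rightarrow> complex) \<Rightarrow> bool" where
  "smooth_dual_path A E J \<beta> \<longleftrightarrow>
     (\<forall>t\<in>{0..1}. \<forall>p. complex_linear_on (Lbun E (J t) p) (\<beta> t p)) \<and>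
     (\<exists>b. smooth_section_path A E (\<lambda>t p. fst (b t p)) \<and> smooth_section_path A E (\<lambda>t p. snd (b t p)) \<and>
        (\<forall>t\<in>{0..1}. \<forall>p. b t p \<in> Lbar E (J t) p \<and>
           (\<forall>v\<in>Lbun E (J t) p. \<beta> t p v = pairing_C E p (b t p) v)))"

text \<open>The Lie algebroid differential in degree one, evaluated on two sections.\<close>

definition d_L ::
    "('a, 'v::real_vector, 'z) courant_scheme \<Rightarrow> ('a \<Rightarrow> 'v \<times> 'v \<Rightarrow> complex) \<Rightarrow>
      ('a \<Rightarrow> 'v \<times> 'v) \<Rightarrow> ('a \<Rightarrow> 'v \<times> 'v) \<Rightarrow> 'a \<Rightarrow> complex" where
  "d_L E \<xi> v w p =
     anchor_C E p (v p) (\<lambda>q. \<xi> q (w q)) - anchor_C E p (w p) (\<lambda>q. \<xi> q (v q))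
     - \<xi> p (bracket_C E v w p)"

definition J_dot ::
    "(real \<Rightarrow> 'a \<Rightarrow> 'v \<Rightarrow> 'v::real_normed_vector) \<Rightarrow> real \<Rightarrow> 'a \<Rightarrow> 'v \<Rightarrow> 'v" where
  "J_dot J t p x = vector_derivative (\<lambda>s. J s p x) (at t within {0..1})"

definition omega_dot ::
    "('a, 'v::real_normed_vector, 'z) courant_scheme \<Rightarrow> (real \<Rightarrow> 'a \<Rightarrow> 'v \<Rightarrow> 'v) \<Rightarrow> real \<Rightarrow>
      ('a \<Rightarrow> 'v \<times> 'v) \<Rightarrow> ('a \<Rightarrow> 'v \<times> 'v) \<Rightarrow> 'a \<Rightarrow> complex" where
  "omega_dot E J t v w p = pairing_C E p (v p) (map_prod (J_dot J t p) (J_dot J t p) (w p))"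

end

theory Submission
  imports Defs
begin

text \<open>Moser's argument.  Write \<open>a \<circ> b = [a, b] + D \<langle>a, b\<rangle>\<close> for the Dorfman bracket, which acts by derivations of the
  pairing, the bracket and the anchor.  Let \<open>y\<close> be the imaginary part of the section of the conjugate bundle that
  represents \<open>\<beta>\<close>.  The real part of the equation for \<open>d\<^sub>L \<beta>\<close> says that \<open>\<partial>\<^sub>t J x = y \<circ> J x - J (y \<circ> x)\<close>, so that \<open>J\<close> is
  parallel for \<open>\<partial>\<^sub>t - y \<circ>\<close>.  The automorphisms obtained by integrating \<open>- y\<close> therefore intertwine the \<open>J t\<close>.  They consist of
  the flow of the vector field \<open>\<rho> (- y)\<close> on the base together with parallel transport in \<open>E\<close> along its integral
  curves.  It suffices to integrate for a short time, uniform by compactness, and to compose.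

  Parallel transport is a linear ordinary differential equation once \<open>E\<close> is embedded in a trivial bundle by
  finitely many global sections \<open>gs k\<close> with smooth coordinate functionals \<open>gc k\<close>.\<close>

section \<open>C^k calculus on subsets of normed spaces, bump functions\<close>

section \<open>Calculus of smooth functions\<close>

text \<open>The bracket is only an operation on global sections, with no regularity in a parameter
  assumed, so its preservation is not visible on single transported vectors. It is obtained for
  whole sections: the operator \<open>Dt\<close>, time derivative plus Dorfman action of the
  generating section, is a derivation of pairing, bracket and anchor; hence the bracket of two
  \<open>Dt\<close>-parallel sections is parallel, and uniqueness of transport identifies it with
  the transported bracket. That time derivatives pass through the bracket is itself forced by the
  Leibniz rule on finitely many generators. Fibres over a moving base point share no linear
  structure. Parallelism is therefore stated weakly, by pairing with arbitrary time-dependent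
  sections. This fits the structures \<open>J t\<close>, which are skew for the pairing and can be
  shifted to the test section. The data live on the closed interval [0,1], while flows and
  derivatives are handled on open time intervals; substituting the squared sine turns the path into
  one over the whole real line.\<close>

lemma C_k_on_cong:
  assumes "open S" "\<And>x. x \<in> S \<Longrightarrow> f x = g x"
  shows "C_k_on k S f \<longleftrightarrow> C_k_on k S g"
  using assms
proof (induction k arbitrary: f g)
  case 0
  then show ?case by (auto cong: continuous_on_cong)
next
  case (Suc k)
  have d: "f differentiable (at x) \<longleftrightarrow> g differentiable (at x)" if "x \<in> S" for x
    using Suc.prems that unfolding differentiable_def
    by (metis has_derivative_transform_within_open)
  have fd: "frechet_derivative f (at x) = frechet_derivative g (at x)" if "x \<in> S" for x
  proof -
    have "(f has_derivative f') (at x) \<longleftrightarrow> (g has_derivative f') (at x)" for f'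
      using Suc.prems that by (metis has_derivative_transform_within_open)
    then show ?thesis unfolding frechet_derivative_def by simp
  qed
  have "C_k_on k S (\<lambda>x. frechet_derivative f (at x) v) \<longleftrightarrow> C_k_on k S (\<lambda>x. frechet_derivative g (at x) v)" for v
    by (rule Suc.IH[OF Suc.prems(1)]) (simp add: fd)
  then show ?case using d by auto
qed

lemma C_k_on_subset: "C_k_on k S f \<Longrightarrow> T \<subseteq> S \<Longrightarrow> C_k_on k T f"
  by (induction k arbitrary: f) (auto intro: continuous_on_subset)

lemma C_k_on_local:
  assumes "\<And>x. x \<in> S \<Longrightarrow> \<exists>U. open U \<and> x \<in> U \<and> C_k_on k U f"
  shows "C_k_on k S f"
  using assms
proof (induction k arbitrary: f)
  case 0
  then have "continuous (at x within S) f" if "x \<in> S" for x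
    using that by (metis C_k_on.simps(1) continuous_at_imp_continuous_at_within continuous_on_eq_continuous_at)
  then show ?case by (simp add: continuous_on_eq_continuous_within)
next
  case (Suc k)
  have "C_k_on k S (\<lambda>x. frechet_derivative f (at x) v)" for v
    by (rule Suc.IH) (use Suc.prems in fastforce)
  moreover have "f differentiable (at x)" if "x \<in> S" for x
    using Suc.prems[OF that] by auto
  ultimately show ?case by simp
qed

lemma C_k_on_SucD: "C_k_on (Suc k) S f \<Longrightarrow> C_k_on k S f"
proof (induction k arbitrary: f)
  case 0
  then show ?case
    by (simp add: continuous_at_imp_continuous_on differentiable_imp_continuous_within)
next
  case (Suc k)
  then show ?case by (metis C_k_on.simps(2))
qed

lemma C_k_on_continuous: "C_k_on k S f \<Longrightarrow> continuous_on S f"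
  by (induction k) (auto dest: C_k_on_SucD simp del: C_k_on.simps(2))

text \<open>\<open>frechet_derivative\<close> is a choice operator; this rule admits any explicit
  formula for the derivative and drives the inductions on the order.\<close>

lemma C_k_on_SucI:
  assumes "open S" "\<And>x. x \<in> S \<Longrightarrow> (f has_derivative f' x) (at x)"
    and "\<And>v. C_k_on k S (\<lambda>x. f' x v)"
  shows "C_k_on (Suc k) S f"
proof -
  have "frechet_derivative f (at x) = f' x" if "x \<in> S" for x
    using assms(2)[OF that] frechet_derivative_at by metis
  then have "C_k_on k S (\<lambda>x. frechet_derivative f (at x) v)" for v
    using C_k_on_cong[OF assms(1), of "\<lambda>x. frechet_derivative f (at x) v" "\<lambda>x. f' x v"] assms(3) by simp
  then show ?thesis using assms(2) by (auto simp: differentiable_def)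
qed

lemma C_k_on_SucE:
  assumes "C_k_on (Suc k) S f"
  shows "x \<in> S \<Longrightarrow> (f has_derivative frechet_derivative f (at x)) (at x)"
    and "C_k_on k S (\<lambda>x. frechet_derivative f (at x) v)"
  using assms frechet_derivative_works by auto

lemma C_k_on_const: "open S \<Longrightarrow> C_k_on k S (\<lambda>x. c)"
proof (induction k arbitrary: c)
  case (Suc k)
  then show ?case by (intro C_k_on_SucI[OF _ has_derivative_const]) auto
qed auto

lemma C_k_on_linear_comp:
  assumes "bounded_linear h" "open S" "C_k_on k S f"
  shows "C_k_on k S (\<lambda>x. h (f x))"
  using assms(3)
proof (induction k arbitrary: f)
  case 0
  then show ?case
    using assms(1) by (auto intro: bounded_linear.continuous_on)
next
  case (Suc k)
  note E = C_k_on_SucE[OF Suc.prems]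
  show ?case
    by (rule C_k_on_SucI[OF assms(2) bounded_linear.has_derivative[OF assms(1) E(1)]])
       (auto intro!: Suc.IH E(2))
qed

lemma C_k_on_linear: "bounded_linear h \<Longrightarrow> open S \<Longrightarrow> C_k_on k S h"
proof (cases k)
  case (Suc n)
  assume h: "bounded_linear h" "open S"
  show ?thesis unfolding Suc
    by (rule C_k_on_SucI[OF h(2) bounded_linear_imp_has_derivative[OF h(1)]])
       (auto intro: C_k_on_const h)
qed (auto intro: linear_continuous_on)

lemma C_k_on_add:
  assumes "open S" "C_k_on k S f" "C_k_on k S g"
  shows "C_k_on k S (\<lambda>x. f x + g x)"
  using assms(2,3)
proof (induction k arbitrary: f g)
  case (Suc k)
  note F = C_k_on_SucE[OF Suc.prems(1)] and G = C_k_on_SucE[OF Suc.prems(2)]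
  show ?case
    by (rule C_k_on_SucI[OF assms(1) has_derivative_add[OF F(1) G(1)]])
       (auto intro!: Suc.IH F(2) G(2))
qed (auto intro: continuous_intros)

lemma C_k_on_sum:
  assumes "open S" "\<And>i. i \<in> I \<Longrightarrow> C_k_on k S (f i)"
  shows "C_k_on k S (\<lambda>x. \<Sum>i\<in>I. f i x)"
  using assms(2)
proof (induction I rule: infinite_finite_induct)
  case (insert i I)
  then show ?case by (simp add: C_k_on_add[OF assms(1)])
qed (simp_all add: C_k_on_const assms(1))

lemma C_k_on_bilinear:
  assumes h: "bounded_bilinear h" and "open S" "C_k_on k S f" "C_k_on k S g"
  shows "C_k_on k S (\<lambda>x. h (f x) (g x))"
  using assms(3,4)
proof (induction k arbitrary: f g)
  case 0
  then show ?case using bounded_bilinear.continuous_on[OF h] by auto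
next
  case (Suc k)
  note F = C_k_on_SucE[OF Suc.prems(1)] and G = C_k_on_SucE[OF Suc.prems(2)]
  show ?case
    by (rule C_k_on_SucI[OF assms(2) bounded_bilinear.FDERIV[OF h F(1) G(1)]])
       (auto intro!: C_k_on_add assms(2) Suc.IH F(2) G(2) C_k_on_SucD[OF Suc.prems(1)] C_k_on_SucD[OF Suc.prems(2)])
qed

lemma C_k_on_Pair:
  fixes f :: "'x::real_normed_vector \<Rightarrow> 'c::real_normed_vector"
    and g :: "'x \<Rightarrow> 'd::real_normed_vector"
  assumes "open S" "C_k_on k S f" "C_k_on k S g"
  shows "C_k_on k S (\<lambda>x. (f x, g x))"
proof -
  have *: "bounded_linear (\<lambda>a. (a, 0 :: 'd))"
      "bounded_linear (\<lambda>b. (0 :: 'c, b))"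
    by (intro bounded_linear_Pair bounded_linear_ident bounded_linear_zero)+
  have "C_k_on k S (\<lambda>x. (f x, 0) + (0, g x))"
    by (rule C_k_on_add[OF assms(1) C_k_on_linear_comp[OF *(1) assms(1,2)] C_k_on_linear_comp[OF *(2) assms(1,3)]])
  then show ?thesis by simp
qed

subsection \<open>Finite-dimensional spaces\<close>

text \<open>A predicate on types rather than a class: it covers the zero space and passes to
  products with the time axis.\<close>

definition fin_dim :: "'x::real_vector itself \<Rightarrow> bool" where
  "fin_dim T \<longleftrightarrow> (\<exists>B::'x set. finite B \<and> span B = UNIV)"

text \<open>Algebraic coordinates are continuous because all norms on a finite-dimensional space are
  equivalent. If the coordinate sum \<open>N\<close> were not bounded by the norm, normalised
  vectors with \<open>N\<close> equal to 1 would tend to 0 in norm, yet a subsequence converging in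
  coordinates has a limit with \<open>N\<close> equal to 1.\<close>

lemma fin_dim_coordinates:
  assumes "fin_dim TYPE('x::real_normed_vector)"
  obtains B :: "'x::real_normed_vector set" and c :: "'x \<Rightarrow> 'x \<Rightarrow> real"
  where "finite B" "\<And>b. b \<in> B \<Longrightarrow> bounded_linear (c b)" "\<And>x. x = (\<Sum>b\<in>B. c b x *\<^sub>R b)"
proof -
  obtain B0 :: "'x set" where B0: "finite B0" "span B0 = UNIV"
    using assms by (auto simp: fin_dim_def)
  obtain B where B: "B \<subseteq> B0" "independent B" "span B = UNIV"
    using B0 maximal_independent_subset[of B0] span_mono span_span
    by (metis span_eq span_superset top.extremum_uniqueI)
  have fB: "finite B" using B B0 finite_subset by blast
  define c where "c b x = representation B x b" for b x
  have lin: "linear (c b)" for b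
    unfolding c_def using B(2,3)
    by (intro linearI) (simp_all add: representation_add representation_scale)
  have exp: "x = (\<Sum>b\<in>B. c b x *\<^sub>R b)" for x
    unfolding c_def using sum_representation_eq[OF B(2) _ fB, of x] B(3) by simp
  have cB: "c k (\<Sum>b\<in>B. e b *\<^sub>R b) = e k" if "k \<in> B" for k e
  proof -
    have "c k (\<Sum>b\<in>B. e b *\<^sub>R b) = (\<Sum>b\<in>B. e b * c k b)"
      by (simp add: linear_sum[OF lin] linear_cmul[OF lin])
    also have "\<dots> = (\<Sum>b\<in>B. if b = k then e b else 0)"
      by (rule sum.cong) (auto simp: c_def representation_basis[OF B(2)])
    also have "\<dots> = e k" using that fB by simp
    finally show ?thesis .
  qed
  define N where "N x = (\<Sum>b\<in>B. \<bar>c b x\<bar>)" for x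
  have "\<exists>K. \<forall>x. N x \<le> K * norm x"
  proof (rule ccontr)
    assume "\<not> ?thesis"
    then have "\<exists>x. N x > real (Suc n) * norm x" for n by (metis not_less)
    then obtain x where x: "\<And>n. N (x n) > real (Suc n) * norm (x n)" by metis
    have Npos: "N (x n) > 0" for n
      using x[of n] by (smt (verit) norm_ge_zero mult_nonneg_nonneg of_nat_0_le_iff)
    define y where "y n = (1 / N (x n)) *\<^sub>R x n" for n
    have Ny: "N (y n) = 1" for n
      using Npos[of n] unfolding y_def N_def
      by (simp add: linear_cmul[OF lin] abs_mult flip: sum_distrib_left sum_divide_distrib)
    have ny: "norm (y n) < 1 / real (Suc n)" for n
      using x[of n] Npos[of n] by (simp add: y_def field_simps)
    \<comment> \<open>Bolzano-Weierstrass in the coordinates, each of which stays in [-1,1] along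
      \<open>y\<close>.\<close>
    have "\<forall>d\<subseteq>B. \<exists>l::'x. \<exists>r. strict_mono r \<and>
        (\<forall>e>0. eventually (\<lambda>n. \<forall>i\<in>d. dist (c i (y (r n))) (c i l) < e) sequentially)"
    proof (rule compact_lemma_general[where unproj = "\<lambda>e. \<Sum>b\<in>B. e b *\<^sub>R b"])
      fix k assume "k \<in> B"
      then have "\<bar>c k (y n)\<bar> \<le> 1" for n
        using Ny[of n] fB member_le_sum[of k B "\<lambda>b. \<bar>c b (y n)\<bar>"] by (simp add: N_def)
      then show "bounded ((\<lambda>x. c k x) ` range y)"
        by (auto simp: bounded_iff intro!: exI[of _ 1])
    qed (use fB cB exp in auto)
    then obtain l r where r: "strict_mono r"
      and l: "\<And>e. e > 0 \<Longrightarrow> eventually (\<lambda>n. \<forall>i\<in>B. dist (c i (y (r n))) (c i l) < e) sequentially"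
      by blast
    have lim: "(\<lambda>n. c i (y (r n))) \<longlonglongrightarrow> c i l" if "i \<in> B" for i
    proof (rule tendstoI)
      fix e :: real assume "e > 0"
      from l[OF this] show "eventually (\<lambda>n. dist (c i (y (r n))) (c i l) < e) sequentially"
        by (rule eventually_mono) (use that in auto)
    qed
    have "(\<lambda>n. N (y (r n))) \<longlonglongrightarrow> N l"
      unfolding N_def by (intro tendsto_intros lim)
    then have N1: "N l = 1" by (simp add: Ny LIMSEQ_const_iff)
    have "(\<lambda>n. \<Sum>b\<in>B. c b (y (r n)) *\<^sub>R b) \<longlonglongrightarrow> (\<Sum>b\<in>B. c b l *\<^sub>R b)"
      by (intro tendsto_intros lim)
    then have 1: "(\<lambda>n. y (r n)) \<longlonglongrightarrow> l" by (simp flip: exp)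
    have "y \<longlonglongrightarrow> 0"
      by (rule Lim_null_comparison[OF _ LIMSEQ_inverse_real_of_nat])
         (use ny in \<open>auto intro!: always_eventually less_imp_le simp: divide_inverse\<close>)
    then have "(\<lambda>n. y (r n)) \<longlonglongrightarrow> 0" using LIMSEQ_subseq_LIMSEQ[OF _ r] by (auto simp: o_def)
    with 1 have "l = 0" using LIMSEQ_unique by blast
    then show False using N1 by (simp add: N_def linear_0[OF lin])
  qed
  then obtain K where K: "\<And>x. N x \<le> K * norm x" by blast
  have "bounded_linear (c b)" if "b \<in> B" for b
  proof (rule bounded_linear_intro)
    show "norm (c b x) \<le> norm x * K" for x
      using K[of x] member_le_sum[of b B "\<lambda>b. \<bar>c b x\<bar>"] that fB by (simp add: N_def mult.commute)
  qed (use lin in \<open>auto simp: linear_add linear_cmul\<close>)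
  then show ?thesis using that fB exp by blast
qed

lemma fin_dim_real: "fin_dim TYPE(real)"
  unfolding fin_dim_def
proof (intro exI[of _ "{1}"] conjI)
  show "span {1::real} = UNIV"
    by (metis UNIV_eq_I real_scaleR_def mult.right_neutral span_base span_scale singletonI)
qed simp

lemma fin_dim_prod:
  assumes "fin_dim TYPE('x::real_normed_vector)" "fin_dim TYPE('y::real_normed_vector)"
  shows "fin_dim TYPE('x::real_normed_vector \<times> 'y::real_normed_vector)"
proof -
  obtain A :: "'x set" and B :: "'y set" where AB: "finite A" "span A = UNIV" "finite B" "span B = UNIV"
    using assms by (auto simp: fin_dim_def)
  let ?C = "(\<lambda>a. (a, 0)) ` A \<union> (\<lambda>b. (0, b)) ` B"
  have l: "linear (\<lambda>a::'x. (a, 0::'y))" "linear (\<lambda>b::'y. (0::'x, b))"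
    by (auto intro!: linearI)
  have "(a, b) \<in> span ?C" for a b
  proof -
    have "(a, 0) \<in> span ?C"
      using AB(2) linear_span_image[OF l(1), of A] span_mono[of "(\<lambda>a. (a, 0)) ` A" ?C] by auto
    moreover have "(0, b) \<in> span ?C"
      using AB(4) linear_span_image[OF l(2), of B] span_mono[of "(\<lambda>b. (0, b)) ` B" ?C] by auto
    ultimately have "(a, 0) + (0, b) \<in> span ?C" by (rule span_add)
    then show ?thesis by simp
  qed
  then have "span ?C = UNIV" by auto
  then show ?thesis using AB(1,3) unfolding fin_dim_def by (intro exI[of _ ?C] conjI) auto
qed

lemma linear_bounded_fin_dim:
  assumes "fin_dim TYPE('x::real_normed_vector)" "linear (f :: 'x::real_normed_vector \<Rightarrow> 'y::real_normed_vector)"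
  shows "bounded_linear f"
proof -
  obtain B :: "'x set" and c where B: "finite B" "\<And>b. b \<in> B \<Longrightarrow> bounded_linear (c b)" "\<And>x. x = (\<Sum>b\<in>B. c b x *\<^sub>R b)"
    using fin_dim_coordinates[OF assms(1)] by metis
  have "f x = (\<Sum>b\<in>B. c b x *\<^sub>R f b)" for x
    by (subst B(3)[of x], simp add: linear_sum[OF assms(2)] linear_cmul[OF assms(2)])
  then have "f = (\<lambda>x. \<Sum>b\<in>B. c b x *\<^sub>R f b)" by (rule ext)
  moreover have "bounded_linear (\<lambda>x. \<Sum>b\<in>B. c b x *\<^sub>R f b)"
    by (intro bounded_linear_sum bounded_linear_scaleR_const B(2))
  ultimately show ?thesis by simp
qed

text \<open>The order is measured by derivatives in fixed directions, but the chain rule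
  differentiates \<open>g\<close> in the direction \<open>?f' x v\<close>, which moves with x.
  Expanding this direction in a basis turns the derivative into a finite sum of scalar functions
  times derivatives of \<open>g\<close> in fixed directions, composed with \<open>f\<close>; to
  these the induction hypothesis applies.\<close>

lemma C_k_on_comp:
  fixes f :: "'x::real_normed_vector \<Rightarrow> 'y::real_normed_vector" and g :: "'y \<Rightarrow> 'z::real_normed_vector"
  assumes "fin_dim TYPE('y)" "open S" "open T" "f ` S \<subseteq> T" "C_k_on k S f" "C_k_on k T g"
  shows "C_k_on k S (\<lambda>x. g (f x))"
  using assms(5,6)
proof (induction k arbitrary: g)
  case 0
  then show ?case using assms(4) by (auto intro: continuous_on_compose2)
next
  case (Suc k)
  obtain B :: "'y set" and c where B: "finite B" "\<And>b. b \<in> B \<Longrightarrow> bounded_linear (c b)" "\<And>x. x = (\<Sum>b\<in>B. c b x *\<^sub>R b)"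
    using fin_dim_coordinates[OF assms(1)] by metis
  note F = C_k_on_SucE[OF Suc.prems(1)] and G = C_k_on_SucE[OF Suc.prems(2)]
  let ?f' = "\<lambda>x. frechet_derivative f (at x)" and ?g' = "\<lambda>x. frechet_derivative g (at x)"
  have "((\<lambda>x. g (f x)) has_derivative (\<lambda>v. \<Sum>b\<in>B. c b (?f' x v) *\<^sub>R ?g' (f x) b)) (at x)" if "x \<in> S" for x
  proof -
    have fx: "f x \<in> T" using that assms(4) by auto
    have l: "linear (?g' (f x))"
      using G(1)[OF fx] has_derivative_bounded_linear bounded_linear.linear by blast
    have "?g' (f x) (?f' x v) = (\<Sum>b\<in>B. c b (?f' x v) *\<^sub>R ?g' (f x) b)" for v
      by (subst B(3)[of "?f' x v"], simp add: linear_sum[OF l] linear_cmul[OF l])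
    then show ?thesis
      using has_derivative_compose[OF F(1)[OF that] G(1)[OF fx]] by simp
  qed
  then show ?case
    by (rule C_k_on_SucI[OF assms(2)])
       (auto intro!: C_k_on_sum C_k_on_bilinear[OF bounded_bilinear_scaleR] assms C_k_on_linear_comp[OF B(2)]
          F(2) Suc.IH G(2) C_k_on_SucD[OF Suc.prems(1)])
qed

subsection \<open>Smoothness on open sets\<close>

lemma smooth_on_open: 
  assumes "open S"
  shows "smooth_on S f \<longleftrightarrow> (\<forall>k. C_k_on k S f)"
proof
  assume L: "smooth_on S f"
  show "\<forall>k. C_k_on k S f"
  proof (intro allI C_k_on_local)
    fix k x assume "x \<in> S"
    then obtain U g where U: "open U" "x \<in> U" "\<forall>k. C_k_on k U g" "\<forall>y\<in>S \<inter> U. f y = g y"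
      using L unfolding smooth_on_def by metis
    then have "C_k_on k (S \<inter> U) g" using C_k_on_subset by blast
    then have "C_k_on k (S \<inter> U) f" using C_k_on_cong[of "S \<inter> U" f g] U assms by auto
    then show "\<exists>U. open U \<and> x \<in> U \<and> C_k_on k U f" using U assms \<open>x \<in> S\<close> by blast
  qed
qed (use assms in \<open>unfold smooth_on_def, blast\<close>)

lemma smooth_on_subset: "smooth_on S f \<Longrightarrow> T \<subseteq> S \<Longrightarrow> smooth_on T f"
proof -
  assume S: "smooth_on S f" "T \<subseteq> S"
  show ?thesis unfolding smooth_on_def
  proof
    fix x assume "x \<in> T"
    with S obtain U g where "open U" "x \<in> U" "\<forall>k. C_k_on k U g" "\<forall>y\<in>S \<inter> U. f y = g y"
      unfolding smooth_on_def by (metis subsetD)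
    with S(2) show "\<exists>U g. open U \<and> x \<in> U \<and> (\<forall>k. C_k_on k U g) \<and> (\<forall>y\<in>T \<inter> U. f y = g y)"
      by (intro exI[of _ U] exI[of _ g]) auto
  qed
qed

lemma smooth_on_cong: "(\<And>x. x \<in> S \<Longrightarrow> f x = g x) \<Longrightarrow> smooth_on S f \<longleftrightarrow> smooth_on S g"
  unfolding smooth_on_def by simp

lemma smooth_on_local:
  assumes "\<And>x. x \<in> S \<Longrightarrow> \<exists>U. open U \<and> x \<in> U \<and> smooth_on (S \<inter> U) f"
  shows "smooth_on S f"
  unfolding smooth_on_def
proof
  fix x assume x: "x \<in> S"
  obtain U where U: "open U" "x \<in> U" "smooth_on (S \<inter> U) f" using assms[OF x] by blast
  then obtain V g where V: "open V" "x \<in> V" "\<forall>k. C_k_on k V g" "\<forall>y\<in>(S \<inter> U) \<inter> V. f y = g y"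
    using x unfolding smooth_on_def by (metis IntI)
  then show "\<exists>U g. open U \<and> x \<in> U \<and> (\<forall>k. C_k_on k U g) \<and> (\<forall>y\<in>S \<inter> U. f y = g y)"
    using U C_k_on_subset[of _ V g "U \<inter> V"] by (intro exI[of _ "U \<inter> V"] exI[of _ g]) auto
qed

lemma smooth_on_continuous: "smooth_on S f \<Longrightarrow> continuous_on S f"
  unfolding continuous_on_eq_continuous_within
proof
  fix x assume "smooth_on S f" "x \<in> S"
  then obtain U g where U: "open U" "x \<in> U" "\<forall>k. C_k_on k U g" "\<forall>y\<in>S \<inter> U. f y = g y"
    unfolding smooth_on_def by metis
  then have "continuous_on U g" by (metis C_k_on.simps(1))
  then have "continuous (at x within S) g"
    using U by (simp add: continuous_at_imp_continuous_at_within continuous_on_eq_continuous_at)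
  then show "continuous (at x within S) f"
    using continuous_transform_within_openin[of x S g "S \<inter> U" f] U \<open>x \<in> S\<close> by auto
qed

lemma smooth_on_const: "open S \<Longrightarrow> smooth_on S (\<lambda>x. c)"
  by (simp add: smooth_on_open C_k_on_const)

lemma smooth_on_linear_comp: "bounded_linear h \<Longrightarrow> open S \<Longrightarrow> smooth_on S f \<Longrightarrow> smooth_on S (\<lambda>x. h (f x))"
  by (simp add: smooth_on_open C_k_on_linear_comp)

lemma smooth_on_linear: "bounded_linear h \<Longrightarrow> open S \<Longrightarrow> smooth_on S h"
  by (simp add: smooth_on_open C_k_on_linear)

lemma smooth_on_add: "open S \<Longrightarrow> smooth_on S f \<Longrightarrow> smooth_on S g \<Longrightarrow> smooth_on S (\<lambda>x. f x + g x)"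
  by (simp add: smooth_on_open C_k_on_add)

lemma smooth_on_sum: "open S \<Longrightarrow> (\<And>i. i \<in> I \<Longrightarrow> smooth_on S (f i)) \<Longrightarrow> smooth_on S (\<lambda>x. \<Sum>i\<in>I. f i x)"
  by (simp add: smooth_on_open C_k_on_sum)

lemma smooth_on_scaleR: "open S \<Longrightarrow> smooth_on S f \<Longrightarrow> smooth_on S g \<Longrightarrow> smooth_on S (\<lambda>x. f x *\<^sub>R g x)"
  by (simp add: smooth_on_open C_k_on_bilinear[OF bounded_bilinear_scaleR])

lemma smooth_on_mult:
  fixes f g :: "'x::real_normed_vector \<Rightarrow> real"
  shows "open S \<Longrightarrow> smooth_on S f \<Longrightarrow> smooth_on S g \<Longrightarrow> smooth_on S (\<lambda>x. f x * g x)"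
  by (simp add: smooth_on_open C_k_on_bilinear[OF bounded_bilinear_mult])

lemma smooth_on_Pair: "open S \<Longrightarrow> smooth_on S f \<Longrightarrow> smooth_on S g \<Longrightarrow> smooth_on S (\<lambda>x. (f x, g x))"
  by (simp add: smooth_on_open C_k_on_Pair)

lemma smooth_on_minus: "open S \<Longrightarrow> smooth_on S f \<Longrightarrow> smooth_on S (\<lambda>x. - f x)"
  by (rule smooth_on_linear_comp[OF bounded_linear_minus[OF bounded_linear_ident]])

lemma smooth_on_diff: "open S \<Longrightarrow> smooth_on S f \<Longrightarrow> smooth_on S g \<Longrightarrow> smooth_on S (\<lambda>x. f x - g x)"
  using smooth_on_add[OF _ _ smooth_on_minus, of S f g] by simp

lemma smooth_on_comp:
  fixes f :: "'x::real_normed_vector \<Rightarrow> 'y::real_normed_vector" and g :: "'y \<Rightarrow> 'z::real_normed_vector"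
  assumes "fin_dim TYPE('y)" "open S" "f ` S \<subseteq> T" "smooth_on S f" "smooth_on T g"
  shows "smooth_on S (\<lambda>x. g (f x))"
proof (rule smooth_on_local)
  fix x assume x: "x \<in> S"
  then obtain U h where U: "open U" "f x \<in> U" "\<forall>k. C_k_on k U h" "\<forall>y\<in>T \<inter> U. g y = h y"
    using assms(3,5) unfolding smooth_on_def by (metis image_subset_iff)
  let ?V = "S \<inter> f -` U"
  have oV: "open ?V"
    using continuous_open_preimage[OF smooth_on_continuous[OF assms(4)] assms(2) U(1)] .
  have "C_k_on k ?V (\<lambda>x. h (f x))" for k
    by (rule C_k_on_comp[OF assms(1) oV U(1) _ _ U(3)[rule_format]])
       (use assms(4) assms(2) in \<open>auto simp: smooth_on_open intro: C_k_on_subset\<close>)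
  then have "smooth_on ?V (\<lambda>x. h (f x))" using oV by (simp add: smooth_on_open)
  then have "smooth_on (S \<inter> ?V) (\<lambda>x. g (f x))"
    using smooth_on_cong[of "S \<inter> ?V" "\<lambda>x. g (f x)" "\<lambda>x. h (f x)"] U(4) assms(3)
    by (auto intro: smooth_on_subset)
  then show "\<exists>U. open U \<and> x \<in> U \<and> smooth_on (S \<inter> U) (\<lambda>x. g (f x))"
    using oV x U by (intro exI[of _ ?V]) auto
qed

lemma smooth_on_derivative:
  assumes "open S" "smooth_on S f"
  shows "x \<in> S \<Longrightarrow> (f has_derivative frechet_derivative f (at x)) (at x)"
    and "smooth_on S (\<lambda>x. frechet_derivative f (at x) v)"
  using assms C_k_on_SucE[of _ S f] by (auto simp: smooth_on_open simp del: C_k_on.simps(2))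

lemma smooth_on_inverse:
  assumes "open S" "smooth_on S f" "\<And>x. x \<in> S \<Longrightarrow> f x \<noteq> (0::real)"
  shows "smooth_on S (\<lambda>x. inverse (f x))"
proof -
  have o: "open {x::real. x \<noteq> 0}" by (simp add: open_Collect_neq)
  have "C_k_on k {x::real. x \<noteq> 0} inverse" for k
  proof (induction k)
    case (Suc k)
    have "(inverse has_derivative (\<lambda>v. - (inverse x * v * inverse x))) (at x)" if "x \<in> {x. x \<noteq> 0}" for x::real
      using that by (intro has_derivative_inverse') auto
    moreover have "C_k_on k {x::real. x \<noteq> 0} (\<lambda>x. - (inverse x * v * inverse x))" for v
      by (intro C_k_on_linear_comp[OF bounded_linear_minus[OF bounded_linear_ident]] o
          C_k_on_bilinear[OF bounded_bilinear_mult] Suc C_k_on_const)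
    ultimately show ?case by (rule C_k_on_SucI[OF o])
  qed (auto intro!: continuous_intros)
  then have "smooth_on {x::real. x \<noteq> 0} inverse" using o by (simp add: smooth_on_open)
  then show ?thesis
    by (intro smooth_on_comp[OF fin_dim_real assms(1) _ assms(2), of "{x. x \<noteq> 0}" inverse])
       (use assms(3) in \<open>auto simp: image_subset_iff\<close>)
qed

text \<open>The span of sine and cosine is closed under differentiation, so the induction runs over
  general coefficients.\<close>

lemma smooth_on_sin_cos:
  "smooth_on (UNIV::real set) sin" "smooth_on (UNIV::real set) cos"
proof -
  have "C_k_on k (UNIV::real set) (\<lambda>x. a * sin x + b * cos x)" for k a b
  proof (induction k arbitrary: a b)
    case (Suc k)
    have "((\<lambda>x. a * sin x + b * cos x) has_derivative (\<lambda>v. (v * - b) * sin x + (v * a) * cos x)) (at x)" for x::real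
      by (auto intro!: derivative_eq_intros simp: algebra_simps)
    then show ?case by (intro C_k_on_SucI[OF open_UNIV _ Suc.IH])
  qed (auto intro!: continuous_intros)
  from this[of _ 1 0] this[of _ 0 1] show "smooth_on (UNIV::real set) sin" "smooth_on (UNIV::real set) cos"
    by (simp_all add: smooth_on_open)
qed

subsection \<open>Bump functions\<close>

text \<open>The derivative of \<open>h n\<close> is a combination of \<open>h (Suc n)\<close> and
  \<open>h (n + 2)\<close>, and every \<open>h n\<close> tends to 0 at 0; so the induction on the
  order runs over the whole family.\<close>

lemma smooth_on_exp_inverse: "smooth_on UNIV (\<lambda>x::real. if x > 0 then exp (- inverse x) else 0)"
proof -
  define h where "h n x = (if x > 0 then inverse x ^ n * exp (- inverse x) else 0)" for n and x::real
  have lim0: "(h n \<longlongrightarrow> 0) (at 0)" for n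
  proof -
    have "((\<lambda>y::real. y ^ n / exp y) \<longlongrightarrow> 0) at_top" by (rule tendsto_power_div_exp_0)
    then have "((\<lambda>x::real. inverse x ^ n / exp (inverse x)) \<longlongrightarrow> 0) (at_right 0)"
      using filterlim_compose filterlim_inverse_at_top_right by fast
    then have "(h n \<longlongrightarrow> 0) (at_right 0)"
      by (rule Lim_transform_eventually)
         (auto simp: h_def eventually_at_filter exp_minus divide_inverse)
    moreover have "(h n \<longlongrightarrow> 0) (at_left 0)"
      by (rule Lim_transform_eventually[OF tendsto_const])
         (auto simp: h_def eventually_at_filter)
    ultimately show ?thesis using filterlim_split_at by blast
  qed
  have der: "(h n has_derivative (\<lambda>v. v * (- real n * h (Suc n) x + h (n + 2) x))) (at x)" for n x
  proof -
    consider "x > 0" | "x < 0" | "x = 0" by linarith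
    then have "(h n has_real_derivative (- real n * h (Suc n) x + h (n + 2) x)) (at x)"
    proof cases
      case 1
      have "((\<lambda>x. inverse x ^ n * exp (- inverse x)) has_real_derivative
         (- real n * h (Suc n) x + h (n + 2) x)) (at x)"
        using 1 by (auto intro!: derivative_eq_intros simp: h_def)
          (cases n; simp add: field_simps power2_eq_square)
      then show ?thesis
        by (rule has_field_derivative_transform_within_open[where S = "{0<..}"]) (use 1 in \<open>auto simp: h_def\<close>)
    next
      case 2
      have "((\<lambda>x. 0) has_real_derivative (- real n * h (Suc n) x + h (n + 2) x)) (at x)"
        using 2 by (auto simp: h_def)
      then show ?thesis
        by (rule has_field_derivative_transform_within_open[where S = "{..<0}"]) (use 2 in \<open>auto simp: h_def\<close>)
    next
      case 3
      \<comment> \<open>Dividing \<open>h n\<close> by its argument raises the index, so the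
        derivative at 0 is the limit of \<open>h (Suc n)\<close>.\<close>
      have "(\<lambda>y. (h n (0 + y) - h n 0) / y) = h (Suc n)"
        by (auto simp: h_def field_simps)
      then have "(h n has_real_derivative 0) (at 0)"
        using lim0[of "Suc n"] by (simp add: has_field_derivative_iff h_def)
      then show ?thesis using 3 by (simp add: h_def)
    qed
    then show ?thesis by (simp add: has_field_derivative_def mult_commute_abs)
  qed
  have "C_k_on k UNIV (h n)" for k n
  proof (induction k arbitrary: n)
    case 0
    then show ?case
      by (metis C_k_on.simps(1) UNIV_I continuous_at_imp_continuous_on der has_derivative_continuous)
  next
    case (Suc k)
    show ?case
      by (intro C_k_on_SucI[OF open_UNIV der] C_k_on_bilinear[OF bounded_bilinear_mult] C_k_on_add
           C_k_on_const open_UNIV Suc)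
  qed
  moreover have "h 0 = (\<lambda>x. if x > 0 then exp (- inverse x) else 0)" by (auto simp: h_def)
  ultimately show ?thesis unfolding smooth_on_open[OF open_UNIV] by metis
qed

lemma smooth_step:
  obtains h :: "real \<Rightarrow> real"
  where "smooth_on UNIV h" "\<And>x. x \<le> 0 \<Longrightarrow> h x = 0" "\<And>x. x \<ge> 1 \<Longrightarrow> h x = 1"
proof
  define e where "e x = (if x > 0 then exp (- inverse x) else 0)" for x :: real
  have e: "smooth_on UNIV e" unfolding e_def by (rule smooth_on_exp_inverse)
  have pos: "e x + e (1 - x) > 0" for x
    by (auto simp: e_def add_pos_pos)
  have e1: "smooth_on UNIV (\<lambda>x. e (1 - x))"
    by (rule smooth_on_comp[OF fin_dim_real _ _ _ e])
       (intro smooth_on_diff smooth_on_const smooth_on_linear bounded_linear_ident open_UNIV subset_UNIV)+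
  show "smooth_on UNIV (\<lambda>x. e x * inverse (e x + e (1 - x)))"
    by (intro smooth_on_mult smooth_on_inverse smooth_on_add e e1 open_UNIV) (use pos less_irrefl in metis)
  show "e x * inverse (e x + e (1 - x)) = 0" if "x \<le> 0" for x using that by (simp add: e_def)
  show "e x * inverse (e x + e (1 - x)) = 1" if "x \<ge> 1" for x using that by (simp add: e_def)
qed

text \<open>The given norm need not be smooth, so the distance from \<open>x0\<close> is measured by
  the sum \<open>q\<close> of squared coordinates, whose small sublevel sets lie in small
  balls.\<close>

lemma bump_function:
  assumes fd: "fin_dim TYPE('x::real_normed_vector)" and "open U" "(x0::'x::real_normed_vector) \<in> U"
  obtains \<kappa> :: "'x::real_normed_vector \<Rightarrow> real" and V r
  where "smooth_on UNIV \<kappa>" "open V" "x0 \<in> V" "\<forall>x\<in>V. \<kappa> x = 1"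
    "cball x0 r \<subseteq> U" "V \<subseteq> cball x0 r" "\<forall>x. x \<notin> cball x0 r \<longrightarrow> \<kappa> x = 0"
proof -
  obtain B :: "'x set" and c where B: "finite B" "\<And>b. b \<in> B \<Longrightarrow> bounded_linear (c b)" "\<And>x. x = (\<Sum>b\<in>B. c b x *\<^sub>R b)"
    using fin_dim_coordinates[OF fd] by metis
  obtain r where r: "r > 0" "cball x0 r \<subseteq> U" using assms open_contains_cball by blast
  define q where "q x = (\<Sum>b\<in>B. c b (x - x0) * c b (x - x0))" for x
  have cs: "smooth_on UNIV (\<lambda>x. c b (x - x0))" if "b \<in> B" for b
    by (intro smooth_on_linear_comp[OF B(2)[OF that]] smooth_on_diff smooth_on_const
         smooth_on_linear bounded_linear_ident open_UNIV)
  have qs: "smooth_on UNIV q" unfolding q_def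
    by (intro smooth_on_sum smooth_on_mult cs open_UNIV)
  define K where "K = (\<Sum>b\<in>B. norm b) + 1"
  have K: "K > 0" "(\<Sum>b\<in>B. norm b) < K"
    using sum_nonneg[of B norm] by (auto simp: K_def)
  \<comment> \<open>With this value \<open>q x < 2 * \<rho>\<close> bounds every coordinate by
    \<open>r / K\<close> and hence the distance by r. The profile \<open>2 - q x / \<rho>\<close>
    exceeds 1 where \<open>q x < \<rho>\<close> and is at most 0 where
    \<open>q x \<ge> 2 * \<rho>\<close>.\<close>
  define \<rho> where "\<rho> = (r / K)\<^sup>2 / 2"
  have \<rho>: "\<rho> > 0" using K r by (simp add: \<rho>_def)
  have small: "x \<in> cball x0 r" if "q x < 2 * \<rho>" for x
  proof -
    have "\<bar>c b (x - x0)\<bar> \<le> r / K" if "b \<in> B" for b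
    proof -
      have "c b (x - x0) * c b (x - x0) \<le> q x"
        unfolding q_def using member_le_sum[OF that, of "\<lambda>b. c b (x - x0) * c b (x - x0)"] B(1) by simp
      also have "\<dots> \<le> (r / K)\<^sup>2" using \<open>q x < 2 * \<rho>\<close> by (simp add: \<rho>_def)
      finally have "(c b (x - x0))\<^sup>2 \<le> (r / K)\<^sup>2" by (simp add: power2_eq_square)
      then show ?thesis using K r by (metis abs_of_pos divide_pos_pos real_sqrt_abs real_sqrt_le_iff)
    qed
    then have "norm (\<Sum>b\<in>B. c b (x - x0) *\<^sub>R b) \<le> (\<Sum>b\<in>B. r / K * norm b)"
      by (intro sum_norm_le) (use mult_right_mono[OF _ norm_ge_zero] in force)
    then have "norm (x - x0) \<le> (\<Sum>b\<in>B. r / K * norm b)"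
      using B(3)[of "x - x0"] by simp
    also have "\<dots> = r / K * (\<Sum>b\<in>B. norm b)" by (simp add: sum_distrib_left)
    also have "\<dots> \<le> r / K * K" using K r by (intro mult_left_mono) auto
    finally show ?thesis using K by (simp add: dist_norm norm_minus_commute)
  qed
  obtain h :: "real \<Rightarrow> real" where h: "smooth_on UNIV h" "\<And>x. x \<le> 0 \<Longrightarrow> h x = 0" "\<And>x. x \<ge> 1 \<Longrightarrow> h x = 1"
    using smooth_step by metis
  show ?thesis
  proof (rule that[of "\<lambda>x. h (2 + - inverse \<rho> * q x)" "{x. q x < \<rho>}" r])
    show "smooth_on UNIV (\<lambda>x. h (2 + - inverse \<rho> * q x))"
      by (rule smooth_on_comp[OF fin_dim_real _ _ _ h(1)])
         (intro smooth_on_add smooth_on_mult smooth_on_const qs open_UNIV subset_UNIV)+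
    show "open {x. q x < \<rho>}"
      by (intro open_Collect_less continuous_on_const smooth_on_continuous[OF qs])
    show "x0 \<in> {x. q x < \<rho>}" using \<rho> B(2) by (simp add: q_def linear_0 bounded_linear.linear)
    show "\<forall>x\<in>{x. q x < \<rho>}. h (2 + - inverse \<rho> * q x) = 1"
      using \<rho> by (intro ballI h(3)) (simp add: field_simps)
    show "cball x0 r \<subseteq> U" by (rule r)
    show "{x. q x < \<rho>} \<subseteq> cball x0 r" using small \<rho> by fastforce
    show "\<forall>x. x \<notin> cball x0 r \<longrightarrow> h (2 + - inverse \<rho> * q x) = 0"
    proof (intro allI impI h(2))
      fix x assume "x \<notin> cball x0 r"
      then have "2 * \<rho> \<le> q x" using small[of x] not_less by blast
      then show "2 + - inverse \<rho> * q x \<le> 0" using \<rho> by (simp add: field_simps)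
    qed
  qed
qed

section \<open>Gronwall's inequality, Picard iteration, smooth dependence on parameters\<close>

section \<open>Ordinary differential equations\<close>

subsection \<open>Gronwall's inequality and uniqueness\<close>

text \<open>The norm of \<open>w\<close> need not be differentiable, but the integral majorant
  \<open>R\<close>, which dominates it by the mean value inequality, is. Multiplying
  \<open>R\<close> by the integrating factor and subtracting the contribution of
  \<open>\<eta>\<close> gives the nonincreasing function \<open>Z\<close>.\<close>

lemma gronwall_forward:
  fixes w :: "real \<Rightarrow> 'y::banach"
  assumes "a \<le> b" "L \<ge> 0" "\<eta> \<ge> 0"
    and der: "\<And>s. s \<in> {a..b} \<Longrightarrow> (w has_vector_derivative w' s) (at s)"
    and bnd: "\<And>s. s \<in> {a..b} \<Longrightarrow> norm (w' s) \<le> L * norm (w s) + \<eta>"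
  shows "norm (w b) \<le> (norm (w a) + \<eta> * (b - a)) * exp (L * (b - a))"
proof (cases "a = b")
  case False
  with assms(1) have "a < b" by simp
  have wc: "continuous_on {a..b} w"
    by (rule continuous_on_vector_derivative) (use der has_vector_derivative_at_within in blast)
  define h where "h s = L * norm (w s) + \<eta>" for s
  have hc: "continuous_on {a..b} h" unfolding h_def by (intro continuous_intros wc)
  define R where "R s = norm (w a) + integral {a..s} h" for s
  have R': "(R has_vector_derivative h s) (at s within {a..b})" if "s \<in> {a..b}" for s
    unfolding R_def using integral_has_vector_derivative[OF hc that]
    by (auto intro!: derivative_eq_intros)
  have Rc: "continuous_on {a..b} R"
    by (rule continuous_on_vector_derivative) (use R' in blast)
  have wR: "norm (w s) \<le> R s" if s: "s \<in> {a..b}" for s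
  proof (cases "a = s")
    case False
    then have "norm (w s - w a) \<le> R s - R a"
    proof (intro differentiable_bound_general[where f' = w' and \<phi>' = h])
      show "a < s" using False s by simp
      show "continuous_on {a..s} w" "continuous_on {a..s} R"
        using s by (auto intro: continuous_on_subset[OF wc] continuous_on_subset[OF Rc])
      fix x assume x: "a < x" "x < s"
      then show "(w has_vector_derivative w' x) (at x)" using der s by auto
      have "at x within {a..b} = at x" by (rule at_within_interior) (use x s in auto)
      then show "(R has_vector_derivative h x) (at x)" using R'[of x] x s by auto
      show "norm (w' x) \<le> h x" using bnd[of x] x s by (simp add: h_def)
    qed
    then show ?thesis using norm_triangle_ineq2[of "w s" "w a"] by (simp add: R_def)
  qed (simp add: R_def)
  define Z where "Z s = exp (- L * (s - a)) * R s - \<eta> * (s - a)" for s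
  have "Z a \<ge> Z b"
  proof (rule DERIV_nonpos_imp_decreasing_open[OF assms(1)])
    fix x assume x: "a < x" "x < b"
    have "at x within {a..b} = at x" by (rule at_within_interior) (use x in auto)
    then have Rx: "(R has_real_derivative h x) (at x)"
      using R'[of x] x by (simp add: has_real_derivative_iff_has_vector_derivative)
    have "(Z has_real_derivative exp (- L * (x - a)) * (h x - L * R x) - \<eta>) (at x)"
      unfolding Z_def by (rule derivative_eq_intros Rx refl)+ (simp add: algebra_simps)
    moreover have "exp (- L * (x - a)) * (h x - L * R x) - \<eta> \<le> 0"
    proof -
      have "h x - L * R x \<le> \<eta>"
        using mult_left_mono[OF wR assms(2), of x] x by (simp add: h_def)
      then have "exp (- L * (x - a)) * (h x - L * R x) \<le> exp (- L * (x - a)) * \<eta>" by simp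
      also have "\<dots> \<le> 1 * \<eta>"
        using x assms by (intro mult_right_mono) auto
      finally show ?thesis by simp
    qed
    ultimately show "\<exists>y. (Z has_real_derivative y) (at x) \<and> y \<le> 0" by blast
  next
    show "continuous_on {a..b} Z" unfolding Z_def by (intro continuous_intros Rc)
  qed
  then have "exp (- L * (b - a)) * R b \<le> norm (w a) + \<eta> * (b - a)"
    by (simp add: Z_def R_def)
  then have "exp (- (L * (b - a))) * R b * exp (L * (b - a)) \<le> (norm (w a) + \<eta> * (b - a)) * exp (L * (b - a))"
    by (intro mult_right_mono) simp_all
  moreover have "exp (- (L * (b - a))) * R b * exp (L * (b - a)) = R b * (exp (- (L * (b - a))) * exp (L * (b - a)))"
    by (simp only: ac_simps)
  moreover have "exp (- (L * (b - a))) * exp (L * (b - a)) = 1"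
    by (simp flip: exp_add)
  ultimately have "R b \<le> (norm (w a) + \<eta> * (b - a)) * exp (L * (b - a))" by simp
  then show ?thesis using wR[of b] assms by simp
qed simp

lemma has_vector_derivative_reflect:
  assumes "(w has_vector_derivative d) (at (- s))"
  shows "((\<lambda>s. w (- s)) has_vector_derivative - d) (at (s::real))"
proof -
  have "(uminus has_vector_derivative - 1) (at s)"
    by (auto intro!: derivative_eq_intros)
  then show ?thesis
    using vector_diff_chain_at[of uminus "-1" s w d] assms by (simp add: o_def)
qed

text \<open>Backward time is reduced to forward time by reflecting the time axis.\<close>

lemma gronwall:
  fixes w :: "real \<Rightarrow> 'y::banach"
  assumes "L \<ge> 0" "\<eta> \<ge> 0"
    and der: "\<And>s. s \<in> closed_segment t0 t \<Longrightarrow> (w has_vector_derivative w' s) (at s)"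
    and bnd: "\<And>s. s \<in> closed_segment t0 t \<Longrightarrow> norm (w' s) \<le> L * norm (w s) + \<eta>"
  shows "norm (w t) \<le> (norm (w t0) + \<eta> * \<bar>t - t0\<bar>) * exp (L * \<bar>t - t0\<bar>)"
proof (cases "t0 \<le> t")
  case True
  then show ?thesis
    using gronwall_forward[of t0 t L \<eta> w w'] assms by (simp add: closed_segment_eq_real_ivl)
next
  case False
  have "norm ((\<lambda>s. w (- s)) (- t)) \<le> (norm ((\<lambda>s. w (- s)) (- t0)) + \<eta> * (- t - - t0)) * exp (L * (- t - - t0))"
  proof (rule gronwall_forward[where w' = "\<lambda>s. - w' (- s)"])
    fix s assume s: "s \<in> {- t0..- t}"
    then have "- s \<in> closed_segment t0 t" using False by (simp add: closed_segment_eq_real_ivl)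
    then show "((\<lambda>s. w (- s)) has_vector_derivative - w' (- s)) (at s)"
      and "norm (- w' (- s)) \<le> L * norm (w (- s)) + \<eta>"
      using has_vector_derivative_reflect der bnd by auto
  qed (use False assms in auto)
  then show ?thesis using False by simp
qed

lemma ode_unique:
  fixes u v :: "real \<Rightarrow> 'y::banach"
  assumes "\<And>s. s \<in> closed_segment t0 t \<Longrightarrow> (u has_vector_derivative f s (u s)) (at s)"
    and "\<And>s. s \<in> closed_segment t0 t \<Longrightarrow> (v has_vector_derivative f s (v s)) (at s)"
    and "\<And>s y z. s \<in> closed_segment t0 t \<Longrightarrow> norm (f s y - f s z) \<le> L * norm (y - z)"
    and "u t0 = v t0"
  shows "u t = v t"
proof -
  \<comment> \<open>A negative Lipschitz constant is possible only if the space is a single point,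
    where uniqueness is trivial.\<close>
  have L: "L \<ge> 0 \<or> (\<forall>y z::'y. y = z)"
    using assms(3)[of t0] by (metis eq_iff_diff_eq_0 ends_in_segment(1) norm_ge_zero norm_le_zero_iff
        order_trans zero_le_mult_iff)
  show ?thesis
  proof (cases "L \<ge> 0")
    case True
    have "norm (u t - v t) \<le> (norm (u t0 - v t0) + 0 * \<bar>t - t0\<bar>) * exp (L * \<bar>t - t0\<bar>)"
      by (rule gronwall[where w' = "\<lambda>s. f s (u s) - f s (v s)"])
         (use assms True in \<open>auto intro!: derivative_eq_intros\<close>)
    then show ?thesis using assms(4) by simp
  qed (use L in blast)
qed

subsection \<open>Existence\<close>

lemma antiderivative_exists:
  fixes h :: "real \<Rightarrow> 'y::banach"
  assumes "continuous_on UNIV h"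
  obtains H where "H 0 = 0" "\<And>t. (H has_vector_derivative h t) (at t)"
proof -
  \<comment> \<open>Both integrals start to the left of 0 and of t, so no interval is traversed
    backwards. Near a given time the moving lower end is exchanged for the fixed
    \<open>- N\<close>.\<close>
  define H where "H t = integral {- (\<bar>t\<bar> + 1)..t} h - integral {- (\<bar>t\<bar> + 1)..0} h" for t
  have int: "h integrable_on {a..b}" for a b
    by (rule integrable_continuous_real) (rule continuous_on_subset[OF assms subset_UNIV])
  have "H 0 = 0" by (simp add: H_def)
  moreover have "(H has_vector_derivative h t) (at t)" for t
  proof -
  define N :: real where "N = \<bar>t\<bar> + 2"
  have H: "H s = integral {- N..s} h - integral {- N..0} h" if "\<bar>s - t\<bar> < 1" for s :: real
  proof -
    have "integral {- N..c} h = integral {- N..- (\<bar>s\<bar> + 1)} h + integral {- (\<bar>s\<bar> + 1)..c} h"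
      if "c \<ge> - \<bar>s\<bar>" for c
      using that \<open>\<bar>s - t\<bar> < 1\<close> int
      by (intro Henstock_Kurzweil_Integration.integral_combine[symmetric]) (auto simp: N_def)
    from this[of s] this[of 0] show ?thesis by (simp add: H_def)
  qed
  have "((\<lambda>s. integral {- N..s} h) has_vector_derivative h t) (at t within {- N..N})"
    by (rule integral_has_vector_derivative) (auto simp: N_def intro: continuous_on_subset[OF assms])
  moreover have "at t within {- N..N} = at t" by (rule at_within_interior) (auto simp: N_def)
  ultimately have "((\<lambda>s. integral {- N..s} h) has_vector_derivative h t) (at t)" by simp
  then have "((\<lambda>s. integral {- N..s} h - integral {- N..0} h) has_vector_derivative h t) (at t)"
    by (auto intro!: derivative_eq_intros)
  then show ?thesis
    by (rule has_vector_derivative_transform_within_open[where S = "{t - 1<..<t + 1}"])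
       (use H in \<open>auto simp: abs_if\<close>)
  qed
  ultimately show ?thesis using that by blast
qed

text \<open>In the sup norm weighted by \<open>exp (c * \<bar>t\<bar>)\<close>, integration from 0
  divides the size by c. With c twice the Lipschitz constant this gives the Picard operator the
  contraction factor one half, without shrinking the time interval.\<close>

lemma weighted_bound:
  fixes H :: "real \<Rightarrow> 'y::real_normed_vector"
  assumes "H 0 = 0" "\<And>t. (H has_vector_derivative h t) (at t)" "c > 0" "K \<ge> 0"
    and "\<And>t. norm (h t) \<le> K * exp (c * \<bar>t\<bar>)"
  shows "norm (H t) \<le> K / c * exp (c * \<bar>t\<bar>)"
proof -
  have fwd: "norm (G t) \<le> K / c * exp (c * t)"
    if "t \<ge> 0" "G 0 = 0" "\<And>t. (G has_vector_derivative g t) (at t)" "\<And>t. norm (g t) \<le> K * exp (c * \<bar>t\<bar>)"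
    for G g :: "real \<Rightarrow> 'y" and t
  proof (cases "t = 0")
    case False
    have "norm (G t - G 0) \<le> (\<lambda>s. K / c * exp (c * s)) t - (\<lambda>s. K / c * exp (c * s)) 0"
    proof (rule differentiable_bound_general[where f' = g and \<phi>' = "\<lambda>s. K * exp (c * s)"])
      show "continuous_on {0..t} G"
        by (rule continuous_on_vector_derivative) (use that(3) has_vector_derivative_at_within in blast)
      show "((\<lambda>s. K / c * exp (c * s)) has_vector_derivative K * exp (c * x)) (at x)" for x
        unfolding has_real_derivative_iff_has_vector_derivative[symmetric]
        using assms(3) by (auto intro!: derivative_eq_intros)
      show "norm (g x) \<le> K * exp (c * x)" if "0 < x" for x
        using \<open>\<And>t. norm (g t) \<le> K * exp (c * \<bar>t\<bar>)\<close>[of x] that by simp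
      show "continuous_on {0..t} (\<lambda>s. K / c * exp (c * s))" by (intro continuous_intros)
    qed (use that False in auto)
    then have "norm (G t) \<le> K / c * exp (c * t) - K / c" using that by simp
    also have "\<dots> \<le> K / c * exp (c * t)" using assms by simp
    finally show ?thesis .
  qed (use that assms in auto)
  show ?thesis
  proof (cases "t \<ge> 0")
    case False
    have "norm ((\<lambda>s. H (- s)) (- t)) \<le> K / c * exp (c * (- t))"
    proof (rule fwd[where g = "\<lambda>s. - h (- s)"])
      show "((\<lambda>s. H (- s)) has_vector_derivative - h (- s)) (at s)" for s
        by (rule has_vector_derivative_reflect[OF assms(2)])
      show "norm (- h (- s)) \<le> K * exp (c * \<bar>s\<bar>)" for s using assms(5)[of "- s"] by simp
    qed (use False assms in auto)
    then show ?thesis using False by simp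
  qed (use fwd assms in auto)
qed

text \<open>In the norm weighted by \<open>exp (- 2 L \<bar>t\<bar>)\<close> the Picard operator is a contraction on the whole
  real line.\<close>

lemma ivp_exists_lipschitz:
  fixes f :: "real \<Rightarrow> 'y::banach \<Rightarrow> 'y"
  assumes cont: "continuous_on UNIV (\<lambda>(t, y). f t y)"
    and L: "L > 0" "\<And>t y z. norm (f t y - f t z) \<le> L * norm (y - z)"
    and M: "\<And>t. norm (f t x) \<le> M"
  obtains u where "u 0 = x" "\<And>t. (u has_vector_derivative f t (u t)) (at t)"
proof -
  let ?E = "\<lambda>t::real. exp (2 * L * \<bar>t\<bar>)"
  have M0: "M \<ge> 0" using M[of 0] norm_ge_zero order_trans by blast
  \<comment> \<open>The unknown is the bounded function \<open>w\<close> for which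
    \<open>x + ?E t *\<^sub>R w t\<close> is the solution; subtracting \<open>x\<close> and dividing
    by the weight keeps it in the complete space of bounded continuous functions.\<close>
  define F where "F w t = f t (x + ?E t *\<^sub>R apply_bcontfun w t)" for w :: "real \<Rightarrow>\<^sub>C 'y" and t
  have Fc: "continuous_on UNIV (F w)" for w
  proof -
    have "continuous_on UNIV (\<lambda>t. (t, x + ?E t *\<^sub>R apply_bcontfun w t))"
      by (intro continuous_intros continuous_on_apply_bcontfun)
    from continuous_on_compose2[OF cont this] show ?thesis unfolding F_def by simp
  qed
  have "\<exists>H. H 0 = 0 \<and> (\<forall>t. (H has_vector_derivative F w t) (at t))" for w
    using antiderivative_exists[OF Fc[of w]] by blast
  then obtain H where H: "\<And>w. H w 0 = 0" "\<And>w t. (H w has_vector_derivative F w t) (at t)" by metis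
  have Hc: "continuous_on UNIV (H w)" for w
    using H(2) by (meson continuous_at_imp_continuous_on has_vector_derivative_continuous)
  have Hb: "norm (H w t) \<le> (M + L * norm w) / (2 * L) * ?E t" for w t
  proof (rule weighted_bound[OF H])
    fix t
    have "norm (F w t) \<le> norm (f t x) + norm (F w t - f t x)" by norm
    also have "\<dots> \<le> M + L * norm (?E t *\<^sub>R apply_bcontfun w t)"
      using M[of t] L(2)[of t "x + ?E t *\<^sub>R apply_bcontfun w t" x] by (simp add: F_def)
    also have "\<dots> \<le> M * ?E t + L * (?E t * norm w)"
      using M0 L(1) norm_bounded[of w t]
      by (intro add_mono mult_left_mono) (auto simp: mult_le_cancel_left1)
    finally show "norm (F w t) \<le> (M + L * norm w) * ?E t" by (simp add: algebra_simps)
  qed (use L M0 in auto)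
  define P where "P w = Bcontfun (\<lambda>t. (1 / ?E t) *\<^sub>R H w t)" for w
  have "(\<lambda>t. (1 / ?E t) *\<^sub>R H w t) \<in> bcontfun" for w
  proof (rule bcontfun_normI)
    show "norm ((1 / ?E t) *\<^sub>R H w t) \<le> (M + L * norm w) / (2 * L)" for t
      using Hb[of w t] by (simp add: field_simps)
  qed (intro continuous_intros Hc; simp)
  then have P: "apply_bcontfun (P w) t = (1 / ?E t) *\<^sub>R H w t" for w t
    unfolding P_def by (simp add: Bcontfun_inverse)
  have "dist (P w) (P v) \<le> 1 / 2 * dist w v" for w v
  proof (rule dist_bound)
    fix t
    have "norm ((\<lambda>t. H w t - H v t) t) \<le> (L * dist w v) / (2 * L) * ?E t"
    proof (rule weighted_bound[where h = "\<lambda>t. F w t - F v t"])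
      fix t
      have "norm (F w t - F v t) \<le> L * norm (?E t *\<^sub>R (apply_bcontfun w t - apply_bcontfun v t))"
        using L(2)[of t "x + ?E t *\<^sub>R apply_bcontfun w t" "x + ?E t *\<^sub>R apply_bcontfun v t"]
        by (simp add: F_def algebra_simps)
      also have "\<dots> \<le> L * (?E t * dist w v)"
        using L(1) dist_bounded[of w t v] by (intro mult_left_mono) (auto simp: dist_norm)
      finally show "norm (F w t - F v t) \<le> (L * dist w v) * ?E t" by (simp add: algebra_simps)
    qed (use H L in \<open>auto intro!: derivative_eq_intros\<close>)
    moreover have "dist (apply_bcontfun (P w) t) (apply_bcontfun (P v) t) = (1 / ?E t) * norm (H w t - H v t)"
      by (simp add: P dist_norm flip: scaleR_diff_right)
    ultimately show "dist (apply_bcontfun (P w) t) (apply_bcontfun (P v) t) \<le> 1 / 2 * dist w v"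
      using L(1) mult_left_mono[of "norm (H w t - H v t)" "L * dist w v / (2 * L) * ?E t" "1 / ?E t"] by simp
  qed
  then obtain w where w: "P w = w"
    using banach_fix_type[of "1/2" P] by auto
  have wt: "?E t *\<^sub>R apply_bcontfun w t = H w t" for t
    using arg_cong[OF w, of "\<lambda>w. ?E t *\<^sub>R apply_bcontfun w t"] by (simp add: P)
  show ?thesis
  proof
    show "x + H w 0 = x" by (simp add: H)
    show "((\<lambda>t. x + H w t) has_vector_derivative f t (x + H w t)) (at t)" for t
      using H(2)[of w t] by (auto simp: F_def wt intro!: derivative_eq_intros)
  qed
qed

text \<open>The Lipschitz constant may grow with time. Clamping time to a bounded interval makes it
  uniform, and uniqueness glues the solutions belonging to growing intervals.\<close>

lemma ivp_exists:
  fixes f :: "real \<Rightarrow> 'y::banach \<Rightarrow> 'y"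
  assumes cont: "continuous_on UNIV (\<lambda>(t, y). f t y)"
    and lip: "\<And>T. \<exists>L. \<forall>t y z. \<bar>t\<bar> \<le> T \<longrightarrow> norm (f t y - f t z) \<le> L * norm (y - z)"
  obtains u where "u 0 = x" "\<And>t. (u has_vector_derivative f t (u t)) (at t)"
proof -
  have "\<exists>u. u 0 = x \<and> (\<forall>t. \<bar>t\<bar> < T \<longrightarrow> (u has_vector_derivative f t (u t)) (at t))" if T: "T > 0" for T
  proof -
    define c where "c t = max (- T) (min T t)" for t
    have c: "\<bar>c t\<bar> \<le> T" for t using T by (auto simp: c_def)
    obtain L where L: "\<And>t y z. \<bar>t\<bar> \<le> T \<Longrightarrow> norm (f t y - f t z) \<le> L * norm (y - z)"
      using lip[of T] by blast
    have "continuous_on {-T..T} (\<lambda>t. f t x)"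
    proof -
      have "continuous_on {-T..T} (\<lambda>t. (t, x))" by (intro continuous_intros)
      from continuous_on_compose2[OF cont this] show ?thesis by simp
    qed
    then have "bounded ((\<lambda>t. f t x) ` {-T..T})"
      by (intro compact_imp_bounded compact_continuous_image) auto
    then obtain M where "\<forall>y\<in>(\<lambda>t. f t x) ` {-T..T}. norm y \<le> M"
      unfolding bounded_iff by blast
    then have M: "\<And>t. \<bar>t\<bar> \<le> T \<Longrightarrow> norm (f t x) \<le> M"
      by (auto simp: abs_le_iff minus_le_iff)
    have "continuous_on UNIV (\<lambda>(t, y). f (c t) y)"
    proof -
      have "continuous_on UNIV (\<lambda>z::real \<times> 'y. (c (fst z), snd z))"
        unfolding c_def by (intro continuous_intros)
      from continuous_on_compose2[OF cont this] show ?thesis by (simp add: case_prod_beta)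
    qed
    then obtain u where u: "u 0 = x" "\<And>t. (u has_vector_derivative f (c t) (u t)) (at t)"
    proof (rule ivp_exists_lipschitz)
      show "norm (f (c t) y - f (c t) z) \<le> max L 1 * norm (y - z)" for t y z
        by (rule order_trans[OF L[OF c]]) (intro mult_right_mono; simp)
      show "norm (f (c t) x) \<le> M" for t using M[OF c] .
    qed auto
    moreover have "c t = t" if "\<bar>t\<bar> < T" for t using that by (auto simp: c_def)
    ultimately show ?thesis by metis
  qed
  then obtain U where U: "\<And>T. T > 0 \<Longrightarrow> U T 0 = x"
    "\<And>T t. T > 0 \<Longrightarrow> \<bar>t\<bar> < T \<Longrightarrow> (U T has_vector_derivative f t (U T t)) (at t)"
    by metis
  have eq: "U T t = U S t" if "\<bar>t\<bar> < T" "\<bar>t\<bar> < S" for T S t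
  proof -
    obtain L where L: "\<And>s y z. \<bar>s\<bar> \<le> \<bar>t\<bar> \<Longrightarrow> norm (f s y - f s z) \<le> L * norm (y - z)"
      using lip[of "\<bar>t\<bar>"] by blast
    have s: "\<bar>s\<bar> \<le> \<bar>t\<bar>" if "s \<in> closed_segment 0 t" for s
      using that by (auto simp: closed_segment_eq_real_ivl split: if_splits)
    show ?thesis
    proof (rule ode_unique[of 0 t _ f])
      fix s assume "s \<in> closed_segment 0 t"
      from s[OF this] that show "(U T has_vector_derivative f s (U T s)) (at s)"
        "(U S has_vector_derivative f s (U S s)) (at s)"
        by (auto intro!: U)
    next
      show "U T 0 = U S 0" using U(1)[of T] U(1)[of S] that by auto
    qed (use L s in blast)
  qed
  show ?thesis
  proof
    \<comment> \<open>At time t the solution of radius \<open>\<bar>t\<bar> + 1\<close> is read off;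
      on the unit neighbourhood of t all these values agree with the single solution of radius
      \<open>\<bar>t\<bar> + 2\<close>.\<close>
    show "U (\<bar>0\<bar> + 1) 0 = x" by (simp add: U)
    fix t :: real
    have "(U (\<bar>t\<bar> + 2) has_vector_derivative f t (U (\<bar>t\<bar> + 1) t)) (at t)"
      using U(2)[of "\<bar>t\<bar> + 2" t] eq[of t "\<bar>t\<bar> + 2" "\<bar>t\<bar> + 1"] by simp
    then show "((\<lambda>t. U (\<bar>t\<bar> + 1) t) has_vector_derivative f t (U (\<bar>t\<bar> + 1) t)) (at t)"
      by (rule has_vector_derivative_transform_within_open[where S = "{t - 1<..<t + 1}"])
         (auto intro!: eq)
  qed
qed

subsection \<open>Linear equations with parameters\<close>

text \<open>Tube lemma: continuity at \<open>p0\<close> is uniform over a compact time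
  interval.\<close>

lemma uniform_on_compact_interval:
  fixes G :: "real \<times> 'p::real_normed_vector \<Rightarrow> 'z::real_normed_vector"
  assumes "continuous_on UNIV G" "\<epsilon> > 0"
  obtains \<delta> where "\<delta> > 0" "\<And>t p. \<bar>t\<bar> \<le> T \<Longrightarrow> norm (p - p0) < \<delta> \<Longrightarrow> norm (G (t, p) - G (t, p0)) < \<epsilon>"
proof -
  let ?W = "{z::'p \<times> real. norm (G (snd z, fst z) - G (snd z, p0)) < \<epsilon>}"
  have "continuous_on UNIV (\<lambda>z::'p \<times> real. G (snd z, fst z))"
    by (rule continuous_on_compose2[OF assms(1)]) (auto intro!: continuous_intros)
  moreover have "continuous_on UNIV (\<lambda>z::'p \<times> real. G (snd z, p0))"
    by (rule continuous_on_compose2[OF assms(1)]) (auto intro!: continuous_intros)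
  ultimately have "open ?W"
    by (intro open_Collect_less continuous_intros)
  moreover have "{p0} \<times> {-T..T} \<subseteq> ?W" using assms(2) by auto
  ultimately obtain X where X: "p0 \<in> X" "open X" "X \<times> {-T..T} \<subseteq> ?W"
    using Elementary_Topology.tube_lemma[of "{-T..T}" ?W p0] by auto
  then obtain \<delta> where \<delta>: "\<delta> > 0" "ball p0 \<delta> \<subseteq> X" using open_contains_ball by blast
  show ?thesis
  proof (rule that[OF \<delta>(1)])
    fix t p assume "\<bar>t\<bar> \<le> T" "norm (p - p0) < \<delta>"
    then have "(p, t) \<in> X \<times> {-T..T}" using \<delta>(2) by (auto simp: dist_norm norm_minus_commute)
    from subsetD[OF X(3) this] show "norm (G (t, p) - G (t, p0)) < \<epsilon>" by simp
  qed
qed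

lemma bounded_on_interval:
  fixes G :: "real \<Rightarrow> 'z::real_normed_vector"
  assumes "continuous_on UNIV G"
  obtains M where "M > 0" "\<And>t. \<bar>t\<bar> \<le> T \<Longrightarrow> norm (G t) \<le> M"
proof -
  have "bounded (G ` {-T..T})"
    by (intro compact_imp_bounded compact_continuous_image continuous_on_subset[OF assms]) auto
  then obtain M where "M > 0" "\<forall>y \<in> G ` {-T..T}. norm y \<le> M" unfolding bounded_pos by blast
  then show ?thesis using that[of M] by (auto simp: abs_le_iff minus_le_iff)
qed

lemma seg0_abs: "s \<in> closed_segment 0 t \<Longrightarrow> \<bar>t\<bar> \<le> T \<Longrightarrow> \<bar>s\<bar> \<le> (T::real)"
  by (auto simp: closed_segment_eq_real_ivl split: if_splits)

text \<open>Gronwall's inequality in the form used for parameters: one bound valid at all times of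
  \<open>[- T, T]\<close>.\<close>

lemma linear_ode_bound:
  fixes w :: "real \<Rightarrow> 'y::banach"
  assumes "\<And>s. (w has_vector_derivative blinfun_apply (A s) (w s) + g s) (at s)"
    and "\<And>s. \<bar>s\<bar> \<le> T \<Longrightarrow> norm (A s) \<le> L" "\<And>s. \<bar>s\<bar> \<le> T \<Longrightarrow> norm (g s) \<le> \<eta>" "\<bar>t\<bar> \<le> T" 
  shows "norm (w t) \<le> (norm (w 0) + \<eta> * T) * exp (L * T)"
proof -
  have L: "L \<ge> 0" "\<eta> \<ge> 0" using assms(2,3)[of 0] assms(4) norm_ge_zero order_trans
    by (smt (verit))+
  have "norm (w t) \<le> (norm (w 0) + \<eta> * \<bar>t - 0\<bar>) * exp (L * \<bar>t - 0\<bar>)"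
  proof (rule gronwall[OF L, where w' = "\<lambda>s. A s (w s) + g s"])
    fix s assume "s \<in> closed_segment 0 t"
    then have s: "\<bar>s\<bar> \<le> T" using seg0_abs assms(4) by blast
    show "(w has_vector_derivative A s (w s) + g s) (at s)" by (rule assms)
    have "norm (A s (w s)) \<le> L * norm (w s)"
      using norm_blinfun[of "A s" "w s"] mult_right_mono[OF assms(2)[OF s], of "norm (w s)"] by simp
    then show "norm (A s (w s) + g s) \<le> L * norm (w s) + \<eta>"
      using assms(3)[OF s] norm_triangle_ineq[of "A s (w s)" "g s"] by linarith
  qed
  also have "\<dots> \<le> (norm (w 0) + \<eta> * T) * exp (L * T)"
    using L assms(4) by (intro mult_mono add_mono) (auto intro: mult_left_mono)
  finally show ?thesis .
qed

lemma linear_ode_unique: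
  fixes u v :: "real \<Rightarrow> 'y::banach"
  assumes "continuous_on UNIV A"
    and "\<And>s. (u has_vector_derivative blinfun_apply (A s) (u s) + g s) (at s)"
    and "\<And>s. (v has_vector_derivative blinfun_apply (A s) (v s) + g s) (at s)"
    and "u 0 = v 0"
  shows "u t = v t"
proof -
  obtain L where L: "\<And>s. \<bar>s\<bar> \<le> \<bar>t\<bar> \<Longrightarrow> norm (A s) \<le> L" using bounded_on_interval[OF assms(1)] by metis
  have "norm (u t - v t) \<le> (norm (u 0 - v 0) + 0 * \<bar>t\<bar>) * exp (L * \<bar>t\<bar>)"
  proof (rule linear_ode_bound[of _ A "\<lambda>_. 0"])
    show "((\<lambda>t. u t - v t) has_vector_derivative A s (u s - v s) + 0) (at s)" for s
      using has_vector_derivative_diff[OF assms(2,3)[of s]] by (simp add: blinfun.diff_right)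
  qed (use L in auto)
  then show ?thesis using assms(4) by simp
qed

lemma linear_ode_exists:
  fixes A :: "real \<Rightarrow> 'y::banach \<Rightarrow>\<^sub>L 'y"
  assumes "continuous_on UNIV A" "continuous_on UNIV g"
  obtains u where "u 0 = x" "\<And>t. (u has_vector_derivative A t (u t) + g t) (at t)"
proof (rule ivp_exists[of "\<lambda>t y. A t y + g t"])
  have "continuous_on UNIV (\<lambda>z. A (fst z) (snd z) + g (fst z))"
    by (intro continuous_intros continuous_on_compose2[OF assms(1)] continuous_on_compose2[OF assms(2)]) auto
  then show "continuous_on UNIV (\<lambda>(t, y). A t y + g t)" by (simp add: case_prod_beta)
  fix T
  obtain L where L: "\<And>s. \<bar>s\<bar> \<le> T \<Longrightarrow> norm (A s) \<le> L" using bounded_on_interval[OF assms(1)] by metis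
  have "norm (A t y + g t - (A t z + g t)) \<le> L * norm (y - z)" if "\<bar>t\<bar> \<le> T" for t y z
  proof -
    have "norm (A t y + g t - (A t z + g t)) = norm (A t (y - z))" by (simp add: blinfun.diff_right)
    also have "\<dots> \<le> L * norm (y - z)"
      using norm_blinfun[of "A t" "y - z"] mult_right_mono[OF L[OF that], of "norm (y - z)"] by simp
    finally show ?thesis .
  qed
  then show "\<exists>L. \<forall>t y z. \<bar>t\<bar> \<le> T \<longrightarrow> norm (A t y + g t - (A t z + g t)) \<le> L * norm (y - z)" by blast
qed (use that in blast)

lemma continuous_slice:
  assumes "continuous_on UNIV (G :: real \<times> 'p::real_normed_vector \<Rightarrow> 'z::topological_space)"
  shows "continuous_on UNIV (\<lambda>t. G (t, p))"
  by (rule continuous_on_compose2[OF assms]) (auto intro!: continuous_intros)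

text \<open>The difference of the solutions at \<open>p\<close> and \<open>p0\<close> solves the
  equation at \<open>p\<close>, with an inhomogeneity built from the differences of the data. This
  is small uniformly on compact time intervals, so Gronwall's inequality applies.\<close>

lemma linear_ode_continuous:
  fixes A :: "real \<times> 'p::real_normed_vector \<Rightarrow> 'y::banach \<Rightarrow>\<^sub>L 'y"
  assumes A: "continuous_on UNIV A" and g: "continuous_on UNIV g" and u0: "continuous_on UNIV u0"
    and u: "\<And>t p. ((\<lambda>t. u (t, p)) has_vector_derivative A (t, p) (u (t, p)) + g (t, p)) (at t)"
    and "\<And>p. u (0, p) = u0 p"
  shows "continuous_on UNIV u"
proof -
  have cu: "continuous_on UNIV (\<lambda>t. u (t, p))" for p
    using u by (meson continuous_at_imp_continuous_on has_vector_derivative_continuous)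
  have "continuous (at z) u" for z
  proof (cases z)
    case (Pair t0 p0)
    define T where "T = \<bar>t0\<bar> + 1"
    have T: "T > 0" by (simp add: T_def)
    obtain M where M: "M > 0" "\<And>t. \<bar>t\<bar> \<le> T \<Longrightarrow> norm (u (t, p0)) \<le> M" using bounded_on_interval[OF cu] by metis
    obtain L where L: "L > 0" "\<And>t. \<bar>t\<bar> \<le> T \<Longrightarrow> norm (A (t, p0)) \<le> L"
      using bounded_on_interval[OF continuous_slice[OF A]] by metis
    show ?thesis unfolding continuous_at_eps_delta Pair
    proof (intro allI impI)
      fix e :: real assume e: "e > 0"
      define E where "E = exp ((L + 1) * T)"
      have E: "E > 0" by (simp add: E_def)
      \<comment> \<open>Scaled so that the Gronwall bound for moving the parameter comes to
        \<open>e / 4\<close>; a further \<open>e / 2\<close> is spent on moving time at fixed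
        \<open>p0\<close>.\<close>
      define \<epsilon> where "\<epsilon> = e / (4 * E * (1 + (M + 1) * T))"
      have pos: "1 + (M + 1) * T > 0" using M T by (simp add: add_pos_pos)
      have \<epsilon>: "\<epsilon> > 0" using e E pos by (simp add: \<epsilon>_def)
      obtain d1 where d1: "d1 > 0" "\<And>t p. \<bar>t\<bar> \<le> T \<Longrightarrow> norm (p - p0) < d1 \<Longrightarrow> norm (A (t, p) - A (t, p0)) < min 1 \<epsilon>"
        using uniform_on_compact_interval[OF A, of "min 1 \<epsilon>"] \<epsilon> by (metis min_less_iff_conj zero_less_one)
      obtain d2 where d2: "d2 > 0" "\<And>t p. \<bar>t\<bar> \<le> T \<Longrightarrow> norm (p - p0) < d2 \<Longrightarrow> norm (g (t, p) - g (t, p0)) < \<epsilon>"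
        using uniform_on_compact_interval[OF g \<epsilon>] by metis
      obtain d3 where d3: "d3 > 0" "\<And>p. norm (p - p0) < d3 \<Longrightarrow> norm (u0 p - u0 p0) < \<epsilon>"
        using u0 \<epsilon> unfolding continuous_on_eq_continuous_at[OF open_UNIV] continuous_at_eps_delta
        by (metis UNIV_I dist_norm)
      obtain d4 where d4: "d4 > 0" "\<And>t. \<bar>t - t0\<bar> < d4 \<Longrightarrow> norm (u (t, p0) - u (t0, p0)) < e / 2"
        using cu[of p0] half_gt_zero[OF e] unfolding continuous_on_eq_continuous_at[OF open_UNIV] continuous_at_eps_delta
        by (metis UNIV_I dist_norm real_norm_def)
      define d where "d = min (min (min d1 d2) (min d3 d4)) 1"
      have "norm (u z - u (t0, p0)) < e" if z: "dist z (t0, p0) < d" for z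
      proof (cases z)
        case (Pair t p)
        have "\<bar>t - t0\<bar> < d" "norm (p - p0) < d"
          using z dist_fst_le[of z "(t0, p0)"] dist_snd_le[of z "(t0, p0)"]
          by (auto simp: Pair dist_norm dist_real_def)
        then have td: "\<bar>t - t0\<bar> < 1" "\<bar>t - t0\<bar> < d4" and pd: "norm (p - p0) < d1" "norm (p - p0) < d2" "norm (p - p0) < d3"
          by (auto simp: d_def)
        have "norm (u (t, p) - u (t, p0)) \<le> (norm (u (0, p) - u (0, p0)) + (\<epsilon> * M + \<epsilon>) * T) * exp ((L + 1) * T)"
        proof (rule linear_ode_bound[of _ "\<lambda>t. A (t, p)" "\<lambda>t. (A (t, p) - A (t, p0)) (u (t, p0)) + (g (t, p) - g (t, p0))"])
          show "((\<lambda>s. u (s, p) - u (s, p0)) has_vector_derivative A (s, p) (u (s, p) - u (s, p0)) +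
             ((A (s, p) - A (s, p0)) (u (s, p0)) + (g (s, p) - g (s, p0)))) (at s)" for s
            using has_vector_derivative_diff[OF u[of p s] u[of p0 s]]
            by (simp add: blinfun.bilinear_simps algebra_simps)
          fix s assume s: "\<bar>s\<bar> \<le> T"
          show "norm (A (s, p)) \<le> L + 1"
            using d1(2)[OF s pd(1)] L(2)[OF s] norm_triangle_ineq2[of "A (s, p)" "A (s, p0)"] by simp
          have "norm ((A (s, p) - A (s, p0)) (u (s, p0))) \<le> norm (A (s, p) - A (s, p0)) * norm (u (s, p0))"
            by (rule norm_blinfun)
          also have "\<dots> \<le> \<epsilon> * M" using d1(2)[OF s pd(1)] M(2)[OF s] using \<epsilon> by (intro mult_mono) auto
          finally show "norm ((A (s, p) - A (s, p0)) (u (s, p0)) + (g (s, p) - g (s, p0))) \<le> \<epsilon> * M + \<epsilon>"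
            using d2(2)[OF s pd(2)] norm_triangle_ineq[of "(A (s, p) - A (s, p0)) (u (s, p0))" "g (s, p) - g (s, p0)"]
            by linarith
        qed (use td in \<open>auto simp: T_def\<close>)
        also have "\<dots> \<le> (\<epsilon> + (\<epsilon> * M + \<epsilon>) * T) * E"
          unfolding E_def using d3(2)[OF pd(3)] by (intro mult_right_mono add_right_mono) (auto simp: assms)
        also have "\<dots> = \<epsilon> * (1 + (M + 1) * T) * E" by (simp add: algebra_simps)
        also have "\<dots> = e / 4" using E pos by (simp add: \<epsilon>_def)
        finally show ?thesis
          using d4(2)[OF td(2)] norm_triangle_ineq[of "u (t, p) - u (t, p0)" "u (t, p0) - u (t0, p0)"] e
          by (simp add: Pair)
      qed
      moreover have "d > 0" using d1 d2 d3 d4 by (simp add: d_def)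
      ultimately show "\<exists>d>0. \<forall>x'. dist x' (t0, p0) < d \<longrightarrow> dist (u x') (u (t0, p0)) < e"
        by (auto simp: dist_norm)
    qed
  qed
  then show ?thesis by (simp add: continuous_at_imp_continuous_on)
qed

text \<open>Mean value inequality for \<open>G t\<close> minus its linear part at \<open>p0\<close>.
  The change of the derivative is controlled on the finitely many basis vectors, where the tube
  lemma makes it uniform in time.\<close>

lemma uniform_differentiability:
  fixes G :: "real \<Rightarrow> 'p::real_normed_vector \<Rightarrow> 'z::real_normed_vector"
  assumes fd: "fin_dim TYPE('p)"
    and G: "\<And>t p. (G t has_derivative G' t p) (at p)"
    and c: "\<And>v. continuous_on UNIV (\<lambda>(t, p). G' t p v)" and "\<eta> > 0"
  obtains \<delta> where "\<delta> > 0"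
    "\<And>t p. \<bar>t\<bar> \<le> T \<Longrightarrow> norm (p - p0) < \<delta> \<Longrightarrow> norm (G t p - G t p0 - G' t p0 (p - p0)) \<le> \<eta> * norm (p - p0)"
proof -
  obtain B :: "'p set" and cc where B: "finite B" "\<And>b. b \<in> B \<Longrightarrow> bounded_linear (cc b)" "\<And>x. x = (\<Sum>b\<in>B. cc b x *\<^sub>R b)"
    using fin_dim_coordinates[OF fd] by metis
  have "\<exists>K. K > 0 \<and> (\<forall>x. \<bar>cc b x\<bar> \<le> norm x * K)" if "b \<in> B" for b
    using bounded_linear.pos_bounded[OF B(2)[OF that]] by auto
  then obtain K where K: "\<And>b. b \<in> B \<Longrightarrow> K b > 0" "\<And>b x. b \<in> B \<Longrightarrow> \<bar>cc b x\<bar> \<le> norm x * K b" by metis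
  define S where "S = (\<Sum>b\<in>B. K b) + 1"
  have S: "S > 0" "(\<Sum>b\<in>B. K b) \<le> S" using K(1) sum_nonneg[of B K] by (auto simp: S_def less_imp_le add_nonneg_pos)
  have "\<exists>\<delta>>0. \<forall>t p. \<bar>t\<bar> \<le> T \<longrightarrow> norm (p - p0) < \<delta> \<longrightarrow> norm (G' t p b - G' t p0 b) < \<eta> / S" for b
  proof -
    have "\<eta> / S > 0" using S \<open>\<eta> > 0\<close> by simp
    from uniform_on_compact_interval[OF c[of b] this, of T p0] show ?thesis by (metis case_prod_conv)
  qed
  then obtain d where d: "\<And>b. d b > 0"
    "\<And>b t p. \<bar>t\<bar> \<le> T \<Longrightarrow> norm (p - p0) < d b \<Longrightarrow> norm (G' t p b - G' t p0 b) < \<eta> / S" by metis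
  define \<delta> where "\<delta> = Min (insert 1 (d ` B))"
  have \<delta>: "\<delta> > 0" "\<And>b. b \<in> B \<Longrightarrow> \<delta> \<le> d b" using B(1) d(1) by (auto simp: \<delta>_def)
  show ?thesis
  proof (rule that[OF \<delta>(1)])
    fix t p assume t: "\<bar>t\<bar> \<le> T" and p: "norm (p - p0) < \<delta>"
    let ?h = "\<lambda>q. G t q - G' t p0 q"
    have l: "linear (G' t q)" for q using G has_derivative_bounded_linear bounded_linear.linear by blast
    have "norm (?h p - ?h p0) \<le> \<eta> * norm (p - p0)"
    proof (rule differentiable_bound[where S = "ball p0 \<delta>" and f' = "\<lambda>q v. G' t q v - G' t p0 v"])
      fix q assume q: "q \<in> ball p0 \<delta>"
      have "(G' t p0 has_derivative G' t p0) (at q)"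
        by (rule bounded_linear_imp_has_derivative[OF has_derivative_bounded_linear[OF G]])
      then show "(?h has_derivative (\<lambda>v. G' t q v - G' t p0 v)) (at q within ball p0 \<delta>)"
        by (rule has_derivative_diff[OF has_derivative_at_withinI[OF G] has_derivative_at_withinI])
      show "onorm (\<lambda>v. G' t q v - G' t p0 v) \<le> \<eta>"
      proof (rule onorm_bound)
        show "0 \<le> \<eta>" using \<open>\<eta> > 0\<close> by simp
        fix v
        have "G' t q v - G' t p0 v = (\<Sum>b\<in>B. cc b v *\<^sub>R (G' t q b - G' t p0 b))"
        proof -
          have "G' t r v = (\<Sum>b\<in>B. cc b v *\<^sub>R G' t r b)" for r
            by (subst B(3)[of v]) (simp add: linear_sum[OF l] linear_cmul[OF l])
          from this[of q] this[of p0] show ?thesis by (simp add: scaleR_diff_right sum_subtractf)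
        qed
        also have "norm \<dots> \<le> (\<Sum>b\<in>B. (norm v * K b) * (\<eta> / S))"
        proof (rule sum_norm_le)
          fix b assume b: "b \<in> B"
          have "norm (G' t q b - G' t p0 b) \<le> \<eta> / S"
            using d(2)[OF t, of q b] \<delta>(2)[OF b] q by (simp add: dist_norm norm_minus_commute)
          with K(2)[OF b, of v]
          have "\<bar>cc b v\<bar> * norm (G' t q b - G' t p0 b) \<le> (norm v * K b) * (\<eta> / S)"
            by (rule mult_mono) (use K(1)[OF b] in auto)
          then show "norm (cc b v *\<^sub>R (G' t q b - G' t p0 b)) \<le> (norm v * K b) * (\<eta> / S)"
            by (simp only: norm_scaleR)
        qed
        also have "\<dots> = (\<Sum>b\<in>B. K b) / S * (\<eta> * norm v)"
          by (simp add: sum_distrib_right sum_distrib_left sum_divide_distrib mult.commute mult.left_commute)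
        also have "\<dots> \<le> 1 * (\<eta> * norm v)"
          using S \<open>\<eta> > 0\<close> by (intro mult_right_mono) auto
        finally show "norm (G' t q v - G' t p0 v) \<le> \<eta> * norm v" by simp
      qed
    qed (use p \<delta> in \<open>auto simp: dist_norm norm_minus_commute\<close>)
    then show "norm (G t p - G t p0 - G' t p0 (p - p0)) \<le> \<eta> * norm (p - p0)"
      by (simp add: linear_diff[OF l] algebra_simps)
  qed
qed

text \<open>The candidate derivative \<open>w\<close> solves the variational equation. The error
  \<open>u (t, q) - u (t, p) - w (q - p) t\<close> again solves a linear equation, whose
  inhomogeneity is small compared with the increment, uniformly in time; Gronwall's inequality
  passes this on to the error.\<close>

lemma linear_ode_differentiable:
  fixes A :: "real \<times> 'p::real_normed_vector \<Rightarrow> 'y::banach \<Rightarrow>\<^sub>L 'y"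
  assumes fd: "fin_dim TYPE('p)"
    and A: "C_k_on 1 UNIV A" and g: "C_k_on 1 UNIV g" and u0: "\<And>p. (u0 has_derivative u0' p) (at p)"
    and u: "\<And>t p. ((\<lambda>t. u (t, p)) has_vector_derivative A (t, p) (u (t, p)) + g (t, p)) (at t)"
    and ui: "\<And>p. u (0, p) = u0 p"
    and w: "\<And>t v. (w v has_vector_derivative A (t, p) (w v t) +
        (frechet_derivative A (at (t, p)) (0, v) (u (t, p)) + frechet_derivative g (at (t, p)) (0, v))) (at t)"
    and wi: "\<And>v. w v 0 = u0' p v"
  shows "((\<lambda>p. u (t, p)) has_derivative (\<lambda>v. w v t)) (at p)"
proof -
  let ?A' = "\<lambda>t q v. frechet_derivative A (at (t, q)) (0, v)"
  let ?g' = "\<lambda>t q v. frechet_derivative g (at (t, q)) (0, v)"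
  have Ac: "continuous_on UNIV A" and gc: "continuous_on UNIV g"
    using C_k_on_continuous[OF A] C_k_on_continuous[OF g] .
  have part: "((\<lambda>q. h (t, q)) has_derivative (\<lambda>v. frechet_derivative h (at (t, q)) (0, v))) (at q)"
      "linear (\<lambda>v. frechet_derivative h (at (t, q)) (0, v))"
      "continuous_on UNIV (\<lambda>(t, q). frechet_derivative h (at (t, q)) (0, v))"
    if "C_k_on 1 UNIV h" for h :: "real \<times> 'p \<Rightarrow> 'c::real_normed_vector" and t q v
  proof -
    note H = C_k_on_SucE[OF that[unfolded One_nat_def]]
    have d: "((\<lambda>q. (t, q)) has_derivative (\<lambda>v. (0, v))) (at q)"
      by (auto intro!: derivative_eq_intros)
    show 1: "((\<lambda>q. h (t, q)) has_derivative (\<lambda>v. frechet_derivative h (at (t, q)) (0, v))) (at q)"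
      using has_derivative_compose[OF d H(1)] by simp
    show "linear (\<lambda>v. frechet_derivative h (at (t, q)) (0, v))"
      using has_derivative_bounded_linear[OF 1] bounded_linear.linear by blast
    show "continuous_on UNIV (\<lambda>(t, q). frechet_derivative h (at (t, q)) (0, v))"
      using C_k_on_continuous[OF H(2), of "(0, v)"] by (simp add: case_prod_beta)
  qed
  note A' = part[OF A] and g' = part[OF g]
  have Acp: "continuous_on UNIV (\<lambda>t. A (t, p))" by (rule continuous_slice[OF Ac])
  \<comment> \<open>Linearity in the direction is a consequence of uniqueness: combinations of
    solutions of the variational equation solve it for the combined direction.\<close>
  have lin: "linear (\<lambda>v. w v t)" for t
  proof (rule linearI)
    show "w (v + v') t = w v t + w v' t" for v v'
    proof (rule linear_ode_unique[OF Acp w])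
      show "((\<lambda>t. w v t + w v' t) has_vector_derivative A (s, p) (w v s + w v' s) +
          (?A' s p (v + v') (u (s, p)) + ?g' s p (v + v'))) (at s)" for s
        using has_vector_derivative_add[OF w[of v s] w[of v' s]]
        by (simp add: linear_add[OF A'(2)] linear_add[OF g'(2)] blinfun.bilinear_simps algebra_simps)
      show "w (v + v') 0 = w v 0 + w v' 0"
        by (simp add: wi linear_add has_derivative_linear[OF u0])
    qed
    show "w (r *\<^sub>R v) t = r *\<^sub>R w v t" for r v
    proof (rule linear_ode_unique[OF Acp w])
      show "((\<lambda>t. r *\<^sub>R w v t) has_vector_derivative A (s, p) (r *\<^sub>R w v s) +
          (?A' s p (r *\<^sub>R v) (u (s, p)) + ?g' s p (r *\<^sub>R v))) (at s)" for s
        using bounded_linear.has_vector_derivative[OF bounded_linear_scaleR_right[of r] w[of v s]]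
        by (simp add: linear_cmul[OF A'(2)] linear_cmul[OF g'(2)] blinfun.bilinear_simps algebra_simps)
      show "w (r *\<^sub>R v) 0 = r *\<^sub>R w v 0"
        by (simp add: wi linear_cmul has_derivative_linear[OF u0])
    qed
  qed
  define T where "T = \<bar>t\<bar>"
  obtain B :: "'p set" and cc where B: "finite B" "\<And>b. b \<in> B \<Longrightarrow> bounded_linear (cc b)" "\<And>x. x = (\<Sum>b\<in>B. cc b x *\<^sub>R b)"
    using fin_dim_coordinates[OF fd] by metis
  have wc: "continuous_on UNIV (w v)" for v
    using w by (meson continuous_at_imp_continuous_on has_vector_derivative_continuous)
  have uc: "continuous_on UNIV (\<lambda>t. u (t, p))"
    using u by (meson continuous_at_imp_continuous_on has_vector_derivative_continuous)
  have "\<exists>C>0. \<forall>s v. \<bar>s\<bar> \<le> T \<longrightarrow> norm (w v s) \<le> C * norm v"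
  proof -
    have "\<exists>M>0. \<forall>s. \<bar>s\<bar> \<le> T \<longrightarrow> norm (w b s) \<le> M" for b using bounded_on_interval[OF wc[of b], of T] by metis
    then obtain M where M: "\<And>b. M b > 0" "\<And>b s. \<bar>s\<bar> \<le> T \<Longrightarrow> norm (w b s) \<le> M b" by metis
    have "\<exists>K. K > 0 \<and> (\<forall>x. \<bar>cc b x\<bar> \<le> norm x * K)" if "b \<in> B" for b
      using bounded_linear.pos_bounded[OF B(2)[OF that]] by auto
    then obtain K where K: "\<And>b. b \<in> B \<Longrightarrow> K b > 0" "\<And>b x. b \<in> B \<Longrightarrow> \<bar>cc b x\<bar> \<le> norm x * K b" by metis
    have "norm (w v s) \<le> ((\<Sum>b\<in>B. K b * M b) + 1) * norm v" if "\<bar>s\<bar> \<le> T" for s v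
    proof -
      have "w v s = (\<Sum>b\<in>B. cc b v *\<^sub>R w b s)"
        by (subst B(3)[of v]) (simp add: linear_sum[OF lin] linear_cmul[OF lin])
      also have "norm \<dots> \<le> (\<Sum>b\<in>B. (norm v * K b) * M b)"
        using K M(2)[OF that] by (intro sum_norm_le) (auto intro!: mult_mono simp: less_imp_le)
      also have "\<dots> = (\<Sum>b\<in>B. K b * M b) * norm v" by (simp add: sum_distrib_right sum_distrib_left mult_ac)
      also have "\<dots> \<le> ((\<Sum>b\<in>B. K b * M b) + 1) * norm v" by (intro mult_right_mono) auto
      finally show ?thesis .
    qed
    moreover have "(\<Sum>b\<in>B. K b * M b) + 1 > 0"
      using K(1) M(1) by (auto intro!: add_nonneg_pos sum_nonneg simp: less_imp_le)
    ultimately show ?thesis by blast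
  qed
  then obtain C where C: "C > 0" "\<And>s v. \<bar>s\<bar> \<le> T \<Longrightarrow> norm (w v s) \<le> C * norm v" by blast
  obtain M where M: "M > 0" "\<And>s. \<bar>s\<bar> \<le> T \<Longrightarrow> norm (u (s, p)) \<le> M" using bounded_on_interval[OF uc] by metis
  obtain L where L: "L > 0" "\<And>s. \<bar>s\<bar> \<le> T \<Longrightarrow> norm (A (s, p)) \<le> L" using bounded_on_interval[OF Acp] by metis
  show ?thesis unfolding has_derivative_at_alt
  proof (intro conjI allI impI)
    show "bounded_linear (\<lambda>v. w v t)" by (rule linear_bounded_fin_dim[OF fd lin])
    fix e :: real assume e: "e > 0"
    define E where "E = exp ((L + 1) * T)"
    define \<kappa> where "\<kappa> = (1 + (M + 1 + C) * T) * E"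
    have pos: "\<kappa> > 0" using M C unfolding \<kappa>_def E_def T_def by (intro mult_pos_pos add_pos_nonneg) auto
    define \<epsilon> where "\<epsilon> = e / \<kappa>"
    have \<epsilon>: "\<epsilon> > 0" using e pos by (simp add: \<epsilon>_def)
    obtain d1 where d1: "d1 > 0" "\<And>t q. \<bar>t\<bar> \<le> T \<Longrightarrow> norm (q - p) < d1 \<Longrightarrow> norm (A (t, q) - A (t, p)) < min 1 \<epsilon>"
      using uniform_on_compact_interval[OF Ac, of "min 1 \<epsilon>"] \<epsilon> by (metis min_less_iff_conj zero_less_one)
    obtain d2 where d2: "d2 > 0" "\<And>t q. \<bar>t\<bar> \<le> T \<Longrightarrow> norm (q - p) < d2 \<Longrightarrow>
        norm (A (t, q) - A (t, p) - ?A' t p (q - p)) \<le> \<epsilon> * norm (q - p)"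
      using uniform_differentiability[OF fd A'(1,3) \<epsilon>, of T p] by blast
    obtain d3 where d3: "d3 > 0" "\<And>t q. \<bar>t\<bar> \<le> T \<Longrightarrow> norm (q - p) < d3 \<Longrightarrow>
        norm (g (t, q) - g (t, p) - ?g' t p (q - p)) \<le> \<epsilon> * norm (q - p)"
      using uniform_differentiability[OF fd g'(1,3) \<epsilon>, of T p] by blast
    obtain d4 where d4: "d4 > 0" "\<And>q. norm (q - p) < d4 \<Longrightarrow> norm (u0 q - u0 p - u0' p (q - p)) \<le> \<epsilon> * norm (q - p)"
      using u0[of p] \<epsilon> unfolding has_derivative_at_alt by blast
    show "\<exists>d>0. \<forall>q. norm (q - p) < d \<longrightarrow> norm (u (t, q) - u (t, p) - w (q - p) t) \<le> e * norm (q - p)"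
    proof (intro exI[of _ "min (min d1 d2) (min d3 d4)"] conjI allI impI)
      fix q assume "norm (q - p) < min (min d1 d2) (min d3 d4)"
      then have q: "norm (q - p) < d1" "norm (q - p) < d2" "norm (q - p) < d3" "norm (q - p) < d4" by auto
      let ?v = "q - p"
      \<comment> \<open>The three terms are the change of the coefficient acting on \<open>w\<close>
        and the first-order Taylor remainders of \<open>A\<close> and of \<open>g\<close>.\<close>
      let ?r = "\<lambda>s. (A (s, q) - A (s, p)) (w ?v s) + (A (s, q) - A (s, p) - ?A' s p ?v) (u (s, p))
                 + (g (s, q) - g (s, p) - ?g' s p ?v)"
      have "norm (u (t, q) - u (t, p) - w ?v t) \<le>
         (norm (u (0, q) - u (0, p) - w ?v 0) + ((\<epsilon> * (C * norm ?v)) + (\<epsilon> * norm ?v) * M + \<epsilon> * norm ?v) * T) * exp ((L + 1) * T)"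
      proof (rule linear_ode_bound[of _ "\<lambda>s. A (s, q)" ?r])
        show "((\<lambda>s. u (s, q) - u (s, p) - w ?v s) has_vector_derivative
           A (s, q) (u (s, q) - u (s, p) - w ?v s) + ?r s) (at s)" for s
          using has_vector_derivative_diff[OF has_vector_derivative_diff[OF u[of q s] u[of p s]] w[of ?v s]]
          by (simp add: blinfun.bilinear_simps algebra_simps)
        fix s assume s: "\<bar>s\<bar> \<le> T"
        show "norm (A (s, q)) \<le> L + 1"
          using d1(2)[OF s q(1)] L(2)[OF s] norm_triangle_ineq2[of "A (s, q)" "A (s, p)"] by simp
        have "norm ((A (s, q) - A (s, p)) (w ?v s)) \<le> norm (A (s, q) - A (s, p)) * norm (w ?v s)"
          by (rule norm_blinfun)
        also have "\<dots> \<le> \<epsilon> * (C * norm ?v)"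
          using d1(2)[OF s q(1)] C(2)[OF s] \<epsilon> by (intro mult_mono) auto
        finally have 1: "norm ((A (s, q) - A (s, p)) (w ?v s)) \<le> \<epsilon> * (C * norm ?v)" .
        have "norm ((A (s, q) - A (s, p) - ?A' s p ?v) (u (s, p))) \<le> norm (A (s, q) - A (s, p) - ?A' s p ?v) * norm (u (s, p))"
          by (rule norm_blinfun)
        also have "\<dots> \<le> (\<epsilon> * norm ?v) * M"
          using d2(2)[OF s q(2)] M(2)[OF s] \<epsilon> by (intro mult_mono) auto
        finally show "norm (?r s) \<le> (\<epsilon> * (C * norm ?v)) + (\<epsilon> * norm ?v) * M + \<epsilon> * norm ?v"
          by (intro norm_triangle_le add_mono 1 d3(2)[OF s q(3)])
      qed (auto simp: T_def)
      also have "\<dots> \<le> (\<epsilon> * norm ?v + ((\<epsilon> * (C * norm ?v)) + (\<epsilon> * norm ?v) * M + \<epsilon> * norm ?v) * T) * exp ((L + 1) * T)"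
        using d4(2)[OF q(4)] by (intro mult_right_mono add_right_mono) (auto simp: ui wi)
      also have "\<dots> = \<epsilon> * \<kappa> * norm ?v" by (simp add: \<kappa>_def E_def algebra_simps)
      also have "\<dots> = e * norm ?v" using pos by (simp add: \<epsilon>_def)
      finally show "norm (u (t, q) - u (t, p) - w ?v t) \<le> e * norm ?v" .
    qed (use d1 d2 d3 d4 in auto)
  qed
qed

text \<open>The derivative in a parameter direction satisfies a linear equation with the same
  coefficient, but with a new inhomogeneity and initial value that are one order less regular. Hence
  the induction keeps \<open>A\<close> and lets \<open>g\<close>, \<open>u0\<close> and
  \<open>u\<close> vary.\<close>

lemma linear_ode_C_k:
  fixes A :: "real \<times> 'p::real_normed_vector \<Rightarrow> 'y::banach \<Rightarrow>\<^sub>L 'y"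
  assumes fd: "fin_dim TYPE('p)"
    and "C_k_on k UNIV A" "C_k_on k UNIV g" "C_k_on k UNIV u0"
    and "\<And>t p. ((\<lambda>t. u (t, p)) has_vector_derivative A (t, p) (u (t, p)) + g (t, p)) (at t)"
    and "\<And>p. u (0, p) = u0 p"
  shows "C_k_on k UNIV u"
  using assms(2-)
proof (induction k arbitrary: g u0 u)
  case 0
  then show ?case using linear_ode_continuous[of A g u0 u] by simp
next
  case (Suc k)
  note A = Suc.prems(1) and g = Suc.prems(2) and u0 = Suc.prems(3) and u = Suc.prems(4) and ui = Suc.prems(5)
  have uk: "C_k_on k UNIV u"
    by (rule Suc.IH[OF C_k_on_SucD C_k_on_SucD C_k_on_SucD u ui]) (use A g u0 in auto)
  have Ac: "continuous_on UNIV A" using A C_k_on_continuous by blast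
  have one: "C_k_on 1 UNIV h" if "C_k_on (Suc k) UNIV h" for h :: "real \<times> 'p \<Rightarrow> 'c::real_normed_vector"
    unfolding One_nat_def C_k_on.simps using that C_k_on_continuous[OF C_k_on_SucE(2)[OF that]] by auto
  let ?G = "\<lambda>v z. frechet_derivative A (at z) (0, v) (u z) + frechet_derivative g (at z) (0, v)"
  have Gk: "C_k_on k UNIV (?G v)" for v
    by (intro C_k_on_add open_UNIV C_k_on_bilinear[OF bounded_bilinear_blinfun_apply] uk
         C_k_on_SucE(2)[OF A] C_k_on_SucE(2)[OF g])
  have "\<exists>w. w 0 = frechet_derivative u0 (at p) v \<and>
      (\<forall>t. (w has_vector_derivative A (t, p) (w t) + ?G v (t, p)) (at t))" for p v
    using linear_ode_exists[OF continuous_slice[OF Ac] continuous_slice[OF C_k_on_continuous[OF Gk]]] by metis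
  then obtain W where W: "\<And>p v. W p v 0 = frechet_derivative u0 (at p) v"
    "\<And>p v t. (W p v has_vector_derivative A (t, p) (W p v t) + ?G v (t, p)) (at t)" by metis
  have Wk: "C_k_on k UNIV (\<lambda>z. W (snd z) v (fst z))" for v
    by (rule Suc.IH[OF C_k_on_SucD[OF A] Gk C_k_on_SucE(2)[OF u0, of v]]) (use W in auto)
  have dp: "((\<lambda>p. u (t, p)) has_derivative (\<lambda>v. W p v t)) (at p)" for t p
    by (rule linear_ode_differentiable[OF fd one[OF A] one[OF g] C_k_on_SucE(1)[OF u0] u ui]) (auto intro: W)
  define f where "f z = A z (u z) + g z" for z
  have fk: "C_k_on k UNIV f" unfolding f_def
    by (intro C_k_on_add open_UNIV C_k_on_bilinear[OF bounded_bilinear_blinfun_apply] uk C_k_on_SucD[OF A] C_k_on_SucD[OF g])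
  \<comment> \<open>The partial derivatives assemble to a total one because the derivative in time,
    namely the right-hand side \<open>f\<close>, is jointly continuous.\<close>
  have du: "(u has_derivative (\<lambda>d. W (snd z) (snd d) (fst z) + fst d *\<^sub>R f z)) (at z)" for z
  proof (cases z)
    case (Pair t p)
    have "((\<lambda>(p, t). u (t, p)) has_derivative (\<lambda>(dp, dt). W p dp t + blinfun_scaleR_left (f (t, p)) dt)) (at (p, t) within UNIV \<times> UNIV)"
    proof (rule has_derivative_partialsI)
      show "((\<lambda>p. u (t, p)) has_derivative (\<lambda>v. W p v t)) (at p)" by (rule dp)
      show "((\<lambda>t. u (t, p)) has_derivative blinfun_scaleR_left (f (t, p))) (at t)" for t p
        using u[of p t] by (simp add: has_vector_derivative_def f_def)
      have "continuous_on UNIV (\<lambda>z. blinfun_scaleR_left (f (snd z, fst z)))"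
        by (intro bounded_linear.continuous_on[OF bounded_linear_blinfun_scaleR_left]
            continuous_on_compose2[OF C_k_on_continuous[OF fk]]) (auto intro!: continuous_intros)
      then show "continuous (at (p, t) within UNIV \<times> UNIV) (\<lambda>(p, t). blinfun_scaleR_left (f (t, p)))"
        by (simp add: case_prod_beta' continuous_on_eq_continuous_at)
    qed auto
    then have *: "((\<lambda>z. u (snd z, fst z)) has_derivative (\<lambda>d. W p (fst d) t + snd d *\<^sub>R f (t, p))) (at (p, t))"
      by (simp add: case_prod_beta')
    have "((\<lambda>z. (snd z, fst z)) has_derivative (\<lambda>d. (snd d, fst d))) (at (t, p))"
      by (auto intro!: derivative_eq_intros)
    from has_derivative_compose[OF this, of "\<lambda>z. u (snd z, fst z)" "\<lambda>d. W p (fst d) t + snd d *\<^sub>R f (t, p)"] *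
    show ?thesis by (simp add: Pair)
  qed
  show ?case
    by (rule C_k_on_SucI[OF open_UNIV du])
       (intro C_k_on_add open_UNIV Wk C_k_on_bilinear[OF bounded_bilinear_scaleR] C_k_on_const fk)
qed

subsection \<open>Smooth flows\<close>

text \<open>Regularity in each direction gives regularity in the operator norm: an operator on a
  finite-dimensional space is a finite sum of rank-one operators built from its values on a
  basis.\<close>

lemma C_k_on_Blinfun:
  fixes F :: "'z::real_normed_vector \<Rightarrow> 'p::real_normed_vector \<Rightarrow> 'y::real_normed_vector"
  assumes fd: "fin_dim TYPE('p)" and "open S" "\<And>z. bounded_linear (F z)" "\<And>v. C_k_on k S (\<lambda>z. F z v)"
  shows "C_k_on k S (\<lambda>z. Blinfun (F z))"
proof -
  obtain B :: "'p set" and c where B: "finite B" "\<And>b. b \<in> B \<Longrightarrow> bounded_linear (c b)" "\<And>x. x = (\<Sum>b\<in>B. c b x *\<^sub>R b)"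
    using fin_dim_coordinates[OF fd] by metis
  have "Blinfun (F z) = (\<Sum>b\<in>B. blinfun_scaleR_left (F z b) o\<^sub>L Blinfun (c b))" for z
  proof (rule blinfun_eqI)
    fix v
    have l: "linear (F z)" using assms(3) bounded_linear.linear by blast
    have "blinfun_apply (Blinfun (F z)) v = (\<Sum>b\<in>B. c b v *\<^sub>R F z b)"
      by (subst B(3)[of v]) (simp add: bounded_linear_Blinfun_apply assms(3) linear_sum[OF l] linear_cmul[OF l])
    then show "blinfun_apply (Blinfun (F z)) v = blinfun_apply (\<Sum>b\<in>B. blinfun_scaleR_left (F z b) o\<^sub>L Blinfun (c b)) v"
      using B(2) by (simp add: blinfun.sum_left bounded_linear_Blinfun_apply)
  qed
  moreover have "C_k_on k S (\<lambda>z. \<Sum>b\<in>B. blinfun_scaleR_left (F z b) o\<^sub>L Blinfun (c b))"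
    by (intro C_k_on_sum assms C_k_on_bilinear[OF bounded_bilinear_blinfun_compose] C_k_on_const
        C_k_on_linear_comp[OF bounded_linear_blinfun_scaleR_left])
  ultimately show ?thesis by simp
qed

text \<open>A global Lipschitz bound yields solutions for all times. Smoothness is bootstrapped: the
  space derivative \<open>U\<close> of the flow solves a linear equation whose coefficient is the
  derivative of \<open>V\<close> along the flow. If the flow is of class k, so are the coefficient
  and \<open>U\<close>, and the flow is of class k + 1.\<close>

lemma flow_exists:
  fixes V :: "'n::banach \<Rightarrow> 'n"
  assumes fd: "fin_dim TYPE('n)" and V: "smooth_on UNIV V"
    and lip: "\<And>x y. norm (V x - V y) \<le> L * norm (x - y)"
  obtains \<Phi> where "smooth_on UNIV (\<lambda>z. \<Phi> (fst z) (snd z))" "\<And>x. \<Phi> 0 x = x"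
    "\<And>t x. ((\<lambda>t. \<Phi> t x) has_vector_derivative V (\<Phi> t x)) (at t)"
proof -
  have Vk: "C_k_on k UNIV V" for k using V by (simp add: smooth_on_open)
  have Vc: "continuous_on UNIV V" using C_k_on_continuous[OF Vk] .
  have L0: "L \<ge> 0 \<or> (\<forall>x y::'n. x = y)"
    using lip by (metis eq_iff_diff_eq_0 norm_ge_zero norm_le_zero_iff order_trans zero_le_mult_iff)
  define L' where "L' = max L 0"
  have L': "L' \<ge> 0" "norm (V x - V y) \<le> L' * norm (x - y)" for x y
    using lip[of x y] mult_right_mono[of L L' "norm (x - y)"] by (auto simp: L'_def)
  have "\<exists>u. u 0 = x \<and> (\<forall>t. (u has_vector_derivative V (u t)) (at t))" for x
  proof (rule ivp_exists[of "\<lambda>_. V"])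
    show "continuous_on UNIV (\<lambda>(t, y). V y)" 
      using continuous_on_compose2[OF Vc, of UNIV snd] by (simp add: case_prod_beta' continuous_on_snd)
  qed (use lip in blast)+
  then obtain \<phi> where \<phi>0: "\<And>x. \<phi> x 0 = x" and \<phi>: "\<And>x t. (\<phi> x has_vector_derivative V (\<phi> x t)) (at t)" by metis
  define \<Phi> where "\<Phi> z = \<phi> (snd z) (fst z)" for z
  have \<Phi>: "((\<lambda>t. \<Phi> (t, x)) has_vector_derivative V (\<Phi> (t, x))) (at t)" for t x
    using \<phi> by (simp add: \<Phi>_def)
  have gr: "norm (\<Phi> (t, x) - \<Phi> (t, y)) \<le> norm (x - y) * exp (L' * \<bar>t\<bar>)" for t x y
  proof -
    have "norm (\<Phi> (t, x) - \<Phi> (t, y)) \<le> (norm (\<Phi> (0, x) - \<Phi> (0, y)) + 0 * \<bar>t - 0\<bar>) * exp (L' * \<bar>t - 0\<bar>)"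
      by (rule gronwall[where w' = "\<lambda>t. V (\<Phi> (t, x)) - V (\<Phi> (t, y))"])
         (use L' in \<open>auto intro!: derivative_eq_intros \<Phi>\<close>)
    then show ?thesis by (simp add: \<Phi>_def \<phi>0)
  qed
  have \<Phi>cx: "continuous_on UNIV (\<lambda>t. \<Phi> (t, x))" for x
    using \<Phi> by (meson continuous_at_imp_continuous_on has_vector_derivative_continuous)
  have \<Phi>c: "continuous_on UNIV \<Phi>"
  proof -
    have "continuous (at z) \<Phi>" for z
    proof -
      let ?g = "\<lambda>z'. norm (snd z' - snd z) * exp (L' * \<bar>fst z'\<bar>) + norm (\<Phi> (fst z', snd z) - \<Phi> z)"
      have "continuous_on UNIV ?g"
        by (intro continuous_intros continuous_on_compose2[OF \<Phi>cx[of "snd z"], of UNIV fst]) auto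
      then have "isCont ?g z" using continuous_on_eq_continuous_at[OF open_UNIV] by blast
      then have "(?g \<longlongrightarrow> ?g z) (at z)" by (rule isContD)
      then have "(?g \<longlongrightarrow> 0) (at z)" by simp
      then have "((\<lambda>z'. \<Phi> z' - \<Phi> z) \<longlongrightarrow> 0) (at z)"
      proof (rule Lim_null_comparison[rotated], intro always_eventually allI)
        fix z'
        show "norm (\<Phi> z' - \<Phi> z) \<le> ?g z'"
          using gr[of "fst z'" "snd z'" "snd z"] norm_triangle_ineq[of "\<Phi> z' - \<Phi> (fst z', snd z)" "\<Phi> (fst z', snd z) - \<Phi> z"]
          by simp
      qed
      then show ?thesis unfolding continuous_at by (simp add: LIM_zero_iff)
    qed
    then show ?thesis by (simp add: continuous_at_imp_continuous_on)
  qed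
  let ?V' = "\<lambda>x. frechet_derivative V (at x)"
  have V': "(V has_derivative ?V' x) (at x)" for x using C_k_on_SucE(1)[OF Vk] by blast
  have bl: "bounded_linear (?V' x)" for x using V' has_derivative_bounded_linear by blast
  have V'k: "C_k_on k UNIV (\<lambda>x. ?V' x v)" for k v using C_k_on_SucE(2)[OF Vk] .
  define A where "A z = Blinfun (?V' (\<Phi> z))" for z
  have Aapp: "A z v = ?V' (\<Phi> z) v" for z v by (simp add: A_def bounded_linear_Blinfun_apply bl)
  have Ak: "C_k_on k UNIV A" if "C_k_on k UNIV \<Phi>" for k
    unfolding A_def by (rule C_k_on_Blinfun[OF fd open_UNIV bl])
      (rule C_k_on_comp[OF fd open_UNIV open_UNIV subset_UNIV that V'k])
  have A0: "continuous_on UNIV A" using Ak[of 0] \<Phi>c by simp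
  have "\<forall>x v. \<exists>w. w 0 = v \<and> (\<forall>t. (w has_vector_derivative A (t, x) (w t) + 0) (at t))"
  proof (intro allI)
    fix x v
    show "\<exists>w. w 0 = v \<and> (\<forall>t. (w has_vector_derivative A (t, x) (w t) + 0) (at t))"
      by (rule linear_ode_exists[OF continuous_slice[OF A0, of x] continuous_on_const, of v 0]) blast
  qed
  then obtain U where "\<forall>x v. U x v 0 = v \<and> (\<forall>t. (U x v has_vector_derivative A (t, x) (U x v t) + 0) (at t))"
    unfolding choice_iff by blast
  then have U0: "\<And>x v. U x v 0 = v"
    and U: "\<And>x v t. (U x v has_vector_derivative A (t, x) (U x v t) + 0) (at t)" by blast+
  have Ulin: "bounded_linear (\<lambda>v. U x v t)" for x t
  proof (intro linear_bounded_fin_dim[OF fd] linearI)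
    show "U x (v + v') t = U x v t + U x v' t" for v v'
      by (rule linear_ode_unique[OF continuous_slice[OF A0] U])
         (use has_vector_derivative_add[OF U U] in \<open>simp_all add: U0 blinfun.bilinear_simps\<close>)
    show "U x (r *\<^sub>R v) t = r *\<^sub>R U x v t" for r v
      by (rule linear_ode_unique[OF continuous_slice[OF A0] U])
         (use bounded_linear.has_vector_derivative[OF bounded_linear_scaleR_right[of r] U] in
           \<open>simp_all add: U0 blinfun.bilinear_simps\<close>)
  qed
  \<comment> \<open>The equation is nonlinear, so the first derivative is established by hand: the
    error solves the linearised equation with the Taylor remainder \<open>?r\<close> of
    \<open>V\<close> along the solution, which \<open>gr\<close> bounds in terms of the
    increment.\<close>
  have dx: "((\<lambda>x. \<Phi> (t, x)) has_derivative (\<lambda>v. U x v t)) (at x)" for t x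
    unfolding has_derivative_at_alt
  proof (intro conjI Ulin allI impI)
    fix e :: real assume e: "e > 0"
    define T where "T = \<bar>t\<bar>"
    obtain K where K: "K > 0" "\<And>s. \<bar>s\<bar> \<le> T \<Longrightarrow> norm (A (s, x)) \<le> K"
      using bounded_on_interval[OF continuous_slice[OF A0]] by metis
    \<comment> \<open>The summand 1 keeps \<open>\<kappa>\<close> positive when \<open>T\<close> is
      0.\<close>
    define \<kappa> where "\<kappa> = exp (L' * T) * T * exp (K * T) + 1"
    have \<kappa>: "\<kappa> > 0" unfolding \<kappa>_def T_def by (auto intro!: add_nonneg_pos)
    define \<eta> where "\<eta> = e / \<kappa>"
    have \<eta>: "\<eta> > 0" using e \<kappa> by (simp add: \<eta>_def)
    have dV: "((\<lambda>y. V (\<Phi> (s, x) + y)) has_derivative ?V' (\<Phi> (s, x) + y)) (at y)" for s y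
    proof -
      have "((\<lambda>y. \<Phi> (s, x) + y) has_derivative (\<lambda>v. v)) (at y)" by (auto intro!: derivative_eq_intros)
      from has_derivative_compose[OF this V'] show ?thesis by simp
    qed
    have "continuous_on UNIV (\<lambda>(s, y). ?V' (\<Phi> (s, x) + y) v)" for v
      unfolding case_prod_beta'
      by (rule continuous_on_compose2[OF C_k_on_continuous[OF V'k]])
         (auto intro!: continuous_intros continuous_on_compose2[OF \<Phi>cx[of x]])
    from uniform_differentiability[OF fd dV this \<eta>, of T 0]
    obtain \<delta> where \<delta>: "\<delta> > 0" "\<And>s y. \<bar>s\<bar> \<le> T \<Longrightarrow> norm y < \<delta> \<Longrightarrow>
        norm (V (\<Phi> (s, x) + y) - V (\<Phi> (s, x)) - ?V' (\<Phi> (s, x)) y) \<le> \<eta> * norm y" by auto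
    define d where "d = \<delta> / exp (L' * T)"
    show "\<exists>d>0. \<forall>y. norm (y - x) < d \<longrightarrow> norm (\<Phi> (t, y) - \<Phi> (t, x) - U x (y - x) t) \<le> e * norm (y - x)"
    proof (intro exI[of _ d] conjI allI impI)
      show "d > 0" using \<delta> by (simp add: d_def)
      fix y assume y: "norm (y - x) < d"
      have gT: "norm (\<Phi> (s, y) - \<Phi> (s, x)) \<le> norm (y - x) * exp (L' * T)" if "\<bar>s\<bar> \<le> T" for s
        by (rule order_trans[OF gr]) (use that L'(1) in \<open>auto intro!: mult_left_mono\<close>)
      let ?r = "\<lambda>s. V (\<Phi> (s, y)) - V (\<Phi> (s, x)) - ?V' (\<Phi> (s, x)) (\<Phi> (s, y) - \<Phi> (s, x))"
      have "norm (\<Phi> (t, y) - \<Phi> (t, x) - U x (y - x) t) \<le>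
         (norm (\<Phi> (0, y) - \<Phi> (0, x) - U x (y - x) 0) + (\<eta> * (norm (y - x) * exp (L' * T))) * T) * exp (K * T)"
      proof (rule linear_ode_bound[of _ "\<lambda>s. A (s, x)" ?r])
        show "((\<lambda>s. \<Phi> (s, y) - \<Phi> (s, x) - U x (y - x) s) has_vector_derivative
           A (s, x) (\<Phi> (s, y) - \<Phi> (s, x) - U x (y - x) s) + ?r s) (at s)" for s
          using has_vector_derivative_diff[OF has_vector_derivative_diff[OF \<Phi>[of y s] \<Phi>[of x s]] U[of x "y - x" s]]
          by (simp add: Aapp linear_diff[OF bounded_linear.linear[OF bl]])
        fix s assume s: "\<bar>s\<bar> \<le> T"
        have "norm (\<Phi> (s, y) - \<Phi> (s, x)) < \<delta>"
          using gT[OF s] y by (simp add: d_def field_simps order_le_less_trans)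
        from \<delta>(2)[OF s this] have "norm (?r s) \<le> \<eta> * norm (\<Phi> (s, y) - \<Phi> (s, x))" by simp
        also have "\<dots> \<le> \<eta> * (norm (y - x) * exp (L' * T))" using gT[OF s] \<eta> by simp
        finally show "norm (?r s) \<le> \<eta> * (norm (y - x) * exp (L' * T))" .
      qed (use K in \<open>auto simp: T_def\<close>)
      also have "\<dots> = \<eta> * (\<kappa> - 1) * norm (y - x)" by (simp add: \<kappa>_def \<Phi>_def \<phi>0 U0 algebra_simps)
      also have "\<dots> \<le> \<eta> * \<kappa> * norm (y - x)" using \<eta> by (intro mult_right_mono mult_left_mono) auto
      also have "\<dots> = e * norm (y - x)" using \<kappa> by (simp add: \<eta>_def)
      finally show "norm (\<Phi> (t, y) - \<Phi> (t, x) - U x (y - x) t) \<le> e * norm (y - x)" .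
    qed
  qed
  have du: "(\<Phi> has_derivative (\<lambda>d. U (snd z) (snd d) (fst z) + fst d *\<^sub>R V (\<Phi> z))) (at z)" for z
  proof (cases z)
    case (Pair t p)
    have "((\<lambda>(p, t). \<Phi> (t, p)) has_derivative (\<lambda>(dp, dt). U p dp t + blinfun_scaleR_left (V (\<Phi> (t, p))) dt)) (at (p, t) within UNIV \<times> UNIV)"
    proof (rule has_derivative_partialsI)
      show "((\<lambda>p. \<Phi> (t, p)) has_derivative (\<lambda>v. U p v t)) (at p)" by (rule dx)
      show "((\<lambda>t. \<Phi> (t, p)) has_derivative blinfun_scaleR_left (V (\<Phi> (t, p)))) (at t)" for t p
        using \<Phi>[of p t] by (simp add: has_vector_derivative_def)
      have "continuous_on UNIV (\<lambda>z. blinfun_scaleR_left (V (\<Phi> (snd z, fst z))))"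
        by (intro bounded_linear.continuous_on[OF bounded_linear_blinfun_scaleR_left]
            continuous_on_compose2[OF Vc] continuous_on_compose2[OF \<Phi>c]) (auto intro!: continuous_intros)
      then show "continuous (at (p, t) within UNIV \<times> UNIV) (\<lambda>(p, t). blinfun_scaleR_left (V (\<Phi> (t, p))))"
        by (simp add: case_prod_beta' continuous_on_eq_continuous_at)
    qed auto
    then have *: "((\<lambda>z. \<Phi> (snd z, fst z)) has_derivative (\<lambda>d. U p (fst d) t + snd d *\<^sub>R V (\<Phi> (t, p)))) (at (p, t))"
      by (simp add: case_prod_beta')
    have "((\<lambda>z. (snd z, fst z)) has_derivative (\<lambda>d. (snd d, fst d))) (at (t, p))"
      by (auto intro!: derivative_eq_intros)
    from has_derivative_compose[OF this, of "\<lambda>z. \<Phi> (snd z, fst z)" "\<lambda>d. U p (fst d) t + snd d *\<^sub>R V (\<Phi> (t, p))"] *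
    show ?thesis by (simp add: Pair)
  qed
  have "C_k_on k UNIV \<Phi>" for k
  proof (induction k)
    case (Suc k)
    have "C_k_on k UNIV (\<lambda>z. U (snd z) v (fst z))" for v
      by (rule linear_ode_C_k[OF fd Ak[OF Suc] C_k_on_const[OF open_UNIV, of k 0] C_k_on_const[OF open_UNIV, of k v]]) (use U U0 in auto)
    then show ?case
      by (intro C_k_on_SucI[OF open_UNIV du] C_k_on_add open_UNIV C_k_on_bilinear[OF bounded_bilinear_scaleR]
          C_k_on_const C_k_on_comp[OF fd open_UNIV open_UNIV subset_UNIV Suc Vk])
  qed (use \<Phi>c in simp)
  then have "smooth_on UNIV \<Phi>" by (simp add: smooth_on_open)
  moreover have "(\<lambda>z. \<phi> (snd z) (fst z)) = \<Phi>" by (simp add: \<Phi>_def fun_eq_iff)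
  ultimately show ?thesis using that[of "\<lambda>t x. \<phi> x t"] \<phi> \<phi>0 by simp
qed

text \<open>The unknowns live in the dual of the bounded sequences, a Banach space with room for every size
  \<open>N\<close> of the system.\<close>

lemma linear_system_smooth:
  fixes b :: "nat \<Rightarrow> nat \<Rightarrow> real \<times> 'p::real_normed_vector \<Rightarrow> real"
  assumes fd: "fin_dim TYPE('p)" and b: "\<And>k l. k < N \<Longrightarrow> l < N \<Longrightarrow> smooth_on UNIV (b k l)"
  obtains G :: "nat \<Rightarrow> nat \<Rightarrow> real \<times> 'p \<Rightarrow> real"
  where "\<And>k j. k < N \<Longrightarrow> smooth_on UNIV (G k j)"
    "\<And>k j p. G k j (0, p) = (if k = j then 1 else 0)"
    "\<And>k j t p. k < N \<Longrightarrow> ((\<lambda>t. G k j (t, p)) has_real_derivative (\<Sum>l<N. b k l (t, p) * G l j (t, p))) (at t)"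
proof -
  have bc: "(\<lambda>i. if i = k then 1 else (0::real)) \<in> bcontfun" for k :: nat
    by (rule bcontfun_normI[where b = 1]) auto
  \<comment> \<open>\<open>d k\<close> is the unit sequence at k and \<open>e k\<close> the
    evaluation at k; applying a dual element to \<open>d k\<close> reads off its k-th
    coordinate.\<close>
  define d :: "nat \<Rightarrow> nat \<Rightarrow>\<^sub>C real" where "d k = Bcontfun (\<lambda>i. if i = k then 1 else 0)" for k
  define e :: "nat \<Rightarrow> (nat \<Rightarrow>\<^sub>C real) \<Rightarrow>\<^sub>L real" where "e k = Blinfun (\<lambda>y. apply_bcontfun y k)" for k
  have "bounded_linear (\<lambda>y::nat \<Rightarrow>\<^sub>C real. apply_bcontfun y i)" for i
  proof (rule bounded_linear_intro[of _ 1])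
    show "norm (apply_bcontfun y i) \<le> norm y * 1" for y :: "nat \<Rightarrow>\<^sub>C real"
      using norm_bounded[of y i] by simp
  qed auto
  then have e: "e k (d i) = (if i = k then 1 else 0)" for k i
    by (auto simp: e_def d_def bounded_linear_Blinfun_apply Bcontfun_inverse[OF bc])
  have ev: "bounded_linear (\<lambda>y::(nat \<Rightarrow>\<^sub>C real) \<Rightarrow>\<^sub>L real. y (d i))" for i
    by (rule bounded_bilinear.bounded_linear_left[OF bounded_bilinear_blinfun_apply])
  define F :: "nat \<Rightarrow> nat \<Rightarrow> ((nat \<Rightarrow>\<^sub>C real) \<Rightarrow>\<^sub>L real) \<Rightarrow>\<^sub>L ((nat \<Rightarrow>\<^sub>C real) \<Rightarrow>\<^sub>L real)"
    where "F k l = blinfun_scaleR_left (e k) o\<^sub>L Blinfun (\<lambda>y. blinfun_apply y (d l))" for k l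
  have F: "F k l y = y (d l) *\<^sub>R e k" for k l y
    by (simp add: F_def bounded_linear_Blinfun_apply ev)
  \<comment> \<open>On the coordinates \<open>y (d k)\<close> with k < N this operator acts as the
    matrix \<open>b\<close>.\<close>
  define A where "A z = (\<Sum>k<N. \<Sum>l<N. b k l z *\<^sub>R F k l)" for z
  have Ak: "C_k_on n UNIV A" for n
    unfolding A_def
    by (intro C_k_on_sum open_UNIV C_k_on_bilinear[OF bounded_bilinear_scaleR] C_k_on_const)
       (use b in \<open>simp add: smooth_on_open\<close>)
  have Ac: "continuous_on UNIV A" by (rule C_k_on_continuous[OF Ak])
  have "\<forall>j p. \<exists>u. u 0 = e j \<and> (\<forall>t. (u has_vector_derivative A (t, p) (u t) + 0) (at t))"
  proof (intro allI)
    fix j p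
    show "\<exists>u. u 0 = e j \<and> (\<forall>t. (u has_vector_derivative A (t, p) (u t) + 0) (at t))"
      by (rule linear_ode_exists[OF continuous_slice[OF Ac, of p] continuous_on_const, of "e j" 0]) blast
  qed
  then obtain u where "\<forall>j p. u j p 0 = e j \<and> (\<forall>t. (u j p has_vector_derivative A (t, p) (u j p t) + 0) (at t))"
    unfolding choice_iff by blast
  then have u0: "\<And>j p. u j p 0 = e j"
    and u: "\<And>j p t. (u j p has_vector_derivative A (t, p) (u j p t) + 0) (at t)" by blast+
  have uk: "C_k_on n UNIV (\<lambda>z. u j (snd z) (fst z))" for n j
    by (rule linear_ode_C_k[OF fd Ak C_k_on_const[OF open_UNIV, of n 0] C_k_on_const[OF open_UNIV, of n "e j"]])
       (use u u0 in auto)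
  show ?thesis
  proof (rule that[of "\<lambda>k j z. blinfun_apply (u j (snd z) (fst z)) (d k)"])
    show "smooth_on UNIV (\<lambda>z. blinfun_apply (u j (snd z) (fst z)) (d k))" for k j
      unfolding smooth_on_open[OF open_UNIV] by (intro allI C_k_on_linear_comp[OF ev] uk open_UNIV)
    show "blinfun_apply (u j (snd (0, p)) (fst (0, p))) (d k) = (if k = j then 1 else 0)" for k j p
      by (simp add: u0 e)
    fix k j t p assume k: "k < N"
    have "((\<lambda>t. blinfun_apply (u j p t) (d k)) has_vector_derivative blinfun_apply (A (t, p) (u j p t) + 0) (d k)) (at t)"
      by (rule bounded_linear.has_vector_derivative[OF ev u])
    moreover have "blinfun_apply (A (t, p) (u j p t) + 0) (d k) = (\<Sum>l<N. b k l (t, p) * blinfun_apply (u j p t) (d l))"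
    proof -
      have "blinfun_apply (A (t, p) (u j p t)) (d k) =
          (\<Sum>k'<N. \<Sum>l<N. b k' l (t, p) * (blinfun_apply (u j p t) (d l) * (if k = k' then 1 else 0)))"
        by (simp add: A_def blinfun.bilinear_simps F e mult.assoc linear_sum[OF bounded_linear.linear[OF ev]])
      also have "\<dots> = (\<Sum>k'<N. if k' = k then \<Sum>l<N. b k l (t, p) * blinfun_apply (u j p t) (d l) else 0)"
        by (intro sum.cong) auto
      finally show ?thesis using k by simp
    qed
    ultimately show "((\<lambda>t. blinfun_apply (u j (snd (t, p)) (fst (t, p))) (d k)) has_real_derivative
        (\<Sum>l<N. b k l (t, p) * blinfun_apply (u j (snd (t, p)) (fst (t, p))) (d l))) (at t)"
      by (simp add: has_real_derivative_iff_has_vector_derivative)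
  qed
qed

section \<open>Time-dependent smooth functions on a manifold and their cutoffs\<close>

section \<open>Smooth functions on manifolds\<close>

text \<open>The time set is a parameter: [0,1] for the given data, open intervals for flows, the
  whole line for objects that do not depend on time.\<close>

definition tsmooth ::
    "('a, 'm::real_normed_vector) atlas \<Rightarrow> real set \<Rightarrow> 'a set \<Rightarrow> (real \<Rightarrow> 'a \<Rightarrow> real) \<Rightarrow> bool" where
  "tsmooth A I W g \<longleftrightarrow>
     (\<forall>(U, \<phi>)\<in>A. smooth_on (I \<times> \<phi> ` (U \<inter> W)) (\<lambda>z. g (fst z) (inv_into U \<phi> (snd z))))"

lemma smooth_on_cong_imp: "smooth_on S f \<Longrightarrow> (\<And>x. x \<in> S \<Longrightarrow> f x = g x) \<Longrightarrow> smooth_on S g"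
  using smooth_on_cong[of S f g] by simp

lemma linear_first_slot:
  fixes f :: "real \<times> 'b::real_vector \<Rightarrow> real"
  assumes "linear f"
  shows "f (v, 0) = f (1, 0) * v"
  using linear_cmul[OF assms, of v "(1, 0)"] by simp

lemma smooth_path_on_tsmooth: "smooth_path_on A W g \<longleftrightarrow> tsmooth A {0..1} W g"
  by (simp add: smooth_path_on_def tsmooth_def case_prod_beta')

text \<open>A basis of the model space with its continuous coordinate functionals belongs to the
  context, because the type of the model space carries no canonical one.\<close>

locale smooth_mfd =
  fixes A :: "('a::{t2_space, second_countable_topology}, 'm::{banach, heine_borel}) atlas"
    and B :: "'m set" and c :: "'m \<Rightarrow> 'm \<Rightarrow> real"
  assumes mfd: "smooth_manifold A"
    and fB: "finite B" and cB: "\<And>b. b \<in> B \<Longrightarrow> bounded_linear (c b)" and expand: "\<And>x. x = (\<Sum>b\<in>B. c b x *\<^sub>R b)"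
begin

lemma fd: "fin_dim TYPE('m)"
  using mfd unfolding smooth_manifold_def fin_dim_def by blast

lemmas fd2 = fin_dim_prod[OF fin_dim_real fd]

lemma
  assumes "(U, \<phi>) \<in> A"
  shows chart_open: "open U" and chart_open_image: "open (\<phi> ` U)" and chart_inj: "inj_on \<phi> U"
    and chart_cont: "continuous_on U \<phi>" and chart_inv_cont: "continuous_on (\<phi> ` U) (inv_into U \<phi>)"
proof -
  have *: "open U" "open (\<phi> ` U)" "homeomorphism U (\<phi> ` U) \<phi> (inv_into U \<phi>)"
    using mfd assms unfolding smooth_manifold_def by auto
  then show "open U" "open (\<phi> ` U)" "continuous_on U \<phi>" "continuous_on (\<phi> ` U) (inv_into U \<phi>)"
    by (auto simp: homeomorphism_def)
  show "inj_on \<phi> U" by (rule inj_on_inverseI) (rule homeomorphism_apply1[OF *(3)])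
qed

lemma chart_ex: obtains U \<phi> where "(U, \<phi>) \<in> A" "p \<in> U"
  using mfd unfolding smooth_manifold_def by blast

lemma chart_inv: "(U, \<phi>) \<in> A \<Longrightarrow> q \<in> U \<Longrightarrow> inv_into U \<phi> (\<phi> q) = q"
  using chart_inj by simp

lemma chart_inv_in: "(U, \<phi>) \<in> A \<Longrightarrow> x \<in> \<phi> ` W \<Longrightarrow> W \<subseteq> U \<Longrightarrow> inv_into U \<phi> x \<in> W \<and> \<phi> (inv_into U \<phi> x) = x"
  using chart_inj by fastforce

lemma chart_open_sub:
  assumes "(U, \<phi>) \<in> A" "open W"
  shows "open (\<phi> ` (U \<inter> W))"
proof -
  have "homeomorphism U (\<phi> ` U) \<phi> (inv_into U \<phi>)" using mfd assms unfolding smooth_manifold_def by auto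
  then have "openin (top_of_set (\<phi> ` U)) (\<phi> ` (U \<inter> W))"
    by (rule homeomorphism_imp_open_map) (use assms in auto)
  then show ?thesis using chart_open_image[OF assms(1)] openin_open_trans by blast
qed

lemma transition: "(U, \<phi>) \<in> A \<Longrightarrow> (V, \<psi>) \<in> A \<Longrightarrow> smooth_on (\<phi> ` (U \<inter> V)) (\<lambda>x. \<psi> (inv_into U \<phi> x))"
  using mfd unfolding smooth_manifold_def by (fastforce simp: o_def)

lemma tsmoothD: "tsmooth A I W g \<Longrightarrow> (U, \<phi>) \<in> A \<Longrightarrow>
    smooth_on (I \<times> \<phi> ` (U \<inter> W)) (\<lambda>z. g (fst z) (inv_into U \<phi> (snd z)))"
  unfolding tsmooth_def by auto

lemma tsmooth_local_time:
  assumes "\<And>t p. t \<in> I \<Longrightarrow> p \<in> W \<Longrightarrow> \<exists>T W'. open T \<and> t \<in> T \<and> open W' \<and> p \<in> W' \<and> tsmooth A (I \<inter> T) (W \<inter> W') g"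
  shows "tsmooth A I W g"
  unfolding tsmooth_def
proof (clarify, rule smooth_on_local)
  fix U \<phi> z assume U: "(U, \<phi>) \<in> A" and z: "z \<in> I \<times> \<phi> ` (U \<inter> W)"
  then obtain t p where tp: "z = (t, \<phi> p)" "t \<in> I" "p \<in> U" "p \<in> W" by auto
  obtain T W' where W': "open T" "t \<in> T" "open W'" "p \<in> W'" "tsmooth A (I \<inter> T) (W \<inter> W') g"
    using assms[OF tp(2,4)] by blast
  let ?N = "T \<times> \<phi> ` (U \<inter> W')"
  have "open ?N" by (intro open_Times chart_open_sub[OF U] W')
  moreover have "z \<in> ?N" using tp W' by auto
  moreover have "I \<times> \<phi> ` (U \<inter> W) \<inter> ?N \<subseteq> (I \<inter> T) \<times> \<phi> ` (U \<inter> (W \<inter> W'))"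
    using chart_inj[OF U] by (auto simp: inj_on_def image_iff)
  then have "smooth_on (I \<times> \<phi> ` (U \<inter> W) \<inter> ?N) (\<lambda>z. g (fst z) (inv_into U \<phi> (snd z)))"
    by (rule smooth_on_subset[OF tsmoothD[OF W'(5) U]])
  ultimately show "\<exists>N. open N \<and> z \<in> N \<and> smooth_on (I \<times> \<phi> ` (U \<inter> W) \<inter> N) (\<lambda>z. g (fst z) (inv_into U \<phi> (snd z)))"
    by blast
qed

lemma tsmooth_local:
  assumes "\<And>p. p \<in> W \<Longrightarrow> \<exists>W'. open W' \<and> p \<in> W' \<and> tsmooth A I (W \<inter> W') g"
  shows "tsmooth A I W g"
proof (rule tsmooth_local_time)
  fix t p assume "p \<in> W"
  from assms[OF this] show "\<exists>T W'. open T \<and> t \<in> T \<and> open W' \<and> p \<in> W' \<and> tsmooth A (I \<inter> T) (W \<inter> W') g"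
    by (intro exI[of _ "UNIV :: real set"]) simp
qed

text \<open>One chart suffices, since the transition maps carry the expression to every other
  chart.\<close>

lemma tsmooth_chartI:
  assumes U: "(U, \<phi>) \<in> A" and W: "open W" "W \<subseteq> U" and I: "open I"
    and g: "smooth_on (I \<times> \<phi> ` W) (\<lambda>z. g (fst z) (inv_into U \<phi> (snd z)))"
  shows "tsmooth A I W g"
  unfolding tsmooth_def
proof clarify
  fix V \<psi> assume V: "(V, \<psi>) \<in> A"
  let ?S = "I \<times> \<psi> ` (V \<inter> W)"
  have o: "open ?S" using I chart_open_sub[OF V W(1)] by (rule open_Times)
  have tr: "smooth_on ?S (\<lambda>z. \<phi> (inv_into V \<psi> (snd z)))"
    by (rule smooth_on_comp[OF fd o _ _ transition[OF V U]])
       (use W o in \<open>auto intro!: smooth_on_linear bounded_linear_snd\<close>)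
  have "smooth_on ?S (\<lambda>z. (\<lambda>z. g (fst z) (inv_into U \<phi> (snd z))) (fst z, \<phi> (inv_into V \<psi> (snd z))))"
  proof (rule smooth_on_comp[OF fd2 o _ _ g])
    show "(\<lambda>z. (fst z, \<phi> (inv_into V \<psi> (snd z)))) ` ?S \<subseteq> I \<times> \<phi> ` W"
      using chart_inv_in[OF V, of _ "V \<inter> W"] by auto
    show "smooth_on ?S (\<lambda>z. (fst z, \<phi> (inv_into V \<psi> (snd z))))"
      by (intro smooth_on_Pair o tr smooth_on_linear bounded_linear_fst)
  qed
  moreover have "inv_into U \<phi> (\<phi> (inv_into V \<psi> (snd z))) = inv_into V \<psi> (snd z)" if "z \<in> ?S" for z
    using that chart_inv_in[OF V, of "snd z" "V \<inter> W"] W chart_inv[OF U] by auto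
  ultimately show "smooth_on ?S (\<lambda>z. g (fst z) (inv_into V \<psi> (snd z)))"
    using smooth_on_cong[of ?S "\<lambda>z. g (fst z) (inv_into U \<phi> (\<phi> (inv_into V \<psi> (snd z))))"] by simp
qed

lemma tsmooth_subset: "tsmooth A I W g \<Longrightarrow> I' \<subseteq> I \<Longrightarrow> W' \<subseteq> W \<Longrightarrow> tsmooth A I' W' g"
  unfolding tsmooth_def by (fastforce intro: smooth_on_subset)

lemma tsmooth_cong:
  assumes "\<And>t p. t \<in> I \<Longrightarrow> p \<in> W \<Longrightarrow> g t p = h t p" "tsmooth A I W g"
  shows "tsmooth A I W h"
  unfolding tsmooth_def
proof clarify
  fix U \<phi> assume U: "(U, \<phi>) \<in> A"
  have "g (fst z) (inv_into U \<phi> (snd z)) = h (fst z) (inv_into U \<phi> (snd z))" if "z \<in> I \<times> \<phi> ` (U \<inter> W)" for z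
    using that chart_inv_in[OF U, of "snd z" "U \<inter> W"] by (auto intro!: assms(1))
  then show "smooth_on (I \<times> \<phi> ` (U \<inter> W)) (\<lambda>z. h (fst z) (inv_into U \<phi> (snd z)))"
    by (rule smooth_on_cong_imp[OF tsmoothD[OF assms(2) U]])
qed

lemma open_chart_box: "(U, \<phi>) \<in> A \<Longrightarrow> open I \<Longrightarrow> open W \<Longrightarrow> open (I \<times> \<phi> ` (U \<inter> W))"
  by (intro open_Times chart_open_sub)

lemma tsmooth_const: "open I \<Longrightarrow> open W \<Longrightarrow> tsmooth A I W (\<lambda>t p. k)"
  unfolding tsmooth_def by (auto intro!: smooth_on_const open_chart_box)

lemma tsmooth_time: "open I \<Longrightarrow> open W \<Longrightarrow> smooth_on UNIV h \<Longrightarrow> tsmooth A I W (\<lambda>t p. h t)"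
  unfolding tsmooth_def
proof clarify
  fix U \<phi> assume I: "open I" "open W" and h: "smooth_on UNIV h" and U: "(U, \<phi>) \<in> A"
  note o = open_chart_box[OF U I]
  show "smooth_on (I \<times> \<phi> ` (U \<inter> W)) (\<lambda>z. h (fst z))"
    by (rule smooth_on_comp[OF fin_dim_real o subset_UNIV smooth_on_linear[OF bounded_linear_fst o] h])
qed

lemma tsmooth_add: "open I \<Longrightarrow> open W \<Longrightarrow> tsmooth A I W g \<Longrightarrow> tsmooth A I W h \<Longrightarrow> tsmooth A I W (\<lambda>t p. g t p + h t p)"
  unfolding tsmooth_def by (force intro!: smooth_on_add open_chart_box)

lemma tsmooth_mult: "open I \<Longrightarrow> open W \<Longrightarrow> tsmooth A I W g \<Longrightarrow> tsmooth A I W h \<Longrightarrow> tsmooth A I W (\<lambda>t p. g t p * h t p)"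
  unfolding tsmooth_def by (force intro!: smooth_on_mult open_chart_box)

lemma tsmooth_minus: "open I \<Longrightarrow> open W \<Longrightarrow> tsmooth A I W g \<Longrightarrow> tsmooth A I W (\<lambda>t p. - g t p)"
  unfolding tsmooth_def by (force intro!: smooth_on_minus open_chart_box)

lemma tsmooth_diff: "open I \<Longrightarrow> open W \<Longrightarrow> tsmooth A I W g \<Longrightarrow> tsmooth A I W h \<Longrightarrow> tsmooth A I W (\<lambda>t p. g t p - h t p)"
  unfolding tsmooth_def by (force intro!: smooth_on_diff open_chart_box)

lemma tsmooth_sum:
  "open I \<Longrightarrow> open W \<Longrightarrow> (\<And>i. i \<in> S \<Longrightarrow> tsmooth A I W (g i)) \<Longrightarrow> tsmooth A I W (\<lambda>t p. \<Sum>i\<in>S. g i t p)"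
  unfolding tsmooth_def by (force intro!: smooth_on_sum open_chart_box)

lemma tsmooth_inverse:
  assumes "open I" "open W" "tsmooth A I W g" "\<And>t p. t \<in> I \<Longrightarrow> p \<in> W \<Longrightarrow> g t p \<noteq> 0"
  shows "tsmooth A I W (\<lambda>t p. inverse (g t p))"
  unfolding tsmooth_def
proof clarify
  fix U \<phi> assume U: "(U, \<phi>) \<in> A"
  show "smooth_on (I \<times> \<phi> ` (U \<inter> W)) (\<lambda>z. inverse (g (fst z) (inv_into U \<phi> (snd z))))"
  proof (rule smooth_on_inverse[OF open_chart_box[OF U assms(1,2)] tsmoothD[OF assms(3) U]])
    fix z assume z: "z \<in> I \<times> \<phi> ` (U \<inter> W)"
    then have "inv_into U \<phi> (snd z) \<in> W" using chart_inv_in[OF U, of "snd z" "U \<inter> W"] by auto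
    then show "g (fst z) (inv_into U \<phi> (snd z)) \<noteq> 0" using z assms(4) by (auto simp: mem_Times_iff)
  qed
qed

lemma tsmooth_reparam:
  assumes "open I" "open W" "tsmooth A K W g" "smooth_on UNIV \<sigma>" "\<sigma> ` I \<subseteq> K"
  shows "tsmooth A I W (\<lambda>t. g (\<sigma> t))"
  unfolding tsmooth_def
proof clarify
  fix U \<phi> assume U: "(U, \<phi>) \<in> A"
  note o = open_chart_box[OF U assms(1,2)]
  have "smooth_on (I \<times> \<phi> ` (U \<inter> W)) (\<lambda>z. (\<lambda>z. g (fst z) (inv_into U \<phi> (snd z))) (\<sigma> (fst z), snd z))"
  proof (rule smooth_on_comp[OF fd2 o _ _ tsmoothD[OF assms(3) U]])
    show "smooth_on (I \<times> \<phi> ` (U \<inter> W)) (\<lambda>z. (\<sigma> (fst z), snd z))"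
      by (intro smooth_on_Pair o smooth_on_linear[OF bounded_linear_snd]
          smooth_on_comp[OF fin_dim_real o subset_UNIV smooth_on_linear[OF bounded_linear_fst o] assms(4)])
  qed (use assms(5) in auto)
  then show "smooth_on (I \<times> \<phi> ` (U \<inter> W)) (\<lambda>z. g (\<sigma> (fst z)) (inv_into U \<phi> (snd z)))" by simp
qed

lemma tsmooth_static:
  assumes "open W" "smooth_fun_on A W f" "open I"
  shows "tsmooth A I W (\<lambda>t. f)"
  unfolding tsmooth_def
proof clarify
  fix U \<phi> assume U: "(U, \<phi>) \<in> A"
  note o = open_chart_box[OF U assms(3,1)]
  have f: "smooth_on (\<phi> ` (U \<inter> W)) (\<lambda>x. f (inv_into U \<phi> x))"
    using assms(2) U unfolding smooth_fun_on_def by (auto simp: o_def)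
  show "smooth_on (I \<times> \<phi> ` (U \<inter> W)) (\<lambda>z. f (inv_into U \<phi> (snd z)))"
    by (rule smooth_on_comp[OF fd o _ smooth_on_linear[OF bounded_linear_snd o] f]) auto
qed

lemma tsmooth_slice:
  assumes "open W" "tsmooth A I W g" "t \<in> I"
  shows "smooth_fun_on A W (g t)"
  unfolding smooth_fun_on_def
proof clarify
  fix U \<phi> assume U: "(U, \<phi>) \<in> A"
  note o = chart_open_sub[OF U assms(1)]
  have "smooth_on (\<phi> ` (U \<inter> W)) (\<lambda>x. (\<lambda>z. g (fst z) (inv_into U \<phi> (snd z))) (t, x))"
  proof (rule smooth_on_comp[OF fd2 o _ _ tsmoothD[OF assms(2) U]])
    show "smooth_on (\<phi> ` (U \<inter> W)) (\<lambda>x. (t, x))"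
      by (intro smooth_on_Pair o smooth_on_const smooth_on_linear bounded_linear_ident)
  qed (use assms(3) in auto)
  then show "smooth_on (\<phi> ` (U \<inter> W)) (g t \<circ> inv_into U \<phi>)" by (simp add: o_def)
qed

lemma smooth_fun_tsmooth: "open W \<Longrightarrow> smooth_fun_on A W f \<longleftrightarrow> tsmooth A UNIV W (\<lambda>t. f)"
  using tsmooth_static[OF _ _ open_UNIV] tsmooth_slice by blast

lemma tsmooth_time_deriv:
  assumes I: "open I" "open W" and g: "tsmooth A I W g"
  shows "t \<in> I \<Longrightarrow> p \<in> W \<Longrightarrow> ((\<lambda>s. g s p) has_real_derivative deriv (\<lambda>s. g s p) t) (at t)"
    and "tsmooth A I W (\<lambda>t p. deriv (\<lambda>s. g s p) t)"
proof -
  have dt: "((\<lambda>s. g s p) has_real_derivative frechet_derivative (\<lambda>z. g (fst z) (inv_into U \<phi> (snd z))) (at (t, \<phi> p)) (1, 0)) (at t)"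
    if U: "(U, \<phi>) \<in> A" and tp: "t \<in> I" "p \<in> U \<inter> W" for U \<phi> t p
  proof -
    let ?F = "\<lambda>z. g (fst z) (inv_into U \<phi> (snd z))"
    let ?d = "frechet_derivative ?F (at (t, \<phi> p))"
    have F: "(?F has_derivative ?d) (at (t, \<phi> p))"
      by (rule smooth_on_derivative(1)[OF open_chart_box[OF U I] tsmoothD[OF g U]]) (use tp in auto)
    have "((\<lambda>s. (s, \<phi> p)) has_derivative (\<lambda>v. (v, 0))) (at t)" by (auto intro!: derivative_eq_intros)
    from has_derivative_compose[OF this F]
    have 1: "((\<lambda>s. g s p) has_derivative (\<lambda>v. ?d (v, 0))) (at t)" using tp chart_inv[OF U] by simp
    have 2: "(\<lambda>v. ?d (v, 0)) = (*) (?d (1, 0))"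
      by (rule ext, rule linear_first_slot[OF bounded_linear.linear[OF has_derivative_bounded_linear[OF F]]])
    show ?thesis unfolding has_field_derivative_def by (rule has_derivative_eq_rhs[OF 1 2])
  qed
  show "((\<lambda>s. g s p) has_real_derivative deriv (\<lambda>s. g s p) t) (at t)" if tp: "t \<in> I" "p \<in> W"
  proof -
    obtain U \<phi> where U: "(U, \<phi>) \<in> A" "p \<in> U" using chart_ex by blast
    have "p \<in> U \<inter> W" using U tp by simp
    note d = dt[OF U(1) tp(1) this]
    show ?thesis using d unfolding DERIV_imp_deriv[OF d] .
  qed
  show "tsmooth A I W (\<lambda>t p. deriv (\<lambda>s. g s p) t)"
    unfolding tsmooth_def
  proof clarify
    fix U \<phi> assume U: "(U, \<phi>) \<in> A"
    let ?F = "\<lambda>z. g (fst z) (inv_into U \<phi> (snd z))"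
    have "smooth_on (I \<times> \<phi> ` (U \<inter> W)) (\<lambda>z. frechet_derivative ?F (at z) (1, 0))"
      by (rule smooth_on_derivative(2)[OF open_chart_box[OF U I] tsmoothD[OF g U]])
    moreover have "frechet_derivative ?F (at z) (1, 0) = deriv (\<lambda>s. g s (inv_into U \<phi> (snd z))) (fst z)"
      if "z \<in> I \<times> \<phi> ` (U \<inter> W)" for z
    proof -
      let ?q = "inv_into U \<phi> (snd z)"
      have "?q \<in> U \<inter> W" "\<phi> ?q = snd z" using that chart_inv_in[OF U, of "snd z" "U \<inter> W"] by auto
      then show ?thesis using dt[OF U, of "fst z" ?q] that DERIV_imp_deriv by fastforce
    qed
    ultimately show "smooth_on (I \<times> \<phi> ` (U \<inter> W)) (\<lambda>z. deriv (\<lambda>s. g s (inv_into U \<phi> (snd z))) (fst z))"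
      by (rule smooth_on_cong_imp)
  qed
qed

lemma tsmooth_continuous:
  assumes "open I" "open W" "tsmooth A I W g"
  shows "continuous_on (I \<times> W) (\<lambda>z. g (fst z) (snd z))"
proof -
  have "continuous (at z) (\<lambda>z. g (fst z) (snd z))" if z: "z \<in> I \<times> W" for z
  proof -
    obtain U \<phi> where U: "(U, \<phi>) \<in> A" "snd z \<in> U" using chart_ex by blast
    have o: "open (I \<times> (U \<inter> W))" by (intro open_Times assms open_Int chart_open[OF U(1)])
    have "continuous_on (I \<times> (U \<inter> W)) (\<lambda>z. (\<lambda>z. g (fst z) (inv_into U \<phi> (snd z))) (fst z, \<phi> (snd z)))"
      by (rule continuous_on_compose2[OF smooth_on_continuous[OF tsmoothD[OF assms(3) U(1)]]])
         (auto intro!: continuous_intros continuous_on_compose2[OF chart_cont[OF U(1)]])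
    then have "continuous_on (I \<times> (U \<inter> W)) (\<lambda>z. g (fst z) (snd z))"
      by (rule continuous_on_eq) (use chart_inv[OF U(1)] in auto)
    then show ?thesis
      using continuous_on_eq_continuous_at[OF o, of "\<lambda>z. g (fst z) (snd z)"] z U(2)
      by (metis IntI mem_Times_iff)
  qed
  then show ?thesis by (simp add: continuous_at_imp_continuous_on)
qed

subsection \<open>Cutoff functions\<close>

text \<open>Extension by 0 is smooth only off a closed set. \<open>K\<close> corresponds to a closed
  ball in a chart; it is compact, and hence closed in the manifold by the Hausdorff
  property.\<close>

lemma cutoff_exists:
  assumes "open W" "p \<in> W"
  obtains l N K where "smooth_fun A l" "open N" "p \<in> N" "N \<subseteq> K" "K \<subseteq> W" "closed K"
    "\<And>q. q \<in> N \<Longrightarrow> l q = 1" "\<And>q. q \<notin> K \<Longrightarrow> l q = 0"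
proof -
  obtain U \<phi> where U: "(U, \<phi>) \<in> A" "p \<in> U" using chart_ex by blast
  let ?i = "inv_into U \<phi>"
  have o: "open (\<phi> ` (U \<inter> W))" "\<phi> p \<in> \<phi> ` (U \<inter> W)" using chart_open_sub[OF U(1)] assms U by auto
  obtain \<kappa> :: "_ \<Rightarrow> real" and V r where \<kappa>: "smooth_on UNIV \<kappa>" "open V" "\<phi> p \<in> V" "\<forall>x\<in>V. \<kappa> x = 1"
    "cball (\<phi> p) r \<subseteq> \<phi> ` (U \<inter> W)" "V \<subseteq> cball (\<phi> p) r" "\<forall>x. x \<notin> cball (\<phi> p) r \<longrightarrow> \<kappa> x = 0"
    by (rule bump_function[OF fd o])
  define K where "K = ?i ` cball (\<phi> p) r"
  define N where "N = U \<inter> \<phi> -` V"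
  define l where "l q = (if q \<in> U then \<kappa> (\<phi> q) else 0)" for q
  have "compact K" unfolding K_def
    by (intro compact_continuous_image compact_cball continuous_on_subset[OF chart_inv_cont[OF U(1)]])
       (use \<kappa>(5) in auto)
  then have cK: "closed K" by (rule compact_imp_closed)
  have KW: "K \<subseteq> U \<inter> W" unfolding K_def
    using \<kappa>(5) chart_inv_in[OF U(1), of _ "U \<inter> W"] by fastforce
  have oN: "open N" unfolding N_def
    by (rule continuous_open_preimage[OF chart_cont[OF U(1)] chart_open[OF U(1)] \<kappa>(2)])
  have inK: "q \<in> K" if "q \<in> U" "\<phi> q \<in> cball (\<phi> p) r" for q
    unfolding K_def using that chart_inv[OF U(1)] by (metis imageI)
  have l0: "l q = 0" if "q \<notin> K" for q using that inK \<kappa>(7) by (auto simp: l_def)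
  have "tsmooth A UNIV UNIV (\<lambda>t. l)"
  proof (rule tsmooth_local)
    fix q :: 'a
    show "\<exists>W'. open W' \<and> q \<in> W' \<and> tsmooth A UNIV (UNIV \<inter> W') (\<lambda>t. l)"
    proof (cases "q \<in> U")
      case True
      have "tsmooth A UNIV U (\<lambda>t. l)"
      proof (rule tsmooth_chartI[OF U(1)])
        have o: "open (UNIV \<times> \<phi> ` U)" by (intro open_Times chart_open_image[OF U(1)] open_UNIV)
        have "smooth_on (UNIV \<times> \<phi> ` U) (\<lambda>z::real \<times> 'm. \<kappa> (snd z))"
          by (rule smooth_on_comp[OF fd o subset_UNIV smooth_on_linear[OF bounded_linear_snd o] \<kappa>(1)])
        moreover have "\<kappa> (snd z) = l (?i (snd z))" if "z \<in> UNIV \<times> \<phi> ` U" for z :: "real \<times> 'm"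
          using that chart_inv_in[OF U(1), of "snd z" U] by (auto simp: l_def)
        ultimately show "smooth_on (UNIV \<times> \<phi> ` U) (\<lambda>z::real \<times> 'm. l (?i (snd z)))"
          by (rule smooth_on_cong_imp)
      qed (use chart_open[OF U(1)] in auto)
      then show ?thesis using True chart_open[OF U(1)] by auto
    next
      case False
      then have q: "q \<in> - K" using KW by auto
      have "tsmooth A UNIV (- K) (\<lambda>t. l)"
        by (rule tsmooth_cong[OF _ tsmooth_const[of UNIV "- K" 0]]) (use l0 cK in auto)
      then show ?thesis using q cK by (metis inf_top_left open_Compl)
    qed
  qed
  then have "smooth_fun A l" using smooth_fun_tsmooth[of UNIV] by simp
  moreover have "N \<subseteq> K" using inK \<kappa>(6) by (auto simp: N_def)
  moreover have "l q = 1" if "q \<in> N" for q using that \<kappa>(4) by (auto simp: N_def l_def)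
  ultimately show ?thesis using that[of l N K] oN KW cK l0 \<kappa>(3) U(2) by (auto simp: N_def)
qed

text \<open>The function is a product on \<open>W\<close> and 0 on the complement of
  \<open>K\<close>, and these two open sets cover the manifold.\<close>

lemma tsmooth_extend:
  assumes "open I" "open W" "smooth_fun A l" "closed K" "K \<subseteq> W" "\<And>q. q \<notin> K \<Longrightarrow> l q = 0" "tsmooth A I W g"
  shows "tsmooth A I UNIV (\<lambda>t q. if q \<in> W then l q * g t q else 0)"
proof (rule tsmooth_local)
  fix q :: 'a
  have "smooth_fun_on A W l"
    using assms(3) tsmooth_subset[of UNIV UNIV "\<lambda>t. l" UNIV W] smooth_fun_tsmooth assms(2) by auto
  then have "tsmooth A I W (\<lambda>t. l)" using tsmooth_static assms by blast
  then have 1: "tsmooth A I W (\<lambda>t q. if q \<in> W then l q * g t q else 0)"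
    using tsmooth_cong[OF _ tsmooth_mult[OF assms(1,2) _ assms(7)], of "\<lambda>t. l"] by auto
  have 2: "tsmooth A I (- K) (\<lambda>t q. if q \<in> W then l q * g t q else 0)"
    by (rule tsmooth_cong[OF _ tsmooth_const[of I "- K" 0]]) (use assms in auto)
  show "\<exists>W'. open W' \<and> q \<in> W' \<and> tsmooth A I (UNIV \<inter> W') (\<lambda>t q. if q \<in> W then l q * g t q else 0)"
  proof (cases "q \<in> W")
    case True
    then show ?thesis using 1 assms(2) by (intro exI[of _ W]) simp
  next
    case False
    then have "q \<in> - K" using assms(5) by auto
    then show ?thesis using 2 assms(4) by (intro exI[of _ "- K"]) (simp add: open_Compl)
  qed
qed

end

section \<open>Derivations at a point, Hadamard's lemma, integral curves\<close>

section \<open>Tangent vectors and vector fields\<close>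

lemma smooth_on_extend:
  assumes "open U" "smooth_on U g" "smooth_on UNIV \<kappa>" "closed K" "K \<subseteq> U" "\<And>x. x \<notin> K \<Longrightarrow> \<kappa> x = 0"
  shows "smooth_on UNIV (\<lambda>x. if x \<in> U then \<kappa> x *\<^sub>R g x else 0)"
proof (rule smooth_on_local)
  fix x
  have 1: "smooth_on U (\<lambda>x. if x \<in> U then \<kappa> x *\<^sub>R g x else 0)"
    by (rule smooth_on_cong_imp[OF smooth_on_scaleR[OF assms(1) smooth_on_subset[OF assms(3)] assms(2)]]) auto
  have 2: "smooth_on (- K) (\<lambda>x. if x \<in> U then \<kappa> x *\<^sub>R g x else 0)"
    by (rule smooth_on_cong_imp[OF smooth_on_const[of "- K" 0]]) (use assms in auto)
  show "\<exists>N. open N \<and> x \<in> N \<and> smooth_on (UNIV \<inter> N) (\<lambda>x. if x \<in> U then \<kappa> x *\<^sub>R g x else 0)"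
  proof (cases "x \<in> U")
    case True
    then show ?thesis using 1 assms(1) by (intro exI[of _ U]) simp
  next
    case False
    then have "x \<in> - K" using assms(5) by auto
    then show ?thesis using 2 assms(4) by (intro exI[of _ "- K"]) (simp add: open_Compl)
  qed
qed

text \<open>The mixed derivative is read off from differentiating \<open>F (t, x) = F (0, x) + \<integral> \<partial>\<^sub>t F\<close> under the
  integral sign, which is an instance of the differentiability of a linear equation in its parameter.\<close>

lemma mixed_derivative_UNIV:
  fixes F :: "real \<times> 'p::real_normed_vector \<Rightarrow> 'y::banach"
  assumes fd: "fin_dim TYPE('p)" and F: "smooth_on UNIV F"
  shows "((\<lambda>t. frechet_derivative F (at (t, x)) (0, v)) has_vector_derivative
    frechet_derivative (\<lambda>z. frechet_derivative F (at z) (1, 0)) (at (t, x)) (0, v)) (at t)"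
proof -
  define g where "g z = frechet_derivative F (at z) (1, 0)" for z
  have D: "(F has_derivative frechet_derivative F (at z)) (at z)" for z
    using smooth_on_derivative(1)[OF open_UNIV F] by simp
  have gs: "smooth_on UNIV g" unfolding g_def by (rule smooth_on_derivative(2)[OF open_UNIV F])
  have Dx: "((\<lambda>x. F (t, x)) has_derivative (\<lambda>v. frechet_derivative F (at (t, x)) (0, v))) (at x)" for t x
  proof -
    have "((\<lambda>x. (t, x)) has_derivative (\<lambda>v. (0, v))) (at x)" by (auto intro!: derivative_eq_intros)
    from has_derivative_compose[OF this D] show ?thesis .
  qed
  have Dt: "((\<lambda>t. F (t, x)) has_vector_derivative g (t, x)) (at t)" for t x
  proof -
    have "((\<lambda>t. (t, x)) has_derivative (\<lambda>v. (v, 0))) (at t)" by (auto intro!: derivative_eq_intros)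
    from has_derivative_compose[OF this D]
    have 1: "((\<lambda>t. F (t, x)) has_derivative (\<lambda>v. frechet_derivative F (at (t, x)) (v, 0))) (at t)" .
    have 2: "frechet_derivative F (at (t, x)) (v, 0) = v *\<^sub>R g (t, x)" for v
      using linear_cmul[OF bounded_linear.linear[OF has_derivative_bounded_linear[OF D]], of "(t, x)" v "(1, 0)"]
      by (metis g_def mult.right_neutral real_scaleR_def scaleR_Pair scaleR_zero_right)
    show ?thesis unfolding has_vector_derivative_def by (rule has_derivative_eq_rhs[OF 1]) (rule ext, rule 2)
  qed
  define g' where "g' v t = frechet_derivative g (at (t, x)) (0, v)" for v t
  have "continuous_on UNIV (g' v)" for v
    unfolding g'_def
    by (rule continuous_slice[OF smooth_on_continuous[OF smooth_on_derivative(2)[OF open_UNIV gs]]])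
  then have "\<exists>w. w 0 = frechet_derivative F (at (0, x)) (0, v) \<and> (\<forall>t. (w has_vector_derivative g' v t) (at t))" for v
    using ivp_exists[of "\<lambda>t y. g' v t" "frechet_derivative F (at (0, x)) (0, v)"]
    by (metis (no_types, lifting) antiderivative_exists add.right_neutral has_vector_derivative_add_const add.commute)
  then obtain w where w: "\<And>v. w v 0 = frechet_derivative F (at (0, x)) (0, v)"
    "\<And>v t. (w v has_vector_derivative g' v t) (at t)" by metis
  have C1: "C_k_on 1 UNIV (\<lambda>z::real \<times> 'p. 0 :: 'y \<Rightarrow>\<^sub>L 'y)" by (rule C_k_on_const[OF open_UNIV])
  have gC1: "C_k_on 1 UNIV g" using gs unfolding smooth_on_open[OF open_UNIV] by blast
  have "((\<lambda>p. F (t, p)) has_derivative (\<lambda>v. w v t)) (at x)" for t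
  proof (rule linear_ode_differentiable[OF fd C1 gC1 Dx[of 0]])
    show "((\<lambda>t. F (t, p)) has_vector_derivative blinfun_apply 0 (F (t, p)) + g (t, p)) (at t)" for t p
      using Dt by simp
    show "(w v has_vector_derivative blinfun_apply 0 (w v t) +
        (blinfun_apply (frechet_derivative (\<lambda>z. 0) (at (t, x)) (0, v)) (F (t, x)) + frechet_derivative g (at (t, x)) (0, v)))
      (at t)" for t v using w(2)[of v t] by (simp add: g'_def)
  qed (use w(1) in auto)
  then have "(\<lambda>v. w v t) = (\<lambda>v. frechet_derivative F (at (t, x)) (0, v))" for t
    using Dx has_derivative_unique by blast
  then have "w v = (\<lambda>t. frechet_derivative F (at (t, x)) (0, v))" by (metis ext)
  then show ?thesis using w(2)[of v t] unfolding g'_def g_def by simp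
qed

text \<open>Both derivatives depend on \<open>F\<close> only near the point, so a bump function
  reduces the claim to a function on the whole space.\<close>

lemma mixed_derivative:
  fixes F :: "real \<times> 'p::real_normed_vector \<Rightarrow> 'y::banach"
  assumes fd: "fin_dim TYPE('p)" and S: "open S" and F: "smooth_on S F" and z: "(t, x) \<in> S"
  shows "((\<lambda>t. frechet_derivative F (at (t, x)) (0, v)) has_vector_derivative
    frechet_derivative (\<lambda>z. frechet_derivative F (at z) (1, 0)) (at (t, x)) (0, v)) (at t)"
proof -
  obtain \<kappa> :: "_ \<Rightarrow> real" and V r where \<kappa>: "smooth_on UNIV \<kappa>" "open V" "(t, x) \<in> V" "\<forall>z\<in>V. \<kappa> z = 1"
    "cball (t, x) r \<subseteq> S" "V \<subseteq> cball (t, x) r" "\<forall>z. z \<notin> cball (t, x) r \<longrightarrow> \<kappa> z = 0"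
    by (rule bump_function[OF fin_dim_prod[OF fin_dim_real fd] S z])
  define G where "G z = (if z \<in> S then \<kappa> z *\<^sub>R F z else 0)" for z
  have G: "smooth_on UNIV G" unfolding G_def
    by (rule smooth_on_extend[OF S F \<kappa>(1) closed_cball \<kappa>(5)]) (use \<kappa>(7) in auto)
  have eq: "G z = F z" if "z \<in> V" for z using that \<kappa> by (auto simp: G_def)
  have d1: "frechet_derivative G (at z) = frechet_derivative F (at z)" if "z \<in> V" for z
  proof -
    have "(F has_derivative frechet_derivative F (at z)) (at z)"
      by (rule smooth_on_derivative(1)[OF S F]) (use that \<kappa> in auto)
    then have "(G has_derivative frechet_derivative F (at z)) (at z)"
      by (rule has_derivative_transform_within_open[OF _ \<kappa>(2) that]) (use eq in auto)
    then show ?thesis using frechet_derivative_at by metis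
  qed
  have "frechet_derivative (\<lambda>z. frechet_derivative G (at z) (1, 0)) (at (t, x)) =
      frechet_derivative (\<lambda>z. frechet_derivative F (at z) (1, 0)) (at (t, x))"
  proof -
    have "((\<lambda>z. frechet_derivative G (at z) (1, 0)) has_derivative
      frechet_derivative (\<lambda>z. frechet_derivative G (at z) (1, 0)) (at (t, x))) (at (t, x))"
      by (rule smooth_on_derivative(1)[OF open_UNIV smooth_on_derivative(2)[OF open_UNIV G]]) simp
    then have "((\<lambda>z. frechet_derivative F (at z) (1, 0)) has_derivative
      frechet_derivative (\<lambda>z. frechet_derivative G (at z) (1, 0)) (at (t, x))) (at (t, x))"
      by (rule has_derivative_transform_within_open[OF _ \<kappa>(2,3)]) (use d1 in auto)
    then show ?thesis using frechet_derivative_at by metis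
  qed
  with mixed_derivative_UNIV[OF fd G, of x v t]
  have *: "((\<lambda>t. frechet_derivative G (at (t, x)) (0, v)) has_vector_derivative
    frechet_derivative (\<lambda>z. frechet_derivative F (at z) (1, 0)) (at (t, x)) (0, v)) (at t)" by simp
  have "open ((\<lambda>s. (s, x)) -` V)" by (rule open_vimage[OF \<kappa>(2)]) (auto intro!: continuous_intros)
  then show ?thesis
    by (rule has_vector_derivative_transform_within_open[OF *]) (use \<kappa>(3) d1 in auto)
qed

context smooth_mfd
begin

lemma smooth_fun_iff: "smooth_fun A f \<longleftrightarrow> tsmooth A UNIV UNIV (\<lambda>t. f)"
  by (rule smooth_fun_tsmooth[OF open_UNIV])

lemma smooth_fun_const: "smooth_fun A (\<lambda>q. k)"
  and smooth_fun_add: "smooth_fun A f \<Longrightarrow> smooth_fun A g \<Longrightarrow> smooth_fun A (\<lambda>q. f q + g q)"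
  and smooth_fun_mult: "smooth_fun A f \<Longrightarrow> smooth_fun A g \<Longrightarrow> smooth_fun A (\<lambda>q. f q * g q)"
  and smooth_fun_minus: "smooth_fun A f \<Longrightarrow> smooth_fun A (\<lambda>q. - f q)"
  and smooth_fun_diff: "smooth_fun A f \<Longrightarrow> smooth_fun A g \<Longrightarrow> smooth_fun A (\<lambda>q. f q - g q)"
  unfolding smooth_fun_iff
  by (auto intro!: tsmooth_const tsmooth_add tsmooth_mult tsmooth_minus tsmooth_diff)

lemma smooth_fun_sum: "(\<And>i. i \<in> S \<Longrightarrow> smooth_fun A (f i)) \<Longrightarrow> smooth_fun A (\<lambda>q. \<Sum>i\<in>S. f i q)"
  unfolding smooth_fun_iff by (auto intro!: tsmooth_sum)

lemma tangent_vectorD: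
  assumes "tangent_vector A p D"
  shows "smooth_fun A f \<Longrightarrow> smooth_fun A g \<Longrightarrow> D (\<lambda>q. f q + g q) = D f + D g"
    and "smooth_fun A f \<Longrightarrow> smooth_fun A g \<Longrightarrow> D (\<lambda>q. f q * g q) = f p * D g + g p * D f"
    and "smooth_fun A f \<Longrightarrow> D (\<lambda>q. k * f q) = k * D f"
  using assms unfolding tangent_vector_def by auto

lemma tangent_vector_const:
  assumes D: "tangent_vector A p D"
  shows "D (\<lambda>q. k) = 0"
proof -
  have "D (\<lambda>q. 1) = 0"
    using tangent_vectorD(2)[OF D smooth_fun_const[of 1] smooth_fun_const[of 1]] by simp
  then show ?thesis using tangent_vectorD(3)[OF D smooth_fun_const[of 1], of k] by simp
qed

lemma tangent_vector_minus:
  "tangent_vector A p D \<Longrightarrow> smooth_fun A f \<Longrightarrow> D (\<lambda>q. - f q) = - D f"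
  using tangent_vectorD(3)[of p D f "- 1"] by simp

lemma tangent_vector_diff:
  "tangent_vector A p D \<Longrightarrow> smooth_fun A f \<Longrightarrow> smooth_fun A g \<Longrightarrow> D (\<lambda>q. f q - g q) = D f - D g"
  using tangent_vectorD(1)[of p D f "\<lambda>q. - g q"] tangent_vector_minus[of p D g] smooth_fun_minus by simp

lemma tangent_vector_sum:
  assumes D: "tangent_vector A p D" and f: "\<And>i. i \<in> S \<Longrightarrow> smooth_fun A (f i)"
  shows "D (\<lambda>q. \<Sum>i\<in>S. f i q) = (\<Sum>i\<in>S. D (f i))"
  using f
proof (induction S rule: infinite_finite_induct)
  case (insert i S)
  then show ?case using tangent_vectorD(1)[OF D, of "f i" "\<lambda>q. \<Sum>i\<in>S. f i q"] by (simp add: smooth_fun_sum)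
qed (simp_all add: tangent_vector_const[OF D])

text \<open>A cutoff supported in \<open>N\<close> annihilates the difference of the two functions.
  At p the cutoff is 1 and the difference 0, so the Leibniz rule for this vanishing product leaves
  only the derivation of the difference.\<close>

lemma tangent_vector_local:
  assumes D: "tangent_vector A p D" and f: "smooth_fun A f" and g: "smooth_fun A g"
    and N: "open N" "p \<in> N" "\<And>q. q \<in> N \<Longrightarrow> f q = g q"
  shows "D f = D g"
proof -
  let ?h = "\<lambda>q. f q - g q"
  obtain l N' K where l: "smooth_fun A l" "open N'" "p \<in> N'" "N' \<subseteq> K" "K \<subseteq> N" "closed K"
    "\<And>q. q \<in> N' \<Longrightarrow> l q = 1" "\<And>q. q \<notin> K \<Longrightarrow> l q = 0"
    by (rule cutoff_exists[OF N(1,2)]) blast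
  have "(\<lambda>q. l q * ?h q) = (\<lambda>q. 0)"
  proof
    fix q
    show "l q * ?h q = 0" using l(8)[of q] l(5) N(3)[of q] by (cases "q \<in> K") auto
  qed
  then have "0 = l p * D ?h + ?h p * D l"
    using tangent_vectorD(2)[OF D l(1) smooth_fun_diff[OF f g]] tangent_vector_const[OF D, of 0] by simp
  then show ?thesis using l(3,7) N(2,3) tangent_vector_diff[OF D f g] by simp
qed

text \<open>The coefficient \<open>g b x\<close> is the integral over s in [0,1] of the b-derivative
  of \<open>F\<close> at \<open>x0 + s *\<^sub>R (x - x0)\<close>. It is realised as the value at
  time 1 of an antiderivative with parameter x, so that its smoothness in x is an instance of
  \<open>linear_ode_C_k\<close>.\<close>

lemma hadamard:
  assumes F: "smooth_on UNIV (F :: 'm \<Rightarrow> real)"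
  obtains g where "\<And>b. smooth_on UNIV (g b)" "\<And>x. F x = F x0 + (\<Sum>b\<in>B. c b (x - x0) * g b x)"
    "\<And>b. g b x0 = frechet_derivative F (at x0) b"
proof -
  have D: "(F has_derivative frechet_derivative F (at x)) (at x)" for x
    using smooth_on_derivative(1)[OF open_UNIV F] by simp
  define h where "h b z = frechet_derivative F (at (x0 + fst z *\<^sub>R (snd z - x0))) b" for b z
  have hs: "smooth_on UNIV (h b)" for b unfolding h_def
    by (rule smooth_on_comp[OF fd open_UNIV subset_UNIV _ smooth_on_derivative(2)[OF open_UNIV F]])
       (intro smooth_on_add smooth_on_scaleR smooth_on_diff smooth_on_const open_UNIV
          smooth_on_linear[OF bounded_linear_fst] smooth_on_linear[OF bounded_linear_snd])
  have hc: "continuous_on UNIV (\<lambda>s. h b (s, x))" for b x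
    by (rule continuous_slice[OF smooth_on_continuous[OF hs]])
  have "\<forall>b x. \<exists>G. G 0 = 0 \<and> (\<forall>s. (G has_vector_derivative h b (s, x)) (at s))"
    using antiderivative_exists[OF hc] by metis
  then obtain G where G: "\<And>b x. G b x 0 = 0" "\<And>b x s. (G b x has_vector_derivative h b (s, x)) (at s)"
    by metis
  have Gs: "smooth_on UNIV (\<lambda>z. G b (snd z) (fst z))" for b
    unfolding smooth_on_open[OF open_UNIV]
  proof
    fix k
    show "C_k_on k UNIV (\<lambda>z. G b (snd z) (fst z))"
    proof (rule linear_ode_C_k[OF fd C_k_on_const[OF open_UNIV, of k 0] _ C_k_on_const[OF open_UNIV, of k 0]])
      show "C_k_on k UNIV (h b)" using hs unfolding smooth_on_open[OF open_UNIV] by blast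
    qed (use G in auto)
  qed
  have eq: "F (x0 + s *\<^sub>R (x - x0)) - F x0 = (\<Sum>b\<in>B. c b (x - x0) * G b x s)" for s x
  proof (rule ode_unique[of 0 s _ "\<lambda>s y. frechet_derivative F (at (x0 + s *\<^sub>R (x - x0))) (x - x0)" _ 0])
    fix s
    have "((\<lambda>s. x0 + s *\<^sub>R (x - x0)) has_derivative (\<lambda>v. v *\<^sub>R (x - x0))) (at s)"
      by (auto intro!: derivative_eq_intros)
    from has_derivative_compose[OF this D]
    have "((\<lambda>s. F (x0 + s *\<^sub>R (x - x0))) has_vector_derivative
       frechet_derivative F (at (x0 + s *\<^sub>R (x - x0))) (x - x0)) (at s)"
      unfolding has_vector_derivative_def
      by (simp add: linear_cmul[OF bounded_linear.linear[OF has_derivative_bounded_linear[OF D]]])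
    then show "((\<lambda>s. F (x0 + s *\<^sub>R (x - x0)) - F x0) has_vector_derivative
       frechet_derivative F (at (x0 + s *\<^sub>R (x - x0))) (x - x0)) (at s)"
      by (auto intro!: derivative_eq_intros)
    have l: "linear (frechet_derivative F (at y))" for y
      using D has_derivative_bounded_linear bounded_linear.linear by blast
    have "frechet_derivative F (at (x0 + s *\<^sub>R (x - x0))) (x - x0) = (\<Sum>b\<in>B. c b (x - x0) * h b (s, x))"
      by (subst (2) expand[of "x - x0"]) (simp add: h_def linear_sum[OF l] linear_cmul[OF l])
    moreover have "((\<lambda>s. \<Sum>b\<in>B. c b (x - x0) * G b x s) has_vector_derivative (\<Sum>b\<in>B. c b (x - x0) * h b (s, x))) (at s)"
      by (intro has_vector_derivative_sum has_vector_derivative_mult_right G(2))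
    ultimately show "((\<lambda>s. \<Sum>b\<in>B. c b (x - x0) * G b x s) has_vector_derivative
        frechet_derivative F (at (x0 + s *\<^sub>R (x - x0))) (x - x0)) (at s)" by simp
  qed (simp_all add: G)
  show ?thesis
  proof (rule that[of "\<lambda>b x. G b x 1"])
    show "smooth_on UNIV (\<lambda>x. G b x 1)" for b
      using smooth_on_comp[OF fd2 open_UNIV subset_UNIV _ Gs, of "\<lambda>x. (1, x)"]
      by (simp add: smooth_on_Pair smooth_on_const smooth_on_linear[OF bounded_linear_ident])
    show "F x = F x0 + (\<Sum>b\<in>B. c b (x - x0) * G b x 1)" for x using eq[of 1 x] by simp
    fix b
    have "G b x0 1 = 1 *\<^sub>R frechet_derivative F (at x0) b"
    proof (rule ode_unique[of 0 1 _ "\<lambda>s y. frechet_derivative F (at x0) b" "\<lambda>s. s *\<^sub>R frechet_derivative F (at x0) b" 0])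
      show "(G b x0 has_vector_derivative frechet_derivative F (at x0) b) (at s)" for s
        using G(2)[of b x0 s] by (simp add: h_def)
    qed (auto intro!: derivative_eq_intros simp: G)
    then show "G b x0 1 = frechet_derivative F (at x0) b" by simp
  qed
qed

lemma smooth_fun_chart:
  "smooth_fun A f \<Longrightarrow> (U, \<phi>) \<in> A \<Longrightarrow> smooth_on (\<phi> ` U) (\<lambda>x. f (inv_into U \<phi> x))"
  unfolding smooth_fun_on_def by (fastforce simp: o_def)

lemma smooth_fun_of_chart:
  assumes "(U, \<phi>) \<in> A" "smooth_on (\<phi> ` U) h"
  shows "tsmooth A UNIV U (\<lambda>t q. h (\<phi> q))"
proof (rule tsmooth_chartI[OF assms(1) chart_open[OF assms(1)]])
  have o: "open (UNIV \<times> \<phi> ` U)" by (intro open_Times chart_open_image[OF assms(1)] open_UNIV)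
  have "smooth_on (UNIV \<times> \<phi> ` U) (\<lambda>z::real \<times> 'm. h (snd z))"
    by (rule smooth_on_comp[OF fd o _ smooth_on_linear[OF bounded_linear_snd o] assms(2)]) auto
  then show "smooth_on (UNIV \<times> \<phi> ` U) (\<lambda>z::real \<times> 'm. h (\<phi> (inv_into U \<phi> (snd z))))"
    by (rule smooth_on_cong_imp) (use chart_inv_in[OF assms(1), of _ U] in auto)
qed auto

text \<open>Tangent vectors act on global functions only, so the chart coordinates are cut off to
  global functions that still agree with them near p.\<close>

lemma coords_exist:
  assumes U: "(U, \<phi>) \<in> A" and W: "open W" "p \<in> U \<inter> W"
  obtains xh N where "\<And>b. b \<in> B \<Longrightarrow> smooth_fun A (xh b)" "open N" "p \<in> N" "N \<subseteq> U \<inter> W"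
    "\<And>b q. b \<in> B \<Longrightarrow> q \<in> N \<Longrightarrow> xh b q = c b (\<phi> q)"
proof -
  have oUW: "open (U \<inter> W)" using W chart_open[OF U] by auto
  obtain l N K where l: "smooth_fun A l" "open N" "p \<in> N" "N \<subseteq> K" "K \<subseteq> U \<inter> W" "closed K"
    "\<And>q. q \<in> N \<Longrightarrow> l q = 1" "\<And>q. q \<notin> K \<Longrightarrow> l q = 0"
    by (rule cutoff_exists[OF oUW W(2)]) blast
  have "smooth_fun A (\<lambda>q. if q \<in> U then l q * c b (\<phi> q) else 0)" if "b \<in> B" for b
    unfolding smooth_fun_iff
    by (rule tsmooth_extend[OF open_UNIV chart_open[OF U] l(1,6) _ l(8)])
       (use l(5) smooth_fun_of_chart[OF U smooth_on_linear[OF cB[OF that] chart_open_image[OF U]]] in auto)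
  moreover have "N \<subseteq> U \<inter> W" using l(4,5) by blast
  moreover from this have "(if q \<in> U then l q * c b (\<phi> q) else 0) = c b (\<phi> q)" if "q \<in> N" for b q
    using l(7)[OF that] that by auto
  ultimately show ?thesis
    using l(2,3) that[of "\<lambda>b q. if q \<in> U then l q * c b (\<phi> q) else 0" N] by blast
qed

text \<open>By Hadamard's lemma \<open>f\<close> is, near p, a constant plus a sum of products whose
  first factors vanish at p. The Leibniz rule then leaves the first derivatives of \<open>f\<close>
  as coefficients of the values \<open>D (xh b)\<close>.\<close>

lemma tangent_vector_chart:
  assumes D: "tangent_vector A p D" and U: "(U, \<phi>) \<in> A"
    and xh: "\<And>b. b \<in> B \<Longrightarrow> smooth_fun A (xh b)" "open N" "p \<in> N" "N \<subseteq> U"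
      "\<And>b q. b \<in> B \<Longrightarrow> q \<in> N \<Longrightarrow> xh b q = c b (\<phi> q)"
    and f: "smooth_fun A f"
  shows "D f = (\<Sum>b\<in>B. D (xh b) * frechet_derivative (\<lambda>x. f (inv_into U \<phi> x)) (at (\<phi> p)) b)"
proof -
  let ?x0 = "\<phi> p" and ?f = "\<lambda>x. f (inv_into U \<phi> x)"
  have pU: "p \<in> U" using xh by auto
  have oU: "open (\<phi> ` U)" by (rule chart_open_image[OF U])
  have x0: "?x0 \<in> \<phi> ` U" using pU by simp
  obtain \<kappa> :: "_ \<Rightarrow> real" and V r where \<kappa>: "smooth_on UNIV \<kappa>" "open V" "?x0 \<in> V" "\<forall>x\<in>V. \<kappa> x = 1"
    "cball ?x0 r \<subseteq> \<phi> ` U" "V \<subseteq> cball ?x0 r" "\<forall>x. x \<notin> cball ?x0 r \<longrightarrow> \<kappa> x = 0"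
    by (rule bump_function[OF fd oU x0])
  define F where "F x = (if x \<in> \<phi> ` U then \<kappa> x *\<^sub>R ?f x else 0)" for x
  have Fs: "smooth_on UNIV F" unfolding F_def
    by (rule smooth_on_extend[OF oU smooth_fun_chart[OF f U] \<kappa>(1) closed_cball \<kappa>(5)]) (use \<kappa>(7) in auto)
  have Ff: "F x = ?f x" if "x \<in> V" for x using that \<kappa> by (auto simp: F_def)
  have "(?f has_derivative frechet_derivative ?f (at ?x0)) (at ?x0)"
    by (rule smooth_on_derivative(1)[OF oU smooth_fun_chart[OF f U] x0])
  then have "(F has_derivative frechet_derivative ?f (at ?x0)) (at ?x0)"
    by (rule has_derivative_transform_within_open[OF _ \<kappa>(2,3)]) (use Ff in auto)
  then have FD: "frechet_derivative F (at ?x0) = frechet_derivative ?f (at ?x0)"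
    using frechet_derivative_at by metis
  obtain g where g: "\<And>b. smooth_on UNIV (g b)" "\<And>x. F x = F ?x0 + (\<Sum>b\<in>B. c b (x - ?x0) * g b x)"
    "\<And>b. g b ?x0 = frechet_derivative F (at ?x0) b"
    by (rule hadamard[OF Fs, of ?x0]) blast
  obtain l N' K where l: "smooth_fun A l" "open N'" "p \<in> N'" "N' \<subseteq> K" "K \<subseteq> U" "closed K"
    "\<And>q. q \<in> N' \<Longrightarrow> l q = 1" "\<And>q. q \<notin> K \<Longrightarrow> l q = 0"
    by (rule cutoff_exists[OF chart_open[OF U] pU]) blast
  define \<gamma> where "\<gamma> b q = (if q \<in> U then l q * g b (\<phi> q) else 0)" for b q
  have \<gamma>: "smooth_fun A (\<gamma> b)" for b
    unfolding smooth_fun_iff \<gamma>_def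
    by (rule tsmooth_extend[OF open_UNIV chart_open[OF U] l(1,6,5,8)])
       (use smooth_fun_of_chart[OF U smooth_on_subset[OF g(1)]] in auto)
  define M where "M = (N \<inter> N') \<inter> (U \<inter> \<phi> -` V)"
  have oM: "open M" unfolding M_def
    using xh(2) l(2) continuous_open_preimage[OF chart_cont[OF U] chart_open[OF U] \<kappa>(2)] by blast
  have pM: "p \<in> M" using xh(3) l(3) pU \<kappa>(3) by (simp add: M_def)
  let ?h = "\<lambda>q. F ?x0 + (\<Sum>b\<in>B. (xh b q - xh b p) * \<gamma> b q)"
  have hs: "smooth_fun A (\<lambda>q. (xh b q - xh b p) * \<gamma> b q)" if "b \<in> B" for b
    by (intro smooth_fun_mult smooth_fun_diff smooth_fun_const \<gamma> xh(1) that)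
  have "D f = D ?h"
  proof (rule tangent_vector_local[OF D f _ oM pM])
    show "smooth_fun A ?h" by (intro smooth_fun_add smooth_fun_const smooth_fun_sum hs)
    fix q assume q: "q \<in> M"
    have "f q = F (\<phi> q)" using q Ff chart_inv[OF U] by (auto simp: M_def)
    also have "\<dots> = F ?x0 + (\<Sum>b\<in>B. c b (\<phi> q - ?x0) * g b (\<phi> q))" by (rule g(2))
    also have "(\<Sum>b\<in>B. c b (\<phi> q - ?x0) * g b (\<phi> q)) = (\<Sum>b\<in>B. (xh b q - xh b p) * \<gamma> b q)"
      using q l(7) pM xh(5)
      by (intro sum.cong) (auto simp: M_def \<gamma>_def linear_diff[OF bounded_linear.linear[OF cB]])
    finally show "f q = ?h q" .
  qed
  also have "\<dots> = (\<Sum>b\<in>B. D (\<lambda>q. (xh b q - xh b p) * \<gamma> b q))"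
  proof -
    have "D ?h = D (\<lambda>q. F ?x0) + D (\<lambda>q. \<Sum>b\<in>B. (xh b q - xh b p) * \<gamma> b q)"
      by (rule tangent_vectorD(1)[OF D smooth_fun_const smooth_fun_sum]) (rule hs)
    also have "D (\<lambda>q. \<Sum>b\<in>B. (xh b q - xh b p) * \<gamma> b q) = (\<Sum>b\<in>B. D (\<lambda>q. (xh b q - xh b p) * \<gamma> b q))"
      by (rule tangent_vector_sum[OF D hs])
    finally show ?thesis by (simp add: tangent_vector_const[OF D])
  qed
  also have "\<dots> = (\<Sum>b\<in>B. D (xh b) * frechet_derivative ?f (at ?x0) b)"
  proof (rule sum.cong[OF refl])
    fix b assume b: "b \<in> B"
    have "D (\<lambda>q. (xh b q - xh b p) * \<gamma> b q) = \<gamma> b p * D (\<lambda>q. xh b q - xh b p)"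
      using tangent_vectorD(2)[OF D smooth_fun_diff[OF xh(1)[OF b] smooth_fun_const] \<gamma>, of "xh b p" b] by simp
    also have "D (\<lambda>q. xh b q - xh b p) = D (xh b)"
      using tangent_vector_diff[OF D xh(1)[OF b] smooth_fun_const] tangent_vector_const[OF D] by simp
    also have "\<gamma> b p = frechet_derivative ?f (at ?x0) b"
      using g(3) FD l(3,7) pU by (simp add: \<gamma>_def)
    finally show "D (\<lambda>q. (xh b q - xh b p) * \<gamma> b q) = D (xh b) * frechet_derivative ?f (at ?x0) b"
      by simp
  qed
  finally show ?thesis .
qed

definition vfield :: "real set \<Rightarrow> (real \<Rightarrow> 'a \<Rightarrow> ('a \<Rightarrow> real) \<Rightarrow> real) \<Rightarrow> bool" where
  "vfield I X \<longleftrightarrow> (\<forall>t\<in>I. \<forall>p. tangent_vector A p (X t p)) \<and>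
     (\<forall>f. smooth_fun A f \<longrightarrow> tsmooth A I UNIV (\<lambda>t p. X t p f))"

text \<open>Space and time derivatives are two slots of a single Frechet derivative in the chart,
  which is jointly smooth.\<close>

lemma tsmooth_partial:
  assumes I: "open I" and g: "tsmooth A I UNIV g" and U: "(U, \<phi>) \<in> A"
  defines "F \<equiv> \<lambda>z. g (fst z) (inv_into U \<phi> (snd z))"
  shows "t \<in> I \<Longrightarrow> p \<in> U \<Longrightarrow> (F has_derivative frechet_derivative F (at (t, \<phi> p))) (at (t, \<phi> p))"
    and "t \<in> I \<Longrightarrow> p \<in> U \<Longrightarrow> frechet_derivative (\<lambda>x. g t (inv_into U \<phi> x)) (at (\<phi> p)) b
        = frechet_derivative F (at (t, \<phi> p)) (0, b)"
    and "t \<in> I \<Longrightarrow> p \<in> U \<Longrightarrow> deriv (\<lambda>s. g s p) t = frechet_derivative F (at (t, \<phi> p)) (1, 0)"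
    and "tsmooth A I U (\<lambda>t q. frechet_derivative F (at (t, \<phi> q)) v)"
proof -
  have o: "open (I \<times> \<phi> ` U)" by (intro open_Times I chart_open_image[OF U])
  have Fs: "smooth_on (I \<times> \<phi> ` U) F" using tsmoothD[OF g U] by (simp add: F_def)
  show FD: "(F has_derivative frechet_derivative F (at (t, \<phi> p))) (at (t, \<phi> p))" if "t \<in> I" "p \<in> U" for t p
    by (rule smooth_on_derivative(1)[OF o Fs]) (use that in auto)
  show "frechet_derivative (\<lambda>x. g t (inv_into U \<phi> x)) (at (\<phi> p)) b = frechet_derivative F (at (t, \<phi> p)) (0, b)"
    if "t \<in> I" "p \<in> U"
  proof -
    have "((\<lambda>x. (t, x)) has_derivative (\<lambda>v. (0, v))) (at (\<phi> p))" by (auto intro!: derivative_eq_intros)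
    from has_derivative_compose[OF this FD[OF that]]
    have "((\<lambda>x. g t (inv_into U \<phi> x)) has_derivative (\<lambda>v. frechet_derivative F (at (t, \<phi> p)) (0, v))) (at (\<phi> p))"
      by (simp add: F_def)
    from frechet_derivative_at[OF this] show ?thesis by metis
  qed
  show "deriv (\<lambda>s. g s p) t = frechet_derivative F (at (t, \<phi> p)) (1, 0)" if "t \<in> I" "p \<in> U"
  proof -
    have "((\<lambda>s. (s, \<phi> p)) has_derivative (\<lambda>v. (v, 0))) (at t)" by (auto intro!: derivative_eq_intros)
    from has_derivative_compose[OF this FD[OF that]]
    have 1: "((\<lambda>s. g s p) has_derivative (\<lambda>v. frechet_derivative F (at (t, \<phi> p)) (v, 0))) (at t)"
      using chart_inv[OF U that(2)] by (simp add: F_def)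
    have "((\<lambda>s. g s p) has_derivative (*) (deriv (\<lambda>s. g s p) t)) (at t)"
      using tsmooth_time_deriv(1)[OF I open_UNIV g that(1), of p] by (simp add: has_field_derivative_def)
    from has_derivative_unique[OF this 1] show ?thesis by (metis mult.right_neutral)
  qed
  show "tsmooth A I U (\<lambda>t q. frechet_derivative F (at (t, \<phi> q)) v)"
  proof (rule tsmooth_chartI[OF U chart_open[OF U] subset_refl I])
    show "smooth_on (I \<times> \<phi> ` U) (\<lambda>z. frechet_derivative F (at (fst z, \<phi> (inv_into U \<phi> (snd z)))) v)"
      by (rule smooth_on_cong_imp[OF smooth_on_derivative(2)[OF o Fs]])
         (use chart_inv_in[OF U, of _ U] in auto)
  qed
qed

text \<open>\<open>vfield\<close> tests smoothness on functions without time dependence; the chart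
  formula for tangent vectors extends this to time-dependent ones.\<close>

lemma vfield_tsmooth:
  assumes I: "open I" and X: "vfield I X" and g: "tsmooth A I UNIV g"
  shows "tsmooth A I UNIV (\<lambda>t p. X t p (g t))"
proof (rule tsmooth_local)
  fix p
  obtain U \<phi> where U: "(U, \<phi>) \<in> A" "p \<in> U" using chart_ex by blast
  obtain xh N where xh: "\<And>b. b \<in> B \<Longrightarrow> smooth_fun A (xh b)" "open N" "p \<in> N" "N \<subseteq> U \<inter> UNIV"
    "\<And>b q. b \<in> B \<Longrightarrow> q \<in> N \<Longrightarrow> xh b q = c b (\<phi> q)"
    by (rule coords_exist[OF U(1) open_UNIV]) (use U(2) in auto)
  let ?F = "\<lambda>z. g (fst z) (inv_into U \<phi> (snd z))"
  have "tsmooth A I N (\<lambda>t p. \<Sum>b\<in>B. X t p (xh b) * frechet_derivative ?F (at (t, \<phi> p)) (0, b))"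
  proof (intro tsmooth_sum tsmooth_mult I xh(2))
    fix b assume b: "b \<in> B"
    show "tsmooth A I N (\<lambda>t p. X t p (xh b))"
      using X xh(1)[OF b] unfolding vfield_def by (blast intro: tsmooth_subset)
    show "tsmooth A I N (\<lambda>t p. frechet_derivative ?F (at (t, \<phi> p)) (0, b))"
      using tsmooth_partial(4)[OF I g U(1)] by (rule tsmooth_subset) (use xh(4) in auto)
  qed
  then have "tsmooth A I N (\<lambda>t p. X t p (g t))"
  proof (rule tsmooth_cong[rotated])
    fix t q assume tq: "t \<in> I" "q \<in> N"
    then have qU: "q \<in> U" using xh(4) by auto
    have "X t q (g t) = (\<Sum>b\<in>B. X t q (xh b) * frechet_derivative (\<lambda>x. g t (inv_into U \<phi> x)) (at (\<phi> q)) b)"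
      using X tq(1) xh(4) unfolding vfield_def
      by (intro tangent_vector_chart[OF _ U(1) xh(1,2) tq(2) _ xh(5)] tsmooth_slice[OF open_UNIV g]) auto
    then show "(\<Sum>b\<in>B. X t q (xh b) * frechet_derivative ?F (at (t, \<phi> q)) (0, b)) = X t q (g t)"
      using tsmooth_partial(2)[OF I g U(1) tq(1) qU] by simp
  qed
  then show "\<exists>W'. open W' \<and> p \<in> W' \<and> tsmooth A I (UNIV \<inter> W') (\<lambda>t p. X t p (g t))"
    using xh(2,3) by (intro exI[of _ N]) simp
qed

text \<open>In a chart a derivation is a fixed combination of partial derivatives in space, and
  these commute with the derivative in time.\<close>

lemma tangent_vector_time_deriv:
  assumes I: "open I" and D: "tangent_vector A p D" and g: "tsmooth A I UNIV g" and t: "t \<in> I"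
  shows "((\<lambda>s. D (g s)) has_real_derivative D (\<lambda>q. deriv (\<lambda>s. g s q) t)) (at t)"
proof -
  obtain U \<phi> where U: "(U, \<phi>) \<in> A" "p \<in> U" using chart_ex by blast
  obtain xh N where xh: "\<And>b. b \<in> B \<Longrightarrow> smooth_fun A (xh b)" "open N" "p \<in> N" "N \<subseteq> U \<inter> UNIV"
    "\<And>b q. b \<in> B \<Longrightarrow> q \<in> N \<Longrightarrow> xh b q = c b (\<phi> q)"
    by (rule coords_exist[OF U(1) open_UNIV]) (use U(2) in auto)
  have NU: "N \<subseteq> U" using xh(4) by auto
  let ?F = "\<lambda>z. g (fst z) (inv_into U \<phi> (snd z))"
  let ?Ft = "\<lambda>z. frechet_derivative ?F (at z) (1, 0)"
  have g': "tsmooth A I UNIV (\<lambda>t q. deriv (\<lambda>s. g s q) t)" by (rule tsmooth_time_deriv(2)[OF I open_UNIV g])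
  have o: "open (I \<times> \<phi> ` U)" by (intro open_Times I chart_open_image[OF U(1)])
  have Fs: "smooth_on (I \<times> \<phi> ` U) ?F" using tsmoothD[OF g U(1)] by simp
  have 1: "D (g s) = (\<Sum>b\<in>B. D (xh b) * frechet_derivative ?F (at (s, \<phi> p)) (0, b))" if "s \<in> I" for s
    using tangent_vector_chart[OF D U(1) xh(1,2,3) NU xh(5) tsmooth_slice[OF open_UNIV g that]]
      tsmooth_partial(2)[OF I g U(1) that U(2)] by simp
  have "((\<lambda>s. \<Sum>b\<in>B. D (xh b) * frechet_derivative ?F (at (s, \<phi> p)) (0, b)) has_vector_derivative
     (\<Sum>b\<in>B. D (xh b) * frechet_derivative ?Ft (at (t, \<phi> p)) (0, b))) (at t)"
    by (intro has_vector_derivative_sum has_vector_derivative_mult_right mixed_derivative[OF fd o Fs])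
       (use t U(2) in auto)
  moreover have "(\<Sum>b\<in>B. D (xh b) * frechet_derivative ?Ft (at (t, \<phi> p)) (0, b)) = D (\<lambda>q. deriv (\<lambda>s. g s q) t)"
  proof -
    have "D (\<lambda>q. deriv (\<lambda>s. g s q) t) = (\<Sum>b\<in>B. D (xh b) *
        frechet_derivative (\<lambda>x. deriv (\<lambda>s. g s (inv_into U \<phi> x)) t) (at (\<phi> p)) b)"
      by (rule tangent_vector_chart[OF D U(1) xh(1,2,3) NU xh(5) tsmooth_slice[OF open_UNIV g' t]])
    also have "\<dots> = (\<Sum>b\<in>B. D (xh b) *
        frechet_derivative (\<lambda>z. deriv (\<lambda>s. g s (inv_into U \<phi> (snd z))) (fst z)) (at (t, \<phi> p)) (0, b))"
      using tsmooth_partial(2)[OF I g' U(1) t U(2)] by simp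
    also have "frechet_derivative (\<lambda>z. deriv (\<lambda>s. g s (inv_into U \<phi> (snd z))) (fst z)) (at (t, \<phi> p))
        = frechet_derivative ?Ft (at (t, \<phi> p))"
    proof -
      have "(?Ft has_derivative frechet_derivative ?Ft (at (t, \<phi> p))) (at (t, \<phi> p))"
        by (rule smooth_on_derivative(1)[OF o smooth_on_derivative(2)[OF o Fs]]) (use t U(2) in auto)
      then have "((\<lambda>z. deriv (\<lambda>s. g s (inv_into U \<phi> (snd z))) (fst z)) has_derivative
          frechet_derivative ?Ft (at (t, \<phi> p))) (at (t, \<phi> p))"
      proof (rule has_derivative_transform_within_open[OF _ o])
        fix z assume z: "z \<in> I \<times> \<phi> ` U"
        then have "inv_into U \<phi> (snd z) \<in> U" "\<phi> (inv_into U \<phi> (snd z)) = snd z"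
          using chart_inv_in[OF U(1), of "snd z" U] by auto
        then show "?Ft z = deriv (\<lambda>s. g s (inv_into U \<phi> (snd z))) (fst z)"
          using tsmooth_partial(3)[OF I g U(1), of "fst z" "inv_into U \<phi> (snd z)"] z by auto
      qed (use t U(2) in auto)
      then show ?thesis by (rule frechet_derivative_at[symmetric])
    qed
    finally show ?thesis by simp
  qed
  ultimately have "((\<lambda>s. \<Sum>b\<in>B. D (xh b) * frechet_derivative ?F (at (s, \<phi> p)) (0, b)) has_real_derivative
     D (\<lambda>q. deriv (\<lambda>s. g s q) t)) (at t)"
    by (simp add: has_real_derivative_iff_has_vector_derivative)
  then show ?thesis
    by (rule has_field_derivative_transform_within_open[OF _ I t]) (use 1 in auto)
qed

definition integral_curve :: "real set \<Rightarrow> (real \<Rightarrow> 'a \<Rightarrow> ('a \<Rightarrow> real) \<Rightarrow> real) \<Rightarrow> (real \<Rightarrow> 'a) \<Rightarrow> bool" where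
  "integral_curve I X \<gamma> \<longleftrightarrow> continuous_on I \<gamma> \<and>
     (\<forall>f. smooth_fun A f \<longrightarrow> (\<forall>t\<in>I. ((\<lambda>s. f (\<gamma> s)) has_real_derivative X t (\<gamma> t) f) (at t)))"

lemma integral_curve_chart:
  assumes I: "open I" and \<gamma>: "integral_curve I X \<gamma>" and t: "t \<in> I" and U: "(U, \<phi>) \<in> A"
    and xh: "\<And>b. b \<in> B \<Longrightarrow> smooth_fun A (xh b)" "open N" "\<gamma> t \<in> N" "N \<subseteq> U"
      "\<And>b q. b \<in> B \<Longrightarrow> q \<in> N \<Longrightarrow> xh b q = c b (\<phi> q)"
  shows "((\<lambda>s. \<phi> (\<gamma> s)) has_vector_derivative (\<Sum>b\<in>B. X t (\<gamma> t) (xh b) *\<^sub>R b)) (at t)"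
proof -
  have "((\<lambda>s. \<Sum>b\<in>B. xh b (\<gamma> s) *\<^sub>R b) has_vector_derivative (\<Sum>b\<in>B. X t (\<gamma> t) (xh b) *\<^sub>R b)) (at t)"
  proof (rule has_vector_derivative_sum)
    fix b assume "b \<in> B"
    then have "((\<lambda>s. xh b (\<gamma> s)) has_real_derivative X t (\<gamma> t) (xh b)) (at t)"
      using \<gamma> xh(1) t unfolding integral_curve_def by blast
    then show "((\<lambda>s. xh b (\<gamma> s) *\<^sub>R b) has_vector_derivative X t (\<gamma> t) (xh b) *\<^sub>R b) (at t)"
      by (auto simp: has_real_derivative_iff_has_vector_derivative intro!: derivative_eq_intros)
  qed
  moreover have "open (I \<inter> \<gamma> -` N)"
    using \<gamma> unfolding integral_curve_def by (intro continuous_open_preimage I xh(2)) auto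
  moreover have "(\<Sum>b\<in>B. xh b (\<gamma> s) *\<^sub>R b) = \<phi> (\<gamma> s)" if "s \<in> I \<inter> \<gamma> -` N" for s
    using that xh(5) by (subst expand[of "\<phi> (\<gamma> s)"]) auto
  ultimately show ?thesis
    using t xh(3) by (auto intro: has_vector_derivative_transform_within_open[where S = "I \<inter> \<gamma> -` N"])
qed

text \<open>Time enters explicitly and through the curve; the chain rule in a chart separates the
  two contributions.\<close>

lemma integral_curve_chain:
  assumes I: "open I" and X: "vfield I X" and \<gamma>: "integral_curve I X \<gamma>" and t: "t \<in> I"
    and g: "tsmooth A I UNIV g"
  shows "((\<lambda>s. g s (\<gamma> s)) has_real_derivative deriv (\<lambda>s. g s (\<gamma> t)) t + X t (\<gamma> t) (g t)) (at t)"
proof -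
  obtain U \<phi> where U: "(U, \<phi>) \<in> A" "\<gamma> t \<in> U" using chart_ex by blast
  obtain xh N where xh: "\<And>b. b \<in> B \<Longrightarrow> smooth_fun A (xh b)" "open N" "\<gamma> t \<in> N" "N \<subseteq> U \<inter> UNIV"
    "\<And>b q. b \<in> B \<Longrightarrow> q \<in> N \<Longrightarrow> xh b q = c b (\<phi> q)"
    by (rule coords_exist[OF U(1) open_UNIV]) (use U(2) in auto)
  have NU: "N \<subseteq> U" using xh(4) by auto
  let ?F = "\<lambda>z. g (fst z) (inv_into U \<phi> (snd z))" and ?z = "(t, \<phi> (\<gamma> t))"
  let ?D = "frechet_derivative ?F (at ?z)" and ?v = "\<Sum>b\<in>B. X t (\<gamma> t) (xh b) *\<^sub>R b"
  have D: "(?F has_derivative ?D) (at ?z)" by (rule tsmooth_partial(1)[OF I g U(1) t U(2)])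
  have l: "linear ?D" using D has_derivative_bounded_linear bounded_linear.linear by blast
  have "((\<lambda>s. \<phi> (\<gamma> s)) has_derivative (\<lambda>h. h *\<^sub>R ?v)) (at t)"
    using integral_curve_chart[OF I \<gamma> t U(1) xh(1,2,3) NU xh(5)] by (simp add: has_vector_derivative_def)
  then have "((\<lambda>s. (s, \<phi> (\<gamma> s))) has_derivative (\<lambda>h. (h, h *\<^sub>R ?v))) (at t)"
    by (intro has_derivative_Pair has_derivative_ident)
  from has_derivative_compose[OF this D]
  have 1: "((\<lambda>s. ?F (s, \<phi> (\<gamma> s))) has_derivative (\<lambda>h. ?D (h, h *\<^sub>R ?v))) (at t)" .
  have val: "?D (1, ?v) = deriv (\<lambda>s. g s (\<gamma> t)) t + X t (\<gamma> t) (g t)"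
  proof -
    have "(0, ?v) = (\<Sum>b\<in>B. X t (\<gamma> t) (xh b) *\<^sub>R (0::real, b))"
      by (simp add: sum_prod)
    then have "?D (0, ?v) = (\<Sum>b\<in>B. X t (\<gamma> t) (xh b) * ?D (0, b))"
      by (simp only: linear_sum[OF l] linear_cmul[OF l] real_scaleR_def)
    also have "\<dots> = X t (\<gamma> t) (g t)"
    proof -
      have "tangent_vector A (\<gamma> t) (X t (\<gamma> t))" using X t unfolding vfield_def by blast
      from tangent_vector_chart[OF this U(1) xh(1,2,3) NU xh(5) tsmooth_slice[OF open_UNIV g t]]
      show ?thesis using tsmooth_partial(2)[OF I g U(1) t U(2)] by simp
    qed
    finally have "?D ((1, 0) + (0, ?v)) = deriv (\<lambda>s. g s (\<gamma> t)) t + X t (\<gamma> t) (g t)"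
      using tsmooth_partial(3)[OF I g U(1) t U(2)] by (simp only: linear_add[OF l])
    then show ?thesis by simp
  qed
  have "(\<lambda>h. ?D (h, h *\<^sub>R ?v)) = (\<lambda>h. h * ?D (1, ?v))"
    using linear_cmul[OF l, of _ "(1, ?v)"] by (simp add: fun_eq_iff)
  then have 2: "((\<lambda>s. ?F (s, \<phi> (\<gamma> s))) has_real_derivative ?D (1, ?v)) (at t)"
    using 1 by (simp add: has_field_derivative_def mult_commute_abs)
  have "open (I \<inter> \<gamma> -` U)"
    using \<gamma> unfolding integral_curve_def by (intro continuous_open_preimage I chart_open[OF U(1)]) auto
  from has_field_derivative_transform_within_open[OF 2 this, of "\<lambda>s. g s (\<gamma> s)"]
  show ?thesis using t U(2) chart_inv[OF U(1)] val by simp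
qed

end

section \<open>Time-dependent sections, local frames, global generators\<close>

section \<open>Sections of vector bundles\<close>

definition tsection ::
    "('a, 'm::real_normed_vector) atlas \<Rightarrow> ('a, 'v::real_vector, 'z) vbundle_scheme \<Rightarrow> real set \<Rightarrow> (real \<Rightarrow> 'a \<Rightarrow> 'v) \<Rightarrow> bool" where
  "tsection A E I s \<longleftrightarrow> (\<forall>t\<in>I. \<forall>p. s t p \<in> fib E p) \<and>
     (\<forall>(U, e)\<in>frames E. \<forall>i<vb_rank E. tsmooth A I U (\<lambda>t p. coord (vb_rank E) e p (s t p) i))"

lemma smooth_section_path_tsection: "smooth_section_path A E s \<longleftrightarrow> tsection A E {0..1} s"
  by (simp add: smooth_section_path_def tsection_def smooth_path_on_tsmooth)

locale bundle_mfd = smooth_mfd A B c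
  for A :: "('a::{t2_space, second_countable_topology}, 'm::{banach, heine_borel}) atlas" and B c +
  fixes E :: "('a, 'v::real_vector) courant"
  assumes vb: "vector_bundle A E"
begin

abbreviation r where "r \<equiv> vb_rank E"

lemma fib_subspace: "subspace (fib E p)"
  using vb by (simp add: vector_bundle_def)

lemmas fib_add = subspace_add[OF fib_subspace] and fib_scale = subspace_scale[OF fib_subspace]
  and fib_0 = subspace_0[OF fib_subspace] and fib_sum = subspace_sum[OF fib_subspace]
  and fib_diff = subspace_diff[OF fib_subspace] and fib_neg = subspace_neg[OF fib_subspace]

lemma functional_sum:
  fixes m :: nat
  assumes add: "\<And>x y. x \<in> fib E p \<Longrightarrow> y \<in> fib E p \<Longrightarrow> f (x + y) = f x + (f y :: real)"
    and scale: "\<And>k x. x \<in> fib E p \<Longrightarrow> f (k *\<^sub>R x) = k * f x" and x: "\<And>i. i < m \<Longrightarrow> x i \<in> fib E p"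
  shows "f (\<Sum>i<m. k i *\<^sub>R x i) = (\<Sum>i<m. k i * f (x i))"
  using x
proof (induction m)
  case 0
  show ?case using scale[OF fib_0, of 0] by simp
next
  case (Suc m)
  have "(\<Sum>i<m. k i *\<^sub>R x i) \<in> fib E p" using Suc by (intro fib_sum fib_scale) auto
  then show ?case using Suc by (simp add: add scale fib_scale)
qed

lemma frame_ex: obtains U e where "(U, e) \<in> frames E" "p \<in> U"
proof -
  have "\<exists>(U, e)\<in>frames E. p \<in> U" using vb by (simp add: vector_bundle_def)
  then show ?thesis using that by blast
qed

lemma
  assumes "(U, e) \<in> frames E"
  shows frame_open: "open U"
    and frame_inj: "p \<in> U \<Longrightarrow> inj_on (\<lambda>i. e i p) {..<r}"
    and frame_indep: "p \<in> U \<Longrightarrow> independent ((\<lambda>i. e i p) ` {..<r})"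
    and frame_span: "p \<in> U \<Longrightarrow> span ((\<lambda>i. e i p) ` {..<r}) = fib E p"
  using vb assms unfolding vector_bundle_def by fast+

lemma frame_in: "(U, e) \<in> frames E \<Longrightarrow> p \<in> U \<Longrightarrow> i < r \<Longrightarrow> e i p \<in> fib E p"
  using frame_span span_base by (metis imageI lessThan_iff)

lemma coord_expand:
  assumes "(U, e) \<in> frames E" "p \<in> U" "x \<in> fib E p"
  shows "x = (\<Sum>i<r. coord r e p x i *\<^sub>R e i p)"
proof -
  let ?F = "(\<lambda>i. e i p) ` {..<r}"
  have "x = (\<Sum>b\<in>?F. representation ?F x b *\<^sub>R b)"
    by (rule sum_representation_eq[symmetric, OF frame_indep[OF assms(1,2)]])
       (use assms frame_span in auto)
  also have "\<dots> = (\<Sum>i<r. coord r e p x i *\<^sub>R e i p)"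
    using sum.reindex[OF frame_inj[OF assms(1,2)]] by (simp add: coord_def o_def)
  finally show ?thesis .
qed

lemma coord_add:
  assumes "(U, e) \<in> frames E" "p \<in> U" "x \<in> fib E p" "y \<in> fib E p"
  shows "coord r e p (x + y) i = coord r e p x i + coord r e p y i"
  unfolding coord_def using assms frame_span[OF assms(1,2)]
  by (simp add: representation_add[OF frame_indep[OF assms(1,2)]])

lemma coord_scale:
  assumes "(U, e) \<in> frames E" "p \<in> U" "x \<in> fib E p"
  shows "coord r e p (k *\<^sub>R x) i = k * coord r e p x i"
  unfolding coord_def using assms frame_span[OF assms(1,2)]
  by (simp add: representation_scale[OF frame_indep[OF assms(1,2)]])

lemma coord_sum:
  assumes "(U, e) \<in> frames E" "p \<in> U" "finite S" "\<And>k. k \<in> S \<Longrightarrow> x k \<in> fib E p"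
  shows "coord r e p (\<Sum>k\<in>S. x k) i = (\<Sum>k\<in>S. coord r e p (x k) i)"
  using assms(3,4)
proof (induction S rule: finite_induct)
  case empty
  show ?case using coord_scale[OF assms(1,2) fib_0, of 0 i] by simp
next
  case (insert k S)
  then show ?case using coord_add[OF assms(1,2), of "x k" "\<Sum>k\<in>S. x k"] fib_sum[of S x p] by simp
qed

lemma coord_frame:
  assumes "(U, e) \<in> frames E" "p \<in> U" "i < r" "j < r"
  shows "coord r e p (e j p) i = (if i = j then 1 else 0)"
  unfolding coord_def using assms frame_inj[OF assms(1,2)]
  by (subst representation_basis[OF frame_indep[OF assms(1,2)]]) (auto simp: inj_on_def)

lemma coord_transition:
  assumes "(U, e) \<in> frames E" "(V, h) \<in> frames E" "p \<in> U \<inter> V" "x \<in> fib E p"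
  shows "coord r h p x j = (\<Sum>i<r. coord r e p x i * coord r h p (e i p) j)"
proof -
  have "coord r h p x j = coord r h p (\<Sum>i<r. coord r e p x i *\<^sub>R e i p) j"
    using coord_expand[OF assms(1) _ assms(4)] assms(3) by auto
  also have "\<dots> = (\<Sum>i<r. coord r e p x i * coord r h p (e i p) j)"
  proof -
    have p: "p \<in> U" "p \<in> V" using assms(3) by auto
    show ?thesis
      by (subst coord_sum[OF assms(2) p(2)])
         (auto intro!: fib_scale frame_in[OF assms(1) p(1)] sum.cong coord_scale[OF assms(2) p(2)])
  qed
  finally show ?thesis .
qed

lemma frame_transition:
  assumes "(U, e) \<in> frames E" "(V, h) \<in> frames E" "i < r" "j < r" "open I"
  shows "tsmooth A I (U \<inter> V) (\<lambda>t p. coord r h p (e i p) j)"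
proof (rule tsmooth_static[OF _ _ assms(5)])
  show "smooth_fun_on A (U \<inter> V) (\<lambda>p. coord r h p (e i p) j)"
    using vb assms unfolding vector_bundle_def by fast
qed (use frame_open assms in auto)

lemma tsectionD:
  assumes "tsection A E I s"
  shows "t \<in> I \<Longrightarrow> s t p \<in> fib E p"
    and "(U, e) \<in> frames E \<Longrightarrow> i < r \<Longrightarrow> tsmooth A I U (\<lambda>t p. coord r e p (s t p) i)"
  using assms unfolding tsection_def by auto

text \<open>One frame near each point suffices, since coordinates in another frame arise by
  multiplication with smooth transition functions.\<close>

lemma tsectionI:
  assumes I: "open I" and fib: "\<And>t p. t \<in> I \<Longrightarrow> s t p \<in> fib E p"
    and loc: "\<And>p. \<exists>U e W. (U, e) \<in> frames E \<and> open W \<and> p \<in> W \<and> W \<subseteq> U \<and>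
        (\<forall>i<r. tsmooth A I W (\<lambda>t q. coord r e q (s t q) i))"
  shows "tsection A E I s"
  unfolding tsection_def
proof (intro conjI ballI allI impI, goal_cases)
  case (2 z)
  obtain V h where z: "z = (V, h)" by (cases z)
  have V: "(V, h) \<in> frames E" using 2 z by simp
  have "tsmooth A I V (\<lambda>t p. coord r h p (s t p) j)" if j: "j < r" for j
  proof (rule tsmooth_local)
    fix p assume p: "p \<in> V"
    obtain U e W where U: "(U, e) \<in> frames E" "open W" "p \<in> W" "W \<subseteq> U"
      "\<forall>i<r. tsmooth A I W (\<lambda>t q. coord r e q (s t q) i)" using loc[of p] by (elim exE conjE)
    have o: "open (V \<inter> W)" using frame_open[OF V] U(2) by auto
    have "tsmooth A I (V \<inter> W) (\<lambda>t q. \<Sum>i<r. coord r e q (s t q) i * coord r h q (e i q) j)"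
    proof (intro tsmooth_sum tsmooth_mult I o)
      fix i assume "i \<in> {..<r}"
      then have i: "i < r" by simp
      show "tsmooth A I (V \<inter> W) (\<lambda>t q. coord r e q (s t q) i)"
        using U(5) i by (auto intro: tsmooth_subset)
      show "tsmooth A I (V \<inter> W) (\<lambda>t q. coord r h q (e i q) j)"
        using U(4) by (auto intro: tsmooth_subset[OF frame_transition[OF U(1) V i j I]])
    qed
    then have "tsmooth A I (V \<inter> W) (\<lambda>t q. coord r h q (s t q) j)"
      by (rule tsmooth_cong[rotated]) (use U(4) coord_transition[OF U(1) V _ fib, symmetric] in auto)
    then show "\<exists>W'. open W' \<and> p \<in> W' \<and> tsmooth A I (V \<inter> W') (\<lambda>t q. coord r h q (s t q) j)"
      using U(2,3) by blast
  qed
  then show ?case by (simp add: z)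
qed (rule fib)

lemma tsection_subset: "tsection A E I s \<Longrightarrow> I' \<subseteq> I \<Longrightarrow> tsection A E I' s"
  unfolding tsection_def by (fastforce intro: tsmooth_subset)

lemma tsection_cong:
  assumes "\<And>t p. t \<in> I \<Longrightarrow> s t p = s' t p" "tsection A E I s"
  shows "tsection A E I s'"
  unfolding tsection_def
proof (intro conjI ballI allI impI, goal_cases)
  case (1 t p)
  then show ?case using assms tsectionD(1) by metis
next
  case (2 z)
  obtain V h where z: "z = (V, h)" by (cases z)
  show ?case unfolding z
  proof (clarify)
    fix i assume "i < r"
    then have "tsmooth A I V (\<lambda>t p. coord r h p (s t p) i)" using 2 assms(2) tsectionD(2) z by blast
    then show "tsmooth A I V (\<lambda>t p. coord r h p (s' t p) i)"
      by (rule tsmooth_cong[rotated]) (simp add: assms(1))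
  qed
qed

lemma tsection_add:
  assumes I: "open I" and a: "tsection A E I a" and b: "tsection A E I b"
  shows "tsection A E I (\<lambda>t p. a t p + b t p)"
  unfolding tsection_def
proof (intro conjI ballI allI impI, goal_cases)
  case (1 t p)
  then show ?case using a b tsectionD(1) fib_add by blast
next
  case (2 z)
  obtain U e where z: "z = (U, e)" by (cases z)
  have U: "(U, e) \<in> frames E" using 2 z by simp
  show ?case unfolding z
  proof (clarify)
    fix i assume i: "i < r"
    have "tsmooth A I U (\<lambda>t p. coord r e p (a t p) i + coord r e p (b t p) i)"
      by (intro tsmooth_add I frame_open[OF U] tsectionD(2)[OF a U i] tsectionD(2)[OF b U i])
    then show "tsmooth A I U (\<lambda>t p. coord r e p (a t p + b t p) i)"
      by (rule tsmooth_cong[rotated])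
         (simp add: coord_add[OF U] tsectionD(1)[OF a] tsectionD(1)[OF b])
  qed
qed

lemma tsection_scale:
  assumes I: "open I" and f: "tsmooth A I UNIV f" and a: "tsection A E I a"
  shows "tsection A E I (\<lambda>t p. f t p *\<^sub>R a t p)"
  unfolding tsection_def
proof (intro conjI ballI allI impI, goal_cases)
  case (1 t p)
  then show ?case using a tsectionD(1) fib_scale by blast
next
  case (2 z)
  obtain U e where z: "z = (U, e)" by (cases z)
  have U: "(U, e) \<in> frames E" using 2 z by simp
  show ?case unfolding z
  proof (clarify)
    fix i assume i: "i < r"
    have "tsmooth A I U (\<lambda>t p. f t p * coord r e p (a t p) i)"
      by (intro tsmooth_mult I frame_open[OF U] tsectionD(2)[OF a U i] tsmooth_subset[OF f]) auto
    then show "tsmooth A I U (\<lambda>t p. coord r e p (f t p *\<^sub>R a t p) i)"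
      by (rule tsmooth_cong[rotated]) (simp add: coord_scale[OF U] tsectionD(1)[OF a])
  qed
qed

lemma tsection_zero: "open I \<Longrightarrow> tsection A E I (\<lambda>t p. 0)"
proof -
  assume I: "open I"
  have "tsmooth A I U (\<lambda>t p. coord r e p 0 i)" if U: "(U, e) \<in> frames E" for U e i
    by (rule tsmooth_cong[OF _ tsmooth_const[OF I frame_open[OF U], of 0]])
       (use coord_sum[OF U, of _ "{}"] in auto)
  then show ?thesis unfolding tsection_def by (auto intro: fib_0)
qed

lemma tsection_sum:
  "open I \<Longrightarrow> (\<And>k. k \<in> S \<Longrightarrow> tsection A E I (a k)) \<Longrightarrow> tsection A E I (\<lambda>t p. \<Sum>k\<in>S. a k t p)"
  by (induction S rule: infinite_finite_induct) (auto intro: tsection_zero tsection_add)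

lemma tsection_minus: "open I \<Longrightarrow> tsection A E I a \<Longrightarrow> tsection A E I (\<lambda>t p. - a t p)"
  using tsection_scale[OF _ tsmooth_const[OF _ open_UNIV], of I a "-1"] by simp

lemma tsection_diff:
  "open I \<Longrightarrow> tsection A E I a \<Longrightarrow> tsection A E I b \<Longrightarrow> tsection A E I (\<lambda>t p. a t p - b t p)"
  using tsection_add[OF _ _ tsection_minus, of I a b] by simp

lemma sections_iff: "s \<in> sections A E \<longleftrightarrow> tsection A E UNIV (\<lambda>t. s)"
  unfolding sections_def tsection_def
  using smooth_fun_tsmooth[OF frame_open] by fastforce

lemma sections_tsection: "s \<in> sections A E \<Longrightarrow> tsection A E I (\<lambda>t. s)"
  unfolding sections_iff by (rule tsection_subset) auto

lemma tsection_sections: "open I \<Longrightarrow> tsection A E I s \<Longrightarrow> t \<in> I \<Longrightarrow> s t \<in> sections A E"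
  unfolding sections_def using tsectionD[of I s] tsmooth_slice[OF frame_open] by fastforce

lemma sections_fib: "s \<in> sections A E \<Longrightarrow> s p \<in> fib E p"
  unfolding sections_def by blast

lemma
  assumes "a \<in> sections A E"
  shows sections_add: "b \<in> sections A E \<Longrightarrow> (\<lambda>p. a p + b p) \<in> sections A E"
    and sections_diff: "b \<in> sections A E \<Longrightarrow> (\<lambda>p. a p - b p) \<in> sections A E"
    and sections_scale: "smooth_fun A f \<Longrightarrow> (\<lambda>p. f p *\<^sub>R a p) \<in> sections A E"
    and sections_minus: "(\<lambda>p. - a p) \<in> sections A E"
  using assms tsection_add[OF open_UNIV] tsection_diff[OF open_UNIV] tsection_minus[OF open_UNIV]
    tsection_scale[OF open_UNIV]
  by (simp_all add: sections_iff smooth_fun_iff)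

lemma sections_sum: "(\<And>k. k \<in> S \<Longrightarrow> a k \<in> sections A E) \<Longrightarrow> (\<lambda>p. \<Sum>k\<in>S. a k p) \<in> sections A E"
  using tsection_sum[OF open_UNIV, of S "\<lambda>k t. a k"] by (simp add: sections_iff)

lemma tsection_time_scale:
  "open I \<Longrightarrow> smooth_on UNIV h \<Longrightarrow> tsection A E I a \<Longrightarrow> tsection A E I (\<lambda>t p. h t *\<^sub>R a t p)"
  by (rule tsection_scale[OF _ tsmooth_time[OF _ open_UNIV]])

lemma tsection_reparam:
  assumes "open I" "tsection A E K s" "smooth_on UNIV \<sigma>" "\<sigma> ` I \<subseteq> K"
  shows "tsection A E I (\<lambda>t. s (\<sigma> t))"
  using assms unfolding tsection_def
  by (fastforce intro!: tsmooth_reparam[OF assms(1) frame_open _ assms(3,4)])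

subsection \<open>Finitely many global generators\<close>

lemma section_extend:
  assumes U: "(U, e) \<in> frames E" and l: "smooth_fun A l" "closed K" "K \<subseteq> U" "\<And>q. q \<notin> K \<Longrightarrow> l q = 0" and i: "i < r"
  shows "(\<lambda>q. if q \<in> U then l q *\<^sub>R e i q else 0) \<in> sections A E"
  unfolding sections_iff
proof (rule tsectionI[OF open_UNIV])
  show "(if q \<in> U then l q *\<^sub>R e i q else 0) \<in> fib E q" for q
    using frame_in[OF U _ i] fib_scale fib_0 by auto
  fix p
  show "\<exists>V h W. (V, h) \<in> frames E \<and> open W \<and> p \<in> W \<and> W \<subseteq> V \<and>
      (\<forall>j<r. tsmooth A UNIV W (\<lambda>t q. coord r h q (if q \<in> U then l q *\<^sub>R e i q else 0) j))"
  proof (cases "p \<in> U")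
    case True
    have "tsmooth A UNIV U (\<lambda>t q. coord r e q (if q \<in> U then l q *\<^sub>R e i q else 0) j)" if j: "j < r" for j
    proof (rule tsmooth_cong)
      show "tsmooth A UNIV U (\<lambda>t q. l q * (if j = i then 1 else 0))"
        by (intro tsmooth_mult open_UNIV frame_open[OF U] tsmooth_const)
           (use l(1) in \<open>auto simp: smooth_fun_iff intro: tsmooth_subset\<close>)
      show "l q * (if j = i then 1 else 0) = coord r e q (if q \<in> U then l q *\<^sub>R e i q else 0) j" if "q \<in> U" for q
        using that coord_scale[OF U that frame_in[OF U that i]] coord_frame[OF U that j i] by simp
    qed
    then show ?thesis using True U frame_open[OF U] by blast
  next
    case False
    obtain V h where V: "(V, h) \<in> frames E" "p \<in> V" by (rule frame_ex)
    let ?W = "V \<inter> - K"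
    have o: "open ?W" using frame_open[OF V(1)] l(2) by auto
    have "tsmooth A UNIV ?W (\<lambda>t q. coord r h q (if q \<in> U then l q *\<^sub>R e i q else 0) j)" for j
      by (rule tsmooth_cong[OF _ tsmooth_const[OF open_UNIV o, of 0]])
         (use l(4) coord_sum[OF V(1), of _ "{}"] in auto)
    then show ?thesis using V o False l(3) by (intro exI[of _ V] exI[of _ h] exI[of _ ?W]) auto
  qed
qed

text \<open>From finitely many frames whose cutoffs are 1 on a cover, the generators are the cut-off
  frame sections, and the functionals are the frame coordinates weighted by the cutoff divided by
  \<open>s\<close>.\<close>

lemma generators_exist:
  assumes "compact (UNIV :: 'a set)"
  obtains N :: nat and S :: "nat \<Rightarrow> 'a \<Rightarrow> 'v" and \<Lambda> :: "nat \<Rightarrow> 'a \<Rightarrow> 'v \<Rightarrow> real"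
  where "\<And>k. k < N \<Longrightarrow> S k \<in> sections A E"
    "\<And>k p x y. k < N \<Longrightarrow> x \<in> fib E p \<Longrightarrow> y \<in> fib E p \<Longrightarrow> \<Lambda> k p (x + y) = \<Lambda> k p x + \<Lambda> k p y"
    "\<And>k p x a. k < N \<Longrightarrow> x \<in> fib E p \<Longrightarrow> \<Lambda> k p (a *\<^sub>R x) = a * \<Lambda> k p x"
    "\<And>p x. x \<in> fib E p \<Longrightarrow> x = (\<Sum>k<N. \<Lambda> k p x *\<^sub>R S k p)"
    "\<And>I s k. open I \<Longrightarrow> tsection A E I s \<Longrightarrow> k < N \<Longrightarrow> tsmooth A I UNIV (\<lambda>t p. \<Lambda> k p (s t p))"
proof -
  have "\<exists>U e l N K. (U, e) \<in> frames E \<and> smooth_fun A l \<and> open N \<and> p \<in> N \<and> N \<subseteq> K \<and> K \<subseteq> U \<and> closed K \<and>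
      (\<forall>q\<in>N. l q = 1) \<and> (\<forall>q. q \<notin> K \<longrightarrow> l q = 0)" for p
  proof -
    obtain U e where U: "(U, e) \<in> frames E" "p \<in> U" by (rule frame_ex)
    obtain l N K where "smooth_fun A l" "open N" "p \<in> N" "N \<subseteq> K" "K \<subseteq> U" "closed K"
      "\<And>q. q \<in> N \<Longrightarrow> l q = 1" "\<And>q. q \<notin> K \<Longrightarrow> l q = 0"
      by (rule cutoff_exists[OF frame_open[OF U(1)] U(2)]) blast
    then show ?thesis using U by blast
  qed
  then obtain U e l N K where *: "\<And>p. (U p, e p) \<in> frames E \<and> smooth_fun A (l p) \<and> open (N p) \<and> p \<in> N p \<and>
      N p \<subseteq> K p \<and> K p \<subseteq> U p \<and> closed (K p) \<and> (\<forall>q\<in>N p. l p q = 1) \<and> (\<forall>q. q \<notin> K p \<longrightarrow> l p q = 0)"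
    by metis
  have oN: "open (N p)" "p \<in> N p" for p using * by blast+
  obtain P where "P \<subseteq> UNIV" and P: "finite P" "UNIV \<subseteq> (\<Union>p\<in>P. N p)"
    by (rule compactE_image[OF assms, of UNIV N]) (use oN in auto)
  \<comment> \<open>The cutoff is spent twice, once to extend the frame sections and once to extend
    the coordinates, so the normalising sum consists of squares.\<close>
  define s where "s q = (\<Sum>p\<in>P. l p q * l p q)" for q
  have s0: "s q > 0" for q
  proof -
    obtain p where p: "p \<in> P" "q \<in> N p" using P(2) by blast
    then have "l p q = 1" using * by blast
    then have "1 \<le> s q" unfolding s_def
      using member_le_sum[OF p(1), of "\<lambda>p. l p q * l p q"] P(1) by simp
    then show ?thesis by simp
  qed
  have ss: "smooth_fun A s" unfolding s_def by (intro smooth_fun_sum smooth_fun_mult) (use * in auto)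
  define G where "G z q = (if q \<in> U (fst z) then l (fst z) q *\<^sub>R e (fst z) (snd z) q else 0)" for z q
  define L where "L z q x = (if q \<in> U (fst z) then l (fst z) q * (inverse (s q) * coord r (e (fst z)) q x (snd z)) else 0)" for z q x
  define Z where "Z = P \<times> {..<r}"
  have fZ: "finite Z" using P by (simp add: Z_def)
  have G: "G z \<in> sections A E" if "z \<in> Z" for z
    unfolding G_def by (rule section_extend[of _ _ _ "K (fst z)"]) (use * that in \<open>auto simp: Z_def\<close>)
  have Ladd: "L z q (x + y) = L z q x + L z q y" if "x \<in> fib E q" "y \<in> fib E q" for z q x y
    using coord_add[of "U (fst z)" "e (fst z)" q x y] * that by (auto simp: L_def algebra_simps)
  have Lscale: "L z q (a *\<^sub>R x) = a * L z q x" if "x \<in> fib E q" for z q a x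
    using coord_scale[of "U (fst z)" "e (fst z)" q x a] * that by (auto simp: L_def)
  have exp: "x = (\<Sum>z\<in>Z. L z q x *\<^sub>R G z q)" if x: "x \<in> fib E q" for q x
  proof -
    have "(\<Sum>z\<in>Z. L z q x *\<^sub>R G z q) = (\<Sum>p\<in>P. \<Sum>i<r. L (p, i) q x *\<^sub>R G (p, i) q)"
      unfolding Z_def by (simp add: sum.cartesian_product case_prod_beta')
    also have "\<dots> = (\<Sum>p\<in>P. (inverse (s q) * (l p q * l p q)) *\<^sub>R x)"
    proof (rule sum.cong[OF refl])
      fix p assume "p \<in> P"
      show "(\<Sum>i<r. L (p, i) q x *\<^sub>R G (p, i) q) = (inverse (s q) * (l p q * l p q)) *\<^sub>R x"
      proof (cases "q \<in> U p")
        case True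
        have "(U p, e p) \<in> frames E" using * by blast
        from coord_expand[OF this True x]
        have "(inverse (s q) * (l p q * l p q)) *\<^sub>R x =
            (inverse (s q) * (l p q * l p q)) *\<^sub>R (\<Sum>i<r. coord r (e p) q x i *\<^sub>R e p i q)"
          by (rule arg_cong)
        then show ?thesis using True by (simp add: L_def G_def scaleR_sum_right mult_ac)
      next
        case False
        then have "l p q = 0" using * by blast
        then show ?thesis using False by (simp add: L_def G_def)
      qed
    qed
    also have "\<dots> = (inverse (s q) * s q) *\<^sub>R x"
      unfolding s_def by (simp add: sum_distrib_left scaleR_left.sum)
    also have "\<dots> = x" using s0[of q] by simp
    finally show ?thesis by simp
  qed
  have smooth: "tsmooth A I UNIV (\<lambda>t p. L z p (\<sigma> t p))" if I: "open I" and \<sigma>: "tsection A E I \<sigma>" and z: "z \<in> Z" for I \<sigma> z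
  proof -
    have zU: "(U (fst z), e (fst z)) \<in> frames E" using * by blast
    note o = frame_open[OF zU]
    have "tsmooth A I (U (fst z)) (\<lambda>t q. inverse (s q) * coord r (e (fst z)) q (\<sigma> t q) (snd z))"
    proof (intro tsmooth_mult I o tsmooth_inverse)
      show "tsmooth A I (U (fst z)) (\<lambda>t. s)"
        using ss unfolding smooth_fun_iff by (rule tsmooth_subset) auto
      show "s q \<noteq> 0" for q using s0[of q] by simp
      show "tsmooth A I (U (fst z)) (\<lambda>t q. coord r (e (fst z)) q (\<sigma> t q) (snd z))"
        by (rule tsectionD(2)[OF \<sigma> zU]) (use z in \<open>auto simp: Z_def\<close>)
    qed
    then show ?thesis unfolding L_def
      by (rule tsmooth_extend[OF I o, of _ "K (fst z)", rotated 4]) (use * in auto)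
  qed
  obtain h where h: "bij_betw h {0..<card Z} Z" using ex_bij_betw_nat_finite[OF fZ] by blast
  have h': "bij_betw h {..<card Z} Z" using h by (simp add: atLeast0LessThan)
  have hZ: "h k \<in> Z" if "k < card Z" for k using h' that by (auto simp: bij_betw_def)
  show ?thesis
  proof (rule that[of "card Z" "\<lambda>k. G (h k)" "\<lambda>k. L (h k)"])
    show "x = (\<Sum>k<card Z. L (h k) q x *\<^sub>R G (h k) q)" if "x \<in> fib E q" for q x
      using exp[OF that] sum.reindex_bij_betw[OF h', of "\<lambda>z. L z q x *\<^sub>R G z q"] by simp
  qed (use G Ladd Lscale smooth hZ in auto)
qed

end

section \<open>Consequences of the Courant axioms, rewritten for the Dorfman bracket\<close>

section \<open>The Dorfman bracket\<close>

locale courant_mfd = bundle_mfd A B c E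
  for A :: "('a::{t2_space, second_countable_topology}, 'm::{banach, heine_borel}) atlas" and B c
    and E :: "('a, 'v::real_vector) courant" +
  assumes ca: "courant_algebroid A E"
begin

abbreviation "\<Gamma> \<equiv> sections A E"
abbreviation pr :: "'a \<Rightarrow> 'v \<Rightarrow> 'v \<Rightarrow> real" where "pr \<equiv> pairing E"
abbreviation an :: "'a \<Rightarrow> 'v \<Rightarrow> ('a \<Rightarrow> real) \<Rightarrow> real" where "an \<equiv> anchor E"

lemma sm: "smooth_metric A E" and sa: "smooth_anchor A E" and sb: "skew_bracket A E"
  using ca by (simp_all add: courant_algebroid_def)

lemma pr_lin: "x \<in> fib E p \<Longrightarrow> linear_between (fib E p) UNIV (pr p x)"
  using sm by (simp add: smooth_metric_def)

lemma pr_sym: "x \<in> fib E p \<Longrightarrow> y \<in> fib E p \<Longrightarrow> pr p x y = pr p y x"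
  using sm by (simp add: smooth_metric_def)

lemma pr_nondeg: "x \<in> fib E p \<Longrightarrow> (\<And>y. y \<in> fib E p \<Longrightarrow> pr p x y = 0) \<Longrightarrow> x = 0"
  using sm by (simp add: smooth_metric_def)

lemma
  assumes "x \<in> fib E p" "y \<in> fib E p"
  shows pr_add: "z \<in> fib E p \<Longrightarrow> pr p x (y + z) = pr p x y + pr p x z"
    and pr_scale: "pr p x (k *\<^sub>R y) = k * pr p x y"
  using pr_lin[OF assms(1)] assms(2) by (simp_all add: linear_between_def)

lemma
  assumes "x \<in> fib E p" "y \<in> fib E p"
  shows pl_add: "z \<in> fib E p \<Longrightarrow> pr p (y + z) x = pr p y x + pr p z x"
    and pl_scale: "pr p (k *\<^sub>R y) x = k * pr p y x"
  using assms pr_add[OF assms] pr_scale[OF assms] pr_sym fib_add fib_scale by metis+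

lemma pr_zero: "x \<in> fib E p \<Longrightarrow> pr p x 0 = 0" "x \<in> fib E p \<Longrightarrow> pr p 0 x = 0"
  using pr_scale[OF _ fib_0, of x p 0] pr_sym[OF _ fib_0, of x p] by simp_all

lemma
  assumes "x \<in> fib E p" "y \<in> fib E p"
  shows pr_minus: "pr p x (- y) = - pr p x y" and pl_minus: "pr p (- y) x = - pr p y x"
  using pr_scale[OF assms, of "-1"] pl_scale[OF assms, of "-1"] by simp_all

lemma pl_diff:
  assumes "x \<in> fib E p" "y \<in> fib E p" "z \<in> fib E p"
  shows "pr p (y - z) x = pr p y x - pr p z x"
  using pl_add[OF assms(1,2) fib_neg[OF assms(3)]] pl_minus[OF assms(1,3)] by simp

lemma pl_sum:
  assumes "x \<in> fib E p" "\<And>k. k \<in> S \<Longrightarrow> y k \<in> fib E p"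
  shows "pr p (\<Sum>k\<in>S. y k) x = (\<Sum>k\<in>S. pr p (y k) x)"
  using assms(2)
  by (induction S rule: infinite_finite_induct) (simp_all add: pr_zero[OF assms(1)] pl_add[OF assms(1)] fib_sum)

lemma pr_sum:
  assumes "x \<in> fib E p" "\<And>k. k \<in> S \<Longrightarrow> y k \<in> fib E p"
  shows "pr p x (\<Sum>k\<in>S. y k) = (\<Sum>k\<in>S. pr p x (y k))"
  using assms(2)
  by (induction S rule: infinite_finite_induct) (simp_all add: pr_zero[OF assms(1)] pr_add[OF assms(1)] fib_sum)

lemma fib_eqI: "x \<in> fib E p \<Longrightarrow> y \<in> fib E p \<Longrightarrow> (\<And>z. z \<in> fib E p \<Longrightarrow> pr p x z = pr p y z) \<Longrightarrow> x = y"
  using pr_nondeg[OF fib_diff, of x p y] by (simp add: pl_diff)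

text \<open>The map \<open>x \<mapsto> \<Sum>\<^sub>i \<langle>x, e\<^sub>i\<rangle> e\<^sub>i\<close> is injective on the fibre by nondegeneracy, hence onto.\<close>

lemma riesz_basis:
  assumes U: "(U, e) \<in> frames E" "p \<in> U" and i: "i < r"
  obtains d where "d \<in> fib E p" "\<And>j. j < r \<Longrightarrow> pr p d (e j p) = (if j = i then 1 else 0)"
proof -
  define T where "T x = (\<Sum>j<r. pr p x (e j p) *\<^sub>R e j p)" for x
  note ein = frame_in[OF U]
  have Tfib: "T x \<in> fib E p" for x unfolding T_def using ein by (intro fib_sum fib_scale) auto
  have Tadd: "T (x + y) = T x + T y" if "x \<in> fib E p" "y \<in> fib E p" for x y
    using that ein by (simp add: T_def pl_add scaleR_add_left sum.distrib)
  have Tscale: "T (k *\<^sub>R x) = k *\<^sub>R T x" if "x \<in> fib E p" for k x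
    using that ein by (simp add: T_def pl_scale scaleR_sum_right)
  have coT: "coord r e p (T x) j = pr p x (e j p)" if "j < r" for x j
  proof -
    have "coord r e p (T x) j = (\<Sum>k<r. pr p x (e k p) * (if j = k then 1 else 0))"
      unfolding T_def by (subst coord_sum[OF U]) (use ein that in \<open>auto simp: coord_scale[OF U] coord_frame[OF U] fib_scale intro!: sum.cong\<close>)
    then show ?thesis using that by (simp add: if_distrib cong: if_cong)
  qed
  have T0: "x = 0" if x: "x \<in> fib E p" "T x = 0" for x
  proof (rule pr_nondeg[OF x(1)])
    fix y assume y: "y \<in> fib E p"
    have "coord r e p 0 j = 0" for j using coord_sum[OF U, of "{}"] by simp
    then have "pr p x (e j p) = 0" if "j < r" for j using coT[OF that, of x] x(2) by simp
    then have "pr p x (\<Sum>j<r. coord r e p y j *\<^sub>R e j p) = 0"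
      using ein x(1) by (subst pr_sum) (auto simp: pr_scale fib_scale)
    then show "pr p x y = 0" using coord_expand[OF U y] by simp
  qed
  define F where "F = (\<lambda>j. e j p) ` {..<r}"
  have Fcard: "card F = r" "finite F" using card_image[OF frame_inj[OF U]] by (simp_all add: F_def)
  have inj: "inj_on T (fib E p)"
  proof (rule inj_onI)
    fix x y assume xy: "x \<in> fib E p" "y \<in> fib E p" "T x = T y"
    have "T (x - y) = T x + T ((-1) *\<^sub>R y)" using Tadd[OF xy(1) fib_scale[OF xy(2), of "-1"]] by simp
    then have "T (x - y) = 0" using Tscale[OF xy(2), of "-1"] xy(3) by simp
    then show "x = y" using T0[OF fib_diff[OF xy(1,2)]] by simp
  qed
  have Fsub: "F \<subseteq> fib E p" using ein by (auto simp: F_def)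
  have Find: "independent F" and Fspan: "span F = fib E p" using frame_indep[OF U] frame_span[OF U] by (simp_all add: F_def)
  have Tsum: "(\<Sum>v\<in>X. k v *\<^sub>R T v) = T (\<Sum>v\<in>X. k v *\<^sub>R v)" if "finite X" "X \<subseteq> fib E p" for X k
    using that
  proof (induction X rule: finite_induct)
    case empty
    then show ?case using Tscale[OF fib_0, of 0] by simp
  next
    case (insert v X)
    then show ?case using Tadd[of "k v *\<^sub>R v" "\<Sum>v\<in>X. k v *\<^sub>R v"]
      by (simp add: Tscale fib_scale fib_sum subset_eq)
  qed
  \<comment> \<open>An injective linear map keeps the basis independent. The images are as numerous
    as the basis, so they span; otherwise one more independent vector could be added to
    them.\<close>
  have "independent (T ` F)"
  proof (rule independent_if_scalars_zero)
    fix f :: "'v \<Rightarrow> real" and x assume f: "(\<Sum>v\<in>T ` F. f v *\<^sub>R v) = 0" and x: "x \<in> T ` F"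
    have "(\<Sum>v\<in>T ` F. f v *\<^sub>R v) = (\<Sum>v\<in>F. f (T v) *\<^sub>R T v)"
      using sum.reindex[OF inj_on_subset[OF inj Fsub], of "\<lambda>v. f v *\<^sub>R v"] by (simp add: o_def)
    also have "\<dots> = T (\<Sum>v\<in>F. f (T v) *\<^sub>R v)" by (rule Tsum[OF Fcard(2) Fsub])
    finally have "T (\<Sum>v\<in>F. f (T v) *\<^sub>R v) = 0" using f by argo
    moreover have "(\<Sum>v\<in>F. f (T v) *\<^sub>R v) \<in> fib E p" using Fsub by (intro fib_sum fib_scale) auto
    ultimately have "(\<Sum>v\<in>F. f (T v) *\<^sub>R v) = 0" using T0 by blast
    then have "\<forall>v\<in>F. f (T v) = 0"
      using independentD[OF Find Fcard(2), of "\<lambda>v. f (T v)"] by auto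
    then show "f x = 0" using x by auto
  qed (use Fcard in simp)
  moreover have Tcard: "card (T ` F) = r" using card_image[OF inj_on_subset[OF inj Fsub]] Fcard by simp
  moreover have "T ` F \<subseteq> span F" using Tfib Fspan by auto
  ultimately have "span (T ` F) = span F"
  proof (intro antisym)
    show "span (T ` F) \<subseteq> span F" using \<open>T ` F \<subseteq> span F\<close> by (rule span_minimal[OF _ subspace_span])
    show "span F \<subseteq> span (T ` F)"
    proof (rule ccontr)
      assume "\<not> ?thesis"
      then obtain v where v: "v \<in> span F" "v \<notin> span (T ` F)" by blast
      have "independent (insert v (T ` F))"
        using independent_insertI[OF v(2) \<open>independent (T ` F)\<close>] .
      moreover have "insert v (T ` F) \<subseteq> span F" using v(1) \<open>T ` F \<subseteq> span F\<close> by auto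
      ultimately have "card (insert v (T ` F)) \<le> card F"
        using independent_span_bound[OF Fcard(2)] by blast
      moreover have "v \<notin> T ` F" using v(2) span_superset by (rule contra_subsetD[rotated])
      then have "card (insert v (T ` F)) = Suc r"
        using Tcard card_insert_disjoint[OF finite_imageI[OF Fcard(2)], of v T] by simp
      ultimately show False using Fcard(1) by simp
    qed
  qed
  then have "e i p \<in> span (T ` F)" using span_base[of "e i p" F] i by (simp add: F_def)
  moreover have "span (T ` F) \<subseteq> T ` fib E p"
  proof (rule span_minimal)
    show "T ` F \<subseteq> T ` fib E p" using Fsub by blast
    show "subspace (T ` fib E p)"
    proof (rule subspaceI)
      have "T 0 = 0" using Tscale[OF fib_0, of 0] by simp
      then show "0 \<in> T ` fib E p" using fib_0[of p] by (metis imageI)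
      fix x assume "x \<in> T ` fib E p"
      then obtain x' where x': "x' \<in> fib E p" "x = T x'" by blast
      show "k *\<^sub>R x \<in> T ` fib E p" for k
        using Tscale[OF x'(1), of k] fib_scale[OF x'(1), of k] x'(2) by (metis imageI)
      fix y assume "y \<in> T ` fib E p"
      then obtain y' where y': "y' \<in> fib E p" "y = T y'" by blast
      show "x + y \<in> T ` fib E p"
        using Tadd[OF x'(1) y'(1)] fib_add[OF x'(1) y'(1)] x'(2) y'(2) by (metis imageI)
    qed
  qed
  ultimately obtain d where d: "d \<in> fib E p" "T d = e i p" by auto
  have "pr p d (e j p) = (if j = i then 1 else 0)" if "j < r" for j
    using coT[OF that, of d] d(2) coord_frame[OF U that i] by simp
  with d(1) show ?thesis by (rule that)
qed

text \<open>Supplies the existence of \<open>Dop\<close>: a functional that is linear on one fibre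
  is represented by the dual basis weighted with its values on the frame.\<close>

lemma riesz:
  assumes add: "\<And>x y. x \<in> fib E p \<Longrightarrow> y \<in> fib E p \<Longrightarrow> f (x + y) = f x + f y"
    and scale: "\<And>k x. x \<in> fib E p \<Longrightarrow> f (k *\<^sub>R x) = k * f x"
  obtains d where "d \<in> fib E p" "\<And>x. x \<in> fib E p \<Longrightarrow> pr p d x = (f x :: real)"
proof -
  obtain U e where U: "(U, e) \<in> frames E" "p \<in> U" by (rule frame_ex)
  note ein = frame_in[OF U]
  have "\<exists>d. d \<in> fib E p \<and> (\<forall>j<r. pr p d (e j p) = (if j = i then 1 else 0))" if "i < r" for i
    using riesz_basis[OF U that] by metis
  then obtain d where d: "\<And>i. i < r \<Longrightarrow> d i \<in> fib E p"
    "\<And>i j. i < r \<Longrightarrow> j < r \<Longrightarrow> pr p (d i) (e j p) = (if j = i then 1 else 0)" by metis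
  define D where "D = (\<Sum>i<r. f (e i p) *\<^sub>R d i)"
  have D: "D \<in> fib E p" unfolding D_def using d(1) by (intro fib_sum fib_scale) auto
  have De: "pr p D (e j p) = f (e j p)" if "j < r" for j
  proof -
    have "pr p D (e j p) = (\<Sum>i<r. f (e i p) * (if j = i then 1 else 0))"
      unfolding D_def using ein[OF that] d that
      by (subst pl_sum) (auto simp: pl_scale fib_scale intro!: sum.cong)
    then show ?thesis using that by (simp add: if_distrib cong: if_cong)
  qed
  have fsum: "f (\<Sum>j\<in>S. k j *\<^sub>R e j p) = (\<Sum>j\<in>S. k j * f (e j p))" if "finite S" "S \<subseteq> {..<r}" for S k
    using that
  proof (induction S rule: finite_induct)
    case empty
    show ?case using scale[OF fib_0, of 0] by simp
  next
    case (insert j S)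
    then have "(\<Sum>j\<in>S. k j *\<^sub>R e j p) \<in> fib E p" using ein by (intro fib_sum fib_scale) auto
    then show ?case using insert ein by (simp add: add scale fib_scale)
  qed
  show ?thesis
  proof (rule that[OF D])
    fix x assume x: "x \<in> fib E p"
    let ?k = "coord r e p x"
    have "pr p D x = pr p D (\<Sum>j<r. ?k j *\<^sub>R e j p)" using coord_expand[OF U x] by simp
    also have "\<dots> = (\<Sum>j<r. ?k j * f (e j p))"
      using D De ein by (subst pr_sum) (auto simp: pr_scale fib_scale intro!: sum.cong)
    also have "\<dots> = f (\<Sum>j<r. ?k j *\<^sub>R e j p)" using fsum[of "{..<r}" ?k] by simp
    also have "\<dots> = f x" using coord_expand[OF U x] by simp
    finally show "pr p D x = f x" .
  qed
qed

lemma an_tangent: "x \<in> fib E p \<Longrightarrow> tangent_vector A p (an p x)"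
  using sa by (simp add: smooth_anchor_def)

lemma
  assumes "smooth_fun A f" "x \<in> fib E p"
  shows an_add: "y \<in> fib E p \<Longrightarrow> an p (x + y) f = an p x f + an p y f"
    and an_scale: "an p (k *\<^sub>R x) f = k * an p x f"
  using sa assms by (simp_all add: smooth_anchor_def linear_between_def)

lemma an_sum:
  assumes "smooth_fun A f" "\<And>k. k \<in> S \<Longrightarrow> x k \<in> fib E p"
  shows "an p (\<Sum>k\<in>S. x k) f = (\<Sum>k\<in>S. an p (x k) f)"
  using assms(2)
  by (induction S rule: infinite_finite_induct)
     (use an_scale[OF assms(1) fib_0, of p 0] in \<open>simp_all add: an_add[OF assms(1)] fib_sum\<close>)

text \<open>Existence comes from \<open>riesz\<close> and uniqueness from nondegeneracy. The
  definite description is handled through these two facts from here on.\<close>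

lemma Dop_char:
  assumes "smooth_fun A f"
  shows "Dop E f p \<in> fib E p" and "x \<in> fib E p \<Longrightarrow> pr p (Dop E f p) x = 1 / 2 * an p x f"
proof -
  obtain d where d: "d \<in> fib E p" "\<And>x. x \<in> fib E p \<Longrightarrow> pr p d x = 1 / 2 * an p x f"
    by (rule riesz[of p "\<lambda>x. 1 / 2 * an p x f"]) (auto simp: an_add[OF assms] an_scale[OF assms])
  have "Dop E f p = d" unfolding Dop_def
  proof (rule the_equality)
    fix d' assume d': "d' \<in> fib E p \<and> (\<forall>x\<in>fib E p. pr p d' x = 1 / 2 * an p x f)"
    show "d' = d"
    proof (rule fib_eqI)
      fix z assume z: "z \<in> fib E p"
      with d' have "pr p d' z = 1 / 2 * an p z f" by blast
      with d(2)[OF z] show "pr p d' z = pr p d z" by simp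
    qed (use d d' in auto)
  qed (use d in auto)
  then show "Dop E f p \<in> fib E p" "x \<in> fib E p \<Longrightarrow> pr p (Dop E f p) x = 1 / 2 * an p x f" using d by auto
qed

lemma Dop_eqI:
  assumes "smooth_fun A f" "d \<in> fib E p" "\<And>x. x \<in> fib E p \<Longrightarrow> pr p d x = 1 / 2 * an p x f"
  shows "Dop E f p = d"
  by (rule fib_eqI[OF Dop_char(1)[OF assms(1)] assms(2)]) (simp add: Dop_char(2)[OF assms(1)] assms(3))

lemma Dop_add:
  assumes "smooth_fun A f" "smooth_fun A g"
  shows "Dop E (\<lambda>q. f q + g q) p = Dop E f p + Dop E g p"
  by (rule Dop_eqI)
     (auto simp: assms smooth_fun_add fib_add Dop_char pl_add tangent_vectorD(1)[OF an_tangent] algebra_simps)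

lemma Dop_mult:
  assumes "smooth_fun A f" "smooth_fun A g"
  shows "Dop E (\<lambda>q. f q * g q) p = f p *\<^sub>R Dop E g p + g p *\<^sub>R Dop E f p"
  by (rule Dop_eqI)
     (auto simp: assms smooth_fun_mult fib_add fib_scale Dop_char pl_add pl_scale
        tangent_vectorD(2)[OF an_tangent] algebra_simps)

lemma Dop_cmult: "smooth_fun A f \<Longrightarrow> Dop E (\<lambda>q. k * f q) p = k *\<^sub>R Dop E f p"
  by (rule Dop_eqI)
     (auto simp: smooth_fun_mult smooth_fun_const fib_scale Dop_char pl_scale tangent_vectorD(3)[OF an_tangent])

lemma Dop_diff:
  "smooth_fun A f \<Longrightarrow> smooth_fun A g \<Longrightarrow> Dop E (\<lambda>q. f q - g q) p = Dop E f p - Dop E g p"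
  by (rule Dop_eqI)
     (auto simp: smooth_fun_diff fib_diff Dop_char pl_diff tangent_vector_diff[OF an_tangent] algebra_simps)

lemma tsmooth_pairing:
  assumes I: "open I" and a: "tsection A E I a" and b: "tsection A E I b"
  shows "tsmooth A I UNIV (\<lambda>t p. pr p (a t p) (b t p))"
proof (rule tsmooth_local)
  fix p :: 'a
  obtain U e where U: "(U, e) \<in> frames E" "p \<in> U" by (rule frame_ex)
  note o = frame_open[OF U(1)]
  have g: "tsmooth A I U (\<lambda>t p. pr p (e i p) (e j p))" if "i < r" "j < r" for i j
  proof (rule tsmooth_static[OF o _ I])
    show "smooth_fun_on A U (\<lambda>p. pr p (e i p) (e j p))"
      using sm U that unfolding smooth_metric_def by fast
  qed
  have "tsmooth A I U (\<lambda>t p. \<Sum>i<r. \<Sum>j<r. coord r e p (a t p) i * (coord r e p (b t p) j * pr p (e i p) (e j p)))"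
    by (intro tsmooth_sum tsmooth_mult I o tsectionD(2)[OF a U(1)] tsectionD(2)[OF b U(1)] g) auto
  then have "tsmooth A I U (\<lambda>t p. pr p (a t p) (b t p))"
  proof (rule tsmooth_cong[rotated])
    fix t q assume t: "t \<in> I" and q: "q \<in> U"
    note ein = frame_in[OF U(1) q]
    have af: "a t q \<in> fib E q" and bf: "b t q \<in> fib E q" using tsectionD(1)[OF a t] tsectionD(1)[OF b t] by auto
    have "pr q (a t q) (b t q) = pr q (\<Sum>i<r. coord r e q (a t q) i *\<^sub>R e i q) (b t q)"
      using coord_expand[OF U(1) q af] by simp
    also have "\<dots> = (\<Sum>i<r. coord r e q (a t q) i * pr q (e i q) (b t q))"
      using bf ein by (subst pl_sum) (auto simp: pl_scale fib_scale intro!: sum.cong)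
    also have "\<dots> = (\<Sum>i<r. coord r e q (a t q) i * (\<Sum>j<r. coord r e q (b t q) j * pr q (e i q) (e j q)))"
    proof (rule sum.cong[OF refl])
      fix i assume "i \<in> {..<r}"
      then have i: "e i q \<in> fib E q" using ein by simp
      have "pr q (e i q) (b t q) = pr q (e i q) (\<Sum>j<r. coord r e q (b t q) j *\<^sub>R e j q)"
        using coord_expand[OF U(1) q bf] by simp
      also have "\<dots> = (\<Sum>j<r. coord r e q (b t q) j * pr q (e i q) (e j q))"
        using i ein by (subst pr_sum) (auto simp: pr_scale fib_scale intro!: sum.cong)
      finally show "coord r e q (a t q) i * pr q (e i q) (b t q) =
        coord r e q (a t q) i * (\<Sum>j<r. coord r e q (b t q) j * pr q (e i q) (e j q))" by simp
    qed
    finally show "(\<Sum>i<r. \<Sum>j<r. coord r e q (a t q) i * (coord r e q (b t q) j * pr q (e i q) (e j q))) = pr q (a t q) (b t q)"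
      by (simp add: sum_distrib_left)
  qed
  then show "\<exists>W'. open W' \<and> p \<in> W' \<and> tsmooth A I (UNIV \<inter> W') (\<lambda>t p. pr p (a t p) (b t p))"
    using o U(2) by (intro exI[of _ U]) simp
qed

lemma vfield_anchor:
  assumes I: "open I" and a: "tsection A E I a"
  shows "vfield I (\<lambda>t p. an p (a t p))"
  unfolding vfield_def
proof (intro conjI ballI allI impI)
  show "tangent_vector A p (an p (a t p))" if "t \<in> I" for t p
    using an_tangent tsectionD(1)[OF a that] by blast
  fix f assume f: "smooth_fun A f"
  show "tsmooth A I UNIV (\<lambda>t p. an p (a t p) f)"
  proof (rule tsmooth_local)
    fix p :: 'a
    obtain U e where U: "(U, e) \<in> frames E" "p \<in> U" by (rule frame_ex)
    note o = frame_open[OF U(1)]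
    have g: "tsmooth A I U (\<lambda>t p. an p (e i p) f)" if "i < r" for i
    proof (rule tsmooth_static[OF o _ I])
      show "smooth_fun_on A U (\<lambda>p. an p (e i p) f)"
        using sa U that f unfolding smooth_anchor_def by fast
    qed
    have "tsmooth A I U (\<lambda>t p. \<Sum>i<r. coord r e p (a t p) i * an p (e i p) f)"
      by (intro tsmooth_sum tsmooth_mult I o tsectionD(2)[OF a U(1)] g) auto
    then have "tsmooth A I U (\<lambda>t p. an p (a t p) f)"
    proof (rule tsmooth_cong[rotated])
      fix t q assume t: "t \<in> I" and q: "q \<in> U"
      have "an q (a t q) f = an q (\<Sum>i<r. coord r e q (a t q) i *\<^sub>R e i q) f"
        using coord_expand[OF U(1) q tsectionD(1)[OF a t]] by simp
      also have "\<dots> = (\<Sum>i<r. coord r e q (a t q) i * an q (e i q) f)"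
        using frame_in[OF U(1) q] by (subst an_sum[OF f]) (auto simp: an_scale[OF f] fib_scale intro!: sum.cong)
      finally show "(\<Sum>i<r. coord r e q (a t q) i * an q (e i q) f) = an q (a t q) f" by simp
    qed
    then show "\<exists>W'. open W' \<and> p \<in> W' \<and> tsmooth A I (UNIV \<inter> W') (\<lambda>t p. an p (a t p) f)"
      using o U(2) by (intro exI[of _ U]) simp
  qed
qed

lemma tsmooth_anchor:
  assumes "open I" "tsection A E I a" "tsmooth A I UNIV g"
  shows "tsmooth A I UNIV (\<lambda>t p. an p (a t p) (g t))"
  using vfield_tsmooth[OF assms(1) vfield_anchor[OF assms(1,2)] assms(3)] .

lemma pair_sec_smooth: "a \<in> \<Gamma> \<Longrightarrow> b \<in> \<Gamma> \<Longrightarrow> smooth_fun A (pair_sec E a b)"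
  unfolding smooth_fun_iff pair_sec_def by (intro tsmooth_pairing open_UNIV sections_tsection)

lemma lie_der_smooth: "a \<in> \<Gamma> \<Longrightarrow> smooth_fun A f \<Longrightarrow> smooth_fun A (lie_der E a f)"
  unfolding smooth_fun_iff lie_der_def by (intro tsmooth_anchor open_UNIV sections_tsection)

lemma bracket_sec: "a \<in> \<Gamma> \<Longrightarrow> b \<in> \<Gamma> \<Longrightarrow> bracket E a b \<in> \<Gamma>"
  using sb by (simp add: skew_bracket_def)

lemma bracket_skew: "a \<in> \<Gamma> \<Longrightarrow> b \<in> \<Gamma> \<Longrightarrow> bracket E a b p = - bracket E b a p"
  using sb unfolding skew_bracket_def by blast

lemma bracket_add_r: "a \<in> \<Gamma> \<Longrightarrow> b \<in> \<Gamma> \<Longrightarrow> d \<in> \<Gamma> \<Longrightarrow> bracket E a (\<lambda>q. b q + d q) p = bracket E a b p + bracket E a d p"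
  using sb unfolding skew_bracket_def by blast

lemma bracket_scale_r: "a \<in> \<Gamma> \<Longrightarrow> b \<in> \<Gamma> \<Longrightarrow> bracket E a (\<lambda>q. k *\<^sub>R b q) p = k *\<^sub>R bracket E a b p"
  using sb unfolding skew_bracket_def by blast

lemma bracket_anchor: "a \<in> \<Gamma> \<Longrightarrow> b \<in> \<Gamma> \<Longrightarrow> smooth_fun A f \<Longrightarrow>
    lie_der E (bracket E a b) f p = lie_der E a (lie_der E b f) p - lie_der E b (lie_der E a f) p"
  using ca unfolding courant_algebroid_def by blast

lemma bracket_jacobi: "a \<in> \<Gamma> \<Longrightarrow> b \<in> \<Gamma> \<Longrightarrow> d \<in> \<Gamma> \<Longrightarrow>
    bracket E (bracket E a b) d p + bracket E (bracket E b d) a p + bracket E (bracket E d a) b p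
        = (1/3) *\<^sub>R Dop E (\<lambda>q. pair_sec E (bracket E a b) d q + pair_sec E (bracket E b d) a q
                              + pair_sec E (bracket E d a) b q) p"
  using ca unfolding courant_algebroid_def by blast

lemma bracket_leibniz: "a \<in> \<Gamma> \<Longrightarrow> b \<in> \<Gamma> \<Longrightarrow> smooth_fun A f \<Longrightarrow>
    bracket E a (\<lambda>q. f q *\<^sub>R b q) p
        = f p *\<^sub>R bracket E a b p + lie_der E a f p *\<^sub>R b p - pair_sec E a b p *\<^sub>R Dop E f p"
  using ca unfolding courant_algebroid_def by blast

lemma anchor_Dop: "smooth_fun A f \<Longrightarrow> smooth_fun A g \<Longrightarrow> an p (Dop E f p) g = 0"
  using ca unfolding courant_algebroid_def by blast

lemma bracket_pair: "a \<in> \<Gamma> \<Longrightarrow> b \<in> \<Gamma> \<Longrightarrow> d \<in> \<Gamma> \<Longrightarrow>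
    lie_der E a (pair_sec E b d) p
        = pr p (bracket E a b p + Dop E (pair_sec E a b) p) (d p)
          + pr p (b p) (bracket E a d p + Dop E (pair_sec E a d) p)"
  using ca unfolding courant_algebroid_def by blast

text \<open>Pointwise identities can thereby be tested on global sections, which are what the axioms
  speak about.\<close>

lemma section_through:
  assumes x: "x \<in> fib E p"
  obtains s where "s \<in> \<Gamma>" "s p = x"
proof -
  obtain U e where U: "(U, e) \<in> frames E" "p \<in> U" by (rule frame_ex)
  obtain l N K where l: "smooth_fun A l" "open N" "p \<in> N" "N \<subseteq> K" "K \<subseteq> U" "closed K"
      "\<And>q. q \<in> N \<Longrightarrow> l q = 1" "\<And>q. q \<notin> K \<Longrightarrow> l q = 0"
    by (rule cutoff_exists[OF frame_open[OF U(1)] U(2)]) blast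
  let ?s = "\<lambda>q. \<Sum>i<r. coord r e p x i *\<^sub>R (if q \<in> U then l q *\<^sub>R e i q else 0)"
  have "?s \<in> \<Gamma>"
    by (intro sections_sum sections_scale section_extend[OF U(1) l(1,6,5,8)] smooth_fun_const) auto
  moreover have "?s p = x" using U(2) l(3,7) coord_expand[OF U x] by simp
  ultimately show ?thesis by (rule that)
qed

text \<open>Smoothness is read off from the Leibniz rule for the bracket instead of inverting the
  Gram matrix. Where the pairing \<open>?m\<close> of \<open>a\<close> and \<open>b\<close> is
  nonzero, \<open>Dop E f\<close> is \<open>?v\<close> divided by \<open>?m\<close>, and
  \<open>?v\<close> is a combination of smooth sections.\<close>

lemma Dop_sec:
  assumes f: "smooth_fun A f"
  shows "Dop E f \<in> \<Gamma>"
  unfolding sections_iff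
proof (rule tsectionI[OF open_UNIV Dop_char(1)[OF f]])
  fix p
  obtain U e where U: "(U, e) \<in> frames E" "p \<in> U" by (rule frame_ex)
  show "\<exists>U e W. (U, e) \<in> frames E \<and> open W \<and> p \<in> W \<and> W \<subseteq> U \<and>
      (\<forall>i<r. tsmooth A UNIV W (\<lambda>t q. coord r e q (Dop E f q) i))"
  proof (cases "r = 0")
    \<comment> \<open>In rank 0 no two vectors have nonzero pairing, but there are no coordinates to
      check either.\<close>
    case True
    then show ?thesis using U frame_open[OF U(1)] by (intro exI[of _ U] exI[of _ e]) auto
  next
    case False
    then have "e 0 p \<in> fib E p" using frame_in[OF U, of 0] by simp
    moreover have "e 0 p \<noteq> 0"
      using frame_indep[OF U] False dependent_zero by (metis imageI lessThan_iff neq0_conv)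
    ultimately obtain y where y: "y \<in> fib E p" "pr p (e 0 p) y \<noteq> 0" using pr_nondeg by blast
    obtain a where a: "a \<in> \<Gamma>" "a p = e 0 p" by (rule section_through[OF \<open>e 0 p \<in> fib E p\<close>])
    obtain b where b: "b \<in> \<Gamma>" "b p = y" by (rule section_through[OF y(1)])
    let ?m = "pair_sec E a b"
    let ?v = "\<lambda>q. f q *\<^sub>R bracket E a b q + lie_der E a f q *\<^sub>R b q - bracket E a (\<lambda>q. f q *\<^sub>R b q) q"
    have v: "?v \<in> \<Gamma>"
      by (intro sections_diff sections_add sections_scale bracket_sec a b f lie_der_smooth)
    define W where "W = {q. ?m q \<noteq> 0} \<inter> U"
    have "continuous_on UNIV ?m"
      using tsmooth_continuous[OF open_UNIV open_UNIV, of "\<lambda>t. ?m"] pair_sec_smooth[OF a(1) b(1)]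
        continuous_on_compose2[of "UNIV \<times> UNIV" "\<lambda>z. ?m (snd z)" UNIV "\<lambda>q. (0, q)"]
      by (auto simp: smooth_fun_iff continuous_on_Pair)
    then have "open {q. ?m q \<noteq> 0}" by (intro open_Collect_neq continuous_on_const)
    then have oW: "open W" unfolding W_def using frame_open[OF U(1)] by auto
    have pW: "p \<in> W" using U(2) a b y by (simp add: W_def pair_sec_def)
    have "tsmooth A UNIV W (\<lambda>t q. coord r e q (Dop E f q) i)" if i: "i < r" for i
    proof (rule tsmooth_cong)
      show "tsmooth A UNIV W (\<lambda>t q. inverse (?m q) * coord r e q (?v q) i)"
      proof (intro tsmooth_mult open_UNIV oW tsmooth_inverse)
        show "tsmooth A UNIV W (\<lambda>t. ?m)"
          using pair_sec_smooth[OF a(1) b(1)] unfolding smooth_fun_iff by (rule tsmooth_subset) auto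
        show "tsmooth A UNIV W (\<lambda>t q. coord r e q (?v q) i)"
          using tsectionD(2)[OF v[unfolded sections_iff] U(1) i] by (rule tsmooth_subset) (auto simp: W_def)
      qed (auto simp: W_def)
      fix q assume q: "q \<in> W"
      then have qU: "q \<in> U" and m: "?m q \<noteq> 0" by (auto simp: W_def)
      have "?v q = ?m q *\<^sub>R Dop E f q" using bracket_leibniz[OF a(1) b(1) f, of q] by simp
      then show "inverse (?m q) * coord r e q (?v q) i = coord r e q (Dop E f q) i"
        using m coord_scale[OF U(1) qU Dop_char(1)[OF f], of "?m q" i] by simp
    qed
    then show ?thesis using U oW pW by (intro exI[of _ U] exI[of _ e] exI[of _ W]) (auto simp: W_def)
  qed
qed

definition dorf :: "('a \<Rightarrow> 'v) \<Rightarrow> ('a \<Rightarrow> 'v) \<Rightarrow> 'a \<Rightarrow> 'v" where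
  "dorf a b = (\<lambda>p. bracket E a b p + Dop E (pair_sec E a b) p)"

lemma dorf_sec: "a \<in> \<Gamma> \<Longrightarrow> b \<in> \<Gamma> \<Longrightarrow> dorf a b \<in> \<Gamma>"
  unfolding dorf_def by (intro sections_add bracket_sec Dop_sec pair_sec_smooth)

lemma sec_eqI:
  assumes "x \<in> fib E p" "y \<in> fib E p" "\<And>d. d \<in> \<Gamma> \<Longrightarrow> pr p x (d p) = pr p y (d p)"
  shows "x = y"
proof (rule fib_eqI[OF assms(1,2)])
  fix z assume "z \<in> fib E p"
  then obtain d where "d \<in> \<Gamma>" "d p = z" by (rule section_through)
  then show "pr p x z = pr p y z" using assms(3) by blast
qed

lemma pair_sec_add_r: "a \<in> \<Gamma> \<Longrightarrow> b \<in> \<Gamma> \<Longrightarrow> d \<in> \<Gamma> \<Longrightarrow> pair_sec E a (\<lambda>q. b q + d q) = (\<lambda>q. pair_sec E a b q + pair_sec E a d q)"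
  by (simp add: pair_sec_def pr_add sections_fib)

lemma pair_sec_scale_r: "a \<in> \<Gamma> \<Longrightarrow> b \<in> \<Gamma> \<Longrightarrow> pair_sec E a (\<lambda>q. f q *\<^sub>R b q) = (\<lambda>q. f q * pair_sec E a b q)"
  by (simp add: pair_sec_def pr_scale sections_fib)

lemma pair_sec_sym: "a \<in> \<Gamma> \<Longrightarrow> b \<in> \<Gamma> \<Longrightarrow> pair_sec E a b = pair_sec E b a"
  by (simp add: pair_sec_def pr_sym[OF sections_fib sections_fib])

lemma dorf_add_r: "a \<in> \<Gamma> \<Longrightarrow> b \<in> \<Gamma> \<Longrightarrow> d \<in> \<Gamma> \<Longrightarrow> dorf a (\<lambda>q. b q + d q) p = dorf a b p + dorf a d p"
  by (simp add: dorf_def bracket_add_r pair_sec_add_r Dop_add pair_sec_smooth)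

lemma dorf_pair: "a \<in> \<Gamma> \<Longrightarrow> b \<in> \<Gamma> \<Longrightarrow> d \<in> \<Gamma> \<Longrightarrow>
    lie_der E a (pair_sec E b d) p = pr p (dorf a b p) (d p) + pr p (b p) (dorf a d p)"
  using bracket_pair by (simp add: dorf_def)

lemma dorf_sym:
  assumes "a \<in> \<Gamma>" "b \<in> \<Gamma>"
  shows "dorf a b p = 2 *\<^sub>R Dop E (pair_sec E a b) p - dorf b a p"
  using bracket_skew[OF assms, of p] pair_sec_sym[OF assms] by (simp add: dorf_def scaleR_2)

lemma bracket_dorf: "bracket E a b p = dorf a b p - Dop E (pair_sec E a b) p"
  by (simp add: dorf_def)

text \<open>By axiom (iv) the anchor does not see the exact term of the Dorfman bracket, so axiom
  (i) carries over.\<close>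

lemma dorf_anchor:
  assumes "a \<in> \<Gamma>" "b \<in> \<Gamma>" "smooth_fun A f"
  shows "lie_der E (dorf a b) f p = lie_der E a (lie_der E b f) p - lie_der E b (lie_der E a f) p"
  using bracket_anchor[OF assms, of p]
  by (simp add: lie_der_def dorf_def an_add[OF assms(3)] sections_fib[OF bracket_sec] assms Dop_char
      pair_sec_smooth anchor_Dop)

text \<open>D is built from the pairing and the anchor alone, and the Dorfman action is a derivation
  of both; hence it commutes with D.\<close>

lemma dorf_Dop:
  assumes a: "a \<in> \<Gamma>" and f: "smooth_fun A f"
  shows "dorf a (Dop E f) p = Dop E (lie_der E a f) p"
proof (rule sec_eqI)
  fix d assume d: "d \<in> \<Gamma>"
  have half: "pair_sec E (Dop E f) d = (\<lambda>q. 1 / 2 * lie_der E d f q)"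
    by (simp add: pair_sec_def lie_der_def Dop_char(2)[OF f] sections_fib[OF d])
  have "lie_der E a (pair_sec E (Dop E f) d) p = 1 / 2 * lie_der E a (lie_der E d f) p"
    unfolding half using tangent_vectorD(3)[OF an_tangent[OF sections_fib[OF a]] lie_der_smooth[OF d f], of p "1/2"]
    by (simp add: lie_der_def)
  moreover have "pr p (Dop E f p) (dorf a d p) = 1 / 2 * lie_der E (dorf a d) f p"
    by (simp add: Dop_char(2)[OF f] sections_fib[OF dorf_sec[OF a d]] lie_der_def)
  ultimately have "pr p (dorf a (Dop E f) p) (d p) = 1 / 2 * lie_der E d (lie_der E a f) p"
    using dorf_pair[OF a Dop_sec[OF f] d, of p] dorf_anchor[OF a d f, of p] by linarith
  then show "pr p (dorf a (Dop E f) p) (d p) = pr p (Dop E (lie_der E a f) p) (d p)"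
    using Dop_char(2)[OF lie_der_smooth[OF a f] sections_fib[OF d], of p] by (simp only: lie_der_def)
qed (auto intro: sections_fib dorf_sec Dop_sec lie_der_smooth assms)

text \<open>The two orders of the Dorfman bracket add up to twice D of the pairing, here D of the
  derivative of \<open>f\<close> along \<open>a\<close>. By \<open>dorf_Dop\<close> the opposite
  order already accounts for all of it.\<close>

lemma Dop_dorf:
  assumes a: "a \<in> \<Gamma>" and f: "smooth_fun A f"
  shows "dorf (Dop E f) a p = 0"
proof -
  have "pair_sec E a (Dop E f) = (\<lambda>q. 1 / 2 * lie_der E a f q)"
    using pair_sec_sym[OF a Dop_sec[OF f]]
    by (simp add: pair_sec_def lie_der_def Dop_char(2)[OF f] sections_fib[OF a] fun_eq_iff)
  then have "2 *\<^sub>R Dop E (pair_sec E a (Dop E f)) p = Dop E (lie_der E a f) p"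
    using Dop_cmult[OF lie_der_smooth[OF a f], of "1/2" p] by simp
  then show ?thesis
    using dorf_sym[OF a Dop_sec[OF f], of p] dorf_Dop[OF a f, of p] by simp
qed

lemma dorf_add_l:
  assumes "a \<in> \<Gamma>" "b \<in> \<Gamma>" "d \<in> \<Gamma>"
  shows "dorf (\<lambda>q. a q + b q) d p = dorf a d p + dorf b d p"
proof -
  have "pair_sec E (\<lambda>q. a q + b q) d = (\<lambda>q. pair_sec E a d q + pair_sec E b d q)"
    using assms by (simp add: pair_sec_def pl_add sections_fib)
  then have 1: "Dop E (pair_sec E (\<lambda>q. a q + b q) d) p = Dop E (pair_sec E a d) p + Dop E (pair_sec E b d) p"
    using assms by (simp add: Dop_add pair_sec_smooth)
  show ?thesis
    unfolding dorf_sym[OF sections_add[OF assms(1,2)] assms(3), of p] dorf_sym[OF assms(1,3), of p]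
      dorf_sym[OF assms(2,3), of p] dorf_add_r[OF assms(3,1,2), of p] 1
    by (simp add: scaleR_add_right)
qed

text \<open>Follows from additivity: the zero section is exact, and exact sections act trivially
  from the left.\<close>

lemma dorf_minus_l:
  assumes "a \<in> \<Gamma>" "b \<in> \<Gamma>"
  shows "dorf (\<lambda>q. - a q) b p = - dorf a b p"
proof -
  have m: "(\<lambda>q. - a q) \<in> \<Gamma>" by (rule sections_minus[OF assms(1)])
  have "dorf (\<lambda>q. a q + - a q) b p = dorf a b p + dorf (\<lambda>q. - a q) b p"
    by (rule dorf_add_l[OF assms(1) m assms(2)])
  moreover have "(\<lambda>q. a q + - a q) = Dop E (\<lambda>q. 0)"
    using Dop_cmult[OF smooth_fun_const[of 0], of 0] by auto
  ultimately show ?thesis using Dop_dorf[OF assms(2) smooth_fun_const[of 0], of p]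
    by (simp add: eq_neg_iff_add_eq_0 add.commute)
qed

lemma dorf_minus_r: "a \<in> \<Gamma> \<Longrightarrow> b \<in> \<Gamma> \<Longrightarrow> dorf a (\<lambda>q. - b q) p = - dorf a b p"
  using bracket_scale_r[of a b "-1" p] pair_sec_scale_r[of a b "\<lambda>_. -1"]
    Dop_cmult[OF pair_sec_smooth, of a b "-1" p] by (simp add: dorf_def)

lemma dorf_diff_r: "a \<in> \<Gamma> \<Longrightarrow> b \<in> \<Gamma> \<Longrightarrow> d \<in> \<Gamma> \<Longrightarrow> dorf a (\<lambda>q. b q - d q) p = dorf a b p - dorf a d p"
  using dorf_add_r[OF _ _ sections_minus, of a b d p] dorf_minus_r by simp

lemma dorf_diff_l: "a \<in> \<Gamma> \<Longrightarrow> b \<in> \<Gamma> \<Longrightarrow> d \<in> \<Gamma> \<Longrightarrow> dorf (\<lambda>q. a q - b q) d p = dorf a d p - dorf b d p"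
  using dorf_add_l[OF _ sections_minus, of a b d p] dorf_minus_l by simp

text \<open>The Jacobiator of the skew bracket differs from that of the Dorfman bracket by exact terms only,
  and axiom (ii) says precisely that these cancel.\<close>

lemma dorf_jacobi:
  assumes a: "a \<in> \<Gamma>" and b: "b \<in> \<Gamma>" and d: "d \<in> \<Gamma>"
  shows "dorf a (dorf b d) p = dorf (dorf a b) d p + dorf b (dorf a d) p"
proof -
  note s = pair_sec_smooth
  \<comment> \<open>By \<open>dorf_sym\<close> and \<open>dorf_pair\<close>, all pairings occurring
    in the Jacobiator are determined by the single function \<open>t\<close> and the three
    derivatives \<open>A1\<close>, \<open>B1\<close>, \<open>C1\<close>.\<close>
  define t where "t = pair_sec E (dorf a b) d"
  define A1 where "A1 = lie_der E a (pair_sec E b d)"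
  define B1 where "B1 = lie_der E b (pair_sec E a d)"
  define C1 where "C1 = lie_der E d (pair_sec E a b)"
  have sm: "smooth_fun A t" "smooth_fun A A1" "smooth_fun A B1" "smooth_fun A C1"
    unfolding t_def A1_def B1_def C1_def by (intro s dorf_sec lie_der_smooth a b d)+
  have half: "pair_sec E (Dop E (pair_sec E x y)) z q = 1 / 2 * lie_der E z (pair_sec E x y) q"
    if "x \<in> \<Gamma>" "y \<in> \<Gamma>" "z \<in> \<Gamma>" for x y z q
    using that by (simp add: pair_sec_def[of E "Dop E _"] lie_der_def Dop_char(2) s sections_fib)
  have brp: "pair_sec E (bracket E x y) z q = pair_sec E (dorf x y) z q - 1 / 2 * lie_der E z (pair_sec E x y) q"
    if "x \<in> \<Gamma>" "y \<in> \<Gamma>" "z \<in> \<Gamma>" for x y z q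
  proof -
    have "pair_sec E (bracket E x y) z q = pr q (dorf x y q) (z q) - pr q (Dop E (pair_sec E x y) q) (z q)"
      unfolding pair_sec_def[of E "bracket E x y"] bracket_dorf
      by (rule pl_diff) (intro sections_fib dorf_sec Dop_sec s that)+
    then show ?thesis using half[OF that, of q] by (simp add: pair_sec_def)
  qed
  have adb: "pair_sec E (dorf a d) b q = A1 q - t q" for q
    using dorf_pair[OF a b d, of q] pr_sym[of "b q" q "dorf a d q"] sections_fib dorf_sec a b d
    by (simp add: A1_def t_def pair_sec_def)
  have bda: "pair_sec E (dorf b d) a q = B1 q + t q - C1 q" for q
  proof -
    have "pair_sec E (dorf b a) d q = C1 q - t q"
    proof -
      have "pair_sec E (dorf b a) d q = pr q (2 *\<^sub>R Dop E (pair_sec E b a) q - dorf a b q) (d q)"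
        using dorf_sym[OF b a, of q] by (simp add: pair_sec_def)
      also have "\<dots> = 2 * pair_sec E (Dop E (pair_sec E b a)) d q - t q"
      proof -
        have f: "d q \<in> fib E q" "Dop E (pair_sec E b a) q \<in> fib E q" "dorf a b q \<in> fib E q"
          by (intro sections_fib dorf_sec Dop_sec s a b d)+
        show ?thesis unfolding t_def pair_sec_def[of E "dorf a b"] pair_sec_def[of E "Dop E _"]
          by (simp add: pl_diff pl_scale f fib_scale)
      qed
      also have "\<dots> = C1 q - t q"
        using half[OF b a d, of q] pair_sec_sym[OF a b] by (simp add: C1_def)
      finally show ?thesis .
    qed
    then show ?thesis
      using dorf_pair[OF b a d, of q] pr_sym[of "a q" q "dorf b d q"] sections_fib dorf_sec a b d
      by (simp add: B1_def pair_sec_def)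
  qed
  have dab: "pair_sec E (dorf d a) b q = t q + B1 q - A1 q" for q
  proof -
    have "pair_sec E (dorf d a) b q = pr q (2 *\<^sub>R Dop E (pair_sec E d a) q - dorf a d q) (b q)"
      using dorf_sym[OF d a, of q] by (simp add: pair_sec_def)
    also have "\<dots> = 2 * pair_sec E (Dop E (pair_sec E d a)) b q - pair_sec E (dorf a d) b q"
    proof -
      have f: "b q \<in> fib E q" "Dop E (pair_sec E d a) q \<in> fib E q" "dorf a d q \<in> fib E q"
        by (intro sections_fib dorf_sec Dop_sec s a b d)+
      show ?thesis unfolding pair_sec_def[of E "dorf a d"] pair_sec_def[of E "Dop E _"]
        by (simp add: pl_diff pl_scale f fib_scale)
    qed
    finally show ?thesis using half[OF d a b, of q] adb pair_sec_sym[OF a d] by (simp add: B1_def)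
  qed
  \<comment> \<open>The function under D in axiom (ii), written in these four functions.\<close>
  define T where "T = (\<lambda>q. 3 * t q - 3 / 2 * C1 q - 3 / 2 * A1 q + 3 / 2 * B1 q)"
  have T: "(\<lambda>q. pair_sec E (bracket E a b) d q + pair_sec E (bracket E b d) a q + pair_sec E (bracket E d a) b q) = T"
    using brp[OF a b d] brp[OF b d a] brp[OF d a b] bda dab pair_sec_sym[OF d a]
    by (simp add: T_def fun_eq_iff A1_def B1_def C1_def flip: t_def)
  have br: "bracket E (bracket E x y) z p = dorf (dorf x y) z p - Dop E (pair_sec E (bracket E x y) z) p"
    if "x \<in> \<Gamma>" "y \<in> \<Gamma>" "z \<in> \<Gamma>" for x y z
  proof -
    have "bracket E x y = (\<lambda>q. dorf x y q - Dop E (pair_sec E x y) q)" by (simp add: bracket_dorf fun_eq_iff)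
    then have "dorf (bracket E x y) z p = dorf (dorf x y) z p"
      using dorf_diff_l[OF dorf_sec Dop_sec, of x y "pair_sec E x y" z p] Dop_dorf[of z "pair_sec E x y" p] that s
      by simp
    then show ?thesis by (simp add: bracket_dorf[of "bracket E x y"])
  qed
  have Tsm: "smooth_fun A T" unfolding T_def
    by (intro smooth_fun_add smooth_fun_diff smooth_fun_mult smooth_fun_const sm)
  have DT: "Dop E T p = 3 *\<^sub>R Dop E t p - (3/2) *\<^sub>R Dop E C1 p - (3/2) *\<^sub>R Dop E A1 p + (3/2) *\<^sub>R Dop E B1 p"
    unfolding T_def
    by (simp only: Dop_add Dop_diff Dop_cmult sm smooth_fun_add smooth_fun_diff smooth_fun_mult smooth_fun_const)
  \<comment> \<open>One third of \<open>Dop E T p\<close> stands in axiom (ii); exchanging the three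
    outer skew brackets for Dorfman brackets adds the whole of it. The inner exchanges change
    nothing by \<open>Dop_dorf\<close>.\<close>
  have 1: "dorf (dorf a b) d p + dorf (dorf b d) a p + dorf (dorf d a) b p = (4/3) *\<^sub>R Dop E T p"
  proof -
    define u1 where "u1 = Dop E (pair_sec E (bracket E a b) d) p"
    define u2 where "u2 = Dop E (pair_sec E (bracket E b d) a) p"
    define u3 where "u3 = Dop E (pair_sec E (bracket E d a) b) p"
    have DTu: "Dop E T p = u1 + u2 + u3"
      unfolding T[symmetric] u1_def u2_def u3_def using a b d s bracket_sec by (simp add: Dop_add smooth_fun_add)
    have "dorf (dorf a b) d p - u1 + (dorf (dorf b d) a p - u2) + (dorf (dorf d a) b p - u3) = (1/3) *\<^sub>R Dop E T p"
      using bracket_jacobi[OF a b d, of p] unfolding T br[OF a b d] br[OF b d a] br[OF d a b] u1_def u2_def u3_def .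
    moreover have "x1 + x2 + x3 = (4/3) *\<^sub>R (u1 + u2 + u3)"
      if "x1 - u1 + (x2 - u2) + (x3 - u3) = (1/3) *\<^sub>R (u1 + u2 + u3)" for x1 x2 x3
    proof -
      have "x1 + x2 + x3 = (x1 - u1 + (x2 - u2) + (x3 - u3)) + (u1 + u2 + u3)" by simp
      also have "\<dots> = (1/3 + 1) *\<^sub>R (u1 + u2 + u3)" unfolding that scaleR_add_left by simp
      finally show ?thesis by simp
    qed
    ultimately show ?thesis unfolding DTu by blast
  qed
  have 2: "dorf (dorf b d) a p = 2 *\<^sub>R (Dop E B1 p + Dop E t p - Dop E C1 p) - dorf a (dorf b d) p"
  proof -
    have "pair_sec E (dorf b d) a = (\<lambda>q. B1 q + t q - C1 q)" using bda by (simp add: fun_eq_iff)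
    then show ?thesis using dorf_sym[OF dorf_sec[OF b d] a, of p] by (simp add: Dop_add Dop_diff sm smooth_fun_add)
  qed
  have 3: "dorf (dorf d a) b p = dorf b (dorf a d) p - 2 *\<^sub>R (Dop E A1 p - Dop E t p)"
  proof -
    have e: "dorf d a = (\<lambda>q. 2 *\<^sub>R Dop E (pair_sec E d a) q - dorf a d q)"
      using dorf_sym[OF d a] by (simp add: fun_eq_iff)
    have "(\<lambda>q. 2 *\<^sub>R Dop E (pair_sec E d a) q) = Dop E (\<lambda>q. 2 * pair_sec E d a q)"
      using Dop_cmult[OF s[OF d a], of 2] by (simp add: fun_eq_iff)
    then have "dorf (\<lambda>q. 2 *\<^sub>R Dop E (pair_sec E d a) q) b p = 0"
      using Dop_dorf[OF b smooth_fun_mult[OF smooth_fun_const[of 2] s[OF d a]], of p] by simp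
    then have "dorf (dorf d a) b p = - dorf (dorf a d) b p"
      unfolding e using dorf_diff_l[OF sections_scale[OF Dop_sec smooth_fun_const] dorf_sec, of "pair_sec E d a" a d b 2 p]
        a b d s by simp
    moreover have "pair_sec E (dorf a d) b = (\<lambda>q. A1 q - t q)" using adb by (simp add: fun_eq_iff)
    ultimately show ?thesis using dorf_sym[OF dorf_sec[OF a d] b, of p] by (simp add: Dop_diff sm)
  qed
  have "dorf (dorf a b) d p - dorf a (dorf b d) p + dorf b (dorf a d) p = 
     (4/3) *\<^sub>R Dop E T p - 2 *\<^sub>R (Dop E B1 p + Dop E t p - Dop E C1 p) + 2 *\<^sub>R (Dop E A1 p - Dop E t p)"
    using 1 unfolding 2 3 by (simp add: algebra_simps)
  also have "\<dots> = 0" unfolding DT by (simp add: algebra_simps flip: scaleR_add_left scaleR_left_diff_distrib)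
  finally show ?thesis by (simp add: algebra_simps)
qed

text \<open>The skew bracket is the Dorfman bracket minus D of the pairing, and the Dorfman action
  of \<open>e\<close> is compatible with each of these constituents.\<close>

lemma dorf_bracket:
  assumes e: "e \<in> \<Gamma>" and a: "a \<in> \<Gamma>" and b: "b \<in> \<Gamma>"
  shows "dorf e (bracket E a b) p = bracket E (dorf e a) b p + bracket E a (dorf e b) p"
proof -
  note s = pair_sec_smooth
  have "bracket E a b = (\<lambda>q. dorf a b q - Dop E (pair_sec E a b) q)" by (simp add: bracket_dorf fun_eq_iff)
  then have "dorf e (bracket E a b) p = dorf e (dorf a b) p - Dop E (lie_der E e (pair_sec E a b)) p"
    using dorf_diff_r[OF e dorf_sec Dop_sec, of a b "pair_sec E a b" p] dorf_Dop[OF e s[OF a b], of p] a b s by simp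
  also have "lie_der E e (pair_sec E a b) = (\<lambda>q. pair_sec E (dorf e a) b q + pair_sec E a (dorf e b) q)"
    using dorf_pair[OF e a b] by (simp add: pair_sec_def fun_eq_iff)
  finally show ?thesis
    unfolding bracket_dorf[of "dorf e a"] bracket_dorf[of a "dorf e b"]
    using dorf_jacobi[OF e a b, of p] Dop_add[OF s[OF dorf_sec[OF e a] b] s[OF a dorf_sec[OF e b]], of p] by simp
qed

end

section \<open>Differentiating pairing, anchor and bracket in time\<close>

section \<open>Time-dependent sections\<close>

context courant_mfd
begin

text \<open>Locally \<open>Dop E (g t)\<close> is a combination of the fixed sections D of the
  coordinate functions, with the partial derivatives of \<open>g t\<close> as coefficients; so time
  enters through smooth coefficients only.\<close>

lemma tsection_Dop:
  assumes I: "open I" and g: "tsmooth A I UNIV g"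
  shows "tsection A E I (\<lambda>t. Dop E (g t))"
proof (rule tsectionI[OF I])
  show "Dop E (g t) p \<in> fib E p" if "t \<in> I" for t p
    by (rule Dop_char(1)[OF tsmooth_slice[OF open_UNIV g that]])
  fix p
  obtain U \<phi> where U: "(U, \<phi>) \<in> A" "p \<in> U" using chart_ex by blast
  obtain xh M where xh: "\<And>b. b \<in> B \<Longrightarrow> smooth_fun A (xh b)" "open M" "p \<in> M" "M \<subseteq> U \<inter> UNIV"
    "\<And>b q. b \<in> B \<Longrightarrow> q \<in> M \<Longrightarrow> xh b q = c b (\<phi> q)"
    by (rule coords_exist[OF U(1) open_UNIV]) (use U(2) in auto)
  have MU: "M \<subseteq> U" using xh(4) by auto
  obtain V h where V: "(V, h) \<in> frames E" "p \<in> V" by (rule frame_ex)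
  let ?W = "V \<inter> M"
  let ?F = "\<lambda>z. g (fst z) (inv_into U \<phi> (snd z))"
  let ?D = "\<lambda>t q b. frechet_derivative ?F (at (t, \<phi> q)) (0, b)"
  have o: "open ?W" using xh(2) frame_open[OF V(1)] by auto
  have loc: "Dop E (g t) q = (\<Sum>b\<in>B. ?D t q b *\<^sub>R Dop E (xh b) q)" if t: "t \<in> I" and q: "q \<in> ?W" for t q
  proof (rule Dop_eqI[OF tsmooth_slice[OF open_UNIV g t]])
    have Df: "Dop E (xh b) q \<in> fib E q" if "b \<in> B" for b by (rule Dop_char(1)[OF xh(1)[OF that]])
    show "(\<Sum>b\<in>B. ?D t q b *\<^sub>R Dop E (xh b) q) \<in> fib E q" by (intro fib_sum fib_scale Df)
    fix x assume x: "x \<in> fib E q"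
    have qM: "q \<in> M" "q \<in> U" using q MU by auto
    have "an q x (g t) = (\<Sum>b\<in>B. an q x (xh b) * ?D t q b)"
      using tangent_vector_chart[OF an_tangent[OF x] U(1) xh(1,2) qM(1) MU xh(5) tsmooth_slice[OF open_UNIV g t]]
        tsmooth_partial(2)[OF I g U(1) t qM(2)] by simp
    moreover have "pr q (\<Sum>b\<in>B. ?D t q b *\<^sub>R Dop E (xh b) q) x = (\<Sum>b\<in>B. ?D t q b * (1 / 2 * an q x (xh b)))"
      using x Df Dop_char(2)[OF xh(1) x]
      by (subst pl_sum) (auto simp: pl_scale fib_scale intro!: sum.cong)
    ultimately show "pr q (\<Sum>b\<in>B. ?D t q b *\<^sub>R Dop E (xh b) q) x = 1 / 2 * an q x (g t)"
      by (simp add: sum_distrib_left mult_ac)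
  qed
  have "tsmooth A I ?W (\<lambda>t q. coord r h q (Dop E (g t) q) i)" if i: "i < r" for i
  proof (rule tsmooth_cong)
    show "tsmooth A I ?W (\<lambda>t q. \<Sum>b\<in>B. ?D t q b * coord r h q (Dop E (xh b) q) i)"
    proof (intro tsmooth_sum tsmooth_mult I o)
      fix b assume b: "b \<in> B"
      show "tsmooth A I ?W (\<lambda>t q. ?D t q b)"
        using tsmooth_partial(4)[OF I g U(1)] by (rule tsmooth_subset) (use MU in auto)
      show "tsmooth A I ?W (\<lambda>t q. coord r h q (Dop E (xh b) q) i)"
        using tsectionD(2)[OF sections_tsection[OF Dop_sec[OF xh(1)[OF b]]] V(1) i, of I]
        by (rule tsmooth_subset) auto
    qed
    fix t q assume t: "t \<in> I" and q: "q \<in> ?W"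
    then have qV: "q \<in> V" by simp
    show "(\<Sum>b\<in>B. ?D t q b * coord r h q (Dop E (xh b) q) i) = coord r h q (Dop E (g t) q) i"
      unfolding loc[OF t q]
      by (subst coord_sum[OF V(1) qV fB]) (auto simp: coord_scale[OF V(1) qV] fib_scale Dop_char(1) xh(1))
  qed
  then show "\<exists>U e W. (U, e) \<in> frames E \<and> open W \<and> p \<in> W \<and> W \<subseteq> U \<and>
      (\<forall>i<r. tsmooth A I W (\<lambda>t q. coord r e q (Dop E (g t) q) i))"
    using V o xh(3) by (intro exI[of _ V] exI[of _ h] exI[of _ ?W]) auto
qed

lemma Dop_time_deriv:
  assumes I: "open I" and g: "tsmooth A I UNIV g" and t: "t \<in> I" and x: "x \<in> fib E p"
  shows "((\<lambda>s. pr p (Dop E (g s) p) x) has_real_derivative pr p (Dop E (\<lambda>q. deriv (\<lambda>s. g s q) t) p) x) (at t)"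
proof -
  have "((\<lambda>s. 1 / 2 * an p x (g s)) has_real_derivative 1 / 2 * an p x (\<lambda>q. deriv (\<lambda>s. g s q) t)) (at t)"
    by (rule DERIV_cmult[OF tangent_vector_time_deriv[OF I an_tangent[OF x] g t]])
  also have "1 / 2 * an p x (\<lambda>q. deriv (\<lambda>s. g s q) t) = pr p (Dop E (\<lambda>q. deriv (\<lambda>s. g s q) t) p) x"
    using Dop_char(2)[OF tsmooth_slice[OF open_UNIV tsmooth_time_deriv(2)[OF I open_UNIV g] t] x] by simp
  finally show ?thesis
    by (rule has_field_derivative_transform_within_open[OF _ I t])
       (simp add: Dop_char(2)[OF tsmooth_slice[OF open_UNIV g] x])
qed

lemma bracket_add_l:
  assumes "a \<in> \<Gamma>" "b \<in> \<Gamma>" "d \<in> \<Gamma>"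
  shows "bracket E (\<lambda>q. a q + b q) d p = bracket E a d p + bracket E b d p"
  using bracket_skew[OF sections_add[OF assms(1,2)] assms(3), of p] bracket_skew[OF assms(1,3), of p]
    bracket_skew[OF assms(2,3), of p] bracket_add_r[OF assms(3,1,2), of p] by simp

lemma bracket_zero_r: "a \<in> \<Gamma> \<Longrightarrow> bracket E a (\<lambda>q. 0) p = 0"
  using bracket_scale_r[of a a 0 p] by simp

lemma bracket_sum_r:
  "a \<in> \<Gamma> \<Longrightarrow> (\<And>k. k \<in> K \<Longrightarrow> b k \<in> \<Gamma>) \<Longrightarrow> bracket E a (\<lambda>q. \<Sum>k\<in>K. b k q) p = (\<Sum>k\<in>K. bracket E a (b k) p)"
  by (induction K rule: infinite_finite_induct) (simp_all add: bracket_zero_r bracket_add_r sections_sum)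

lemma bracket_sum_l:
  assumes "a \<in> \<Gamma>" "\<And>k. k \<in> K \<Longrightarrow> b k \<in> \<Gamma>"
  shows "bracket E (\<lambda>q. \<Sum>k\<in>K. b k q) a p = (\<Sum>k\<in>K. bracket E (b k) a p)"
proof -
  have "bracket E (\<lambda>q. \<Sum>k\<in>K. b k q) a p = - bracket E a (\<lambda>q. \<Sum>k\<in>K. b k q) p"
    by (rule bracket_skew[OF sections_sum[OF assms(2)] assms(1)])
  also have "\<dots> = (\<Sum>k\<in>K. - bracket E a (b k) p)"
    by (simp add: bracket_sum_r[OF assms] sum_negf)
  also have "\<dots> = (\<Sum>k\<in>K. bracket E (b k) a p)"
    by (rule sum.cong[OF refl], rule bracket_skew[OF assms(2) assms(1), symmetric])
  finally show ?thesis .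
qed

text \<open>The Leibniz rule in both slots reduces the bracket of two function multiples to the one
  fixed bracket of \<open>S\<close> and \<open>R\<close> and to values and first derivatives of
  \<open>f\<close> and \<open>g\<close>, whose dependence on time is under control.\<close>

lemma bracket_scaled:
  assumes S: "S \<in> \<Gamma>" and R: "R \<in> \<Gamma>" and f: "smooth_fun A f" and g: "smooth_fun A g"
  shows "bracket E (\<lambda>q. f q *\<^sub>R S q) (\<lambda>q. g q *\<^sub>R R q) p =
    (f p * g p) *\<^sub>R bracket E S R p + (- (g p * an p (R p) f)) *\<^sub>R S p + (g p * pr p (S p) (R p)) *\<^sub>R Dop E f p
    + (f p * an p (S p) g) *\<^sub>R R p + (- (f p * pr p (S p) (R p))) *\<^sub>R Dop E g p"
proof -
  have fS: "(\<lambda>q. f q *\<^sub>R S q) \<in> \<Gamma>" by (rule sections_scale[OF S f])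
  have "bracket E (\<lambda>q. f q *\<^sub>R S q) R p = - bracket E R (\<lambda>q. f q *\<^sub>R S q) p" by (rule bracket_skew[OF fS R])
  also have "\<dots> = f p *\<^sub>R bracket E S R p - an p (R p) f *\<^sub>R S p + pr p (S p) (R p) *\<^sub>R Dop E f p"
    using bracket_leibniz[OF R S f, of p] bracket_skew[OF R S, of p] pr_sym[OF sections_fib[OF R, of p] sections_fib[OF S, of p]]
    by (simp add: lie_der_def pair_sec_def)
  finally have 1: "bracket E (\<lambda>q. f q *\<^sub>R S q) R p =
      f p *\<^sub>R bracket E S R p - an p (R p) f *\<^sub>R S p + pr p (S p) (R p) *\<^sub>R Dop E f p" .
  have 2: "lie_der E (\<lambda>q. f q *\<^sub>R S q) g p = f p * an p (S p) g"
    by (simp add: lie_der_def an_scale[OF g sections_fib[OF S]])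
  have 3: "pair_sec E (\<lambda>q. f q *\<^sub>R S q) R p = f p * pr p (S p) (R p)"
    by (simp add: pair_sec_def pl_scale sections_fib R S)
  show ?thesis
    unfolding bracket_leibniz[OF fS R g] 1 2 3 by (simp add: scaleR_add_right scaleR_diff_right)
qed

end

locale courant_gen = courant_mfd A B c E
  for A :: "('a::{t2_space, second_countable_topology}, 'm::{banach, heine_borel}) atlas" and B c
    and E :: "('a, 'v::real_vector) courant" +
  fixes n :: nat and gs :: "nat \<Rightarrow> 'a \<Rightarrow> 'v" and gc :: "nat \<Rightarrow> 'a \<Rightarrow> 'v \<Rightarrow> real"
  assumes gs: "\<And>k. k < n \<Longrightarrow> gs k \<in> sections A E"
    and gc_add: "\<And>k p x y. k < n \<Longrightarrow> x \<in> fib E p \<Longrightarrow> y \<in> fib E p \<Longrightarrow> gc k p (x + y) = gc k p x + gc k p y"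
    and gc_scale: "\<And>k p x a. k < n \<Longrightarrow> x \<in> fib E p \<Longrightarrow> gc k p (a *\<^sub>R x) = a * gc k p x"
    and gc_expand: "\<And>p x. x \<in> fib E p \<Longrightarrow> x = (\<Sum>k<n. gc k p x *\<^sub>R gs k p)"
    and gc_smooth: "\<And>I s k. open I \<Longrightarrow> tsection A E I s \<Longrightarrow> k < n \<Longrightarrow> tsmooth A I UNIV (\<lambda>t p. gc k p (s t p))"
begin

lemma gs_fib: "k < n \<Longrightarrow> gs k p \<in> fib E p"
  using gs sections_fib by blast

text \<open>Taken on the generator coefficients because \<open>'v\<close> carries no topology in
  this context. By \<open>lin_deriv\<close> the result is the derivative in the fibre.\<close>

definition tder :: "(real \<Rightarrow> 'a \<Rightarrow> 'v) \<Rightarrow> real \<Rightarrow> 'a \<Rightarrow> 'v" where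
  "tder a t p = (\<Sum>k<n. deriv (\<lambda>s. gc k p (a s p)) t *\<^sub>R gs k p)"

lemma tsection_tder: "open I \<Longrightarrow> tsection A E I a \<Longrightarrow> tsection A E I (tder a)"
  unfolding tder_def
  by (intro tsection_sum tsection_scale tsmooth_time_deriv(2) gc_smooth sections_tsection gs open_UNIV) auto

text \<open>A functional that is linear on the fibre is a fixed combination of the generator
  coefficients. Applied to all functionals, this characterises \<open>tder\<close> independently of
  the redundancy of the generators.\<close>

lemma lin_deriv:
  assumes I: "open I" and a: "tsection A E I a" and t: "t \<in> I"
    and add: "\<And>x y. x \<in> fib E p \<Longrightarrow> y \<in> fib E p \<Longrightarrow> f (x + y) = f x + (f y :: real)"
    and scale: "\<And>k x. x \<in> fib E p \<Longrightarrow> f (k *\<^sub>R x) = k * f x"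
  shows "((\<lambda>s. f (a s p)) has_real_derivative f (tder a t p)) (at t)"
proof -
  have "((\<lambda>s. \<Sum>k<n. gc k p (a s p) * f (gs k p)) has_real_derivative
      (\<Sum>k<n. deriv (\<lambda>s. gc k p (a s p)) t * f (gs k p))) (at t)"
    by (intro DERIV_sum DERIV_cmult_right tsmooth_time_deriv(1)[OF I open_UNIV gc_smooth[OF I a] t]) auto
  also have "(\<Sum>k<n. deriv (\<lambda>s. gc k p (a s p)) t * f (gs k p)) = f (tder a t p)"
    unfolding tder_def by (rule functional_sum[symmetric, OF add scale gs_fib])
  finally show ?thesis
  proof (rule has_field_derivative_transform_within_open[OF _ I t])
    fix s assume "s \<in> I"
    then have x: "a s p \<in> fib E p" by (rule tsectionD(1)[OF a])
    have "f (a s p) = f (\<Sum>k<n. gc k p (a s p) *\<^sub>R gs k p)" using gc_expand[OF x] by simp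
    also have "\<dots> = (\<Sum>k<n. gc k p (a s p) * f (gs k p))"
      by (rule functional_sum[OF add scale gs_fib])
    finally show "(\<Sum>k<n. gc k p (a s p) * f (gs k p)) = f (a s p)" by simp
  qed
qed

text \<open>Expanding one argument in the generators turns the pairing of two moving vectors into a
  sum of products of real functions, each covered by \<open>lin_deriv\<close>.\<close>

lemma pair_deriv:
  assumes I: "open I" and a: "tsection A E I a" and b: "tsection A E I b" and t: "t \<in> I"
  shows "((\<lambda>s. pr p (a s p) (b s p)) has_real_derivative pr p (tder a t p) (b t p) + pr p (a t p) (tder b t p)) (at t)"
proof -
  have exp: "pr p x y = (\<Sum>k<n. gc k p y * pr p x (gs k p))" if "x \<in> fib E p" "y \<in> fib E p" for x y
  proof -
    have "pr p x y = pr p x (\<Sum>k<n. gc k p y *\<^sub>R gs k p)" using gc_expand[OF that(2)] by simp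
    also have "\<dots> = (\<Sum>k<n. gc k p y * pr p x (gs k p))"
      using that gs_fib by (subst pr_sum) (auto simp: pr_scale fib_scale intro!: sum.cong)
    finally show ?thesis .
  qed
  have af: "a s p \<in> fib E p" "b s p \<in> fib E p" if "s \<in> I" for s using that a b tsectionD(1) by blast+
  have tf: "tder a t p \<in> fib E p" "tder b t p \<in> fib E p"
    using tsectionD(1)[OF tsection_tder[OF I a] t] tsectionD(1)[OF tsection_tder[OF I b] t] by auto
  have "((\<lambda>s. \<Sum>k<n. gc k p (b s p) * pr p (a s p) (gs k p)) has_real_derivative
     (\<Sum>k<n. gc k p (tder b t p) * pr p (a t p) (gs k p) + pr p (tder a t p) (gs k p) * gc k p (b t p))) (at t)"
  proof (intro DERIV_sum DERIV_mult)
    fix k assume "k \<in> {..<n}"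
    then have k: "k < n" by simp
    show "((\<lambda>s. gc k p (b s p)) has_real_derivative gc k p (tder b t p)) (at t)"
      by (rule lin_deriv[OF I b t gc_add[OF k] gc_scale[OF k]])
    show "((\<lambda>s. pr p (a s p) (gs k p)) has_real_derivative pr p (tder a t p) (gs k p)) (at t)"
      by (rule lin_deriv[OF I a t pl_add[OF gs_fib[OF k]] pl_scale[OF gs_fib[OF k]]])
  qed
  also have "(\<Sum>k<n. gc k p (tder b t p) * pr p (a t p) (gs k p) + pr p (tder a t p) (gs k p) * gc k p (b t p))
      = pr p (tder a t p) (b t p) + pr p (a t p) (tder b t p)"
    unfolding exp[OF tf(1) af(2)[OF t]] exp[OF af(1)[OF t] tf(2)] by (simp add: sum.distrib mult_ac)
  finally show ?thesis
    by (rule has_field_derivative_transform_within_open[OF _ I t]) (use exp af in simp)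
qed

lemma anchor_deriv:
  assumes I: "open I" and a: "tsection A E I a" and g: "tsmooth A I UNIV g" and t: "t \<in> I"
  shows "((\<lambda>s. an p (a s p) (g s)) has_real_derivative
    an p (tder a t p) (g t) + an p (a t p) (\<lambda>q. deriv (\<lambda>s. g s q) t)) (at t)"
proof -
  have exp: "an p x f = (\<Sum>k<n. gc k p x * an p (gs k p) f)" if "x \<in> fib E p" "smooth_fun A f" for x f
  proof -
    have "an p x f = an p (\<Sum>k<n. gc k p x *\<^sub>R gs k p) f" using gc_expand[OF that(1)] by simp
    also have "\<dots> = (\<Sum>k<n. gc k p x * an p (gs k p) f)"
      using that gs_fib by (subst an_sum) (auto simp: an_scale fib_scale intro!: sum.cong)
    finally show ?thesis .
  qed
  have af: "a s p \<in> fib E p" "smooth_fun A (g s)" if "s \<in> I" for s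
    using that tsectionD(1)[OF a] tsmooth_slice[OF open_UNIV g] by blast+
  have tf: "tder a t p \<in> fib E p" "smooth_fun A (\<lambda>q. deriv (\<lambda>s. g s q) t)"
    using tsectionD(1)[OF tsection_tder[OF I a] t]
      tsmooth_slice[OF open_UNIV tsmooth_time_deriv(2)[OF I open_UNIV g] t] by auto
  have "((\<lambda>s. \<Sum>k<n. gc k p (a s p) * an p (gs k p) (g s)) has_real_derivative
     (\<Sum>k<n. gc k p (tder a t p) * an p (gs k p) (g t) + an p (gs k p) (\<lambda>q. deriv (\<lambda>s. g s q) t) * gc k p (a t p))) (at t)"
  proof (intro DERIV_sum DERIV_mult)
    fix k assume "k \<in> {..<n}"
    then have k: "k < n" by simp
    show "((\<lambda>s. gc k p (a s p)) has_real_derivative gc k p (tder a t p)) (at t)"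
      by (rule lin_deriv[OF I a t gc_add[OF k] gc_scale[OF k]])
    show "((\<lambda>s. an p (gs k p) (g s)) has_real_derivative an p (gs k p) (\<lambda>q. deriv (\<lambda>s. g s q) t)) (at t)"
      by (rule tangent_vector_time_deriv[OF I an_tangent[OF gs_fib[OF k]] g t])
  qed
  also have "(\<Sum>k<n. gc k p (tder a t p) * an p (gs k p) (g t) + an p (gs k p) (\<lambda>q. deriv (\<lambda>s. g s q) t) * gc k p (a t p))
      = an p (tder a t p) (g t) + an p (a t p) (\<lambda>q. deriv (\<lambda>s. g s q) t)"
    unfolding exp[OF tf(1) af(2)[OF t]] exp[OF af(1)[OF t] tf(2)] by (simp add: sum.distrib mult_ac)
  finally show ?thesis
    by (rule has_field_derivative_transform_within_open[OF _ I t]) (use exp af in simp)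
qed

lemma bracket_scaled_time:
  assumes I: "open I" and S: "S \<in> \<Gamma>" and R: "R \<in> \<Gamma>" and f: "tsmooth A I UNIV f" and g: "tsmooth A I UNIV g"
  shows "tsection A E I (\<lambda>t. bracket E (\<lambda>q. f t q *\<^sub>R S q) (\<lambda>q. g t q *\<^sub>R R q))"
    and "t \<in> I \<Longrightarrow> y \<in> fib E p \<Longrightarrow>
      ((\<lambda>s. pr p (bracket E (\<lambda>q. f s q *\<^sub>R S q) (\<lambda>q. g s q *\<^sub>R R q) p) y) has_real_derivative
       pr p (bracket E (\<lambda>q. deriv (\<lambda>s. f s q) t *\<^sub>R S q) (\<lambda>q. g t q *\<^sub>R R q) p) y
       + pr p (bracket E (\<lambda>q. f t q *\<^sub>R S q) (\<lambda>q. deriv (\<lambda>s. g s q) t *\<^sub>R R q) p) y) (at t)"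
proof -
  note sl = tsmooth_slice[OF open_UNIV]
  note sec = sections_tsection[OF S, of I] sections_tsection[OF R, of I]
  have "tsection A E I (\<lambda>t p. (f t p * g t p) *\<^sub>R bracket E S R p + (- (g t p * an p (R p) (f t))) *\<^sub>R S p
     + (g t p * pr p (S p) (R p)) *\<^sub>R Dop E (f t) p
     + (f t p * an p (S p) (g t)) *\<^sub>R R p + (- (f t p * pr p (S p) (R p))) *\<^sub>R Dop E (g t) p)"
    by (intro tsection_add tsection_scale I tsmooth_mult tsmooth_minus open_UNIV f g tsmooth_anchor[OF I]
        tsmooth_pairing[OF I] sec tsection_Dop sections_tsection bracket_sec S R)
  then show "tsection A E I (\<lambda>t. bracket E (\<lambda>q. f t q *\<^sub>R S q) (\<lambda>q. g t q *\<^sub>R R q))"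
    by (rule tsection_cong[rotated]) (simp add: bracket_scaled[OF S R sl[OF f] sl[OF g]])
  assume t: "t \<in> I" and y: "y \<in> fib E p"
  have fibs: "bracket E S R p \<in> fib E p" "S p \<in> fib E p" "R p \<in> fib E p"
    using S R bracket_sec sections_fib by blast+
  have exp: "pr p (bracket E (\<lambda>q. u q *\<^sub>R S q) (\<lambda>q. v q *\<^sub>R R q) p) y =
     u p * v p * pr p (bracket E S R p) y - v p * an p (R p) u * pr p (S p) y
     + v p * pr p (S p) (R p) * pr p (Dop E u p) y
     + u p * an p (S p) v * pr p (R p) y - u p * pr p (S p) (R p) * pr p (Dop E v p) y"
    if u: "smooth_fun A u" and v: "smooth_fun A v" for u v
    unfolding bracket_scaled[OF S R u v]
    using y fibs Dop_char(1)[OF u] Dop_char(1)[OF v]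
    by (simp only: pl_add pl_scale fib_add fib_scale) simp
  note f' = tsmooth_time_deriv[OF I open_UNIV f] and g' = tsmooth_time_deriv[OF I open_UNIV g]
  note df = f'(1)[OF t UNIV_I, of p] and dg = g'(1)[OF t UNIV_I, of p]
  note daf = tangent_vector_time_deriv[OF I an_tangent[OF fibs(3)] f t]
    and dag = tangent_vector_time_deriv[OF I an_tangent[OF fibs(2)] g t]
    and dDf = Dop_time_deriv[OF I f t y] and dDg = Dop_time_deriv[OF I g t y]
  have "((\<lambda>s. f s p * g s p * pr p (bracket E S R p) y - g s p * an p (R p) (f s) * pr p (S p) y
     + g s p * pr p (S p) (R p) * pr p (Dop E (f s) p) y
     + f s p * an p (S p) (g s) * pr p (R p) y - f s p * pr p (S p) (R p) * pr p (Dop E (g s) p) y) has_real_derivative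
       pr p (bracket E (\<lambda>q. deriv (\<lambda>s. f s q) t *\<^sub>R S q) (\<lambda>q. g t q *\<^sub>R R q) p) y
       + pr p (bracket E (\<lambda>q. f t q *\<^sub>R S q) (\<lambda>q. deriv (\<lambda>s. g s q) t *\<^sub>R R q) p) y) (at t)"
    unfolding exp[OF sl[OF f'(2) t] sl[OF g t]] exp[OF sl[OF f t] sl[OF g'(2) t]]
    by (rule derivative_eq_intros df dg daf dag dDf dDg refl)+ (simp add: algebra_simps)
  then show "((\<lambda>s. pr p (bracket E (\<lambda>q. f s q *\<^sub>R S q) (\<lambda>q. g s q *\<^sub>R R q) p) y) has_real_derivative
       pr p (bracket E (\<lambda>q. deriv (\<lambda>s. f s q) t *\<^sub>R S q) (\<lambda>q. g t q *\<^sub>R R q) p) y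
       + pr p (bracket E (\<lambda>q. f t q *\<^sub>R S q) (\<lambda>q. deriv (\<lambda>s. g s q) t *\<^sub>R R q) p) y) (at t)"
    by (rule has_field_derivative_transform_within_open[OF _ I t]) (simp add: exp[OF sl[OF f] sl[OF g]])
qed

text \<open>Nothing is assumed about how the bracket reacts to arguments that move with time.
  Expanded in generators it becomes a finite sum of brackets of function multiples, and
  \<open>bracket_scaled_time\<close> differentiates each of them.\<close>

lemma bracket_time:
  assumes I: "open I" and a: "tsection A E I a" and b: "tsection A E I b"
  shows "tsection A E I (\<lambda>t. bracket E (a t) (b t))"
    and "t \<in> I \<Longrightarrow> tder (\<lambda>t. bracket E (a t) (b t)) t p = bracket E (tder a t) (b t) p + bracket E (a t) (tder b t) p"
proof -
  define F where "F k s q = gc k q (a s q)" for k s q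
  define G where "G k s q = gc k q (b s q)" for k s q
  have F: "tsmooth A I UNIV (F k)" and G: "tsmooth A I UNIV (G k)" if "k < n" for k
    unfolding F_def G_def using gc_smooth[OF I a that] gc_smooth[OF I b that] by auto
  note sl = tsmooth_slice[OF open_UNIV]
  have ex: "bracket E (\<lambda>q. \<Sum>k<n. u k q *\<^sub>R gs k q) (\<lambda>q. \<Sum>l<n. v l q *\<^sub>R gs l q) p =
      (\<Sum>k<n. \<Sum>l<n. bracket E (\<lambda>q. u k q *\<^sub>R gs k q) (\<lambda>q. v l q *\<^sub>R gs l q) p)"
    if u: "\<And>k. k < n \<Longrightarrow> smooth_fun A (u k)" and v: "\<And>k. k < n \<Longrightarrow> smooth_fun A (v k)" for u v p
  proof -
    have us: "(\<lambda>q. u k q *\<^sub>R gs k q) \<in> \<Gamma>" "(\<lambda>q. v k q *\<^sub>R gs k q) \<in> \<Gamma>" if "k < n" for k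
      using sections_scale[OF gs[OF that] u[OF that]] sections_scale[OF gs[OF that] v[OF that]] by auto
    have "bracket E (\<lambda>q. \<Sum>k<n. u k q *\<^sub>R gs k q) (\<lambda>q. \<Sum>l<n. v l q *\<^sub>R gs l q) p =
      (\<Sum>k<n. bracket E (\<lambda>q. u k q *\<^sub>R gs k q) (\<lambda>q. \<Sum>l<n. v l q *\<^sub>R gs l q) p)"
      by (rule bracket_sum_l) (auto intro: us sections_sum)
    also have "\<dots> = (\<Sum>k<n. \<Sum>l<n. bracket E (\<lambda>q. u k q *\<^sub>R gs k q) (\<lambda>q. v l q *\<^sub>R gs l q) p)"
      by (intro sum.cong refl bracket_sum_r) (auto intro: us)
    finally show ?thesis .
  qed
  have ab: "a s = (\<lambda>q. \<Sum>k<n. F k s q *\<^sub>R gs k q)" "b s = (\<lambda>q. \<Sum>k<n. G k s q *\<^sub>R gs k q)" if "s \<in> I" for s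
    unfolding F_def G_def using gc_expand[OF tsectionD(1)[OF a that]] gc_expand[OF tsectionD(1)[OF b that]] by blast+
  have eq: "bracket E (a s) (b s) p = (\<Sum>k<n. \<Sum>l<n. bracket E (\<lambda>q. F k s q *\<^sub>R gs k q) (\<lambda>q. G l s q *\<^sub>R gs l q) p)"
    if s: "s \<in> I" for s p
    unfolding ab[OF s] by (rule ex) (use sl[OF F s] sl[OF G s] in auto)
  have "tsection A E I (\<lambda>s p. \<Sum>k<n. \<Sum>l<n. bracket E (\<lambda>q. F k s q *\<^sub>R gs k q) (\<lambda>q. G l s q *\<^sub>R gs l q) p)"
    by (intro tsection_sum I bracket_scaled_time(1) gs F G) auto
  then show sec: "tsection A E I (\<lambda>t. bracket E (a t) (b t))"
    by (rule tsection_cong[rotated]) (simp add: eq)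
  assume t: "t \<in> I"
  have td: "tder a t = (\<lambda>q. \<Sum>k<n. deriv (\<lambda>s. F k s q) t *\<^sub>R gs k q)" "tder b t = (\<lambda>q. \<Sum>k<n. deriv (\<lambda>s. G k s q) t *\<^sub>R gs k q)"
    by (simp_all add: tder_def F_def G_def fun_eq_iff)
  have F': "smooth_fun A (\<lambda>q. deriv (\<lambda>s. F k s q) t)" and G': "smooth_fun A (\<lambda>q. deriv (\<lambda>s. G k s q) t)" if "k < n" for k
    using sl[OF tsmooth_time_deriv(2)[OF I open_UNIV F[OF that]] t] sl[OF tsmooth_time_deriv(2)[OF I open_UNIV G[OF that]] t] by auto
  have secs: "a t \<in> \<Gamma>" "b t \<in> \<Gamma>" "tder a t \<in> \<Gamma>" "tder b t \<in> \<Gamma>"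
    using tsection_sections[OF I _ t] a b tsection_tder[OF I a] tsection_tder[OF I b] by blast+
  show "tder (\<lambda>t. bracket E (a t) (b t)) t p = bracket E (tder a t) (b t) p + bracket E (a t) (tder b t) p"
  proof (rule fib_eqI)
    show "tder (\<lambda>t. bracket E (a t) (b t)) t p \<in> fib E p" by (rule tsectionD(1)[OF tsection_tder[OF I sec] t])
    show "bracket E (tder a t) (b t) p + bracket E (a t) (tder b t) p \<in> fib E p"
      by (intro fib_add sections_fib bracket_sec secs)
    fix y assume y: "y \<in> fib E p"
    have brf: "bracket E (\<lambda>q. u q *\<^sub>R gs k q) (\<lambda>q. v q *\<^sub>R gs l q) p \<in> fib E p"
      if "smooth_fun A u" "smooth_fun A v" "k < n" "l < n" for u v k l
      by (intro sections_fib bracket_sec sections_scale gs that)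
    have psum: "pr p (\<Sum>k<n. \<Sum>l<n. z k l) y = (\<Sum>k<n. \<Sum>l<n. pr p (z k l) y)"
      if "\<And>k l. k < n \<Longrightarrow> l < n \<Longrightarrow> z k l \<in> fib E p" for z
      using that y by (subst pl_sum) (auto intro!: fib_sum sum.cong pl_sum)
    let ?d = "\<lambda>k l. pr p (bracket E (\<lambda>q. deriv (\<lambda>s. F k s q) t *\<^sub>R gs k q) (\<lambda>q. G l t q *\<^sub>R gs l q) p) y
       + pr p (bracket E (\<lambda>q. F k t q *\<^sub>R gs k q) (\<lambda>q. deriv (\<lambda>s. G l s q) t *\<^sub>R gs l q) p) y"
    have "((\<lambda>s. \<Sum>k<n. \<Sum>l<n. pr p (bracket E (\<lambda>q. F k s q *\<^sub>R gs k q) (\<lambda>q. G l s q *\<^sub>R gs l q) p) y) has_real_derivative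
        (\<Sum>k<n. \<Sum>l<n. ?d k l)) (at t)"
      by (intro DERIV_sum bracket_scaled_time(2)[OF I gs gs F G t y]) auto
    then have "((\<lambda>s. pr p (bracket E (a s) (b s) p) y) has_real_derivative (\<Sum>k<n. \<Sum>l<n. ?d k l)) (at t)"
    proof (rule has_field_derivative_transform_within_open[OF _ I t])
      fix s assume s: "s \<in> I"
      show "(\<Sum>k<n. \<Sum>l<n. pr p (bracket E (\<lambda>q. F k s q *\<^sub>R gs k q) (\<lambda>q. G l s q *\<^sub>R gs l q) p) y) =
          pr p (bracket E (a s) (b s) p) y"
        unfolding eq[OF s] by (rule psum[symmetric]) (intro brf sl[OF F s] sl[OF G s])
    qed
    moreover have "((\<lambda>s. pr p (bracket E (a s) (b s) p) y) has_real_derivative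
        pr p (tder (\<lambda>t. bracket E (a t) (b t)) t p) y) (at t)"
      by (rule lin_deriv[OF I sec t pl_add[OF y] pl_scale[OF y]])
    ultimately have "pr p (tder (\<lambda>t. bracket E (a t) (b t)) t p) y = (\<Sum>k<n. \<Sum>l<n. ?d k l)"
      using DERIV_unique by blast
    also have "\<dots> = pr p (bracket E (tder a t) (b t) p) y + pr p (bracket E (a t) (tder b t) p) y"
    proof -
      have "bracket E (tder a t) (b t) p = (\<Sum>k<n. \<Sum>l<n. bracket E (\<lambda>q. deriv (\<lambda>s. F k s q) t *\<^sub>R gs k q) (\<lambda>q. G l t q *\<^sub>R gs l q) p)"
        unfolding td ab[OF t] by (rule ex) (use F' sl[OF G t] in auto)
      moreover have "bracket E (a t) (tder b t) p = (\<Sum>k<n. \<Sum>l<n. bracket E (\<lambda>q. F k t q *\<^sub>R gs k q) (\<lambda>q. deriv (\<lambda>s. G l s q) t *\<^sub>R gs l q) p)"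
        unfolding td ab[OF t] by (rule ex) (use G' sl[OF F t] in auto)
      ultimately show ?thesis
        using psum[OF brf[OF F' sl[OF G t]]] psum[OF brf[OF sl[OF F t] G']] by (simp add: sum.distrib)
    qed
    also have "\<dots> = pr p (bracket E (tder a t) (b t) p + bracket E (a t) (tder b t) p) y"
      by (rule pl_add[symmetric, OF y]) (intro sections_fib bracket_sec secs)+
    finally show "pr p (tder (\<lambda>t. bracket E (a t) (b t)) t p) y =
      pr p (bracket E (tder a t) (b t) p + bracket E (a t) (tder b t) p) y" .
  qed
qed

end

section \<open>The operator d/dt plus Dorfman action, and its parallel lifts\<close>

locale courant_time = courant_gen A B c E n gs gc
  for A :: "('a::{t2_space, second_countable_topology}, 'm::{banach, heine_borel}) atlas" and B c
    and E :: "('a, 'v::real_vector) courant" and n gs gc +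
  fixes I :: "real set" and e :: "real \<Rightarrow> 'a \<Rightarrow> 'v"
  assumes I: "open I" "is_interval I" and e: "tsection A E I e"
begin

abbreviation X where "X \<equiv> \<lambda>t p. anchor E p (e t p)"

lemma vfield_X: "vfield I X"
  by (rule vfield_anchor[OF I(1) e])

text \<open>The covariant time derivative along \<open>e\<close>; its parallel sections are those dragged along by the flow of \<open>e\<close>.\<close>

definition Dt :: "(real \<Rightarrow> 'a \<Rightarrow> 'v) \<Rightarrow> real \<Rightarrow> 'a \<Rightarrow> 'v" where
  "Dt a t p = tder a t p + dorf (e t) (a t) p"

lemma sec_e: "t \<in> I \<Longrightarrow> e t \<in> \<Gamma>"
  by (rule tsection_sections[OF I(1) e])

lemma tsection_dorf: "tsection A E I a \<Longrightarrow> tsection A E I b \<Longrightarrow> tsection A E I (\<lambda>t. dorf (a t) (b t))"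
  unfolding dorf_def pair_sec_def
  by (intro tsection_add I(1) bracket_time(1) tsection_Dop tsmooth_pairing)

lemma tsection_Dt: "tsection A E I a \<Longrightarrow> tsection A E I (Dt a)"
  unfolding Dt_def by (intro tsection_add I(1) tsection_tder tsection_dorf e)

lemma sec_parts:
  assumes "tsection A E I a" "t \<in> I"
  shows "a t \<in> \<Gamma>" "tder a t \<in> \<Gamma>" "dorf (e t) (a t) \<in> \<Gamma>"
  using assms tsection_sections[OF I(1)] tsection_tder[OF I(1)] tsection_dorf[OF e] by blast+

text \<open>On functions the counterpart of \<open>Dt\<close> is the time derivative plus the anchor
  field, which is differentiation along integral curves. The product rule holds because it holds for
  the time derivative and for the Dorfman action separately.\<close>

lemma Dt_pair:
  assumes a: "tsection A E I a" and b: "tsection A E I b" and t: "t \<in> I"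
  shows "deriv (\<lambda>s. pr p (a s p) (b s p)) t + X t p (\<lambda>q. pr q (a t q) (b t q))
      = pr p (Dt a t p) (b t p) + pr p (a t p) (Dt b t p)"
proof -
  note sa = sec_parts[OF a t] and sb = sec_parts[OF b t]
  have 1: "deriv (\<lambda>s. pr p (a s p) (b s p)) t = pr p (tder a t p) (b t p) + pr p (a t p) (tder b t p)"
    by (rule DERIV_imp_deriv[OF pair_deriv[OF I(1) a b t]])
  have 2: "X t p (\<lambda>q. pr q (a t q) (b t q)) = pr p (dorf (e t) (a t) p) (b t p) + pr p (a t p) (dorf (e t) (b t) p)"
    using dorf_pair[OF sec_e[OF t] sa(1) sb(1), of p] by (simp add: lie_der_def pair_sec_def)
  show ?thesis unfolding 1 2 Dt_def
    using sa sb by (simp add: pl_add pr_add sections_fib)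
qed

lemma Dt_bracket:
  assumes a: "tsection A E I a" and b: "tsection A E I b" and t: "t \<in> I"
  shows "Dt (\<lambda>t. bracket E (a t) (b t)) t p = bracket E (Dt a t) (b t) p + bracket E (a t) (Dt b t) p"
proof -
  note sa = sec_parts[OF a t] and sb = sec_parts[OF b t]
  have "Dt a t = (\<lambda>p. tder a t p + dorf (e t) (a t) p)" "Dt b t = (\<lambda>p. tder b t p + dorf (e t) (b t) p)"
    by (simp_all add: Dt_def fun_eq_iff)
  then show ?thesis
    using bracket_time(2)[OF I(1) a b t, of p] dorf_bracket[OF sec_e[OF t] sa(1) sb(1), of p]
      bracket_add_l[OF sa(2,3) sb(1), of p] bracket_add_r[OF sa(1) sb(2,3), of p]
    by (simp add: Dt_def[of "\<lambda>t. bracket E (a t) (b t)"])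
qed

lemma Dt_anchor:
  assumes a: "tsection A E I a" and h: "tsmooth A I UNIV h" and t: "t \<in> I"
  shows "deriv (\<lambda>s. an p (a s p) (h s)) t + X t p (\<lambda>q. an q (a t q) (h t))
      = an p (Dt a t p) (h t) + an p (a t p) (\<lambda>q. deriv (\<lambda>s. h s q) t + X t q (h t))"
proof -
  note sa = sec_parts[OF a t]
  have ht: "smooth_fun A (h t)" by (rule tsmooth_slice[OF open_UNIV h t])
  have h': "smooth_fun A (\<lambda>q. deriv (\<lambda>s. h s q) t)"
    by (rule tsmooth_slice[OF open_UNIV tsmooth_time_deriv(2)[OF I(1) open_UNIV h] t])
  have Xh: "smooth_fun A (\<lambda>q. X t q (h t))"
    using lie_der_smooth[OF sec_e[OF t] ht] by (simp add: lie_der_def)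
  have 1: "deriv (\<lambda>s. an p (a s p) (h s)) t = an p (tder a t p) (h t) + an p (a t p) (\<lambda>q. deriv (\<lambda>s. h s q) t)"
    by (rule DERIV_imp_deriv[OF anchor_deriv[OF I(1) a h t]])
  have 2: "X t p (\<lambda>q. an q (a t q) (h t)) = an p (dorf (e t) (a t) p) (h t) + an p (a t p) (\<lambda>q. X t q (h t))"
    using dorf_anchor[OF sec_e[OF t] sa(1) ht, of p] by (simp add: lie_der_def)
  have 3: "an p (Dt a t p) (h t) = an p (tder a t p) (h t) + an p (dorf (e t) (a t) p) (h t)"
    unfolding Dt_def by (rule an_add[OF ht]) (use sa sections_fib in auto)
  have 4: "an p (a t p) (\<lambda>q. deriv (\<lambda>s. h s q) t + X t q (h t)) =
      an p (a t p) (\<lambda>q. deriv (\<lambda>s. h s q) t) + an p (a t p) (\<lambda>q. X t q (h t))"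
    by (rule tangent_vectorD(1)[OF an_tangent[OF sections_fib[OF sa(1)]] h' Xh])
  show ?thesis unfolding 1 2 3 4 by simp
qed

lemma pair_along:
  assumes \<gamma>: "integral_curve I X \<gamma>" and a: "tsection A E I a" and b: "tsection A E I b" and t: "t \<in> I"
  shows "((\<lambda>s. pr (\<gamma> s) (a s (\<gamma> s)) (b s (\<gamma> s))) has_real_derivative
    pr (\<gamma> t) (Dt a t (\<gamma> t)) (b t (\<gamma> t)) + pr (\<gamma> t) (a t (\<gamma> t)) (Dt b t (\<gamma> t))) (at t)"
  using integral_curve_chain[OF I(1) vfield_X \<gamma> t tsmooth_pairing[OF I(1) a b]] Dt_pair[OF a b t, of "\<gamma> t"]
  by simp

subsection \<open>Parallel transport along integral curves\<close>

text \<open>The weak form of \<open>Dt u = 0\<close> for vectors along the curve: there is no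
  derivative of \<open>u\<close> itself, since the fibres change with the base point, so the
  pairings with time-dependent sections are differentiated instead.\<close>

definition lift :: "(real \<Rightarrow> 'a) \<Rightarrow> (real \<Rightarrow> 'v) \<Rightarrow> bool" where
  "lift \<gamma> u \<longleftrightarrow> (\<forall>t\<in>I. u t \<in> fib E (\<gamma> t) \<and> (\<forall>b. tsection A E I b \<longrightarrow>
     ((\<lambda>s. pr (\<gamma> s) (u s) (b s (\<gamma> s))) has_real_derivative pr (\<gamma> t) (u t) (Dt b t (\<gamma> t))) (at t)))"

lemma lift_fib: "lift \<gamma> u \<Longrightarrow> t \<in> I \<Longrightarrow> u t \<in> fib E (\<gamma> t)"
  unfolding lift_def by blast

lemma lift_deriv: "lift \<gamma> u \<Longrightarrow> t \<in> I \<Longrightarrow> tsection A E I b \<Longrightarrow>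
    ((\<lambda>s. pr (\<gamma> s) (u s) (b s (\<gamma> s))) has_real_derivative pr (\<gamma> t) (u t) (Dt b t (\<gamma> t))) (at t)"
  unfolding lift_def by blast

lemma parallel_lift:
  assumes "integral_curve I X \<gamma>" "tsection A E I a" "\<And>t p. t \<in> I \<Longrightarrow> Dt a t p = 0"
  shows "lift \<gamma> (\<lambda>t. a t (\<gamma> t))"
  unfolding lift_def
proof (intro ballI conjI allI impI)
  fix t assume t: "t \<in> I"
  show "a t (\<gamma> t) \<in> fib E (\<gamma> t)" by (rule tsectionD(1)[OF assms(2) t])
  fix b assume b: "tsection A E I b"
  show "((\<lambda>s. pr (\<gamma> s) (a s (\<gamma> s)) (b s (\<gamma> s))) has_real_derivative pr (\<gamma> t) (a t (\<gamma> t)) (Dt b t (\<gamma> t))) (at t)"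
    using pair_along[OF assms(1,2) b t] assms(3)[OF t] pr_zero(2)[OF tsectionD(1)[OF b t]] by simp
qed

lemma lift_combine:
  assumes u: "lift \<gamma> u" and v: "lift \<gamma> v"
  shows "lift \<gamma> (\<lambda>t. k *\<^sub>R u t + l *\<^sub>R v t)"
  unfolding lift_def
proof (intro ballI conjI allI impI)
  fix t assume t: "t \<in> I"
  show "k *\<^sub>R u t + l *\<^sub>R v t \<in> fib E (\<gamma> t)" using lift_fib[OF u t] lift_fib[OF v t] by (intro fib_add fib_scale)
  fix b assume b: "tsection A E I b"
  have eq: "pr (\<gamma> s) (k *\<^sub>R u s + l *\<^sub>R v s) y = k * pr (\<gamma> s) (u s) y + l * pr (\<gamma> s) (v s) y"
    if "s \<in> I" "y \<in> fib E (\<gamma> s)" for s y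
    using that lift_fib[OF u] lift_fib[OF v] by (simp add: pl_add pl_scale fib_scale)
  have "((\<lambda>s. k * pr (\<gamma> s) (u s) (b s (\<gamma> s)) + l * pr (\<gamma> s) (v s) (b s (\<gamma> s))) has_real_derivative
      k * pr (\<gamma> t) (u t) (Dt b t (\<gamma> t)) + l * pr (\<gamma> t) (v t) (Dt b t (\<gamma> t))) (at t)"
    by (intro DERIV_add DERIV_cmult lift_deriv[OF u t b] lift_deriv[OF v t b])
  then have "((\<lambda>s. pr (\<gamma> s) (k *\<^sub>R u s + l *\<^sub>R v s) (b s (\<gamma> s))) has_real_derivative
      k * pr (\<gamma> t) (u t) (Dt b t (\<gamma> t)) + l * pr (\<gamma> t) (v t) (Dt b t (\<gamma> t))) (at t)"
    by (rule has_field_derivative_transform_within_open[OF _ I(1) t]) (simp add: eq tsectionD(1)[OF b])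
  then show "((\<lambda>s. pr (\<gamma> s) (k *\<^sub>R u s + l *\<^sub>R v s) (b s (\<gamma> s))) has_real_derivative
      pr (\<gamma> t) (k *\<^sub>R u t + l *\<^sub>R v t) (Dt b t (\<gamma> t))) (at t)"
    using eq[OF t tsectionD(1)[OF tsection_Dt[OF b] t]] by simp
qed

text \<open>A connection matrix of \<open>Dt\<close>, taken in the possibly dependent family of
  generators.\<close>

definition Gm :: "nat \<Rightarrow> nat \<Rightarrow> real \<Rightarrow> 'a \<Rightarrow> real" where
  "Gm k j t p = gc k p (dorf (e t) (gs j) p)"

lemma Gm_smooth: "k < n \<Longrightarrow> j < n \<Longrightarrow> tsmooth A I UNIV (Gm k j)"
  unfolding Gm_def by (intro gc_smooth I(1) tsection_dorf e sections_tsection gs)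

lemma Dt_gs:
  assumes t: "t \<in> I" and j: "j < n"
  shows "Dt (\<lambda>t. gs j) t p = (\<Sum>k<n. Gm k j t p *\<^sub>R gs k p)"
proof -
  have "tder (\<lambda>t. gs j) t p = 0" by (simp add: tder_def)
  then show ?thesis
    unfolding Dt_def Gm_def using gc_expand[OF sections_fib[OF dorf_sec[OF sec_e[OF t] gs[OF j]]], of p] by simp
qed

text \<open>The transport equation \<open>\<xi>' = - Gm \<xi>\<close>. As the generators may be
  dependent, it yields lifts but does not by itself identify them; uniqueness is a separate
  argument.\<close>

lemma lift_coefficients:
  assumes \<gamma>: "integral_curve I X \<gamma>"
    and \<xi>: "\<And>k t. k < n \<Longrightarrow> t \<in> I \<Longrightarrow> (\<xi> k has_real_derivative - (\<Sum>j<n. Gm k j t (\<gamma> t) * \<xi> j t)) (at t)"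
  shows "lift \<gamma> (\<lambda>t. \<Sum>k<n. \<xi> k t *\<^sub>R gs k (\<gamma> t))"
  unfolding lift_def
proof (intro ballI conjI allI impI)
  fix t assume t: "t \<in> I"
  show "(\<Sum>k<n. \<xi> k t *\<^sub>R gs k (\<gamma> t)) \<in> fib E (\<gamma> t)" using gs_fib by (intro fib_sum fib_scale) auto
  fix b assume b: "tsection A E I b"
  have eq: "pr (\<gamma> s) (\<Sum>k<n. \<xi> k s *\<^sub>R gs k (\<gamma> s)) y = (\<Sum>k<n. \<xi> k s * pr (\<gamma> s) (gs k (\<gamma> s)) y)"
    if "y \<in> fib E (\<gamma> s)" for s y
    using that gs_fib by (subst pl_sum) (auto simp: pl_scale fib_scale intro!: sum.cong)
  let ?P = "\<lambda>k. pr (\<gamma> t) (gs k (\<gamma> t)) (b t (\<gamma> t))"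
  have bf: "b t (\<gamma> t) \<in> fib E (\<gamma> t)" by (rule tsectionD(1)[OF b t])
  have "((\<lambda>s. \<Sum>k<n. \<xi> k s * pr (\<gamma> s) (gs k (\<gamma> s)) (b s (\<gamma> s))) has_real_derivative
      (\<Sum>k<n. - (\<Sum>j<n. Gm k j t (\<gamma> t) * \<xi> j t) * ?P k
       + (pr (\<gamma> t) (Dt (\<lambda>t. gs k) t (\<gamma> t)) (b t (\<gamma> t)) + pr (\<gamma> t) (gs k (\<gamma> t)) (Dt b t (\<gamma> t))) * \<xi> k t)) (at t)"
    by (intro DERIV_sum DERIV_mult \<xi> t pair_along[OF \<gamma> sections_tsection[OF gs] b t]) auto
  also have "(\<Sum>k<n. - (\<Sum>j<n. Gm k j t (\<gamma> t) * \<xi> j t) * ?P k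
       + (pr (\<gamma> t) (Dt (\<lambda>t. gs k) t (\<gamma> t)) (b t (\<gamma> t)) + pr (\<gamma> t) (gs k (\<gamma> t)) (Dt b t (\<gamma> t))) * \<xi> k t)
     = - (\<Sum>k<n. \<Sum>j<n. Gm k j t (\<gamma> t) * \<xi> j t * ?P k) + (\<Sum>k<n. \<Sum>j<n. Gm j k t (\<gamma> t) * ?P j * \<xi> k t)
       + (\<Sum>k<n. \<xi> k t * pr (\<gamma> t) (gs k (\<gamma> t)) (Dt b t (\<gamma> t)))"
  proof -
    have "pr (\<gamma> t) (Dt (\<lambda>t. gs k) t (\<gamma> t)) (b t (\<gamma> t)) = (\<Sum>j<n. Gm j k t (\<gamma> t) * ?P j)" if "k < n" for k
      unfolding Dt_gs[OF t that]
      using bf gs_fib by (subst pl_sum) (auto simp: pl_scale fib_scale intro!: sum.cong)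
    then show ?thesis
      by (simp add: sum.distrib sum_subtractf sum_negf sum_distrib_right sum_distrib_left ring_distribs mult_ac)
  qed
  \<comment> \<open>Exchanging the two indices shows that the connection terms cancel.\<close>
  also have "(\<Sum>k<n. \<Sum>j<n. Gm j k t (\<gamma> t) * ?P j * \<xi> k t) = (\<Sum>k<n. \<Sum>j<n. Gm k j t (\<gamma> t) * \<xi> j t * ?P k)"
    by (subst sum.swap) (simp add: mult_ac)
  finally have "((\<lambda>s. \<Sum>k<n. \<xi> k s * pr (\<gamma> s) (gs k (\<gamma> s)) (b s (\<gamma> s))) has_real_derivative
      (\<Sum>k<n. \<xi> k t * pr (\<gamma> t) (gs k (\<gamma> t)) (Dt b t (\<gamma> t)))) (at t)" by simp
  then have "((\<lambda>s. pr (\<gamma> s) (\<Sum>k<n. \<xi> k s *\<^sub>R gs k (\<gamma> s)) (b s (\<gamma> s))) has_real_derivative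
      (\<Sum>k<n. \<xi> k t * pr (\<gamma> t) (gs k (\<gamma> t)) (Dt b t (\<gamma> t)))) (at t)"
    by (rule has_field_derivative_transform_within_open[OF _ I(1) t]) (simp add: eq tsectionD(1)[OF b])
  then show "((\<lambda>s. pr (\<gamma> s) (\<Sum>k<n. \<xi> k s *\<^sub>R gs k (\<gamma> s)) (b s (\<gamma> s))) has_real_derivative
      pr (\<gamma> t) (\<Sum>k<n. \<xi> k t *\<^sub>R gs k (\<gamma> t)) (Dt b t (\<gamma> t))) (at t)"
    using eq[OF tsectionD(1)[OF tsection_Dt[OF b] t]] by simp
qed

text \<open>Coefficients in the generators are ambiguous, but the pairings \<open>w k\<close> of the
  difference with the generators are not. They solve a closed linear system, determine the
  difference by nondegeneracy, and vanish by Gronwall's inequality for the sum of their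
  squares.\<close>

lemma lift_unique:
  assumes \<gamma>: "integral_curve I X \<gamma>" and u: "lift \<gamma> u" and v: "lift \<gamma> v"
    and t0: "t0 \<in> I" "u t0 = v t0" and t: "t \<in> I"
  shows "u t = v t"
proof -
  define z where "z s = 1 *\<^sub>R u s + (-1) *\<^sub>R v s" for s
  have z: "lift \<gamma> z" unfolding z_def by (rule lift_combine[OF u v])
  define w where "w k s = pr (\<gamma> s) (z s) (gs k (\<gamma> s))" for k s
  have w': "(w k has_real_derivative (\<Sum>j<n. Gm j k s (\<gamma> s) * w j s)) (at s)" if k: "k < n" and s: "s \<in> I" for k s
  proof -
    have "pr (\<gamma> s) (z s) (Dt (\<lambda>t. gs k) s (\<gamma> s)) = (\<Sum>j<n. Gm j k s (\<gamma> s) * w j s)"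
      unfolding Dt_gs[OF s k] w_def
      using lift_fib[OF z s] gs_fib by (subst pr_sum) (auto simp: pr_scale fib_scale intro!: sum.cong)
    then show ?thesis
      using lift_deriv[OF z s sections_tsection[OF gs[OF k]]] by (simp add: w_def[abs_def])
  qed
  have seg: "closed_segment t0 t \<subseteq> I"
    using I(2) t0(1) t by (simp add: is_interval_convex_1 closed_segment_subset)
  have Gc: "continuous_on I (\<lambda>s. Gm j k s (\<gamma> s))" if "j < n" "k < n" for j k
  proof -
    have "continuous_on I (\<lambda>s. (s, \<gamma> s))"
      using \<gamma> unfolding integral_curve_def by (intro continuous_intros) auto
    from continuous_on_compose2[OF tsmooth_continuous[OF I(1) open_UNIV Gm_smooth[OF that]] this]
    show ?thesis by auto
  qed
  define M where "M s = (\<Sum>k<n. \<Sum>j<n. \<bar>Gm j k s (\<gamma> s)\<bar>)" for s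
  have "continuous_on (closed_segment t0 t) M"
    unfolding M_def by (intro continuous_intros continuous_on_subset[OF Gc seg]) auto
  then have "bounded (M ` closed_segment t0 t)"
    by (intro compact_imp_bounded compact_continuous_image) auto
  then obtain L where L: "\<And>s. s \<in> closed_segment t0 t \<Longrightarrow> \<bar>M s\<bar> \<le> L" "L \<ge> 0"
    unfolding bounded_iff by (metis abs_ge_zero ends_in_segment(1) imageI order_trans real_norm_def)
  define W where "W s = (\<Sum>k<n. w k s * w k s)" for s
  define W' where "W' s = (\<Sum>k<n. 2 * (\<Sum>j<n. Gm j k s (\<gamma> s) * w j s) * w k s)" for s
  have "norm (W t) \<le> (norm (W t0) + 0 * \<bar>t - t0\<bar>) * exp ((2 * L) * \<bar>t - t0\<bar>)"
  proof (rule gronwall[where w' = W'])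
    fix s assume s: "s \<in> closed_segment t0 t"
    have "(W has_real_derivative W' s) (at s)"
      unfolding W_def W'_def
      by (rule DERIV_cong[OF DERIV_sum[OF DERIV_mult[OF w' w']]]) (use s seg in \<open>auto intro!: sum.cong\<close>)
    then show "(W has_vector_derivative W' s) (at s)"
      by (simp add: has_real_derivative_iff_has_vector_derivative)
    have ww: "\<bar>w j s * w k s\<bar> \<le> W s" if "j < n" "k < n" for j k
    proof -
      have "w i s * w i s \<le> W s" if "i < n" for i
        unfolding W_def using that member_le_sum[of i "{..<n}" "\<lambda>k. w k s * w k s"] by simp
      from this[OF that(1)] this[OF that(2)] show ?thesis
        using sum_squares_bound[of "w j s" "w k s"] sum_squares_bound[of "- w j s" "w k s"]
        by (simp add: power2_eq_square abs_le_iff)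
    qed
    have "\<bar>W' s\<bar> \<le> (\<Sum>k<n. \<Sum>j<n. 2 * (\<bar>Gm j k s (\<gamma> s)\<bar> * W s))"
    proof -
      have "W' s = (\<Sum>k<n. \<Sum>j<n. 2 * (Gm j k s (\<gamma> s) * (w j s * w k s)))"
        unfolding W'_def by (simp add: sum_distrib_left sum_distrib_right mult_ac)
      also have "\<bar>\<dots>\<bar> \<le> (\<Sum>k<n. \<Sum>j<n. \<bar>2 * (Gm j k s (\<gamma> s) * (w j s * w k s))\<bar>)"
        by (rule order_trans[OF sum_abs]) (intro sum_mono sum_abs)
      also have "\<dots> \<le> (\<Sum>k<n. \<Sum>j<n. 2 * (\<bar>Gm j k s (\<gamma> s)\<bar> * W s))"
        using ww by (intro sum_mono) (auto simp: abs_mult intro!: mult_left_mono)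
      finally show ?thesis .
    qed
    also have "\<dots> = 2 * (M s * W s)"
      by (simp add: M_def sum_distrib_left sum_distrib_right)
    also have "\<dots> \<le> 2 * (L * W s)"
      using L(1)[OF s] by (auto intro!: mult_right_mono simp: W_def sum_nonneg)
    finally show "norm (W' s) \<le> (2 * L) * norm (W s) + 0"
      by (simp add: W_def sum_nonneg mult_ac abs_of_nonneg)
  qed (use L in auto)
  moreover have "W t0 = 0"
    using t0(2) pr_zero(2)[OF gs_fib] by (simp add: W_def w_def z_def)
  ultimately have "W t = 0" by simp
  then have w0: "w k t = 0" if "k < n" for k
    using that unfolding W_def by (subst (asm) sum_nonneg_eq_0_iff) auto
  have "z t = 0"
  proof (rule pr_nondeg[OF lift_fib[OF z t]])
    fix y assume y: "y \<in> fib E (\<gamma> t)"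
    have "pr (\<gamma> t) (z t) y = pr (\<gamma> t) (z t) (\<Sum>k<n. gc k (\<gamma> t) y *\<^sub>R gs k (\<gamma> t))" using gc_expand[OF y] by simp
    also have "\<dots> = (\<Sum>k<n. gc k (\<gamma> t) y * w k t)"
      unfolding w_def using lift_fib[OF z t] gs_fib by (subst pr_sum) (auto simp: pr_scale fib_scale intro!: sum.cong)
    finally show "pr (\<gamma> t) (z t) y = 0" using w0 by simp
  qed
  then show ?thesis by (simp add: z_def)
qed

end

section \<open>Local flows and fundamental matrices in charts\<close>

section \<open>Flows of time-dependent vector fields\<close>

text \<open>The derivative vanishes off a compact ball and is therefore bounded in each basis
  direction.\<close>

lemma lipschitz_compact_support:
  fixes f :: "'n::{banach, heine_borel} \<Rightarrow> 'y::real_normed_vector"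
  assumes fd: "fin_dim TYPE('n)" and f: "smooth_on UNIV f" and supp: "\<And>x. x \<notin> cball x0 r \<Longrightarrow> f x = 0"
  obtains L where "\<And>x y. norm (f x - f y) \<le> L * norm (x - y)"
proof -
  obtain B :: "'n set" and c where B: "finite B" "\<And>b. b \<in> B \<Longrightarrow> bounded_linear (c b)" "\<And>x. x = (\<Sum>b\<in>B. c b x *\<^sub>R b)"
    by (rule fin_dim_coordinates[OF fd]) blast
  let ?f' = "\<lambda>x. frechet_derivative f (at x)"
  have D: "(f has_derivative ?f' x) (at x)" for x using smooth_on_derivative(1)[OF open_UNIV f] by simp
  have out: "?f' x = (\<lambda>v. 0)" if "x \<notin> cball x0 r" for x
  proof -
    have "((\<lambda>x. 0) has_derivative (\<lambda>v. 0)) (at x)" by simp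
    moreover have "open (- cball x0 r)" by (simp add: open_Compl)
    ultimately have "(f has_derivative (\<lambda>v. 0)) (at x)"
      by (rule has_derivative_transform_within_open) (use that supp in auto)
    from frechet_derivative_at[OF this] show ?thesis by simp
  qed
  have "\<exists>M. \<forall>x. norm (?f' x b) \<le> M" for b
  proof -
    have "continuous_on UNIV (\<lambda>x. ?f' x b)"
      by (rule smooth_on_continuous[OF smooth_on_derivative(2)[OF open_UNIV f]])
    then have "bounded ((\<lambda>x. ?f' x b) ` cball x0 r)"
      by (intro compact_imp_bounded compact_continuous_image compact_cball) (auto intro: continuous_on_subset)
    then obtain M where M: "\<forall>y\<in>(\<lambda>x. ?f' x b) ` cball x0 r. norm y \<le> M" "M > 0" unfolding bounded_pos by blast
    have "norm (?f' x b) \<le> M" for x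
      using M out[of x] by (cases "x \<in> cball x0 r") auto
    then show ?thesis by blast
  qed
  then obtain M where M: "\<And>b x. norm (?f' x b) \<le> M b" by metis
  have M0: "M b \<ge> 0" for b using M[of undefined b] norm_ge_zero order_trans by blast
  have "\<exists>K. K > 0 \<and> (\<forall>x. \<bar>c b x\<bar> \<le> norm x * K)" if "b \<in> B" for b
    using bounded_linear.pos_bounded[OF B(2)[OF that]] by auto
  then obtain K where K: "\<And>b. b \<in> B \<Longrightarrow> K b > 0" "\<And>b x. b \<in> B \<Longrightarrow> \<bar>c b x\<bar> \<le> norm x * K b" by metis
  define L where "L = (\<Sum>b\<in>B. K b * M b)"
  have L0: "0 \<le> L" unfolding L_def using K(1) M0 by (intro sum_nonneg mult_nonneg_nonneg) (auto simp: less_imp_le)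
  have "norm (f x - f y) \<le> L * norm (x - y)" for x y
  proof (rule differentiable_bound[of UNIV f ?f'])
    show "onorm (?f' x) \<le> L" for x
    proof (rule onorm_bound[OF L0])
      fix v
      have l: "linear (?f' x)" using D has_derivative_bounded_linear bounded_linear.linear by blast
      have "?f' x v = (\<Sum>b\<in>B. c b v *\<^sub>R ?f' x b)"
        by (subst B(3)[of v]) (simp add: linear_sum[OF l] linear_cmul[OF l])
      also have "norm \<dots> \<le> (\<Sum>b\<in>B. (norm v * K b) * M b)"
      proof (rule sum_norm_le)
        fix b assume b: "b \<in> B"
        have "\<bar>c b v\<bar> * norm (?f' x b) \<le> (norm v * K b) * M b"
          by (rule mult_mono[OF K(2)[OF b] M]) (use K(1)[OF b] in auto)
        then show "norm (c b v *\<^sub>R ?f' x b) \<le> (norm v * K b) * M b" by (simp only: norm_scaleR)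
      qed
      also have "\<dots> = L * norm v" by (simp add: L_def sum_distrib_right sum_distrib_left mult_ac)
      finally show "norm (?f' x v) \<le> L * norm v" .
    qed
  qed (use D in auto)
  then show ?thesis by (rule that)
qed

context smooth_mfd
begin

text \<open>The field is written in a chart and multiplied by a bump in space and time, which gives
  a globally Lipschitz map agreeing with it near \<open>s0\<close> and \<open>p0\<close>. The last
  conclusion treats arbitrary time-dependent functions in the same way; it serves the coefficients
  of the transport equation.\<close>

lemma local_ode:
  assumes I: "open I" and X: "vfield I X" and s0: "s0 \<in> I"
  obtains U \<phi> M \<delta> and f :: "real \<times> 'm \<Rightarrow> 'm" and L xh
  where "(U, \<phi>) \<in> A" "open M" "p0 \<in> M" "M \<subseteq> U" "\<delta> > 0" "{s0 - \<delta><..<s0 + \<delta>} \<subseteq> I"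
    "smooth_on UNIV f" "\<forall>z w. norm (f z - f w) \<le> L * norm (z - w)"
    "\<forall>b\<in>B. smooth_fun A (xh b)" "\<forall>b\<in>B. \<forall>q\<in>M. xh b q = c b (\<phi> q)"
    "\<forall>t\<in>{s0 - \<delta><..<s0 + \<delta>}. \<forall>q\<in>M. f (t, \<phi> q) = (\<Sum>b\<in>B. X t q (xh b) *\<^sub>R b)"
    "\<forall>g. tsmooth A I UNIV g \<longrightarrow> (\<exists>h. smooth_on UNIV h \<and> (\<forall>t\<in>{s0 - \<delta><..<s0 + \<delta>}. \<forall>q\<in>M. h (t, \<phi> q) = g t q))"
proof -
  obtain U \<phi> where U: "(U, \<phi>) \<in> A" "p0 \<in> U" using chart_ex by blast
  obtain xh N where xh: "\<And>b. b \<in> B \<Longrightarrow> smooth_fun A (xh b)" "open N" "p0 \<in> N" "N \<subseteq> U \<inter> UNIV"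
    "\<And>b q. b \<in> B \<Longrightarrow> q \<in> N \<Longrightarrow> xh b q = c b (\<phi> q)"
    by (rule coords_exist[OF U(1) open_UNIV]) (use U(2) in auto)
  have o: "open (I \<times> \<phi> ` U)" by (intro open_Times I chart_open_image[OF U(1)])
  have z0: "(s0, \<phi> p0) \<in> I \<times> \<phi> ` U" using s0 U(2) by auto
  obtain \<kappa> :: "_ \<Rightarrow> real" and V r where \<kappa>: "smooth_on UNIV \<kappa>" "open V" "(s0, \<phi> p0) \<in> V" "\<forall>x\<in>V. \<kappa> x = 1"
    "cball (s0, \<phi> p0) r \<subseteq> I \<times> \<phi> ` U" "V \<subseteq> cball (s0, \<phi> p0) r" "\<forall>x. x \<notin> cball (s0, \<phi> p0) r \<longrightarrow> \<kappa> x = 0"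
    by (rule bump_function[OF fd2 o z0])
  define ex where "ex g z = (if z \<in> I \<times> \<phi> ` U then \<kappa> z *\<^sub>R g (fst z) (inv_into U \<phi> (snd z)) else 0)"
    for g :: "real \<Rightarrow> 'a \<Rightarrow> real" and z
  have exs: "smooth_on UNIV (ex g)" if "tsmooth A I UNIV g" for g
    unfolding ex_def
    by (rule smooth_on_extend[OF o _ \<kappa>(1) closed_cball \<kappa>(5)]) (use \<kappa>(7) tsmoothD[OF that U(1)] in auto)
  have ex0: "ex g z = 0" if "z \<notin> cball (s0, \<phi> p0) r" for g z
    using \<kappa>(7)[rule_format, OF that] by (simp add: ex_def)
  have exV: "ex g (t, \<phi> q) = g t q" if "(t, \<phi> q) \<in> V" "q \<in> U" for g t q
    using that \<kappa> chart_inv[OF U(1)] by (auto simp: ex_def)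
  define f where "f z = (\<Sum>b\<in>B. ex (\<lambda>t q. X t q (xh b)) z *\<^sub>R b)" for z
  have fs: "smooth_on UNIV f"
    unfolding f_def
    by (intro smooth_on_sum smooth_on_scaleR exs smooth_on_const open_UNIV)
       (use X xh(1) in \<open>auto simp: vfield_def\<close>)
  obtain L where L: "\<And>x y. norm (f x - f y) \<le> L * norm (x - y)"
    by (rule lipschitz_compact_support[OF fd2 fs, of "(s0, \<phi> p0)" r]) (auto simp: f_def ex0)
  obtain T W where TW': "open T" "open W" "(s0, \<phi> p0) \<in> T \<times> W" "T \<times> W \<subseteq> V"
    by (rule open_prod_elim[OF \<kappa>(2,3)])
  then have TW: "open T" "open W" "s0 \<in> T" "\<phi> p0 \<in> W" "T \<times> W \<subseteq> V" by auto
  obtain \<delta> where \<delta>: "\<delta> > 0" "ball s0 \<delta> \<subseteq> T \<inter> I"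
    using open_contains_ball[of "T \<inter> I"] TW I s0 by blast
  have ball: "ball s0 \<delta> = {s0 - \<delta><..<s0 + \<delta>}" by (auto simp: ball_def dist_real_def)
  define M where "M = N \<inter> (U \<inter> \<phi> -` W)"
  have oM: "open M" unfolding M_def
    using xh(2) continuous_open_preimage[OF chart_cont[OF U(1)] chart_open[OF U(1)] TW(2)] by blast
  have inV: "(t, \<phi> q) \<in> V" if "t \<in> {s0 - \<delta><..<s0 + \<delta>}" "q \<in> M" for t q
    using that TW(5) \<delta>(2) unfolding ball M_def by blast
  show ?thesis
  proof (rule that[OF U(1) oM])
    show "p0 \<in> M" using xh(3) U(2) TW(4) by (simp add: M_def)
    show "{s0 - \<delta><..<s0 + \<delta>} \<subseteq> I" using \<delta>(2) ball by simp
    show "\<forall>t\<in>{s0 - \<delta><..<s0 + \<delta>}. \<forall>q\<in>M. f (t, \<phi> q) = (\<Sum>b\<in>B. X t q (xh b) *\<^sub>R b)"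
      unfolding f_def using exV inV by (auto simp: M_def)
    show "\<forall>g. tsmooth A I UNIV g \<longrightarrow> (\<exists>h. smooth_on UNIV h \<and> (\<forall>t\<in>{s0 - \<delta><..<s0 + \<delta>}. \<forall>q\<in>M. h (t, \<phi> q) = g t q))"
    proof (intro allI impI)
      fix g assume g: "tsmooth A I UNIV g"
      show "\<exists>h. smooth_on UNIV h \<and> (\<forall>t\<in>{s0 - \<delta><..<s0 + \<delta>}. \<forall>q\<in>M. h (t, \<phi> q) = g t q)"
        by (rule exI[of _ "ex g"]) (use exs[OF g] exV inV in \<open>auto simp: M_def\<close>)
    qed
    show "\<forall>b\<in>B. \<forall>q\<in>M. xh b q = c b (\<phi> q)" using xh(5) by (simp add: M_def)
  qed (use \<delta> fs L xh(1) in \<open>auto simp: M_def\<close>)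
qed

lemma integral_curve_subset: "integral_curve I X \<gamma> \<Longrightarrow> J \<subseteq> I \<Longrightarrow> integral_curve J X \<gamma>"
  unfolding integral_curve_def by (auto intro: continuous_on_subset)

text \<open>The times of agreement form an open set by uniqueness in a chart, the times of
  disagreement by the Hausdorff property, and the interval is connected.\<close>

lemma integral_curve_unique:
  assumes I: "open I" "is_interval I" and X: "vfield I X"
    and \<gamma>: "integral_curve I X \<gamma>" and \<eta>: "integral_curve I X \<eta>"
    and t0: "t0 \<in> I" "\<gamma> t0 = \<eta> t0" and t: "t \<in> I"
  shows "\<gamma> t = \<eta> t"
proof -
  have \<gamma>c: "continuous_on I \<gamma>" and \<eta>c: "continuous_on I \<eta>"
    using \<gamma> \<eta> unfolding integral_curve_def by auto
  have o1: "open {t \<in> I. \<gamma> t \<noteq> \<eta> t}"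
  proof (subst open_subopen, rule ballI)
    fix t assume "t \<in> {t \<in> I. \<gamma> t \<noteq> \<eta> t}"
    then have t: "t \<in> I" "\<gamma> t \<noteq> \<eta> t" by auto
    obtain P Q where PQ: "open P" "open Q" "\<gamma> t \<in> P" "\<eta> t \<in> Q" "P \<inter> Q = {}"
      using hausdorff[OF t(2)] by blast
    have "open ((I \<inter> \<gamma> -` P) \<inter> (I \<inter> \<eta> -` Q))"
      by (intro open_Int continuous_open_preimage \<gamma>c \<eta>c I PQ)
    moreover have "(I \<inter> \<gamma> -` P) \<inter> (I \<inter> \<eta> -` Q) \<subseteq> {t \<in> I. \<gamma> t \<noteq> \<eta> t}" using PQ(5) by auto
    ultimately show "\<exists>T. open T \<and> t \<in> T \<and> T \<subseteq> {t \<in> I. \<gamma> t \<noteq> \<eta> t}"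
      using t PQ by (intro exI[of _ "(I \<inter> \<gamma> -` P) \<inter> (I \<inter> \<eta> -` Q)"]) auto
  qed
  have o2: "open {t \<in> I. \<gamma> t = \<eta> t}"
  proof (subst open_subopen, rule ballI)
    fix t assume "t \<in> {t \<in> I. \<gamma> t = \<eta> t}"
    then have t: "t \<in> I" "\<gamma> t = \<eta> t" by auto
    obtain U \<phi> M \<delta> and f :: "real \<times> 'm \<Rightarrow> 'm" and L xh where lo: "(U, \<phi>) \<in> A" "open M" "\<gamma> t \<in> M" "M \<subseteq> U" "\<delta> > 0"
      "{t - \<delta><..<t + \<delta>} \<subseteq> I" "smooth_on UNIV f" "\<forall>z w. norm (f z - f w) \<le> L * norm (z - w)"
      "\<forall>b\<in>B. smooth_fun A (xh b)" "\<forall>b\<in>B. \<forall>q\<in>M. xh b q = c b (\<phi> q)"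
      "\<forall>s\<in>{t - \<delta><..<t + \<delta>}. \<forall>q\<in>M. f (s, \<phi> q) = (\<Sum>b\<in>B. X s q (xh b) *\<^sub>R b)"
      by (rule local_ode[OF I(1) X t(1), of "\<gamma> t"])
    have "open ((I \<inter> \<gamma> -` M) \<inter> (I \<inter> \<eta> -` M))"
      by (intro open_Int continuous_open_preimage \<gamma>c \<eta>c I lo(2))
    moreover have "t \<in> (I \<inter> \<gamma> -` M) \<inter> (I \<inter> \<eta> -` M)" using t lo(3) by simp
    ultimately obtain \<epsilon> where \<epsilon>: "\<epsilon> > 0" "ball t \<epsilon> \<subseteq> (I \<inter> \<gamma> -` M) \<inter> (I \<inter> \<eta> -` M)"
      by (rule openE)
    define \<epsilon>' where "\<epsilon>' = min \<epsilon> \<delta>"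
    have "\<gamma> s = \<eta> s" if s: "s \<in> ball t \<epsilon>'" for s
    proof -
      have seg: "closed_segment t s \<subseteq> ball t \<epsilon>'"
        using s by (intro closed_segment_subset) (auto intro: le_less_trans[OF zero_le_dist])
      have in_M: "\<gamma> s \<in> M" "\<eta> s \<in> M" "s \<in> {t - \<delta><..<t + \<delta>}" "s \<in> I" if "s \<in> ball t \<epsilon>'" for s
        using that \<epsilon>(2) by (auto simp: \<epsilon>'_def dist_real_def)
      have der: "((\<lambda>s. \<phi> (\<zeta> s)) has_vector_derivative f (s, \<phi> (\<zeta> s))) (at s)"
        if \<zeta>: "integral_curve I X \<zeta>" "\<zeta> s \<in> M" "s \<in> ball t \<epsilon>'" for \<zeta> s
        using integral_curve_chart[OF I(1) \<zeta>(1) in_M(4)[OF \<zeta>(3)] lo(1) _ lo(2) \<zeta>(2) lo(4), of xh] lo(9,10,11) \<zeta>(2) in_M(3)[OF \<zeta>(3)]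
        by simp
      have "\<phi> (\<gamma> s) = \<phi> (\<eta> s)"
      proof (rule ode_unique[of t s "\<lambda>s. \<phi> (\<gamma> s)" "\<lambda>s x. f (s, x)" "\<lambda>s. \<phi> (\<eta> s)"])
        fix \<sigma> assume "\<sigma> \<in> closed_segment t s"
        then have \<sigma>: "\<sigma> \<in> ball t \<epsilon>'" using seg by blast
        show "((\<lambda>s. \<phi> (\<gamma> s)) has_vector_derivative f (\<sigma>, \<phi> (\<gamma> \<sigma>))) (at \<sigma>)"
          "((\<lambda>s. \<phi> (\<eta> s)) has_vector_derivative f (\<sigma>, \<phi> (\<eta> \<sigma>))) (at \<sigma>)"
          using der[OF \<gamma> _ \<sigma>] der[OF \<eta> _ \<sigma>] in_M[OF \<sigma>] by auto
        show "norm (f (\<sigma>, y) - f (\<sigma>, z)) \<le> L * norm (y - z)" for y z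
          using lo(8)[rule_format, of "(\<sigma>, y)" "(\<sigma>, z)"] by (simp add: norm_Pair)
      qed (use t in simp)
      then show ?thesis using in_M[OF s] chart_inj[OF lo(1)] lo(4) by (meson inj_onD subsetD)
    qed
    moreover have "ball t \<epsilon>' \<subseteq> I" using \<epsilon>(2) by (auto simp: \<epsilon>'_def)
    ultimately show "\<exists>T. open T \<and> t \<in> T \<and> T \<subseteq> {t \<in> I. \<gamma> t = \<eta> t}"
      using \<epsilon>(1) lo(5) by (intro exI[of _ "ball t \<epsilon>'"]) (auto simp: \<epsilon>'_def)
  qed
  have "connected I" using I(2) by (simp add: is_interval_connected_1)
  from connectedD[OF this o2 o1] show ?thesis using t0 t by auto
qed

lemma integral_curve_of_chart:
  assumes J: "open J" and X: "\<And>t p. t \<in> J \<Longrightarrow> tangent_vector A p (X t p)" and U: "(U, \<phi>) \<in> A"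
    and M: "open M" "M \<subseteq> U"
    and xh: "\<forall>b\<in>B. smooth_fun A (xh b)" "\<forall>b\<in>B. \<forall>q\<in>M. xh b q = c b (\<phi> q)"
    and x: "\<And>t. t \<in> J \<Longrightarrow> x t \<in> \<phi> ` M"
      "\<And>t. t \<in> J \<Longrightarrow> (x has_vector_derivative (\<Sum>b\<in>B. X t (inv_into U \<phi> (x t)) (xh b) *\<^sub>R b)) (at t)"
  shows "integral_curve J X (\<lambda>t. inv_into U \<phi> (x t))"
  unfolding integral_curve_def
proof (intro conjI allI impI ballI)
  have "continuous_on J x"
    by (rule continuous_on_vector_derivative) (use x(2) has_vector_derivative_at_within in blast)
  then show "continuous_on J (\<lambda>t. inv_into U \<phi> (x t))"
    by (rule continuous_on_compose2[OF chart_inv_cont[OF U]]) (use x(1) M(2) in blast)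
  fix g t assume g: "smooth_fun A g" and t: "t \<in> J"
  let ?q = "inv_into U \<phi> (x t)"
  have q: "?q \<in> M" "\<phi> ?q = x t" using chart_inv_in[OF U x(1)[OF t] M(2)] by auto
  let ?v = "\<Sum>b\<in>B. X t ?q (xh b) *\<^sub>R b" and ?g = "\<lambda>x. g (inv_into U \<phi> x)"
  let ?D = "frechet_derivative ?g (at (x t))"
  have D: "(?g has_derivative ?D) (at (x t))"
    by (rule smooth_on_derivative(1)[OF chart_open_image[OF U] smooth_fun_chart[OF g U]]) (use x(1)[OF t] M(2) in blast)
  have l: "linear ?D" using D has_derivative_bounded_linear bounded_linear.linear by blast
  have "X t ?q g = (\<Sum>b\<in>B. X t ?q (xh b) * frechet_derivative ?g (at (\<phi> ?q)) b)"
    by (rule tangent_vector_chart[OF X[OF t] U _ M(1) q(1) M(2) _ g]) (use xh in auto)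
  also have "\<dots> = ?D ?v" by (simp add: q(2) linear_sum[OF l] linear_cmul[OF l])
  finally have Xg: "X t ?q g = ?D ?v" .
  have "(x has_derivative (\<lambda>h. h *\<^sub>R ?v)) (at t)" using x(2)[OF t] by (simp add: has_vector_derivative_def)
  from has_derivative_compose[OF this D]
  have "((\<lambda>t. ?g (x t)) has_derivative (\<lambda>h. ?D (h *\<^sub>R ?v))) (at t)" .
  then show "((\<lambda>s. g (inv_into U \<phi> (x s))) has_real_derivative X t ?q g) (at t)"
    unfolding Xg has_field_derivative_def by (simp add: linear_cmul[OF l] mult_commute_abs)
qed

text \<open>\<open>\<Phi> (\<tau>, (s, x))\<close> is the position at time \<open>s + \<tau>\<close> of the solution starting at time \<open>s\<close> from \<open>x\<close>, in a
  chart; \<open>H\<close> is the fundamental matrix of the linear system with coefficients \<open>- G\<close> along this solution.\<close>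

lemma local_flow:
  assumes I: "open I" and X: "vfield I X" and s0: "s0 \<in> I"
    and G: "\<And>k j. k < n \<Longrightarrow> j < n \<Longrightarrow> tsmooth A I UNIV (G k j)"
  obtains U \<phi> N \<delta> and \<Phi> :: "real \<times> real \<times> 'm \<Rightarrow> 'm" and H :: "nat \<Rightarrow> nat \<Rightarrow> real \<times> real \<times> 'm \<Rightarrow> real"
  where "(U, \<phi>) \<in> A" "open N" "p0 \<in> N" "N \<subseteq> U" "\<delta> > 0" "{s0 - \<delta><..<s0 + \<delta>} \<subseteq> I"
    "smooth_on UNIV \<Phi>" "\<forall>k<n. \<forall>j. smooth_on UNIV (H k j)"
    "\<forall>s\<in>{s0 - \<delta><..<s0 + \<delta>}. \<forall>q\<in>N. \<Phi> (0, (s, \<phi> q)) = \<phi> q"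
    "\<forall>s\<in>{s0 - \<delta><..<s0 + \<delta>}. \<forall>t\<in>{s0 - \<delta><..<s0 + \<delta>}. \<forall>q\<in>N. \<Phi> (t - s, (s, \<phi> q)) \<in> \<phi> ` U"
    "\<forall>s\<in>{s0 - \<delta><..<s0 + \<delta>}. \<forall>q\<in>N. integral_curve {s0 - \<delta><..<s0 + \<delta>} X (\<lambda>t. inv_into U \<phi> (\<Phi> (t - s, (s, \<phi> q))))"
    "\<forall>k j z. H k j (0, z) = (if k = j then 1 else 0)"
    "\<forall>s\<in>{s0 - \<delta><..<s0 + \<delta>}. \<forall>t\<in>{s0 - \<delta><..<s0 + \<delta>}. \<forall>q\<in>N. \<forall>k<n. \<forall>j.
      ((\<lambda>t. H k j (t - s, (s, \<phi> q))) has_real_derivative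
        - (\<Sum>l<n. G k l t (inv_into U \<phi> (\<Phi> (t - s, (s, \<phi> q)))) * H l j (t - s, (s, \<phi> q)))) (at t)"
proof -
  obtain U \<phi> M \<delta> and f :: "real \<times> 'm \<Rightarrow> 'm" and L xh where lo: "(U, \<phi>) \<in> A" "open M" "p0 \<in> M" "M \<subseteq> U" "\<delta> > 0"
    "{s0 - \<delta><..<s0 + \<delta>} \<subseteq> I" "smooth_on UNIV f" "\<forall>z w. norm (f z - f w) \<le> L * norm (z - w)"
    "\<forall>b\<in>B. smooth_fun A (xh b)" "\<forall>b\<in>B. \<forall>q\<in>M. xh b q = c b (\<phi> q)"
    "\<forall>s\<in>{s0 - \<delta><..<s0 + \<delta>}. \<forall>q\<in>M. f (s, \<phi> q) = (\<Sum>b\<in>B. X s q (xh b) *\<^sub>R b)"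
    "\<forall>g. tsmooth A I UNIV g \<longrightarrow> (\<exists>h. smooth_on UNIV h \<and> (\<forall>t\<in>{s0 - \<delta><..<s0 + \<delta>}. \<forall>q\<in>M. h (t, \<phi> q) = g t q))"
    by (rule local_ode[OF I X s0, of p0])
  \<comment> \<open>Time becomes a coordinate of speed 1. The equation is then autonomous, and the
    initial time turns into a smooth parameter of its flow.\<close>
  define V where "V z = (1::real, f z)" for z
  have Vs: "smooth_on UNIV V" unfolding V_def by (intro smooth_on_Pair smooth_on_const lo(7) open_UNIV)
  have VL: "norm (V x - V y) \<le> L * norm (x - y)" for x y
    using lo(8)[rule_format, of x y] by (simp add: V_def norm_Pair)
  obtain \<Psi> where \<Psi>: "smooth_on UNIV (\<lambda>z. \<Psi> (fst z) (snd z))" "\<And>x. \<Psi> 0 x = x"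
    "\<And>t x. ((\<lambda>t. \<Psi> t x) has_vector_derivative V (\<Psi> t x)) (at t)"
    by (rule flow_exists[OF fd2 Vs VL]) blast
  have fst\<Psi>: "fst (\<Psi> \<tau> z) = fst z + \<tau>" for \<tau> z
  proof (rule ode_unique[of 0 \<tau> _ "\<lambda>_ _. 1" "\<lambda>\<tau>. fst z + \<tau>" 0])
    show "((\<lambda>\<tau>. fst (\<Psi> \<tau> z)) has_vector_derivative 1) (at s)" for s
      using bounded_linear.has_vector_derivative[OF bounded_linear_fst \<Psi>(3)[where x=z and t=s]] by (simp add: V_def)
  qed (auto intro!: derivative_eq_intros simp: \<Psi>(2))
  define \<Phi> where "\<Phi> w = snd (\<Psi> (fst w) (snd w))" for w
  have \<Phi>s: "smooth_on UNIV \<Phi>" unfolding \<Phi>_def by (rule smooth_on_linear_comp[OF bounded_linear_snd open_UNIV \<Psi>(1)])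
  have \<Phi>': "((\<lambda>t. \<Phi> (t - s, (s, x))) has_vector_derivative f (t, \<Phi> (t - s, (s, x)))) (at t)" for s t x
  proof -
    have "((\<lambda>t. t - s) has_vector_derivative 1) (at t)" by (auto intro!: derivative_eq_intros)
    from vector_diff_chain_at[OF this, of "\<lambda>t. \<Psi> t (s, x)"] \<Psi>(3)[where x="(s, x)" and t="t - s"]
    have "((\<lambda>t. \<Psi> (t - s) (s, x)) has_vector_derivative V (\<Psi> (t - s) (s, x))) (at t)" by (simp add: o_def)
    from bounded_linear.has_vector_derivative[OF bounded_linear_snd this]
    have "((\<lambda>t. \<Phi> (t - s, (s, x))) has_vector_derivative f (\<Psi> (t - s) (s, x))) (at t)"
      by (simp add: \<Phi>_def V_def)
    moreover have "\<Psi> (t - s) (s, x) = (t, \<Phi> (t - s, (s, x)))"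
      using fst\<Psi>[of "t - s" "(s, x)"] by (simp add: \<Phi>_def prod_eq_iff)
    ultimately show ?thesis by simp
  qed
  have "\<exists>g. smooth_on UNIV g \<and> (\<forall>t\<in>{s0 - \<delta><..<s0 + \<delta>}. \<forall>q\<in>M. g (t, \<phi> q) = G k l t q)" if "k < n" "l < n" for k l
    using lo(12) G[OF that] by blast
  then obtain g where g: "\<And>k l. k < n \<Longrightarrow> l < n \<Longrightarrow> smooth_on UNIV (g k l)"
    "\<And>k l t q. k < n \<Longrightarrow> l < n \<Longrightarrow> t \<in> {s0 - \<delta><..<s0 + \<delta>} \<Longrightarrow> q \<in> M \<Longrightarrow> g k l (t, \<phi> q) = G k l t q" by metis
  \<comment> \<open>The minus sign is that of the transport equation in
    \<open>lift_coefficients\<close>.\<close>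
  have bs: "smooth_on UNIV (\<lambda>w. - g k l (\<Psi> (fst w) (snd w)))" if "k < n" "l < n" for k l
    by (intro smooth_on_minus open_UNIV smooth_on_comp[OF fd2 open_UNIV subset_UNIV \<Psi>(1) g(1)] that)
  obtain H where H: "\<And>k j. k < n \<Longrightarrow> smooth_on UNIV (H k j)" "\<And>k j z. H k j (0, z) = (if k = j then 1 else 0)"
    "\<And>k j t z. k < n \<Longrightarrow> ((\<lambda>t. H k j (t, z)) has_real_derivative (\<Sum>l<n. - g k l (\<Psi> t z) * H l j (t, z))) (at t)"
    by (rule linear_system_smooth[OF fd2, of n "\<lambda>k l w. - g k l (\<Psi> (fst w) (snd w))"]) (use bs in auto)
  have oM: "open (\<phi> ` M)" using chart_open_sub[OF lo(1,2)] lo(4) by (simp add: Int_absorb1)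
  have "open (\<Phi> -` (\<phi> ` M))"
    using smooth_on_continuous[OF \<Phi>s] oM by (rule open_vimage[rotated])
  moreover have "(0, (s0, \<phi> p0)) \<in> \<Phi> -` (\<phi> ` M)" using lo(3) by (simp add: \<Phi>_def \<Psi>(2))
  ultimately obtain T T' where T: "open T" "open T'" "0 \<in> T" "(s0, \<phi> p0) \<in> T'" "T \<times> T' \<subseteq> \<Phi> -` (\<phi> ` M)"
    using open_prod_elim by (metis mem_Sigma_iff)
  obtain P Q where PQ: "open P" "open Q" "s0 \<in> P" "\<phi> p0 \<in> Q" "P \<times> Q \<subseteq> T'"
    using open_prod_elim[OF T(2,4)] by (metis mem_Sigma_iff)
  obtain \<epsilon>1 where \<epsilon>1: "\<epsilon>1 > 0" "ball 0 \<epsilon>1 \<subseteq> T" using T(1,3) open_contains_ball by blast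
  obtain \<epsilon>2 where \<epsilon>2: "\<epsilon>2 > 0" "ball s0 \<epsilon>2 \<subseteq> P" using PQ(1,3) open_contains_ball by blast
  \<comment> \<open>The half accounts for s and t both ranging within \<open>\<delta>'\<close> of
    \<open>s0\<close>, so that their difference stays below \<open>\<epsilon>1\<close>.\<close>
  define \<delta>' where "\<delta>' = min \<delta> (min (\<epsilon>1 / 2) \<epsilon>2)"
  define N where "N = M \<inter> (U \<inter> \<phi> -` Q)"
  have oN: "open N" unfolding N_def
    using lo(2) continuous_open_preimage[OF chart_cont[OF lo(1)] chart_open[OF lo(1)] PQ(2)] by blast
  have \<delta>': "{s0 - \<delta>'<..<s0 + \<delta>'} \<subseteq> {s0 - \<delta><..<s0 + \<delta>}" by (auto simp: \<delta>'_def)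
  have inM: "\<Phi> (t - s, (s, \<phi> q)) \<in> \<phi> ` M"
    if "s \<in> {s0 - \<delta>'<..<s0 + \<delta>'}" "t \<in> {s0 - \<delta>'<..<s0 + \<delta>'}" "q \<in> N" for s t q
  proof -
    have "t - s \<in> ball 0 \<epsilon>1" "s \<in> ball s0 \<epsilon>2" using that by (auto simp: \<delta>'_def dist_real_def)
    then have "(t - s, (s, \<phi> q)) \<in> T \<times> T'" using \<epsilon>1 \<epsilon>2 PQ(5) that(3) by (auto simp: N_def)
    then show ?thesis using T(5) by blast
  qed
  show ?thesis
  proof (rule that[OF lo(1) oN, of \<delta>' \<Phi> H])
    show "p0 \<in> N" using lo(3,4) PQ(4) by (auto simp: N_def)
    show "N \<subseteq> U" by (auto simp: N_def)
    show "\<delta>' > 0" using lo(5) \<epsilon>1 \<epsilon>2 by (simp add: \<delta>'_def)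
    show "{s0 - \<delta>'<..<s0 + \<delta>'} \<subseteq> I" using \<delta>' lo(6) by blast
    show "\<forall>s\<in>{s0 - \<delta>'<..<s0 + \<delta>'}. \<forall>q\<in>N. \<Phi> (0, (s, \<phi> q)) = \<phi> q" by (simp add: \<Phi>_def \<Psi>(2))
    show "\<forall>s\<in>{s0 - \<delta>'<..<s0 + \<delta>'}. \<forall>t\<in>{s0 - \<delta>'<..<s0 + \<delta>'}. \<forall>q\<in>N. \<Phi> (t - s, (s, \<phi> q)) \<in> \<phi> ` U"
      using inM lo(4) by blast
    show "\<forall>s\<in>{s0 - \<delta>'<..<s0 + \<delta>'}. \<forall>q\<in>N. integral_curve {s0 - \<delta>'<..<s0 + \<delta>'} X (\<lambda>t. inv_into U \<phi> (\<Phi> (t - s, (s, \<phi> q))))"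
    proof (intro ballI integral_curve_of_chart[OF _ _ lo(1,2,4,9,10)])
      fix s q t assume s: "s \<in> {s0 - \<delta>'<..<s0 + \<delta>'}" and q: "q \<in> N" and t: "t \<in> {s0 - \<delta>'<..<s0 + \<delta>'}"
      show "\<Phi> (t - s, (s, \<phi> q)) \<in> \<phi> ` M" by (rule inM[OF s t q])
      let ?q = "inv_into U \<phi> (\<Phi> (t - s, (s, \<phi> q)))"
      have "?q \<in> M" "\<phi> ?q = \<Phi> (t - s, (s, \<phi> q))" using chart_inv_in[OF lo(1) inM[OF s t q] lo(4)] by auto
      then have "f (t, \<Phi> (t - s, (s, \<phi> q))) = (\<Sum>b\<in>B. X t ?q (xh b) *\<^sub>R b)"
        using lo(11)[rule_format, of t ?q] t \<delta>' by auto
      then show "((\<lambda>t. \<Phi> (t - s, (s, \<phi> q))) has_vector_derivative (\<Sum>b\<in>B. X t ?q (xh b) *\<^sub>R b)) (at t)"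
        using \<Phi>'[of s "\<phi> q" t] by simp
    next
      fix t p assume "t \<in> {s0 - \<delta>'<..<s0 + \<delta>'}"
      then have "t \<in> I" using \<delta>' lo(6) by blast
      then show "tangent_vector A p (X t p)" using X by (simp add: vfield_def)
    qed simp
    show "\<forall>s\<in>{s0 - \<delta>'<..<s0 + \<delta>'}. \<forall>t\<in>{s0 - \<delta>'<..<s0 + \<delta>'}. \<forall>q\<in>N. \<forall>k<n. \<forall>j.
      ((\<lambda>t. H k j (t - s, (s, \<phi> q))) has_real_derivative
        - (\<Sum>l<n. G k l t (inv_into U \<phi> (\<Phi> (t - s, (s, \<phi> q)))) * H l j (t - s, (s, \<phi> q)))) (at t)"
    proof (intro ballI allI impI)
      fix s t q k j assume s: "s \<in> {s0 - \<delta>'<..<s0 + \<delta>'}" and t: "t \<in> {s0 - \<delta>'<..<s0 + \<delta>'}" and q: "q \<in> N" and k: "k < n"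
      let ?q = "inv_into U \<phi> (\<Phi> (t - s, (s, \<phi> q)))"
      have "?q \<in> M" "\<phi> ?q = \<Phi> (t - s, (s, \<phi> q))" using chart_inv_in[OF lo(1) inM[OF s t q] lo(4)] by auto
      moreover have "\<Psi> (t - s) (s, \<phi> q) = (t, \<Phi> (t - s, (s, \<phi> q)))"
        using fst\<Psi>[of "t - s" "(s, \<phi> q)"] by (simp add: \<Phi>_def prod_eq_iff)
      ultimately have gG: "g k l (\<Psi> (t - s) (s, \<phi> q)) = G k l t ?q" if "l < n" for l
        using g(2)[OF k that, of t ?q] t \<delta>' by auto
      have "((\<lambda>t. H k j (t - s, (s, \<phi> q))) has_real_derivative
         (\<Sum>l<n. - g k l (\<Psi> (t - s) (s, \<phi> q)) * H l j (t - s, (s, \<phi> q))) * 1) (at t)"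
        by (rule DERIV_chain2[OF H(3)[OF k]]) (auto intro!: derivative_eq_intros)
      then show "((\<lambda>t. H k j (t - s, (s, \<phi> q))) has_real_derivative
        - (\<Sum>l<n. G k l t ?q * H l j (t - s, (s, \<phi> q)))) (at t)"
        using gG by (simp add: sum_negf)
    qed
  qed (use \<Phi>s H in auto)
qed

end

section \<open>The global flow, parallel transport over it, and the resulting automorphisms\<close>

section \<open>The flow of a time-dependent section\<close>

context smooth_mfd
begin

text \<open>Chart coordinates at the target are replaced by global functions agreeing with them
  nearby, and the pullbacks of these are smooth by hypothesis.\<close>

lemma smooth_map_pullback:
  assumes F: "continuous_on UNIV F" "\<And>f. smooth_fun A f \<Longrightarrow> smooth_fun A (\<lambda>q. f (F q))"
  shows "smooth_map A F"
  unfolding smooth_map_def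
proof (intro conjI F(1), clarify, rule smooth_on_local)
  fix U \<phi> V \<psi> x assume U: "(U, \<phi>) \<in> A" and V: "(V, \<psi>) \<in> A" and x: "x \<in> \<phi> ` (U \<inter> F -` V)"
  then obtain p where p: "x = \<phi> p" "p \<in> U" "F p \<in> V" by auto
  obtain xh N where xh: "\<And>b. b \<in> B \<Longrightarrow> smooth_fun A (xh b)" "open N" "F p \<in> N" "N \<subseteq> V \<inter> UNIV"
    "\<And>b q. b \<in> B \<Longrightarrow> q \<in> N \<Longrightarrow> xh b q = c b (\<psi> q)"
    by (rule coords_exist[OF V open_UNIV]) (use p in auto)
  let ?W = "\<phi> ` (U \<inter> F -` N)"
  have "open (F -` N)" using F(1) xh(2) by (simp add: continuous_on_open_vimage)
  then have o: "open ?W" by (rule chart_open_sub[OF U])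
  have "smooth_on ?W (\<lambda>y. \<Sum>b\<in>B. xh b (F (inv_into U \<phi> y)) *\<^sub>R b)"
    by (intro smooth_on_sum smooth_on_scaleR smooth_on_const o
          smooth_on_subset[OF smooth_fun_chart[OF F(2)[OF xh(1)] U]]) auto
  then have "smooth_on ?W (\<psi> \<circ> F \<circ> inv_into U \<phi>)"
  proof (rule smooth_on_cong_imp)
    fix y assume "y \<in> ?W"
    then have "F (inv_into U \<phi> y) \<in> N" using chart_inv[OF U] by auto
    then show "(\<Sum>b\<in>B. xh b (F (inv_into U \<phi> y)) *\<^sub>R b) = (\<psi> \<circ> F \<circ> inv_into U \<phi>) y"
      using expand[of "\<psi> (F (inv_into U \<phi> y))"] by (simp add: xh(5))
  qed
  then have "smooth_on (\<phi> ` (U \<inter> F -` V) \<inter> ?W) (\<psi> \<circ> F \<circ> inv_into U \<phi>)"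
    by (rule smooth_on_subset) auto
  moreover have "x \<in> ?W" using p xh(3) by auto
  ultimately show "\<exists>N. open N \<and> x \<in> N \<and> smooth_on (\<phi> ` (U \<inter> F -` V) \<inter> N) (\<psi> \<circ> F \<circ> inv_into U \<phi>)"
    using o by blast
qed

text \<open>Near each point a cutoff turns \<open>g\<close> into a global function, to which the
  hypothesis on pullbacks applies.\<close>

lemma smooth_fun_on_pullback:
  assumes F: "continuous_on UNIV F" "\<And>f. smooth_fun A f \<Longrightarrow> smooth_fun A (\<lambda>q. f (F q))"
    and W: "open W" and g: "smooth_fun_on A W g"
  shows "smooth_fun_on A (F -` W) (\<lambda>q. g (F q))"
proof -
  have oF: "open (F -` N)" if "open N" for N using F(1) that by (simp add: continuous_on_open_vimage)
  show ?thesis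
    unfolding smooth_fun_tsmooth[OF oF[OF W]]
  proof (rule tsmooth_local)
    fix p assume p: "p \<in> F -` W"
    obtain l N K where l: "smooth_fun A l" "open N" "F p \<in> N" "N \<subseteq> K" "K \<subseteq> W" "closed K"
      "\<And>q. q \<in> N \<Longrightarrow> l q = 1" "\<And>q. q \<notin> K \<Longrightarrow> l q = 0"
      by (rule cutoff_exists[OF W, of "F p"]) (use p in auto)
    have "smooth_fun A (\<lambda>q. if q \<in> W then l q * g q else 0)"
      unfolding smooth_fun_iff
      by (rule tsmooth_extend[OF open_UNIV W l(1,6,5,8)]) (use g in \<open>simp_all add: smooth_fun_tsmooth[OF W]\<close>)
    from F(2)[OF this] have "tsmooth A UNIV (F -` W \<inter> F -` N) (\<lambda>t q. if F q \<in> W then l (F q) * g (F q) else 0)"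
      unfolding smooth_fun_iff by (rule tsmooth_subset) auto
    then have "tsmooth A UNIV (F -` W \<inter> F -` N) (\<lambda>t q. g (F q))"
      by (rule tsmooth_cong[rotated]) (simp add: l(7))
    then show "\<exists>W'. open W' \<and> p \<in> W' \<and> tsmooth A UNIV (F -` W \<inter> W') (\<lambda>t q. g (F q))"
      using oF[OF l(2)] l(3) by blast
  qed
qed

end

context courant_gen
begin

text \<open>Any smooth local choice of coefficients in the generators will do; they need neither be
  unique nor match between neighbourhoods.\<close>

lemma tsection_generators:
  assumes I: "open I" and fib: "\<And>t p. t \<in> I \<Longrightarrow> s t p \<in> fib E p"
    and loc: "\<And>t p. t \<in> I \<Longrightarrow> \<exists>T W a. open T \<and> t \<in> T \<and> open W \<and> p \<in> W \<and> (\<forall>k<n. tsmooth A (I \<inter> T) W (a k)) \<and>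
      (\<forall>t\<in>I \<inter> T. \<forall>q\<in>W. s t q = (\<Sum>k<n. a k t q *\<^sub>R gs k q))"
  shows "tsection A E I s"
  unfolding tsection_def
proof (intro conjI ballI allI impI fib, assumption, clarify)
  fix U e i assume U: "(U, e) \<in> frames E" and i: "i < r"
  show "tsmooth A I U (\<lambda>t p. coord r e p (s t p) i)"
  proof (rule tsmooth_local_time)
    fix t p assume t: "t \<in> I" and p: "p \<in> U"
    obtain T W a where a: "open T" "t \<in> T" "open W" "p \<in> W" "\<forall>k<n. tsmooth A (I \<inter> T) W (a k)"
      "\<forall>t\<in>I \<inter> T. \<forall>q\<in>W. s t q = (\<Sum>k<n. a k t q *\<^sub>R gs k q)" using loc[OF t, of p] by (elim exE conjE)
    have o: "open (I \<inter> T)" "open (U \<inter> W)" using I a frame_open[OF U] by auto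
    have "tsmooth A (I \<inter> T) (U \<inter> W) (\<lambda>t q. \<Sum>k<n. a k t q * coord r e q (gs k q) i)"
    proof (intro tsmooth_sum tsmooth_mult o)
      fix k assume "k \<in> {..<n}"
      then have k: "k < n" by simp
      show "tsmooth A (I \<inter> T) (U \<inter> W) (a k)" using a(5) k by (auto intro: tsmooth_subset)
      show "tsmooth A (I \<inter> T) (U \<inter> W) (\<lambda>t q. coord r e q (gs k q) i)"
        by (rule tsmooth_subset[OF tsectionD(2)[OF sections_tsection[OF gs[OF k], of UNIV] U i]]) auto
    qed
    then have "tsmooth A (I \<inter> T) (U \<inter> W) (\<lambda>t p. coord r e p (s t p) i)"
    proof (rule tsmooth_cong[rotated])
      fix t q assume "t \<in> I \<inter> T" "q \<in> U \<inter> W"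
      then show "(\<Sum>k<n. a k t q * coord r e q (gs k q) i) = coord r e q (s t q) i"
        using a(6) coord_sum[OF U, of q "{..<n}" "\<lambda>k. a k t q *\<^sub>R gs k q"] coord_scale[OF U]
        by (simp add: gs_fib fib_scale)
    qed
    then show "\<exists>T W. open T \<and> t \<in> T \<and> open W \<and> p \<in> W \<and> tsmooth A (I \<inter> T) (U \<inter> W) (\<lambda>t p. coord r e p (s t p) i)"
      using a by blast
  qed
qed

end

context courant_time
begin

text \<open>The outcome of \<open>local_flow\<close> over \<open>N\<close>, but for the whole time
  interval \<open>I\<close>. That one interval serves all points is what compactness of the base
  will provide.\<close>

definition flow_box :: "'a set \<Rightarrow> ('a \<Rightarrow> 'm) \<Rightarrow> 'a set \<Rightarrow> (real \<times> real \<times> 'm \<Rightarrow> 'm) \<Rightarrow> (nat \<Rightarrow> nat \<Rightarrow> real \<times> real \<times> 'm \<Rightarrow> real) \<Rightarrow> bool" where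
  "flow_box U \<phi> N \<Phi> H \<longleftrightarrow> (U, \<phi>) \<in> A \<and> open N \<and> N \<subseteq> U \<and>
    smooth_on UNIV \<Phi> \<and> (\<forall>k<n. \<forall>j. smooth_on UNIV (H k j)) \<and>
    (\<forall>s\<in>I. \<forall>q\<in>N. \<Phi> (0, (s, \<phi> q)) = \<phi> q) \<and>
    (\<forall>s\<in>I. \<forall>t\<in>I. \<forall>q\<in>N. \<Phi> (t - s, (s, \<phi> q)) \<in> \<phi> ` U) \<and>
    (\<forall>s\<in>I. \<forall>q\<in>N. integral_curve I X (\<lambda>t. inv_into U \<phi> (\<Phi> (t - s, (s, \<phi> q))))) \<and>
    (\<forall>k j z. H k j (0, z) = (if k = j then 1 else 0)) \<and>
    (\<forall>s\<in>I. \<forall>t\<in>I. \<forall>q\<in>N. \<forall>k<n. \<forall>j.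
      ((\<lambda>t. H k j (t - s, (s, \<phi> q))) has_real_derivative
        - (\<Sum>l<n. Gm k l t (inv_into U \<phi> (\<Phi> (t - s, (s, \<phi> q)))) * H l j (t - s, (s, \<phi> q)))) (at t))"

lemma flow_boxD:
  assumes "flow_box U \<phi> N \<Phi> H"
  shows "(U, \<phi>) \<in> A" "open N" "N \<subseteq> U" "smooth_on UNIV \<Phi>" "k < n \<Longrightarrow> smooth_on UNIV (H k j)"
    "s \<in> I \<Longrightarrow> q \<in> N \<Longrightarrow> \<Phi> (0, (s, \<phi> q)) = \<phi> q"
    "s \<in> I \<Longrightarrow> t \<in> I \<Longrightarrow> q \<in> N \<Longrightarrow> \<Phi> (t - s, (s, \<phi> q)) \<in> \<phi> ` U"
    "s \<in> I \<Longrightarrow> q \<in> N \<Longrightarrow> integral_curve I X (\<lambda>t. inv_into U \<phi> (\<Phi> (t - s, (s, \<phi> q))))"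
    "H k j (0, z) = (if k = j then 1 else 0)"
    "s \<in> I \<Longrightarrow> t \<in> I \<Longrightarrow> q \<in> N \<Longrightarrow> k < n \<Longrightarrow> ((\<lambda>t. H k j (t - s, (s, \<phi> q))) has_real_derivative
        - (\<Sum>l<n. Gm k l t (inv_into U \<phi> (\<Phi> (t - s, (s, \<phi> q)))) * H l j (t - s, (s, \<phi> q)))) (at t)"
  using assms unfolding flow_box_def by blast+

end

locale courant_flow = courant_time A B c E n gs gc I e
  for A :: "('a::{t2_space, second_countable_topology}, 'm::{banach, heine_borel}) atlas" and B c
    and E :: "('a, 'v::real_vector) courant" and n gs gc I e +
  assumes flow_box_ex: "\<And>q0. \<exists>U \<phi> N \<Phi> H. q0 \<in> N \<and> flow_box U \<phi> N \<Phi> H"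
begin

text \<open>The motion from time s to time t. A whole curve is chosen and then evaluated; on
  \<open>I\<close> the choice is immaterial by uniqueness.\<close>

definition Fl :: "real \<Rightarrow> real \<Rightarrow> 'a \<Rightarrow> 'a" where
  "Fl s t q = (SOME \<gamma>. integral_curve I X \<gamma> \<and> \<gamma> s = q) t"

lemma
  assumes s: "s \<in> I"
  shows Fl_curve: "integral_curve I X (\<lambda>t. Fl s t q)" and Fl_start: "Fl s s q = q"
proof -
  obtain U \<phi> N \<Phi> H where q: "q \<in> N" and box: "flow_box U \<phi> N \<Phi> H" using flow_box_ex[of q] by (elim exE conjE)
  note b = flow_boxD[OF box]
  have "integral_curve I X (\<lambda>t. inv_into U \<phi> (\<Phi> (t - s, (s, \<phi> q)))) \<and> inv_into U \<phi> (\<Phi> (s - s, (s, \<phi> q))) = q"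
    using b(8)[OF s q] b(6)[OF s q] chart_inv[OF b(1)] q b(3) by auto
  then have "\<exists>\<gamma>. integral_curve I X \<gamma> \<and> \<gamma> s = q" by (intro exI[of _ "\<lambda>t. inv_into U \<phi> (\<Phi> (t - s, (s, \<phi> q)))"])
  from someI_ex[OF this]
  show "integral_curve I X (\<lambda>t. Fl s t q)" "Fl s s q = q" by (auto simp: Fl_def)
qed

lemma Fl_eq:
  assumes "integral_curve I X \<gamma>" "s \<in> I" "t \<in> I"
  shows "Fl s t (\<gamma> s) = \<gamma> t"
  by (rule integral_curve_unique[OF I vfield_X Fl_curve[OF assms(2)] assms(1,2) Fl_start[OF assms(2)] assms(3)])

lemma Fl_comp: "s \<in> I \<Longrightarrow> t \<in> I \<Longrightarrow> t' \<in> I \<Longrightarrow> Fl t t' (Fl s t q) = Fl s t' q"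
  by (rule Fl_eq[OF Fl_curve])

lemma Fl_inverse: "s \<in> I \<Longrightarrow> t \<in> I \<Longrightarrow> Fl t s (Fl s t q) = q"
  by (simp add: Fl_comp Fl_start)

lemma bij_Fl: "s \<in> I \<Longrightarrow> t \<in> I \<Longrightarrow> bij (Fl s t)"
  by (rule o_bij[of "Fl t s"]) (auto simp: Fl_inverse)

lemma inv_Fl: "s \<in> I \<Longrightarrow> t \<in> I \<Longrightarrow> inv (Fl s t) = Fl t s"
  by (rule inv_equality) (auto simp: Fl_inverse)

lemma Fl_local:
  assumes "flow_box U \<phi> N \<Phi> H" "s \<in> I" "t \<in> I" "q \<in> N"
  shows "Fl s t q = inv_into U \<phi> (\<Phi> (t - s, (s, \<phi> q)))"
  using Fl_eq[OF flow_boxD(8)[OF assms(1,2,4)] assms(2,3)] flow_boxD(6)[OF assms(1,2,4)]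
    chart_inv[OF flow_boxD(1)[OF assms(1)]] flow_boxD(3)[OF assms(1)] assms(4) by auto

text \<open>Here the starting time varies and the final time is fixed: dragged sections are
  evaluated by going back to a fixed time, and the argument for the anchor pulls functions back from
  a fixed time.\<close>

lemma Fl_smooth:
  assumes s: "s \<in> I" and f: "smooth_fun A f"
  shows "tsmooth A I UNIV (\<lambda>t q. f (Fl t s q))"
proof (rule tsmooth_local)
  fix q0 :: 'a
  obtain U \<phi> N \<Phi> H where q0: "q0 \<in> N" and box: "flow_box U \<phi> N \<Phi> H" using flow_box_ex[of q0] by (elim exE conjE)
  note b = flow_boxD[OF box]
  have oN: "open (\<phi> ` N)" using chart_open_sub[OF b(1,2)] b(3) by (simp add: Int_absorb1)
  then have o: "open (I \<times> \<phi> ` N)" by (rule open_Times[OF I(1)])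
  have "smooth_on (I \<times> \<phi> ` N) (\<lambda>z. (s - fst z, z))"
    by (intro smooth_on_Pair smooth_on_diff smooth_on_const smooth_on_linear[OF bounded_linear_fst]
        smooth_on_linear[OF bounded_linear_ident] o)
  from smooth_on_comp[OF fin_dim_prod[OF fin_dim_real fd2] o subset_UNIV this b(4)]
  have \<Phi>: "smooth_on (I \<times> \<phi> ` N) (\<lambda>z. \<Phi> (s - fst z, z))" .
  have "smooth_on (I \<times> \<phi> ` N) (\<lambda>z. f (inv_into U \<phi> (\<Phi> (s - fst z, z))))"
    by (rule smooth_on_comp[OF fd o _ \<Phi> smooth_fun_chart[OF f b(1)]]) (use b(7) s in auto)
  then have "smooth_on (I \<times> \<phi> ` N) (\<lambda>z. f (Fl (fst z) s (inv_into U \<phi> (snd z))))"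
  proof (rule smooth_on_cong_imp)
    fix z assume "z \<in> I \<times> \<phi> ` N"
    then obtain t q where z: "z = (t, \<phi> q)" "t \<in> I" "q \<in> N" by auto
    then show "f (inv_into U \<phi> (\<Phi> (s - fst z, z))) = f (Fl (fst z) s (inv_into U \<phi> (snd z)))"
      using Fl_local[OF box z(2) s z(3)] chart_inv[OF b(1)] b(3) by auto
  qed
  then have "tsmooth A I N (\<lambda>t q. f (Fl t s q))" by (rule tsmooth_chartI[OF b(1,2,3) I(1)])
  then show "\<exists>W'. open W' \<and> q0 \<in> W' \<and> tsmooth A I (UNIV \<inter> W') (\<lambda>t q. f (Fl t s q))"
    using b(2) q0 by (intro exI[of _ N]) simp
qed

lemma Fl_smooth_fun: "s \<in> I \<Longrightarrow> t \<in> I \<Longrightarrow> smooth_fun A f \<Longrightarrow> smooth_fun A (\<lambda>q. f (Fl s t q))"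
  using tsmooth_slice[OF open_UNIV Fl_smooth] by blast

lemma Fl_continuous:
  assumes s: "s \<in> I"
  shows "continuous_on (I \<times> UNIV) (\<lambda>z. Fl (fst z) s (snd z))"
proof -
  have "\<exists>N. open N \<and> q0 \<in> N \<and> continuous_on (I \<times> N) (\<lambda>z. Fl (fst z) s (snd z))" for q0
  proof -
    obtain U \<phi> N \<Phi> H where q0: "q0 \<in> N" and box: "flow_box U \<phi> N \<Phi> H" using flow_box_ex[of q0] by (elim exE conjE)
    note b = flow_boxD[OF box]
    have "continuous_on (I \<times> N) (\<lambda>z. \<phi> (snd z))"
      by (rule continuous_on_compose2[OF chart_cont[OF b(1)]]) (use b(3) in \<open>auto intro: continuous_intros\<close>)
    then have "continuous_on (I \<times> N) (\<lambda>z. (s - fst z, (fst z, \<phi> (snd z))))" by (intro continuous_intros)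
    from continuous_on_compose2[OF smooth_on_continuous[OF b(4)] this]
    have "continuous_on (I \<times> N) (\<lambda>z. \<Phi> (s - fst z, (fst z, \<phi> (snd z))))" by simp
    then have "continuous_on (I \<times> N) (\<lambda>z. inv_into U \<phi> (\<Phi> (s - fst z, (fst z, \<phi> (snd z)))))"
      by (rule continuous_on_compose2[OF chart_inv_cont[OF b(1)]]) (use b(7) s in auto)
    then have "continuous_on (I \<times> N) (\<lambda>z. Fl (fst z) s (snd z))"
      by (rule continuous_on_eq) (use Fl_local[OF box _ s] in auto)
    then show ?thesis using b(2) q0 by blast
  qed
  then have "\<forall>q0. \<exists>N. open N \<and> q0 \<in> N \<and> continuous_on (I \<times> N) (\<lambda>z. Fl (fst z) s (snd z))" ..
  from choice[OF this] obtain N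
    where N: "\<forall>q. open (N q) \<and> q \<in> N q \<and> continuous_on (I \<times> N q) (\<lambda>z. Fl (fst z) s (snd z))" by (elim exE)
  have "continuous_on (\<Union>q. I \<times> N q) (\<lambda>z. Fl (fst z) s (snd z))"
    by (rule continuous_on_open_UN) (use N in \<open>auto intro: open_Times I(1)\<close>)
  moreover have "(\<Union>q. I \<times> N q) = I \<times> UNIV" using N by auto
  ultimately show ?thesis by simp
qed

lemma Fl_continuous_space:
  assumes s: "s \<in> I" and t: "t \<in> I"
  shows "continuous_on UNIV (Fl s t)"
proof -
  have "continuous_on UNIV (\<lambda>q::'a. (s, q))" by (intro continuous_intros)
  from continuous_on_compose2[OF Fl_continuous[OF t] this] show ?thesis using s by auto
qed

end

context courant_mfd
begin

text \<open>Unlike the notion it implies (lemma \<open>smooth_auto_courant\<close>), this one is visibly closed under composition,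
  since smoothness is expressed through the action on functions and sections.\<close>

definition smooth_auto :: "('a \<Rightarrow> 'a) \<Rightarrow> ('a \<Rightarrow> 'v \<Rightarrow> 'v) \<Rightarrow> bool" where
  "smooth_auto F \<phi> \<longleftrightarrow> bij F \<and> continuous_on UNIV F \<and> continuous_on UNIV (inv F) \<and>
     (\<forall>f. smooth_fun A f \<longrightarrow> smooth_fun A (\<lambda>q. f (F q)) \<and> smooth_fun A (\<lambda>q. f (inv F q))) \<and>
     (\<forall>p. linear_between (fib E p) (fib E (F p)) (\<phi> p) \<and> bij_betw (\<phi> p) (fib E p) (fib E (F p))) \<and>
     (\<forall>a\<in>\<Gamma>. pushforward F \<phi> a \<in> \<Gamma>) \<and>
     (\<forall>p. \<forall>x\<in>fib E p. \<forall>y\<in>fib E p. pr (F p) (\<phi> p x) (\<phi> p y) = pr p x y) \<and>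
     (\<forall>a\<in>\<Gamma>. \<forall>b\<in>\<Gamma>. bracket E (pushforward F \<phi> a) (pushforward F \<phi> b) = pushforward F \<phi> (bracket E a b)) \<and>
     (\<forall>p. \<forall>x\<in>fib E p. \<forall>f. smooth_fun A f \<longrightarrow> an (F p) (\<phi> p x) f = an p x (\<lambda>q. f (F q)))"

lemma smooth_autoD:
  assumes "smooth_auto F \<phi>"
  shows "bij F" "continuous_on UNIV F" "continuous_on UNIV (inv F)"
    "smooth_fun A f \<Longrightarrow> smooth_fun A (\<lambda>q. f (F q))" "smooth_fun A f \<Longrightarrow> smooth_fun A (\<lambda>q. f (inv F q))"
    "linear_between (fib E p) (fib E (F p)) (\<phi> p)" "bij_betw (\<phi> p) (fib E p) (fib E (F p))"
    "a \<in> \<Gamma> \<Longrightarrow> pushforward F \<phi> a \<in> \<Gamma>"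
    "x \<in> fib E p \<Longrightarrow> y \<in> fib E p \<Longrightarrow> pr (F p) (\<phi> p x) (\<phi> p y) = pr p x y"
    "a \<in> \<Gamma> \<Longrightarrow> b \<in> \<Gamma> \<Longrightarrow> bracket E (pushforward F \<phi> a) (pushforward F \<phi> b) = pushforward F \<phi> (bracket E a b)"
    "x \<in> fib E p \<Longrightarrow> smooth_fun A f \<Longrightarrow> an (F p) (\<phi> p x) f = an p x (\<lambda>q. f (F q))"
  using assms unfolding smooth_auto_def by simp_all

lemma smooth_auto_fib: "smooth_auto F \<phi> \<Longrightarrow> x \<in> fib E p \<Longrightarrow> \<phi> p x \<in> fib E (F p)"
  using smooth_autoD(6) unfolding linear_between_def by blast

text \<open>A frame section is extended by a cutoff to a global section, whose pushforward is
  smooth; pulling its coordinates back along \<open>F\<close> gives the required expression near any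
  point.\<close>

lemma smooth_auto_courant:
  assumes "smooth_auto F \<phi>"
  shows "courant_auto A E F \<phi>"
proof -
  note F = smooth_autoD(1-3)[OF assms] and sm = smooth_autoD(4,5)[OF assms]
    and lin = smooth_autoD(6,7)[OF assms] and push = smooth_autoD(8)[OF assms]
  have oF: "open (F -` N)" if "open N" for N using F(2) that by (simp add: continuous_on_open_vimage)
  have fr: "smooth_fun_on A (U \<inter> F -` V) (\<lambda>p. coord r h (F p) (\<phi> p (e i p)) j)"
    if U: "(U, e) \<in> frames E" and V: "(V, h) \<in> frames E" and ij: "i < r" "j < r" for U e V h i j
  proof -
    have o: "open (U \<inter> F -` V)" using frame_open[OF U] oF[OF frame_open[OF V]] by auto
    show ?thesis
      unfolding smooth_fun_tsmooth[OF o]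
    proof (rule tsmooth_local)
      fix p assume p: "p \<in> U \<inter> F -` V"
      obtain l N K where l: "smooth_fun A l" "open N" "p \<in> N" "N \<subseteq> K" "K \<subseteq> U" "closed K"
        "\<And>q. q \<in> N \<Longrightarrow> l q = 1" "\<And>q. q \<notin> K \<Longrightarrow> l q = 0"
        by (rule cutoff_exists[OF frame_open[OF U], of p]) (use p in auto)
      define a where "a q = (if q \<in> U then l q *\<^sub>R e i q else 0)" for q
      have a: "a \<in> \<Gamma>" unfolding a_def by (rule section_extend[OF U l(1,6,5,8) ij(1)])
      have "smooth_fun_on A V (\<lambda>q. coord r h q (pushforward F \<phi> a q) j)"
        unfolding smooth_fun_tsmooth[OF frame_open[OF V]]
        using tsectionD(2)[OF sections_tsection[OF push[OF a]] V ij(2)] .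
      from smooth_fun_on_pullback[OF F(2) sm(1) frame_open[OF V] this]
      have "tsmooth A UNIV (F -` V) (\<lambda>t q. coord r h (F q) (pushforward F \<phi> a (F q)) j)"
        unfolding smooth_fun_tsmooth[OF oF[OF frame_open[OF V]]] .
      then have "tsmooth A UNIV (U \<inter> F -` V \<inter> N) (\<lambda>t q. coord r h (F q) (pushforward F \<phi> a (F q)) j)"
        by (rule tsmooth_subset) auto
      then have "tsmooth A UNIV (U \<inter> F -` V \<inter> N) (\<lambda>t q. coord r h (F q) (\<phi> q (e i q)) j)"
        by (rule tsmooth_cong[rotated]) (simp add: pushforward_def a_def l(7) bij_is_inj[OF F(1)])
      then show "\<exists>W'. open W' \<and> p \<in> W' \<and> tsmooth A UNIV (U \<inter> F -` V \<inter> W') (\<lambda>t q. coord r h (F q) (\<phi> q (e i q)) j)"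
        using l(2,3) by blast
    qed
  qed
  have "bundle_auto A E F \<phi>"
    unfolding bundle_auto_def diffeo_def
    using F lin fr smooth_map_pullback[OF F(2) sm(1)] smooth_map_pullback[OF F(3) sm(2)] by blast
  then show ?thesis
    using assms unfolding courant_auto_def smooth_auto_def by (simp add: o_def)
qed

lemma smooth_auto_compose:
  assumes \<phi>: "smooth_auto F \<phi>" and \<psi>: "smooth_auto G \<psi>"
  shows "smooth_auto (\<lambda>p. G (F p)) (\<lambda>p x. \<psi> (F p) (\<phi> p x))"
proof -
  note F = smooth_autoD[OF \<phi>] and G = smooth_autoD[OF \<psi>]
  note m = smooth_auto_fib[OF \<phi>]
  have inv: "inv (\<lambda>p. G (F p)) = (\<lambda>q. inv F (inv G q))"
    using o_inv_distrib[OF G(1) F(1)] by (simp add: o_def)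
  have push: "pushforward (\<lambda>p. G (F p)) (\<lambda>p x. \<psi> (F p) (\<phi> p x)) a = pushforward G \<psi> (pushforward F \<phi> a)" for a
    by (simp add: pushforward_def inv surj_f_inv_f[OF bij_is_surj[OF F(1)]])
  show ?thesis
    unfolding smooth_auto_def inv push
  proof (intro conjI allI ballI impI)
    show "bij (\<lambda>p. G (F p))" using bij_comp[OF F(1) G(1)] by (simp add: o_def)
    show "continuous_on UNIV (\<lambda>p. G (F p))" "continuous_on UNIV (\<lambda>q. inv F (inv G q))"
      using continuous_on_compose2[OF G(2) F(2)] continuous_on_compose2[OF F(3) G(3)] by auto
    show "smooth_fun A (\<lambda>q. f (G (F q)))" if "smooth_fun A f" for f by (rule F(4)[OF G(4)[OF that]])
    show "smooth_fun A (\<lambda>q. f (inv F (inv G q)))" if "smooth_fun A f" for f by (rule G(5)[OF F(5)[OF that]])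
    show "linear_between (fib E p) (fib E (G (F p))) (\<lambda>x. \<psi> (F p) (\<phi> p x))" for p
      using F(6)[of p] G(6)[of "F p"] unfolding linear_between_def by simp
    show "bij_betw (\<lambda>x. \<psi> (F p) (\<phi> p x)) (fib E p) (fib E (G (F p)))" for p
      using bij_betw_trans[OF F(7)[of p] G(7)[of "F p"]] by (simp add: o_def)
  qed (simp_all add: F(4,8-11) G(4,8-11) m)
qed

end

context courant_flow
begin

subsection \<open>Parallel transport covering the flow\<close>

lemma lift_cong:
  assumes u: "lift \<gamma> u" and eq: "\<And>t. t \<in> I \<Longrightarrow> \<gamma> t = \<eta> t" "\<And>t. t \<in> I \<Longrightarrow> u t = v t"
  shows "lift \<eta> v"
  unfolding lift_def
proof (intro ballI conjI allI impI)
  fix t assume t: "t \<in> I"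
  show "v t \<in> fib E (\<eta> t)" using lift_fib[OF u t] eq[OF t] by simp
  fix b assume b: "tsection A E I b"
  have "((\<lambda>s. pr (\<gamma> s) (u s) (b s (\<gamma> s))) has_real_derivative pr (\<eta> t) (v t) (Dt b t (\<eta> t))) (at t)"
    using lift_deriv[OF u t b] eq[OF t] by simp
  then show "((\<lambda>s. pr (\<eta> s) (v s) (b s (\<eta> s))) has_real_derivative pr (\<eta> t) (v t) (Dt b t (\<eta> t))) (at t)"
    by (rule has_field_derivative_transform_within_open[OF _ I(1) t]) (simp add: eq)
qed

text \<open>Transport of the vector x over q from time s to time t. As for \<open>Fl\<close>, a
  whole lift is chosen, and \<open>lift_unique\<close> determines it on \<open>I\<close>.\<close>

definition ph :: "real \<Rightarrow> real \<Rightarrow> 'a \<Rightarrow> 'v \<Rightarrow> 'v" where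
  "ph s t q x = (SOME u. lift (\<lambda>t. Fl s t q) u \<and> u s = x) t"

text \<open>In a box the lift is explicit: the fundamental matrix \<open>H\<close> applied to the
  generator coefficients of the initial vector.\<close>

lemma lift_local:
  assumes box: "flow_box U \<phi> N \<Phi> H" and s: "s \<in> I" and q: "q \<in> N" and x: "x \<in> fib E q"
  defines "u \<equiv> \<lambda>t. \<Sum>k<n. (\<Sum>j<n. H k j (t - s, (s, \<phi> q)) * gc j q x) *\<^sub>R gs k (Fl s t q)"
  shows "lift (\<lambda>t. Fl s t q) u" and "u s = x"
proof -
  note b = flow_boxD[OF box]
  show "lift (\<lambda>t. Fl s t q) u"
    unfolding u_def
  proof (rule lift_coefficients[OF Fl_curve[OF s]])
    fix k t assume k: "k < n" and t: "t \<in> I"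
    have "((\<lambda>t. \<Sum>j<n. H k j (t - s, (s, \<phi> q)) * gc j q x) has_real_derivative
       (\<Sum>j<n. - (\<Sum>l<n. Gm k l t (Fl s t q) * H l j (t - s, (s, \<phi> q))) * gc j q x)) (at t)"
      unfolding Fl_local[OF box s t q] by (intro DERIV_sum DERIV_cmult_right b(10) s t q k)
    also have "(\<Sum>j<n. - (\<Sum>l<n. Gm k l t (Fl s t q) * H l j (t - s, (s, \<phi> q))) * gc j q x) =
        - (\<Sum>l<n. Gm k l t (Fl s t q) * (\<Sum>j<n. H l j (t - s, (s, \<phi> q)) * gc j q x))"
      by (simp add: sum_negf sum_distrib_left sum_distrib_right mult_ac) (rule sum.swap)
    finally show "((\<lambda>t. \<Sum>j<n. H k j (t - s, (s, \<phi> q)) * gc j q x) has_real_derivative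
       - (\<Sum>l<n. Gm k l t (Fl s t q) * (\<Sum>j<n. H l j (t - s, (s, \<phi> q)) * gc j q x))) (at t)" .
  qed
  have "(\<Sum>j<n. H k j (0, (s, \<phi> q)) * gc j q x) = gc k q x" if "k < n" for k
    using that by (simp add: b(9) if_distrib[of "\<lambda>y. y * _"] cong: if_cong)
  then show "u s = x" using gc_expand[OF x] by (simp add: u_def Fl_start[OF s])
qed

lemma
  assumes s: "s \<in> I" and x: "x \<in> fib E q"
  shows ph_lift: "lift (\<lambda>t. Fl s t q) (\<lambda>t. ph s t q x)" and ph_start: "ph s s q x = x"
proof -
  obtain U \<phi> N \<Phi> H where q: "q \<in> N" and box: "flow_box U \<phi> N \<Phi> H" using flow_box_ex[of q] by (elim exE conjE)
  have "\<exists>u. lift (\<lambda>t. Fl s t q) u \<and> u s = x" using lift_local[OF box s q x] by blast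
  from someI_ex[OF this]
  show "lift (\<lambda>t. Fl s t q) (\<lambda>t. ph s t q x)" "ph s s q x = x" by (auto simp: ph_def)
qed

lemma ph_fib: "s \<in> I \<Longrightarrow> t \<in> I \<Longrightarrow> x \<in> fib E q \<Longrightarrow> ph s t q x \<in> fib E (Fl s t q)"
  by (rule lift_fib[OF ph_lift])

text \<open>Every lift is the transport of its value at one time; composition, inversion and
  linearity of \<open>ph\<close> are special cases.\<close>

lemma ph_eq:
  assumes \<gamma>: "integral_curve I X \<gamma>" and u: "lift \<gamma> u" and s: "s \<in> I" and t: "t \<in> I"
  shows "ph s t (\<gamma> s) (u s) = u t"
proof -
  have "lift \<gamma> (\<lambda>t. ph s t (\<gamma> s) (u s))"
    by (rule lift_cong[OF ph_lift[OF s lift_fib[OF u s]]]) (auto simp: Fl_eq[OF \<gamma> s])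
  from lift_unique[OF \<gamma> this u s ph_start[OF s lift_fib[OF u s]] t] show ?thesis .
qed

lemma ph_comp: "s \<in> I \<Longrightarrow> t \<in> I \<Longrightarrow> t' \<in> I \<Longrightarrow> x \<in> fib E q \<Longrightarrow> ph t t' (Fl s t q) (ph s t q x) = ph s t' q x"
  by (rule ph_eq[OF Fl_curve ph_lift])

lemma ph_inverse: "s \<in> I \<Longrightarrow> t \<in> I \<Longrightarrow> x \<in> fib E q \<Longrightarrow> ph t s (Fl s t q) (ph s t q x) = x"
  by (simp add: ph_comp ph_start)

lemma ph_linear:
  assumes s: "s \<in> I" and t: "t \<in> I"
  shows "linear_between (fib E q) (fib E (Fl s t q)) (ph s t q)"
proof -
  have "ph s t q (k *\<^sub>R x + l *\<^sub>R y) = k *\<^sub>R ph s t q x + l *\<^sub>R ph s t q y"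
    if "x \<in> fib E q" "y \<in> fib E q" for k l x y
    using ph_eq[OF Fl_curve[OF s] lift_combine[OF ph_lift[OF s that(1)] ph_lift[OF s that(2)]] s t, of k l]
    by (simp add: ph_start[OF s] Fl_start[OF s] that)
  from this[of _ _ 1 1] this[of _ 0 _ 0] show ?thesis
    unfolding linear_between_def using ph_fib[OF s t] fib_0 by auto
qed

lemma ph_bij:
  assumes s: "s \<in> I" and t: "t \<in> I"
  shows "bij_betw (ph s t q) (fib E q) (fib E (Fl s t q))"
proof (rule bij_betwI[where g = "ph t s (Fl s t q)"])
  show "ph t s (Fl s t q) \<in> fib E (Fl s t q) \<rightarrow> fib E q"
    using ph_fib[OF t s, of _ "Fl s t q"] by (simp add: Fl_inverse[OF s t])
  show "ph s t q (ph t s (Fl s t q) y) = y" if "y \<in> fib E (Fl s t q)" for y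
    using ph_inverse[OF t s that] by (simp add: Fl_inverse[OF s t])
qed (use s t ph_fib ph_inverse in auto)

text \<open>The section at time t obtained by dragging \<open>a\<close> along from time s;
  \<open>Fl t s q\<close> is the point that arrives at q.\<close>

definition par :: "real \<Rightarrow> ('a \<Rightarrow> 'v) \<Rightarrow> real \<Rightarrow> 'a \<Rightarrow> 'v" where
  "par s a t q = ph s t (Fl t s q) (a (Fl t s q))"

lemma pushforward_Fl: "s \<in> I \<Longrightarrow> t \<in> I \<Longrightarrow> pushforward (Fl s t) (ph s t) a = par s a t"
  by (simp add: pushforward_def par_def inv_Fl fun_eq_iff)

lemma par_start: "s \<in> I \<Longrightarrow> a \<in> \<Gamma> \<Longrightarrow> par s a s = a"
  by (simp add: par_def fun_eq_iff Fl_start ph_start sections_fib)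

lemma par_Fl: "s \<in> I \<Longrightarrow> t \<in> I \<Longrightarrow> par s a t (Fl s t p) = ph s t p (a p)"
  by (simp add: par_def Fl_inverse)

lemma par_lift: "s \<in> I \<Longrightarrow> a \<in> \<Gamma> \<Longrightarrow> lift (\<lambda>t. Fl s t p) (\<lambda>t. par s a t (Fl s t p))"
  by (rule lift_cong[OF ph_lift]) (auto simp: par_Fl sections_fib)

text \<open>Near a given time and point the backward flow lands in one box, where
  \<open>lift_local\<close> provides smooth coefficients in the generators.\<close>

lemma par_tsection:
  assumes s: "s \<in> I" and a: "a \<in> \<Gamma>"
  shows "tsection A E I (par s a)"
proof (rule tsection_generators[OF I(1)])
  show "par s a t p \<in> fib E p" if "t \<in> I" for t p
    using ph_fib[OF s that sections_fib[OF a], of "Fl t s p"] by (simp add: par_def Fl_inverse[OF that s])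
  fix t0 q0 assume t0: "t0 \<in> I"
  let ?p0 = "Fl t0 s q0"
  obtain U \<phi> N \<Phi> H where p0: "?p0 \<in> N" and box: "flow_box U \<phi> N \<Phi> H" using flow_box_ex[of ?p0] by (elim exE conjE)
  note b = flow_boxD[OF box]
  obtain xh N' where xh: "\<And>b. b \<in> B \<Longrightarrow> smooth_fun A (xh b)" "open N'" "?p0 \<in> N'" "N' \<subseteq> U \<inter> N"
    "\<And>b q. b \<in> B \<Longrightarrow> q \<in> N' \<Longrightarrow> xh b q = c b (\<phi> q)"
    by (rule coords_exist[OF b(1,2)]) (use p0 b(3) in auto)
  let ?S = "(I \<times> UNIV) \<inter> (\<lambda>z. Fl (fst z) s (snd z)) -` N'"
  have "open ?S"
    by (rule continuous_open_preimage[OF Fl_continuous[OF s] _ xh(2)]) (simp add: I(1) open_Times)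
  moreover have "(t0, q0) \<in> ?S" using t0 xh(3) by simp
  ultimately obtain T W where TW: "open T" "open W" "(t0, q0) \<in> T \<times> W" "T \<times> W \<subseteq> ?S"
    by (rule open_prod_elim)
  \<comment> \<open>The chart coordinate of \<open>Fl t s q\<close> is expressed by the global
    functions \<open>xh\<close>, which makes \<open>co\<close> smooth everywhere; it has the
    intended meaning as long as the backward flow lands in \<open>N'\<close>.\<close>
  define co where "co k t q = (\<Sum>j<n. H k j (t - s, (s, \<Sum>b\<in>B. xh b (Fl t s q) *\<^sub>R b)) * gc j (Fl t s q) (a (Fl t s q)))"
    for k t q
  have "tsmooth A I UNIV (co k)" if k: "k < n" for k
    unfolding co_def
  proof (intro tsmooth_sum tsmooth_mult I(1) open_UNIV)
    fix j assume "j \<in> {..<n}"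
    then have j: "j < n" by simp
    have "smooth_fun A (\<lambda>p. gc j p (a p))"
      unfolding smooth_fun_iff by (rule gc_smooth[OF open_UNIV sections_tsection[OF a] j])
    from Fl_smooth[OF s this]
    show "tsmooth A I UNIV (\<lambda>t q. gc j (Fl t s q) (a (Fl t s q)))" .
    show "tsmooth A I UNIV (\<lambda>t q. H k j (t - s, (s, \<Sum>b\<in>B. xh b (Fl t s q) *\<^sub>R b)))"
      unfolding tsmooth_def
    proof clarify
      fix V \<psi> assume V: "(V, \<psi>) \<in> A"
      let ?Q = "I \<times> \<psi> ` (V \<inter> UNIV)"
      have o: "open ?Q" by (rule open_chart_box[OF V I(1) open_UNIV])
      have "smooth_on ?Q (\<lambda>z. (fst z - s, (s, \<Sum>b\<in>B. xh b (Fl (fst z) s (inv_into V \<psi> (snd z))) *\<^sub>R b)))"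
        by (intro smooth_on_Pair smooth_on_diff smooth_on_const smooth_on_linear[OF bounded_linear_fst] smooth_on_sum
            smooth_on_scaleR tsmoothD[OF Fl_smooth[OF s xh(1)] V] o)
      from smooth_on_comp[OF fin_dim_prod[OF fin_dim_real fd2] o subset_UNIV this b(5)[OF k, of j]]
      show "smooth_on ?Q (\<lambda>z. H k j (fst z - s, (s, \<Sum>b\<in>B. xh b (Fl (fst z) s (inv_into V \<psi> (snd z))) *\<^sub>R b)))" .
    qed
  qed
  then have "\<forall>k<n. tsmooth A (I \<inter> T) W (co k)" by (auto intro: tsmooth_subset)
  moreover have "par s a t q = (\<Sum>k<n. co k t q *\<^sub>R gs k q)" if t: "t \<in> I \<inter> T" and q: "q \<in> W" for t q
  proof -
    let ?p = "Fl t s q"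
    have p: "?p \<in> N'" using TW(4) t q by auto
    then have pN: "?p \<in> N" and e: "(\<Sum>b\<in>B. xh b ?p *\<^sub>R b) = \<phi> ?p"
      using xh(4,5) expand[of "\<phi> ?p"] by auto
    have af: "a ?p \<in> fib E ?p" by (rule sections_fib[OF a])
    have tI: "t \<in> I" using t by simp
    have "par s a t q = (\<Sum>k<n. (\<Sum>j<n. H k j (t - s, (s, \<phi> ?p)) * gc j ?p (a ?p)) *\<^sub>R gs k (Fl s t ?p))"
      unfolding par_def
      using ph_eq[OF Fl_curve[OF s] lift_local(1)[OF box s pN af] s tI] lift_local(2)[OF box s pN af]
      by (simp add: Fl_start[OF s])
    then show ?thesis by (simp add: co_def e Fl_inverse[OF tI s])
  qed
  ultimately show "\<exists>T W a'. open T \<and> t0 \<in> T \<and> open W \<and> q0 \<in> W \<and> (\<forall>k<n. tsmooth A (I \<inter> T) W (a' k)) \<and>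
      (\<forall>t\<in>I \<inter> T. \<forall>q\<in>W. par s a t q = (\<Sum>k<n. a' k t q *\<^sub>R gs k q))"
    using TW by blast
qed

text \<open>The pairing with a fixed section along the flow line through q is differentiated twice,
  by the product rule and by the lift property. Comparison leaves the pairing of
  \<open>Dt (par s a) t q\<close> with an arbitrary vector equal to 0.\<close>

lemma Dt_par:
  assumes s: "s \<in> I" and a: "a \<in> \<Gamma>" and t: "t \<in> I"
  shows "Dt (par s a) t q = 0"
proof -
  let ?p = "Fl t s q"
  have q: "Fl s t ?p = q" by (rule Fl_inverse[OF t s])
  have fib: "Dt (par s a) t q \<in> fib E q" by (rule tsectionD(1)[OF tsection_Dt[OF par_tsection[OF s a]] t])
  show ?thesis
  proof (rule pr_nondeg[OF fib])
    fix z assume "z \<in> fib E q"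
    then obtain b where b: "b \<in> \<Gamma>" "b q = z" by (rule section_through)
    have "pr q (Dt (par s a) t q) z + pr q (par s a t q) (Dt (\<lambda>t. b) t q) = pr q (par s a t q) (Dt (\<lambda>t. b) t q)"
      using DERIV_unique[OF pair_along[OF Fl_curve[OF s] par_tsection[OF s a] sections_tsection[OF b(1)] t, of ?p]
          lift_deriv[OF par_lift[OF s a] t sections_tsection[OF b(1)], of ?p]] b(2) by (simp add: q)
    then show "pr q (Dt (par s a) t q) z = 0" by simp
  qed
qed

lemma zero_derivative_constant:
  assumes "\<And>t. t \<in> I \<Longrightarrow> (f has_real_derivative 0) (at t)" "s \<in> I" "t \<in> I"
  shows "f t = f s"
proof -
  have "\<exists>k. \<forall>t\<in>I. f t = k"
    using I(2) assms(1) by (intro has_field_derivative_zero_constant)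
      (auto simp: is_interval_convex_1 intro: has_field_derivative_at_within)
  then show ?thesis using assms by auto
qed

text \<open>Both vectors are extended to sections. The dragged sections are parallel, so their
  pairing has derivative 0 along the flow line.\<close>

lemma ph_pairing:
  assumes s: "s \<in> I" and t: "t \<in> I" and x: "x \<in> fib E p" and y: "y \<in> fib E p"
  shows "pr (Fl s t p) (ph s t p x) (ph s t p y) = pr p x y"
proof -
  obtain a where a: "a \<in> \<Gamma>" "a p = x" using x by (rule section_through)
  obtain b where b: "b \<in> \<Gamma>" "b p = y" using y by (rule section_through)
  let ?f = "\<lambda>t. pr (Fl s t p) (par s a t (Fl s t p)) (par s b t (Fl s t p))"
  have "?f t = ?f s"
  proof (rule zero_derivative_constant[OF _ s t])
    fix t assume t: "t \<in> I"
    show "(?f has_real_derivative 0) (at t)"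
      using pair_along[OF Fl_curve[OF s] par_tsection[OF s a(1)] par_tsection[OF s b(1)] t, of p]
        tsectionD(1)[OF par_tsection[OF s a(1)] t] tsectionD(1)[OF par_tsection[OF s b(1)] t]
      by (simp add: Dt_par[OF s _ t] a b pr_zero)
  qed
  then show ?thesis using a b s t by (simp add: par_Fl par_start Fl_start)
qed

text \<open>By \<open>Dt_bracket\<close> the bracket of two dragged sections is parallel. It agrees
  at time s with the dragged bracket, and lifts are unique.\<close>

lemma par_bracket:
  assumes s: "s \<in> I" and t: "t \<in> I" and a: "a \<in> \<Gamma>" and b: "b \<in> \<Gamma>"
  shows "bracket E (par s a t) (par s b t) = par s (bracket E a b) t"
proof
  fix q
  let ?p = "Fl t s q"
  note pa = par_tsection[OF s a] and pb = par_tsection[OF s b]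
  have z: "bracket E (par s a t) (\<lambda>q. 0) p = 0" "bracket E (\<lambda>q. 0) (par s b t) p = 0" if t: "t \<in> I" for t p
    using bracket_zero_r tsection_sections[OF I(1) pa t] tsection_sections[OF I(1) pb t]
      bracket_skew[of "\<lambda>q. 0" "par s b t" p] tsection_sections[OF I(1) tsection_zero[OF I(1)] t] by auto
  have "Dt (\<lambda>t. bracket E (par s a t) (par s b t)) t p = 0" if t: "t \<in> I" for t p
  proof -
    have "Dt (par s a) t = (\<lambda>q. 0)" "Dt (par s b) t = (\<lambda>q. 0)" using Dt_par[OF s _ t] a b by auto
    then show ?thesis using Dt_bracket[OF pa pb t, of p] z[OF t] by simp
  qed
  from parallel_lift[OF Fl_curve[OF s] bracket_time(1)[OF I(1) pa pb] this]
  have l: "lift (\<lambda>t. Fl s t ?p) (\<lambda>t. bracket E (par s a t) (par s b t) (Fl s t ?p))" .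
  have "bracket E (par s a t) (par s b t) (Fl s t ?p) = par s (bracket E a b) t (Fl s t ?p)"
    by (rule lift_unique[OF Fl_curve[OF s] l par_lift[OF s bracket_sec[OF a b]] s _ t])
       (simp add: par_start s a b bracket_sec)
  then show "bracket E (par s a t) (par s b t) q = par s (bracket E a b) t q"
    by (simp add: Fl_inverse[OF t s])
qed

text \<open>The pullback \<open>h v\<close> of \<open>f\<close> from time t to time v is constant
  along flow lines, so time derivative plus anchor field annihilate it. As the dragged section is
  parallel, \<open>Dt_anchor\<close> makes \<open>?g\<close> constant; its values at t and at s are
  the two sides.\<close>

lemma ph_anchor:
  assumes s: "s \<in> I" and t: "t \<in> I" and x: "x \<in> fib E p" and f: "smooth_fun A f"
  shows "an (Fl s t p) (ph s t p x) f = an p x (\<lambda>q. f (Fl s t q))"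
proof -
  obtain a where a: "a \<in> \<Gamma>" "a p = x" using x by (rule section_through)
  note pa = par_tsection[OF s a(1)]
  define h where "h = (\<lambda>v q. f (Fl v t q))"
  have h: "tsmooth A I UNIV h" unfolding h_def by (rule Fl_smooth[OF t f])
  have inv: "deriv (\<lambda>v. h v q) v + X v q (h v) = 0" if v: "v \<in> I" for v q
  proof -
    have "((\<lambda>w. h w (Fl v w q)) has_real_derivative deriv (\<lambda>w. h w q) v + X v q (h v)) (at v)"
      using integral_curve_chain[OF I(1) vfield_X Fl_curve[OF v] v h, of q] by (simp add: Fl_start[OF v])
    then have "((\<lambda>w. f (Fl v t q)) has_real_derivative deriv (\<lambda>w. h w q) v + X v q (h v)) (at v)"
      by (rule has_field_derivative_transform_within_open[OF _ I(1) v]) (simp add: h_def Fl_comp v t)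
    then show ?thesis using DERIV_unique[OF DERIV_const] by metis
  qed
  let ?g = "\<lambda>v. an (Fl s v p) (par s a v (Fl s v p)) (h v)"
  have "?g t = ?g s"
  proof (rule zero_derivative_constant[OF _ s t])
    fix v assume v: "v \<in> I"
    have ff: "par s a v (Fl s v p) \<in> fib E (Fl s v p)" by (rule tsectionD(1)[OF pa v])
    have hv: "smooth_fun A (h v)" by (rule tsmooth_slice[OF open_UNIV h v])
    have "an (Fl s v p) 0 (h v) = 0" using an_scale[OF hv fib_0, of "Fl s v p" 0] by simp
    then show "(?g has_real_derivative 0) (at v)"
      using integral_curve_chain[OF I(1) vfield_X Fl_curve[OF s] v tsmooth_anchor[OF I(1) pa h], of p]
        Dt_anchor[OF pa h v, of "Fl s v p"] tangent_vector_const[OF an_tangent[OF ff], of 0]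
      by (simp add: inv[OF v] Dt_par[OF s a(1) v])
  qed
  moreover have "h t = f" using Fl_start[OF t] by (simp add: h_def)
  moreover have "h s = (\<lambda>q. f (Fl s t q))" by (simp add: h_def)
  ultimately show ?thesis using a s t by (simp add: par_Fl par_start Fl_start)
qed

lemma smooth_auto_Fl:
  assumes s: "s \<in> I" and t: "t \<in> I"
  shows "smooth_auto (Fl s t) (ph s t)"
  unfolding smooth_auto_def inv_Fl[OF s t] pushforward_Fl[OF s t]
  using s t tsection_sections[OF I(1) par_tsection]
  by (simp add: bij_Fl Fl_continuous_space Fl_smooth_fun ph_linear ph_bij ph_pairing par_bracket ph_anchor)

text \<open>Skewness moves \<open>J t\<close> to the test section, where it commutes with
  \<open>Dt\<close>. Hence \<open>J\<close> applied to a lift is again a lift, the one starting from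
  \<open>J s p x\<close>.\<close>

lemma ph_commutes:
  assumes J: "\<And>t p. t \<in> I \<Longrightarrow> linear_between (fib E p) (fib E p) (J t p)"
    and skew: "\<And>t p x y. t \<in> I \<Longrightarrow> x \<in> fib E p \<Longrightarrow> y \<in> fib E p \<Longrightarrow> pr p (J t p x) y = - pr p x (J t p y)"
    and sec: "\<And>b. tsection A E I b \<Longrightarrow> tsection A E I (\<lambda>t p. J t p (b t p))"
    and par: "\<And>b t p. tsection A E I b \<Longrightarrow> t \<in> I \<Longrightarrow> Dt (\<lambda>t p. J t p (b t p)) t p = J t p (Dt b t p)"
    and s: "s \<in> I" and t: "t \<in> I" and x: "x \<in> fib E p"
  shows "J t (Fl s t p) (ph s t p x) = ph s t p (J s p x)"
proof -
  have Jf: "J t p x \<in> fib E p" if "t \<in> I" "x \<in> fib E p" for t p x using J that unfolding linear_between_def by blast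
  have "lift (\<lambda>t. Fl s t p) (\<lambda>t. J t (Fl s t p) (ph s t p x))"
    unfolding lift_def
  proof (intro ballI conjI allI impI)
    fix t assume t: "t \<in> I"
    show "J t (Fl s t p) (ph s t p x) \<in> fib E (Fl s t p)" by (rule Jf[OF t ph_fib[OF s t x]])
    fix b assume b: "tsection A E I b"
    have "((\<lambda>v. - pr (Fl s v p) (ph s v p x) (J v (Fl s v p) (b v (Fl s v p)))) has_real_derivative
        - pr (Fl s t p) (ph s t p x) (J t (Fl s t p) (Dt b t (Fl s t p)))) (at t)"
      using DERIV_minus[OF lift_deriv[OF ph_lift[OF s x] t sec[OF b]]] by (simp add: par[OF b t])
    then have "((\<lambda>v. pr (Fl s v p) (J v (Fl s v p) (ph s v p x)) (b v (Fl s v p))) has_real_derivative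
        - pr (Fl s t p) (ph s t p x) (J t (Fl s t p) (Dt b t (Fl s t p)))) (at t)"
      by (rule has_field_derivative_transform_within_open[OF _ I(1) t])
         (simp add: skew ph_fib[OF s _ x] tsectionD(1)[OF b])
    then show "((\<lambda>v. pr (Fl s v p) (J v (Fl s v p) (ph s v p x)) (b v (Fl s v p))) has_real_derivative
        pr (Fl s t p) (J t (Fl s t p) (ph s t p x)) (Dt b t (Fl s t p))) (at t)"
      by (simp add: skew[OF t] ph_fib[OF s t x] tsectionD(1)[OF tsection_Dt[OF b] t])
  qed
  from ph_eq[OF Fl_curve[OF s] this s t] show ?thesis by (simp add: ph_start[OF s x] Fl_start[OF s])
qed

end

section \<open>From the exactness equation to the Dorfman derivative of a generalized complex
  structure\<close>

section \<open>Paths of generalized complex structures\<close>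

context courant_mfd
begin

lemma coord_endo:
  assumes lin: "linear_between (fib E p) (fib E p) K" and U: "(U, e) \<in> frames E" "p \<in> U" and x: "x \<in> fib E p"
  shows "coord r e p (K x) j = (\<Sum>i<r. coord r e p x i * coord r e p (K (e i p)) j)"
proof -
  note l = lin[unfolded linear_between_def]
  have "coord r e p (K (\<Sum>i<r. coord r e p x i *\<^sub>R e i p)) j = (\<Sum>i<r. coord r e p x i * coord r e p (K (e i p)) j)"
    by (rule functional_sum[where p = p and f = "\<lambda>x. coord r e p (K x) j"])
       (use l frame_in[OF U] in \<open>simp_all add: coord_add[OF U] coord_scale[OF U]\<close>)
  then show ?thesis using coord_expand[OF U x] by simp
qed

lemma endo_tsection:
  assumes I: "open I" and lin: "\<And>t p. t \<in> I \<Longrightarrow> linear_between (fib E p) (fib E p) (K t p)"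
    and sm: "\<And>U e i j. (U, e) \<in> frames E \<Longrightarrow> i < r \<Longrightarrow> j < r \<Longrightarrow> tsmooth A I U (\<lambda>t p. coord r e p (K t p (e i p)) j)"
    and b: "tsection A E I b"
  shows "tsection A E I (\<lambda>t p. K t p (b t p))"
  unfolding tsection_def
proof (intro conjI ballI allI impI, goal_cases)
  case (1 t p)
  then show ?case using lin[of t p] tsectionD(1)[OF b] unfolding linear_between_def by blast
next
  case (2 z)
  obtain U e where z: "z = (U, e)" by (cases z)
  have U: "(U, e) \<in> frames E" using 2 z by simp
  show ?case unfolding z
  proof (clarify)
    fix j assume j: "j < r"
    have "tsmooth A I U (\<lambda>t p. \<Sum>i<r. coord r e p (b t p) i * coord r e p (K t p (e i p)) j)"
      by (intro tsmooth_sum tsmooth_mult I frame_open[OF U] tsectionD(2)[OF b U] sm[OF U _ j]) auto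
    then show "tsmooth A I U (\<lambda>t p. coord r e p (K t p (b t p)) j)"
      by (rule tsmooth_cong[rotated]) (simp add: coord_endo[OF lin U] tsectionD(1)[OF b])
  qed
qed

lemma gen_complexD:
  assumes "gen_complex A E J"
  shows "linear_between (fib E p) (fib E p) (J p)"
    and "x \<in> fib E p \<Longrightarrow> J p x \<in> fib E p" "x \<in> fib E p \<Longrightarrow> J p (J p x) = - x"
    and "x \<in> fib E p \<Longrightarrow> J p (- x) = - J p x"
    and "x \<in> fib E p \<Longrightarrow> y \<in> fib E p \<Longrightarrow> pr p (J p x) (J p y) = pr p x y"
    and "x \<in> fib E p \<Longrightarrow> y \<in> fib E p \<Longrightarrow> pr p (J p x) y = - pr p x (J p y)"
    and "a \<in> \<Gamma> \<Longrightarrow> (\<lambda>p. J p (a p)) \<in> \<Gamma>"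
    and "a \<in> \<Gamma> \<Longrightarrow> b \<in> \<Gamma> \<Longrightarrow> bracket E (\<lambda>q. J q (a q)) (\<lambda>q. J q (b q)) p - bracket E a b p
        = J p (bracket E (\<lambda>q. J q (a q)) b p + bracket E a (\<lambda>q. J q (b q)) p)"
proof -
  have J: "bundle_endo A E J" "\<And>p x. x \<in> fib E p \<Longrightarrow> J p (J p x) = - x"
    "\<And>p x y. x \<in> fib E p \<Longrightarrow> y \<in> fib E p \<Longrightarrow> pr p (J p x) (J p y) = pr p x y"
    using assms unfolding gen_complex_def by blast+
  have l: "linear_between (fib E p) (fib E p) (J p)" for p using J(1) unfolding bundle_endo_def by blast
  then show "linear_between (fib E p) (fib E p) (J p)" .
  have f: "J p x \<in> fib E p" if "x \<in> fib E p" for p x using l[of p] that unfolding linear_between_def by blast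
  then show "x \<in> fib E p \<Longrightarrow> J p x \<in> fib E p" .
  show "x \<in> fib E p \<Longrightarrow> J p (J p x) = - x" by (rule J(2))
  have "J p ((-1) *\<^sub>R x) = (-1) *\<^sub>R J p x" if "x \<in> fib E p" for p x
    using l[of p] that unfolding linear_between_def by blast
  then show m: "J p (- x) = - J p x" if "x \<in> fib E p" for p x using that by simp
  show "x \<in> fib E p \<Longrightarrow> y \<in> fib E p \<Longrightarrow> pr p (J p x) (J p y) = pr p x y" by (rule J(3))
  show "pr p (J p x) y = - pr p x (J p y)" if "x \<in> fib E p" "y \<in> fib E p"
    using J(3)[OF that(1) f[OF that(2)]] that f[OF that(1)] pr_scale[of "J p x" p y "-1"] by (simp add: J(2))
  show "(\<lambda>p. J p (a p)) \<in> \<Gamma>" if "a \<in> \<Gamma>"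
    unfolding sections_iff
  proof (rule endo_tsection[OF open_UNIV l])
    fix U e i j assume U: "(U, e) \<in> frames E" "i < r" "j < r"
    then have "smooth_fun_on A U (\<lambda>p. coord r e p (J p (e i p)) j)" using J(1) unfolding bundle_endo_def by blast
    then show "tsmooth A UNIV U (\<lambda>t p. coord r e p (J p (e i p)) j)" by (simp add: smooth_fun_tsmooth[OF frame_open[OF U(1)]])
  qed (use that in \<open>simp add: sections_iff\<close>)
  show "bracket E (\<lambda>q. J q (a q)) (\<lambda>q. J q (b q)) p - bracket E a b p
        = J p (bracket E (\<lambda>q. J q (a q)) b p + bracket E a (\<lambda>q. J q (b q)) p)" if "a \<in> \<Gamma>" "b \<in> \<Gamma>"
    using assms that unfolding gen_complex_def by (simp add: algebra_simps)
qed

lemma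
  assumes "a \<in> \<Gamma>" "b \<in> \<Gamma>"
  shows bracket_minus_r: "bracket E a (\<lambda>q. - b q) p = - bracket E a b p"
    and bracket_minus_l: "bracket E (\<lambda>q. - a q) b p = - bracket E a b p"
proof -
  have r: "bracket E a (\<lambda>q. - b q) p = - bracket E a b p" if "a \<in> \<Gamma>" "b \<in> \<Gamma>" for a b
    using bracket_scale_r[OF that, of "-1" p] by simp
  show "bracket E a (\<lambda>q. - b q) p = - bracket E a b p" by (rule r[OF assms])
  show "bracket E (\<lambda>q. - a q) b p = - bracket E a b p"
    using bracket_skew[OF sections_minus[OF assms(1)] assms(2), of p] r[OF assms(2,1)] bracket_skew[OF assms, of p] by simp
qed

lemma dorf_cmult_l:
  assumes a: "a \<in> \<Gamma>" and b: "b \<in> \<Gamma>"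
  shows "dorf (\<lambda>q. k *\<^sub>R a q) b p = k *\<^sub>R dorf a b p"
proof -
  have ka: "(\<lambda>q. k *\<^sub>R a q) \<in> \<Gamma>" by (rule sections_scale[OF a smooth_fun_const])
  have "pair_sec E (\<lambda>q. k *\<^sub>R a q) b = (\<lambda>q. k * pair_sec E a b q)"
    using a b by (auto simp: pair_sec_def pl_scale sections_fib)
  then show ?thesis
    using bracket_skew[OF ka b, of p] bracket_scale_r[OF b a, of k p] bracket_skew[OF a b, of p]
    by (simp add: dorf_def Dop_cmult pair_sec_smooth a b algebra_simps)
qed

text \<open>The real part of \<open>\<omega>\<^sub>K = d\<^sub>L \<xi>\<close>, evaluated on \<open>x - i J x\<close> and \<open>z - i J z\<close>, expresses \<open>K\<close> as the Dorfman
  derivative of \<open>J\<close> along the imaginary part of the section representing \<open>\<xi>\<close>.\<close>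

lemma endo_eq_dorf_derivative:
  assumes J: "gen_complex A E J"
    and K: "\<And>p x. x \<in> fib E p \<Longrightarrow> K p x \<in> fib E p"
      "\<And>p x y. x \<in> fib E p \<Longrightarrow> y \<in> fib E p \<Longrightarrow> pr p (K p x) y = - pr p x (K p y)"
      "\<And>p x. x \<in> fib E p \<Longrightarrow> K p (J p x) = - J p (K p x)"
    and b: "\<And>p. b p \<in> Lbar E J p" "(\<lambda>p. snd (b p)) \<in> \<Gamma>"
    and \<xi>: "\<And>p v. v \<in> Lbun E J p \<Longrightarrow> \<xi> p v = pairing_C E p (b p) v"
    and d: "\<And>v w p. v \<in> L_sections A E J \<Longrightarrow> w \<in> L_sections A E J \<Longrightarrow>
        pairing_C E p (v p) (map_prod (K p) (K p) (w p)) = d_L E \<xi> v w p"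
    and x: "x \<in> \<Gamma>"
  defines "y \<equiv> \<lambda>p. snd (b p)"
  shows "K p (x p) = dorf y (\<lambda>q. J q (x q)) p - J p (dorf y x p)"
proof -
  note JD = gen_complexD[OF J]
  have y: "y \<in> \<Gamma>" using b(2) by (simp add: y_def)
  have yb: "snd (b p) = y p" for p by (simp add: y_def)
  \<comment> \<open>The eigenvalue condition gives the representing section the form
    \<open>- J y + i y\<close>, so its imaginary part y determines it.\<close>
  have b1: "fst (b p) = - J p (y p)" for p
    using b(1)[of p] by (auto simp: eigenbundle_def cscale_def y_def map_prod_def split: prod.splits)
  \<comment> \<open>The vector \<open>u - i J u\<close> is twice the projection of the real vector u
    to the +i-eigenbundle.\<close>
  have inL: "(u, - J q u) \<in> Lbun E J q" if "u \<in> fib E q" for q u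
    using that JD(2)[OF that] JD(3)[OF that] by (auto simp: eigenbundle_def cscale_def fib_neg JD(4))
  have \<xi>': "\<xi> q (u, - J q u) = Complex (2 * pr q (y q) (J q u)) (2 * pr q (y q) u)" if u: "u \<in> fib E q" for q u
  proof -
    have yq: "y q \<in> fib E q" by (rule sections_fib[OF y])
    have "pr q (- J q (y q)) v = - pr q (J q (y q)) v" if "v \<in> fib E q" for v
      using pl_scale[OF that JD(2)[OF yq], of "-1"] by simp
    moreover have "pr q v (- J q u) = - pr q v (J q u)" if "v \<in> fib E q" for v
      using pr_scale[OF that JD(2)[OF u], of "-1"] by simp
    ultimately show ?thesis
      unfolding \<xi>[OF inL[OF u]] pairing_C_def b1
      using JD(5,6)[OF yq u] yq u JD(2) by (simp add: yb fib_neg)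
  qed
  let ?s = "\<lambda>x q. (x q, - J q (x q))"
  have sL: "?s x \<in> L_sections A E J" if "x \<in> \<Gamma>" for x
    using that inL sections_fib[OF that] sections_minus[OF JD(7)[OF that]] by (simp add: L_sections_def o_def)
  show ?thesis
  proof (rule fib_eqI)
    show "K p (x p) \<in> fib E p" by (rule K(1)[OF sections_fib[OF x]])
    show "dorf y (\<lambda>q. J q (x q)) p - J p (dorf y x p) \<in> fib E p"
      by (intro fib_diff JD(2) sections_fib[OF dorf_sec] y x JD(7))
    fix z0 assume "z0 \<in> fib E p"
    then obtain z where z: "z \<in> \<Gamma>" "z p = z0" by (rule section_through)
    define jx where "jx = (\<lambda>q. J q (x q))"
    define jz where "jz = (\<lambda>q. J q (z q))"
    have jx: "jx \<in> \<Gamma>" unfolding jx_def by (rule JD(7)[OF x])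
    have jz: "jz \<in> \<Gamma>" unfolding jz_def by (rule JD(7)[OF z(1)])
    have f: "x p \<in> fib E p" "z p \<in> fib E p" "jx p \<in> fib E p" "jz p \<in> fib E p" "y p \<in> fib E p"
      using x z(1) jx jz y sections_fib by blast+
    have Jx: "J p (x p) = jx p" "J p (z p) = jz p" by (simp_all add: jx_def jz_def)
    \<comment> \<open>The complex bracket of the two sections is \<open>(g, - s)\<close>;
      integrability will say that \<open>g = - J s\<close>, which places it in the
      +i-eigenbundle.\<close>
    define s where "s = bracket E jx z p + bracket E x jz p"
    define g where "g = bracket E x z p - bracket E jx jz p"
    have sf: "s \<in> fib E p" "g \<in> fib E p"
      unfolding s_def g_def by (intro fib_add fib_diff sections_fib[OF bracket_sec] x z(1) jx jz)+
    have "bracket E jx jz p - bracket E x z p = J p s"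
      unfolding s_def jx_def jz_def by (rule JD(8)[OF x z(1)])
    then have g: "g = - J p s" by (simp add: g_def algebra_simps)
    have Jg: "J p g = s" unfolding g using JD(3,4) sf(1) JD(2)[OF sf(1)] by simp
    have br: "bracket_C E (?s x) (?s z) p = (g, - J p g)"
    proof -
      have "bracket_C E (\<lambda>q. (x q, - jx q)) (\<lambda>q. (z q, - jz q)) p = (g, - s)"
        using bracket_minus_r[OF x jz, of p] bracket_minus_l[OF jx z(1), of p]
          bracket_minus_r[OF sections_minus[OF jx] jz, of p] bracket_minus_l[OF jx jz, of p]
        by (simp add: bracket_C_def o_def g_def s_def)
      then show ?thesis by (simp only: Jg) (simp only: jx_def jz_def)
    qed
    have R: "Re \<circ> (\<lambda>q. \<xi> q (?s u q)) = (\<lambda>q. 2 * pair_sec E y (\<lambda>q. J q (u q)) q)"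
      "Im \<circ> (\<lambda>q. \<xi> q (?s u q)) = (\<lambda>q. 2 * pair_sec E y u q)" if "u \<in> \<Gamma>" for u
      using \<xi>'[OF sections_fib[OF that]] by (auto simp: pair_sec_def)
    have an2: "an p u (\<lambda>q. 2 * pair_sec E y v q) = 2 * an p u (pair_sec E y v)"
      "an p (- u) (\<lambda>q. 2 * pair_sec E y v q) = - 2 * an p u (pair_sec E y v)"
      if "u \<in> fib E p" "v \<in> \<Gamma>" for u v
    proof -
      note sv = pair_sec_smooth[OF y that(2)]
      show e: "an p u (\<lambda>q. 2 * pair_sec E y v q) = 2 * an p u (pair_sec E y v)"
        by (rule tangent_vectorD(3)[OF an_tangent[OF that(1)] sv])
      show "an p (- u) (\<lambda>q. 2 * pair_sec E y v q) = - 2 * an p u (pair_sec E y v)"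
        using an_scale[OF smooth_fun_mult[OF smooth_fun_const[of 2] sv] that(1), of "-1"] e by simp
    qed
    have "Re (d_L E \<xi> (?s x) (?s z) p) = 2 * an p (x p) (pair_sec E y jz) + 2 * an p (jx p) (pair_sec E y z)
        - 2 * an p (z p) (pair_sec E y jx) - 2 * an p (jz p) (pair_sec E y x) - 2 * pr p (y p) s"
      unfolding d_L_def anchor_C_def R[OF x] R[OF z(1)] jx_def[symmetric] jz_def[symmetric] br[unfolded Jg]
      using f x z(1) jx jz by (simp add: an2 \<xi>'[OF sf(2), unfolded Jg] Jx)
    moreover have "Re (pairing_C E p (?s x p) (map_prod (K p) (K p) (?s z p))) = 2 * pr p (x p) (K p (z p))"
    proof -
      \<comment> \<open>The hypotheses on \<open>K\<close> give its anticommutation with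
        \<open>J\<close> but no additivity, so signs are produced as \<open>J\<close> applied
        twice.\<close>
      have "K p (- jz p) = J p (K p (z p))"
      proof -
        have "- jz p = J p (J p (jz p))" using JD(3)[OF f(4)] by simp
        then have "K p (- jz p) = - J p (K p (J p (jz p)))" using K(3)[OF JD(2)[OF f(4)]] by simp
        also have "J p (jz p) = - z p" unfolding jz_def by (rule JD(3)[OF f(2)])
        also have "- z p = J p (J p (z p))" using JD(3)[OF f(2)] by simp
        also have "K p (J p (J p (z p))) = - J p (K p (J p (z p)))" by (rule K(3)[OF JD(2)[OF f(2)]])
        also have "K p (J p (z p)) = - J p (K p (z p))" by (rule K(3)[OF f(2)])
        finally show ?thesis using JD(2,3,4) K(1)[OF f(2)] by (simp add: fib_neg)
      qed
      moreover have "pr p (- jx p) (J p (K p (z p))) = - pr p (x p) (K p (z p))"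
        using pl_scale[OF JD(2)[OF K(1)[OF f(2)]] f(3), of "-1"] JD(5)[OF f(1) K(1)[OF f(2)]] by (simp add: jx_def)
      ultimately show ?thesis by (simp add: pairing_C_def Jx)
    qed
    ultimately have 1: "pr p (x p) (K p (z p)) = an p (x p) (pair_sec E y jz) + an p (jx p) (pair_sec E y z)
        - an p (z p) (pair_sec E y jx) - an p (jz p) (pair_sec E y x) - pr p (y p) s"
      using d[OF sL[OF x] sL[OF z(1)], of p] by simp
    \<comment> \<open>Trades an anchor term for Dorfman brackets, using invariance of the pairing
      and \<open>dorf_sym\<close>. Applied to the pairs \<open>x\<close>, \<open>jz\<close> and
      \<open>jx\<close>, \<open>z\<close>, its remaining anchor terms cancel the two negative ones
      in fact \<open>1\<close>.\<close>
    have 2: "an p (u p) (pair_sec E y v) = - pr p (dorf y u p) (v p) + an p (v p) (pair_sec E y u) + pr p (y p) (dorf u v p)"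
      if u: "u \<in> \<Gamma>" and v: "v \<in> \<Gamma>" for u v
    proof -
      have D: "Dop E (pair_sec E u y) p \<in> fib E p" "2 * pr p (Dop E (pair_sec E u y) p) (v p) = an p (v p) (pair_sec E u y)"
        using Dop_char(1)[OF pair_sec_smooth[OF u y]] Dop_char(2)[OF pair_sec_smooth[OF u y] sections_fib[OF v]] by (simp_all add: mult.commute)
      have "dorf u y p = 2 *\<^sub>R Dop E (pair_sec E u y) p - dorf y u p" by (rule dorf_sym[OF u y])
      then have "pr p (dorf u y p) (v p) = an p (v p) (pair_sec E u y) - pr p (dorf y u p) (v p)"
        using D pl_diff[OF sections_fib[OF v] fib_scale[OF D(1)] sections_fib[OF dorf_sec[OF y u]]]
          pl_scale[OF sections_fib[OF v] D(1)] by simp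
      then show ?thesis
        using dorf_pair[OF u y v, of p] pair_sec_sym[OF u y] by (simp add: lie_der_def)
    qed
    \<comment> \<open>The exact terms of the two brackets cancel because \<open>J\<close> is skew,
      so s may be written with Dorfman brackets.\<close>
    have s: "s = dorf jx z p + dorf x jz p"
    proof -
      have "pair_sec E jx z = (\<lambda>q. - pair_sec E x jz q)"
        using JD(6) x z(1) by (auto simp: pair_sec_def jx_def jz_def sections_fib)
      then have "Dop E (pair_sec E jx z) p = - Dop E (pair_sec E x jz) p"
        using Dop_cmult[OF pair_sec_smooth[OF x jz], of "-1" p] by simp
      then show ?thesis by (simp add: s_def dorf_def)
    qed
    have ys: "pr p (y p) s = pr p (y p) (dorf jx z p) + pr p (y p) (dorf x jz p)"
      unfolding s by (intro pr_add f sections_fib[OF dorf_sec] x z(1) jx jz)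
    have "pr p (x p) (K p (z p)) = - pr p (dorf y x p) (jz p) - pr p (dorf y jx p) (z p)"
      using 1 2[OF x jz] 2[OF jx z(1)] ys by simp
    moreover have "pr p (dorf y jx p - J p (dorf y x p)) (z p) = pr p (dorf y jx p) (z p) - pr p (J p (dorf y x p)) (z p)"
      by (intro pl_diff f sections_fib[OF dorf_sec] JD(2) y x jx)
    moreover have "pr p (J p (dorf y x p)) (z p) = - pr p (dorf y x p) (jz p)"
      unfolding jz_def by (intro JD(6) f sections_fib[OF dorf_sec] y x)
    ultimately show "pr p (K p (x p)) z0 = pr p (dorf y (\<lambda>q. J q (x q)) p - J p (dorf y x p)) z0"
      using K(2)[OF f(1,2)] unfolding z(2)[symmetric] jx_def by simp
  qed
qed

end

text \<open>Derivatives at the ends of [0,1] are one-sided, but still unique.\<close>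

lemma has_derivative_within_unit_unique:
  fixes f g :: "real \<Rightarrow> real"
  assumes "t \<in> {0..1}" "(f has_real_derivative a) (at t within {0..1})" "(g has_real_derivative b) (at t within {0..1})"
    and "\<And>s. s \<in> {0..1} \<Longrightarrow> f s = g s"
  shows "a = b"
proof -
  have "(f has_vector_derivative a) (at t within cbox 0 1)"
    using assms(2) by (simp add: has_real_derivative_iff_has_vector_derivative)
  moreover have "(f has_vector_derivative b) (at t within cbox 0 1)"
    using has_field_derivative_transform_within[OF assms(3) zero_less_one assms(1), of f] assms(4)
    by (simp add: has_real_derivative_iff_has_vector_derivative)
  ultimately show ?thesis
    using assms(1) by (intro vector_derivative_unique_within_closed_interval[of 0 1 t f]) auto
qed

context smooth_mfd
begin

text \<open>Smoothness on a time set that is not open means a local smooth extension, whose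
  derivative restricts to the time set; at an end of [0,1] it becomes one-sided.\<close>

lemma tsmooth_has_derivative_within:
  assumes g: "tsmooth A I W g" and t: "t \<in> I" and p: "p \<in> W"
  shows "\<exists>D. ((\<lambda>s. g s p) has_real_derivative D) (at t within I)"
proof -
  obtain U \<phi> where U: "(U, \<phi>) \<in> A" "p \<in> U" using chart_ex by blast
  have "(t, \<phi> p) \<in> I \<times> \<phi> ` (U \<inter> W)" using t p U(2) by auto
  with tsmoothD[OF g U(1)] obtain V h where V: "open V" "(t, \<phi> p) \<in> V" "\<forall>k. C_k_on k V h"
      "\<forall>z\<in>(I \<times> \<phi> ` (U \<inter> W)) \<inter> V. g (fst z) (inv_into U \<phi> (snd z)) = h z"
    unfolding smooth_on_def by blast
  have "C_k_on (Suc 0) V h" using V(3) by blast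
  then have "h differentiable (at (t, \<phi> p))" using V(2) by simp
  then obtain D where D: "(h has_derivative D) (at (t, \<phi> p))" unfolding differentiable_def by blast
  obtain P Q where PQ: "open P" "open Q" "(t, \<phi> p) \<in> P \<times> Q" "P \<times> Q \<subseteq> V"
    by (rule open_prod_elim[OF V(1,2)])
  have "((\<lambda>s. (s, \<phi> p)) has_derivative (\<lambda>v. (v, 0))) (at t within I)" by (auto intro!: derivative_eq_intros)
  from has_derivative_compose[OF this D]
  have h: "((\<lambda>s. h (s, \<phi> p)) has_derivative (\<lambda>v. D (v, 0))) (at t within I)" .
  have "(\<lambda>v. D (v, 0)) = (*) (D (1, 0))"
    by (rule ext, rule linear_first_slot[OF bounded_linear.linear[OF has_derivative_bounded_linear[OF D]]])
  with h have "((\<lambda>s. h (s, \<phi> p)) has_real_derivative D (1, 0)) (at t within I)"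
    unfolding has_field_derivative_def by simp
  moreover obtain d where d: "d > 0" "ball t d \<subseteq> P" using PQ(1,3) open_contains_ball by blast
  have "h (s, \<phi> p) = g s p" if "s \<in> I" "dist s t < d" for s
  proof -
    have "s \<in> P" using that d by (auto simp: dist_commute)
    then have "(s, \<phi> p) \<in> (I \<times> \<phi> ` (U \<inter> W)) \<inter> V" using that(1) PQ p U(2) by auto
    from bspec[OF V(4) this] show ?thesis using chart_inv[OF U] by simp
  qed
  ultimately have "((\<lambda>s. g s p) has_real_derivative D (1, 0)) (at t within I)"
    by (rule has_field_derivative_transform_within[OF _ d(1) t])
  then show ?thesis ..
qed

end

context courant_gen
begin

text \<open>The neighbourhood \<open>snd z\<close> stays the same for every time radius up to
  \<open>fst z\<close>, so that finitely many boxes can be cut down to a common time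
  interval.\<close>

lemma flow_boxes_exist:
  assumes e: "tsection A E UNIV e"
  shows "\<exists>z. fst z > 0 \<and> open (snd z) \<and> p0 \<in> snd z \<and> (\<forall>\<delta>. 0 < \<delta> \<and> \<delta> \<le> fst z \<longrightarrow>
    (\<exists>U \<phi> \<Phi> H. courant_time.flow_box A E n gs gc {s0 - \<delta><..<s0 + \<delta>} e U \<phi> (snd z) \<Phi> H))"
proof -
  interpret U: courant_time A B c E n gs gc UNIV e
    by unfold_locales (auto simp: e)
  obtain U \<phi> N \<delta>0 and \<Phi> :: "real \<times> real \<times> 'm \<Rightarrow> 'm" and H :: "nat \<Rightarrow> nat \<Rightarrow> real \<times> real \<times> 'm \<Rightarrow> real"
    where lf: "(U, \<phi>) \<in> A" "open N" "p0 \<in> N" "N \<subseteq> U" "\<delta>0 > 0" "{s0 - \<delta>0<..<s0 + \<delta>0} \<subseteq> UNIV"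
    "smooth_on UNIV \<Phi>" "\<forall>k<n. \<forall>j. smooth_on UNIV (H k j)"
    "\<forall>s\<in>{s0 - \<delta>0<..<s0 + \<delta>0}. \<forall>q\<in>N. \<Phi> (0, (s, \<phi> q)) = \<phi> q"
    "\<forall>s\<in>{s0 - \<delta>0<..<s0 + \<delta>0}. \<forall>t\<in>{s0 - \<delta>0<..<s0 + \<delta>0}. \<forall>q\<in>N. \<Phi> (t - s, (s, \<phi> q)) \<in> \<phi> ` U"
    "\<forall>s\<in>{s0 - \<delta>0<..<s0 + \<delta>0}. \<forall>q\<in>N. integral_curve {s0 - \<delta>0<..<s0 + \<delta>0} (\<lambda>t p. an p (e t p))
        (\<lambda>t. inv_into U \<phi> (\<Phi> (t - s, (s, \<phi> q))))"
    "\<forall>k j z. H k j (0, z) = (if k = j then 1 else 0)"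
    "\<forall>s\<in>{s0 - \<delta>0<..<s0 + \<delta>0}. \<forall>t\<in>{s0 - \<delta>0<..<s0 + \<delta>0}. \<forall>q\<in>N. \<forall>k<n. \<forall>j.
      ((\<lambda>t. H k j (t - s, (s, \<phi> q))) has_real_derivative
        - (\<Sum>l<n. U.Gm k l t (inv_into U \<phi> (\<Phi> (t - s, (s, \<phi> q)))) * H l j (t - s, (s, \<phi> q)))) (at t)"
    by (rule local_flow[OF open_UNIV U.vfield_X UNIV_I U.Gm_smooth])
  have "\<exists>U \<phi> \<Phi> H. courant_time.flow_box A E n gs gc {s0 - \<delta><..<s0 + \<delta>} e U \<phi> N \<Phi> H" if \<delta>: "0 < \<delta>" "\<delta> \<le> \<delta>0" for \<delta>
  proof -
    interpret W: courant_time A B c E n gs gc "{s0 - \<delta><..<s0 + \<delta>}" e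
      by unfold_locales (auto intro: tsection_subset[OF e] simp: is_interval_oo)
    have sub: "{s0 - \<delta><..<s0 + \<delta>} \<subseteq> {s0 - \<delta>0<..<s0 + \<delta>0}" using \<delta> by auto
    have "W.flow_box U \<phi> N \<Phi> H"
      unfolding W.flow_box_def
    proof (intro conjI)
      show "\<forall>s\<in>{s0 - \<delta><..<s0 + \<delta>}. \<forall>q\<in>N. integral_curve {s0 - \<delta><..<s0 + \<delta>} (\<lambda>t p. an p (e t p))
        (\<lambda>t. inv_into U \<phi> (\<Phi> (t - s, (s, \<phi> q))))"
        using lf(11) sub by (intro ballI integral_curve_subset[OF _ sub]) blast
    qed (use lf sub in \<open>blast+\<close>)
    then show ?thesis by blast
  qed
  then show ?thesis using lf(2,3,5) by (intro exI[of _ "(\<delta>0, N)"]) simp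
qed

lemma local_flow_exists:
  assumes cpt: "compact (UNIV :: 'a set)" and e: "tsection A E UNIV e"
  obtains \<delta> where "\<delta> > 0" "courant_flow A B c E n gs gc {s0 - \<delta><..<s0 + \<delta>} e"
proof -
  have "\<forall>p. \<exists>z. fst z > 0 \<and> open (snd z) \<and> p \<in> snd z \<and> (\<forall>\<delta>. 0 < \<delta> \<and> \<delta> \<le> fst z \<longrightarrow>
    (\<exists>U \<phi> \<Phi> H. courant_time.flow_box A E n gs gc {s0 - \<delta><..<s0 + \<delta>} e U \<phi> (snd z) \<Phi> H))"
    by (intro allI flow_boxes_exist[OF e])
  from choice[OF this] obtain z where z: "\<forall>p. fst (z p) > 0 \<and> open (snd (z p)) \<and> p \<in> snd (z p) \<and>
    (\<forall>\<delta>. 0 < \<delta> \<and> \<delta> \<le> fst (z p) \<longrightarrow>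
    (\<exists>U \<phi> \<Phi> H. courant_time.flow_box A E n gs gc {s0 - \<delta><..<s0 + \<delta>} e U \<phi> (snd (z p)) \<Phi> H))"
    by (elim exE)
  have oz: "open (snd (z p))" "p \<in> snd (z p)" "fst (z p) > 0" for p using z by blast+
  obtain P where P: "finite P" "UNIV \<subseteq> (\<Union>p\<in>P. snd (z p))"
    by (rule compactE_image[OF cpt, of UNIV "\<lambda>p. snd (z p)"]) (use oz in auto)
  \<comment> \<open>The inserted 1 makes the minimum defined without an argument that
    \<open>P\<close> is nonempty.\<close>
  define \<delta> where "\<delta> = Min (insert 1 ((\<lambda>p. fst (z p)) ` P))"
  have \<delta>0: "\<delta> > 0" unfolding \<delta>_def using P(1) oz(3) by (subst Min_gr_iff) auto
  have \<delta>le: "\<delta> \<le> fst (z p)" if "p \<in> P" for p unfolding \<delta>_def using P(1) that by (intro Min_le) auto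
  interpret W: courant_time A B c E n gs gc "{s0 - \<delta><..<s0 + \<delta>}" e
    by unfold_locales (auto intro: tsection_subset[OF e] simp: is_interval_oo)
  have "courant_flow A B c E n gs gc {s0 - \<delta><..<s0 + \<delta>} e"
  proof unfold_locales
    fix q0
    obtain p where p: "p \<in> P" "q0 \<in> snd (z p)" using P(2) by blast
    then show "\<exists>U \<phi> N \<Phi> H. q0 \<in> N \<and> W.flow_box U \<phi> N \<Phi> H" using z[rule_format, of p] \<delta>0 \<delta>le[OF p(1)] by blast
  qed
  with \<delta>0 show ?thesis by (rule that)
qed

end

section \<open>The given path: its derivative, its generating section, isomorphism of the
  endpoints\<close>

locale gen_complex_path = courant_gen A B c E n gs gc
  for A :: "('a::{t2_space, second_countable_topology}, 'm::{banach, heine_borel}) atlas" and B c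
    and E :: "('a, 'v::real_normed_vector) courant" and n gs gc +
  fixes J :: "real \<Rightarrow> 'a \<Rightarrow> 'v \<Rightarrow> 'v" and \<beta> :: "real \<Rightarrow> 'a \<Rightarrow> 'v \<times> 'v \<Rightarrow> complex"
  assumes compact_base: "compact (UNIV :: 'a set)"
    and J: "\<And>t. t \<in> {0..1} \<Longrightarrow> gen_complex A E (J t)"
    and J_smooth: "smooth_endo_path A E J"
    and \<beta>_smooth: "smooth_dual_path A E J \<beta>"
    and omega_exact: "\<And>t v w p. t \<in> {0..1} \<Longrightarrow> v \<in> L_sections A E (J t) \<Longrightarrow> w \<in> L_sections A E (J t) \<Longrightarrow>
      omega_dot E J t v w p = d_L E (\<beta> t) v w p"
begin

text \<open>\<open>J_dot\<close> is a derivative in the norm of \<open>'v\<close>. In a frame at p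
  it is the derivative of the real coordinates, with frame vectors that do not move; so it stays in
  the fibre and commutes with every functional that is linear on the fibre.\<close>

lemma
  assumes t: "t \<in> {0..1}" and x: "x \<in> fib E p"
  shows J_dot_fib: "J_dot J t p x \<in> fib E p"
    and J_dot_functional: "(\<And>x y. x \<in> fib E p \<Longrightarrow> y \<in> fib E p \<Longrightarrow> f (x + y) = f x + f y) \<Longrightarrow>
      (\<And>k x. x \<in> fib E p \<Longrightarrow> f (k *\<^sub>R x) = k * f x) \<Longrightarrow>
      ((\<lambda>s. f (J s p x)) has_real_derivative f (J_dot J t p x)) (at t within {0..1})"
proof -
  obtain U e where U: "(U, e) \<in> frames E" "p \<in> U" by (rule frame_ex)
  have ef: "e j p \<in> fib E p" if "j < r" for j by (rule frame_in[OF U that])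
  have "\<exists>D. ((\<lambda>s. coord r e p (J s p x) j) has_real_derivative D) (at t within {0..1})" if j: "j < r" for j
  proof -
    have "\<exists>D. ((\<lambda>s. coord r e p (J s p (e i p)) j) has_real_derivative D) (at t within {0..1})" if i: "i < r" for i
    proof (rule tsmooth_has_derivative_within[OF _ t U(2)])
      show "tsmooth A {0..1} U (\<lambda>s p. coord r e p (J s p (e i p)) j)"
        using J_smooth U(1) i j unfolding smooth_endo_path_def smooth_path_on_tsmooth by blast
    qed
    then obtain D where D: "\<And>i. i < r \<Longrightarrow> ((\<lambda>s. coord r e p (J s p (e i p)) j) has_real_derivative D i) (at t within {0..1})"
      by metis
    have "((\<lambda>s. \<Sum>i<r. coord r e p x i * coord r e p (J s p (e i p)) j) has_real_derivative
        (\<Sum>i<r. coord r e p x i * D i)) (at t within {0..1})"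
      by (intro DERIV_sum DERIV_cmult D) auto
    then have "((\<lambda>s. coord r e p (J s p x) j) has_real_derivative (\<Sum>i<r. coord r e p x i * D i)) (at t within {0..1})"
      by (rule has_field_derivative_transform_within[OF _ zero_less_one t])
         (rule coord_endo[OF gen_complexD(1)[OF J] U x, symmetric])
    then show ?thesis ..
  qed
  then obtain D where D: "\<And>j. j < r \<Longrightarrow> ((\<lambda>s. coord r e p (J s p x) j) has_real_derivative D j) (at t within {0..1})"
    by metis
  have exp: "J s p x = (\<Sum>j<r. coord r e p (J s p x) j *\<^sub>R e j p)" if "s \<in> {0..1}" for s
    by (rule coord_expand[OF U gen_complexD(2)[OF J[OF that] x]])
  have "((\<lambda>s. \<Sum>j<r. coord r e p (J s p x) j *\<^sub>R e j p) has_vector_derivative (\<Sum>j<r. D j *\<^sub>R e j p)) (at t within {0..1})"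
  proof (rule has_vector_derivative_sum)
    fix j assume "j \<in> {..<r}"
    then have j: "j < r" by simp
    show "((\<lambda>s. coord r e p (J s p x) j *\<^sub>R e j p) has_vector_derivative D j *\<^sub>R e j p) (at t within {0..1})"
      using has_vector_derivative_scaleR[OF D[OF j] has_vector_derivative_const[of "e j p"]] by simp
  qed
  then have "((\<lambda>s. J s p x) has_vector_derivative (\<Sum>j<r. D j *\<^sub>R e j p)) (at t within {0..1})"
    by (rule has_vector_derivative_transform[OF t exp, rotated])
  then have Jd: "J_dot J t p x = (\<Sum>j<r. D j *\<^sub>R e j p)"
    unfolding J_dot_def using t by (intro vector_derivative_within_cbox[of 0 1, unfolded interval_cbox[symmetric]]) auto
  show "J_dot J t p x \<in> fib E p" unfolding Jd using ef by (intro fib_sum fib_scale) auto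
  assume add: "\<And>x y. x \<in> fib E p \<Longrightarrow> y \<in> fib E p \<Longrightarrow> f (x + y) = f x + f y"
    and scale: "\<And>k x. x \<in> fib E p \<Longrightarrow> f (k *\<^sub>R x) = k * f x"
  have fs: "f (\<Sum>j<r. k j *\<^sub>R e j p) = (\<Sum>j<r. k j * f (e j p))" for k
    by (rule functional_sum[OF add scale ef])
  have "((\<lambda>s. \<Sum>j<r. coord r e p (J s p x) j * f (e j p)) has_real_derivative (\<Sum>j<r. D j * f (e j p))) (at t within {0..1})"
    by (intro DERIV_sum DERIV_cmult_right D) auto
  then show "((\<lambda>s. f (J s p x)) has_real_derivative f (J_dot J t p x)) (at t within {0..1})"
    unfolding Jd fs
  proof (rule has_field_derivative_transform_within[OF _ zero_less_one t])
    fix s :: real assume "s \<in> {0..1}"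
    then show "(\<Sum>j<r. coord r e p (J s p x) j * f (e j p)) = f (J s p x)"
      using exp fs[of "\<lambda>j. coord r e p (J s p x) j"] by simp
  qed
qed

lemma J_dot_skew:
  assumes t: "t \<in> {0..1}" and x: "x \<in> fib E p" and y: "y \<in> fib E p"
  shows "pr p (J_dot J t p x) y = - pr p x (J_dot J t p y)"
proof (rule has_derivative_within_unit_unique[OF t])
  show "((\<lambda>s. pr p (J s p x) y) has_real_derivative pr p (J_dot J t p x) y) (at t within {0..1})"
    by (rule J_dot_functional[OF t x]) (auto simp: pl_add pl_scale y)
  show "((\<lambda>s. - pr p x (J s p y)) has_real_derivative - pr p x (J_dot J t p y)) (at t within {0..1})"
    by (intro DERIV_minus J_dot_functional[OF t y]) (auto simp: pr_add pr_scale x)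
  show "pr p (J s p x) y = - pr p x (J s p y)" if "s \<in> {0..1}" for s
    by (rule gen_complexD(6)[OF J[OF that] x y])
qed

text \<open>Obtained by differentiating orthogonality of \<open>J\<close> and using skewness of the
  derivative. The frame expansion turns the pairing of two moving vectors into a sum of products of
  real functions.\<close>

lemma J_dot_anticommute:
  assumes t: "t \<in> {0..1}" and x: "x \<in> fib E p"
  shows "J_dot J t p (J t p x) = - J t p (J_dot J t p x)"
proof (rule fib_eqI)
  let ?K = "J_dot J t p"
  note Jf = gen_complexD(2)[OF J[OF t]] and Kf = J_dot_fib[OF t]
  show "?K (J t p x) \<in> fib E p" "- J t p (?K x) \<in> fib E p" by (intro Kf Jf fib_neg x)+
  fix z assume z: "z \<in> fib E p"
  obtain U e where U: "(U, e) \<in> frames E" "p \<in> U" by (rule frame_ex)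
  have ef: "e j p \<in> fib E p" if "j < r" for j by (rule frame_in[OF U that])
  have exp: "pr p u w = (\<Sum>j<r. coord r e p u j * pr p (e j p) w)" if "u \<in> fib E p" "w \<in> fib E p" for u w
    using functional_sum[of p "\<lambda>u. pr p u w" r "\<lambda>j. e j p" "coord r e p u", OF pl_add[OF that(2)] pl_scale[OF that(2)] ef]
      coord_expand[OF U that(1)] by simp
  have "(\<Sum>j<r. coord r e p (?K x) j * pr p (e j p) (J t p z) + pr p (e j p) (?K z) * coord r e p (J t p x) j) = 0"
  proof (rule has_derivative_within_unit_unique[OF t])
    show "((\<lambda>s. \<Sum>j<r. coord r e p (J s p x) j * pr p (e j p) (J s p z)) has_real_derivative
      (\<Sum>j<r. coord r e p (?K x) j * pr p (e j p) (J t p z) + pr p (e j p) (?K z) * coord r e p (J t p x) j)) (at t within {0..1})"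
      by (intro DERIV_sum DERIV_mult J_dot_functional[OF t x, where f = "\<lambda>u. coord r e p u _"]
            J_dot_functional[OF t z, where f = "\<lambda>u. pr p (e _ p) u"])
         (auto simp: coord_add[OF U] coord_scale[OF U] pr_add pr_scale ef)
    show "((\<lambda>s. pr p x z) has_real_derivative 0) (at t within {0..1})" by simp
    show "(\<Sum>j<r. coord r e p (J s p x) j * pr p (e j p) (J s p z)) = pr p x z" if "s \<in> {0..1}" for s
      using exp[of "J s p x" "J s p z"] gen_complexD(2,5)[OF J[OF that]] x z by simp
  qed
  then have "pr p (?K x) (J t p z) + pr p (J t p x) (?K z) = 0"
    using exp[OF Kf[OF x] Jf[OF z]] exp[OF Jf[OF x] Kf[OF z]] by (simp add: sum.distrib mult.commute)
  then show "pr p (?K (J t p x)) z = pr p (- J t p (?K x)) z"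
    using J_dot_skew[OF t Jf[OF x] z] gen_complexD(6)[OF J[OF t] Kf[OF x] z] pl_minus[OF z Jf[OF Kf[OF x]]] by simp
qed

text \<open>Reparametrizing time by \<open>sin\<^sup>2\<close> extends the path smoothly to all of the real line.\<close>

definition Jr :: "real \<Rightarrow> 'a \<Rightarrow> 'v \<Rightarrow> 'v" where
  "Jr t = J ((sin t)\<^sup>2)"

lemma sin_sq_unit: "(sin t)\<^sup>2 \<in> {0..1::real}"
  by (simp add: abs_square_le_1)

lemma sin_sq_smooth: "smooth_on (UNIV :: real set) (\<lambda>t. (sin t)\<^sup>2)"
  unfolding power2_eq_square by (intro smooth_on_mult smooth_on_sin_cos open_UNIV)

lemmas Jr_gen_complex = J[OF sin_sq_unit, folded Jr_def]

lemma Jr_tsection: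
  assumes I: "open I" and b: "tsection A E I b"
  shows "tsection A E I (\<lambda>t p. Jr t p (b t p))"
proof (rule endo_tsection[OF I gen_complexD(1)[OF Jr_gen_complex] _ b])
  fix U e i j assume U: "(U, e) \<in> frames E" and ij: "i < r" "j < r"
  have "tsmooth A {0..1} U (\<lambda>s p. coord r e p (J s p (e i p)) j)"
    using J_smooth U ij unfolding smooth_endo_path_def smooth_path_on_tsmooth by blast
  from tsmooth_reparam[OF I frame_open[OF U] this sin_sq_smooth]
  show "tsmooth A I U (\<lambda>t p. coord r e p (Jr t p (e i p)) j)"
    unfolding Jr_def using sin_sq_unit by blast
qed

lemma Jr_functional:
  assumes x: "x \<in> fib E p" and f: "\<And>x y. x \<in> fib E p \<Longrightarrow> y \<in> fib E p \<Longrightarrow> f (x + y) = f x + f y"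
      "\<And>k x. x \<in> fib E p \<Longrightarrow> f (k *\<^sub>R x) = k * f x"
  shows "((\<lambda>s. f (Jr s p x)) has_real_derivative (2 * sin t * cos t) * f (J_dot J ((sin t)\<^sup>2) p x)) (at t)"
proof -
  \<comment> \<open>At the ends of [0,1] only a one-sided derivative exists, so the chain rule is
    used with the derivative within the range of the squared sine.\<close>
  have "((\<lambda>s. f (J s p x)) has_real_derivative f (J_dot J ((sin t)\<^sup>2) p x)) (at ((sin t)\<^sup>2) within range (\<lambda>t. (sin t)\<^sup>2))"
    by (rule has_field_derivative_subset[OF J_dot_functional[OF sin_sq_unit x f]]) (use sin_sq_unit in auto)
  moreover have "((\<lambda>t. (sin t)\<^sup>2) has_real_derivative 2 * sin t * cos t) (at t)"
    by (auto intro!: derivative_eq_intros)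
  ultimately have "((\<lambda>s. f (J s p x)) \<circ> (\<lambda>t. (sin t)\<^sup>2) has_real_derivative
      f (J_dot J ((sin t)\<^sup>2) p x) * (2 * sin t * cos t)) (at t)"
    by (rule DERIV_image_chain)
  then show ?thesis by (simp add: o_def Jr_def mult_ac)
qed

text \<open>Both \<open>Jr\<close> and the section move. Pairing with a fixed section
  \<open>z\<close> and shifting \<open>Jr\<close> to it by skewness separates the two dependences,
  and \<open>pair_deriv\<close> applies.\<close>

lemma Jr_tder:
  assumes I: "open I" and b: "tsection A E I b" and t: "t \<in> I"
  shows "tder (\<lambda>t p. Jr t p (b t p)) t p = Jr t p (tder b t p) + (2 * sin t * cos t) *\<^sub>R J_dot J ((sin t)\<^sup>2) p (b t p)"
proof (rule fib_eqI)
  let ?K = "J_dot J ((sin t)\<^sup>2) p" and ?k = "2 * sin t * cos t"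
  note Jb = Jr_tsection[OF I b] and JD = gen_complexD[OF Jr_gen_complex]
  have bf: "b t p \<in> fib E p" "tder b t p \<in> fib E p"
    using tsectionD(1)[OF b t] tsectionD(1)[OF tsection_tder[OF I b] t] by auto
  have Kf: "?K x \<in> fib E p" if "x \<in> fib E p" for x by (rule J_dot_fib[OF sin_sq_unit that])
  show "tder (\<lambda>t p. Jr t p (b t p)) t p \<in> fib E p" by (rule tsectionD(1)[OF tsection_tder[OF I Jb] t])
  show "Jr t p (tder b t p) + ?k *\<^sub>R ?K (b t p) \<in> fib E p" by (intro fib_add fib_scale JD(2) Kf bf)
  fix z0 assume "z0 \<in> fib E p"
  then obtain z where z: "z \<in> \<Gamma>" "z p = z0" by (rule section_through)
  have zf: "z p \<in> fib E p" by (rule sections_fib[OF z(1)])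
  note Jz = Jr_tsection[OF I sections_tsection[OF z(1)]]
  have dz: "pr p (b t p) (tder (\<lambda>t p. Jr t p (z p)) t p) = ?k * pr p (b t p) (?K (z p))"
  proof (rule DERIV_unique)
    show "((\<lambda>s. pr p (b t p) (Jr s p (z p))) has_real_derivative pr p (b t p) (tder (\<lambda>t p. Jr t p (z p)) t p)) (at t)"
      by (rule lin_deriv[OF I Jz t]) (auto simp: pr_add pr_scale bf)
    show "((\<lambda>s. pr p (b t p) (Jr s p (z p))) has_real_derivative ?k * pr p (b t p) (?K (z p))) (at t)"
      by (rule Jr_functional[OF zf]) (auto simp: pr_add pr_scale bf)
  qed
  have "pr p (tder (\<lambda>t p. Jr t p (b t p)) t p) (z p) = - (pr p (tder b t p) (Jr t p (z p)) + ?k * pr p (b t p) (?K (z p)))"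
  proof (rule DERIV_unique)
    show "((\<lambda>s. pr p (Jr s p (b s p)) (z p)) has_real_derivative pr p (tder (\<lambda>t p. Jr t p (b t p)) t p) (z p)) (at t)"
      by (rule lin_deriv[OF I Jb t]) (auto simp: pl_add pl_scale zf)
    have "((\<lambda>s. - pr p (b s p) (Jr s p (z p))) has_real_derivative
        - (pr p (tder b t p) (Jr t p (z p)) + ?k * pr p (b t p) (?K (z p)))) (at t)"
      using DERIV_minus[OF pair_deriv[OF I b Jz t, of p]] by (simp only: dz)
    then show "((\<lambda>s. pr p (Jr s p (b s p)) (z p)) has_real_derivative
        - (pr p (tder b t p) (Jr t p (z p)) + ?k * pr p (b t p) (?K (z p)))) (at t)"
      by (rule has_field_derivative_transform_within_open[OF _ I t]) (simp add: JD(6) tsectionD(1)[OF b] zf)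
  qed
  also have "\<dots> = pr p (Jr t p (tder b t p) + ?k *\<^sub>R ?K (b t p)) (z p)"
    using bf zf JD(2) Kf by (simp add: pl_add pl_scale fib_scale JD(6) J_dot_skew[OF sin_sq_unit])
  finally show "pr p (tder (\<lambda>t p. Jr t p (b t p)) t p) z0 = pr p (Jr t p (tder b t p) + ?k *\<^sub>R ?K (b t p)) z0"
    by (simp add: z(2))
qed

text \<open>The section is y, taken at the reparametrized time, multiplied by minus the derivative
  of the squared sine. By \<open>endo_eq_dorf_derivative\<close> its Dorfman action on
  \<open>Jr\<close> then cancels the time derivative of \<open>Jr\<close>, which is the commutation
  required by \<open>ph_commutes\<close>.\<close>

lemma generating_section:
  obtains e where "tsection A E UNIV e"
    "\<And>I b t p. open I \<Longrightarrow> tsection A E I b \<Longrightarrow> t \<in> I \<Longrightarrow> tder (\<lambda>t p. Jr t p (b t p)) t p + dorf (e t) (\<lambda>p. Jr t p (b t p)) p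
      = Jr t p (tder b t p + dorf (e t) (b t) p)"
proof -
  obtain b0 where b0: "tsection A E {0..1} (\<lambda>t p. snd (b0 t p))"
    "\<And>t p. t \<in> {0..1} \<Longrightarrow> b0 t p \<in> Lbar E (J t) p"
    "\<And>t p v. t \<in> {0..1} \<Longrightarrow> v \<in> Lbun E (J t) p \<Longrightarrow> \<beta> t p v = pairing_C E p (b0 t p) v"
    using \<beta>_smooth unfolding smooth_dual_path_def smooth_section_path_tsection by blast
  define y where "y t p = snd (b0 t p)" for t p
  have y: "y t \<in> \<Gamma>" if "t \<in> {0..1}" for t
    unfolding sections_iff
    using tsection_reparam[OF open_UNIV b0(1) smooth_on_const[OF open_UNIV], of t] that by (simp add: y_def[abs_def])
  define e where "e t p = - (2 * sin t * cos t) *\<^sub>R y ((sin t)\<^sup>2) p" for t p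
  have "smooth_on (UNIV::real set) (\<lambda>t. - (2 * sin t * cos t))"
    by (intro smooth_on_minus smooth_on_mult smooth_on_const smooth_on_sin_cos open_UNIV)
  from tsection_time_scale[OF open_UNIV this tsection_reparam[OF open_UNIV b0(1) sin_sq_smooth]]
  have e: "tsection A E UNIV e" unfolding e_def[abs_def] y_def using sin_sq_unit by blast
  show ?thesis
  proof (rule that[OF e])
    fix I b t p assume I: "open I" and b: "tsection A E I b" and t: "t \<in> I"
    let ?k = "2 * sin t * cos t" and ?u = "(sin t)\<^sup>2"
    let ?K = "J_dot J ?u"
    note JD = gen_complexD[OF Jr_gen_complex[of t]]
    have bt: "b t \<in> \<Gamma>" by (rule tsection_sections[OF I b t])
    note yu = y[OF sin_sq_unit, of t]
    have K: "?K p (b t p) = dorf (y ?u) (\<lambda>q. Jr t q (b t q)) p - Jr t p (dorf (y ?u) (b t) p)"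
      unfolding y_def Jr_def
    proof (rule endo_eq_dorf_derivative[where \<xi> = "\<beta> ?u" and K = ?K])
      show "gen_complex A E (J ?u)" by (rule J[OF sin_sq_unit])
      show "pairing_C E p (v p) (map_prod (?K p) (?K p) (w p)) = d_L E (\<beta> ?u) v w p"
        if "v \<in> L_sections A E (J ?u)" "w \<in> L_sections A E (J ?u)" for v w p
        using omega_exact[OF sin_sq_unit that] by (simp add: omega_dot_def)
      show "(\<lambda>p. snd (b0 ?u p)) \<in> \<Gamma>" using yu by (simp add: y_def[abs_def])
    qed (use J_dot_fib J_dot_skew J_dot_anticommute b0(2,3) bt sin_sq_unit in blast)+
    have d: "dorf (e t) x p = - ?k *\<^sub>R dorf (y ?u) x p" if "x \<in> \<Gamma>" for x
      using dorf_cmult_l[OF yu that, of "- ?k" p] by (simp add: e_def[abs_def])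
    have df: "dorf (y ?u) (b t) p \<in> fib E p" "tder b t p \<in> fib E p"
      using sections_fib[OF dorf_sec[OF yu bt]] tsectionD(1)[OF tsection_tder[OF I b] t] by auto
    have "Jr t p (tder b t p + - ?k *\<^sub>R dorf (y ?u) (b t) p) = Jr t p (tder b t p) + - ?k *\<^sub>R Jr t p (dorf (y ?u) (b t) p)"
      using JD(1)[of p] df fib_scale[OF df(1), of "- ?k"] unfolding linear_between_def by metis
    then show "tder (\<lambda>t p. Jr t p (b t p)) t p + dorf (e t) (\<lambda>p. Jr t p (b t p)) p = Jr t p (tder b t p + dorf (e t) (b t) p)"
      unfolding Jr_tder[OF I b t] d[OF bt] d[OF JD(7)[OF bt]] K by (simp add: scaleR_diff_right)
  qed
qed

text \<open>Phrased with \<open>smooth_auto\<close>, so that transitivity follows from closure under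
  composition.\<close>

definition isomorphic :: "('a \<Rightarrow> 'v \<Rightarrow> 'v) \<Rightarrow> ('a \<Rightarrow> 'v \<Rightarrow> 'v) \<Rightarrow> bool" where
  "isomorphic K K' \<longleftrightarrow> (\<exists>F \<phi>. smooth_auto F \<phi> \<and> (\<forall>p. \<forall>x\<in>fib E p. K' (F p) (\<phi> p x) = \<phi> p (K p x)))"

lemma isomorphic_trans:
  assumes "isomorphic K K'" "isomorphic K' K''"
  shows "isomorphic K K''"
proof -
  obtain F \<phi> where F: "smooth_auto F \<phi>" "\<forall>p. \<forall>x\<in>fib E p. K' (F p) (\<phi> p x) = \<phi> p (K p x)"
    using assms(1) unfolding isomorphic_def by blast
  obtain G \<psi> where G: "smooth_auto G \<psi>" "\<forall>p. \<forall>x\<in>fib E p. K'' (G p) (\<psi> p x) = \<psi> p (K' p x)"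
    using assms(2) unfolding isomorphic_def by blast
  have "K'' (G (F p)) (\<psi> (F p) (\<phi> p x)) = \<psi> (F p) (\<phi> p (K p x))" if "x \<in> fib E p" for p x
    using F(2) G(2) smooth_auto_fib[OF F(1) that] that by simp
  then show ?thesis unfolding isomorphic_def using smooth_auto_compose[OF F(1) G(1)] by blast
qed

lemma locally_isomorphic: "\<exists>\<delta>>0. \<forall>s\<in>{s0 - \<delta><..<s0 + \<delta>}. \<forall>t\<in>{s0 - \<delta><..<s0 + \<delta>}. isomorphic (Jr s) (Jr t)"
proof -
  obtain e where e: "tsection A E UNIV e"
    "\<And>I b t p. open I \<Longrightarrow> tsection A E I b \<Longrightarrow> t \<in> I \<Longrightarrow> tder (\<lambda>t p. Jr t p (b t p)) t p + dorf (e t) (\<lambda>p. Jr t p (b t p)) p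
      = Jr t p (tder b t p + dorf (e t) (b t) p)"
    by (rule generating_section) blast
  obtain \<delta> where \<delta>: "\<delta> > 0" "courant_flow A B c E n gs gc {s0 - \<delta><..<s0 + \<delta>} e"
    by (rule local_flow_exists[OF compact_base e(1)])
  interpret F: courant_flow A B c E n gs gc "{s0 - \<delta><..<s0 + \<delta>}" e by (rule \<delta>(2))
  have "isomorphic (Jr s) (Jr t)" if s: "s \<in> {s0 - \<delta><..<s0 + \<delta>}" and t: "t \<in> {s0 - \<delta><..<s0 + \<delta>}" for s t
  proof -
    have "Jr t (F.Fl s t p) (F.ph s t p x) = F.ph s t p (Jr s p x)" if "x \<in> fib E p" for p x
    proof (rule F.ph_commutes[OF _ _ _ _ s t that])
      show "linear_between (fib E p) (fib E p) (Jr t p)" for t p by (rule gen_complexD(1)[OF Jr_gen_complex])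
      show "pr p (Jr t p x) y = - pr p x (Jr t p y)" if "x \<in> fib E p" "y \<in> fib E p" for t p x y
        by (rule gen_complexD(6)[OF Jr_gen_complex that])
    qed (use Jr_tsection[OF F.I(1)] e(2)[OF F.I(1)] in \<open>unfold F.Dt_def, blast+\<close>)
    then show ?thesis unfolding isomorphic_def using F.smooth_auto_Fl[OF s t] by blast
  qed
  then show ?thesis using \<delta>(1) by blast
qed

text \<open>Isomorphism is transitive and holds locally in time in both orders, so connectedness of
  the real line extends it to all pairs of times; the squared sine is 0 at 0 and 1 at
  \<open>pi / 2\<close>.\<close>

lemma endpoints_isomorphic: "isomorphic (J 0) (J 1)"
proof -
  have "isomorphic (Jr 0) (Jr (pi / 2))"
  proof (rule connected_equivalence_relation_gen[of UNIV 0 "pi / 2" "\<lambda>_. True" "\<lambda>s t. isomorphic (Jr s) (Jr t)"])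
    show "isomorphic (Jr s) (Jr u)" if "isomorphic (Jr s) (Jr t)" "isomorphic (Jr t) (Jr u)" for s t u
      by (rule isomorphic_trans[OF that])
    fix s0 :: real
    obtain \<delta> where \<delta>: "\<delta> > 0" "\<forall>s\<in>{s0 - \<delta><..<s0 + \<delta>}. \<forall>t\<in>{s0 - \<delta><..<s0 + \<delta>}. isomorphic (Jr s) (Jr t)"
      using locally_isomorphic by blast
    then show "\<exists>T. openin (top_of_set UNIV) T \<and> s0 \<in> T \<and> (\<forall>x\<in>T. \<forall>y\<in>T. True \<and> True \<longrightarrow> isomorphic (Jr x) (Jr y))"
      by (intro exI[of _ "{s0 - \<delta><..<s0 + \<delta>}"]) auto
  qed auto
  then show ?thesis by (simp add: Jr_def)
qed

end

theorem theorem4p4: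
  fixes A :: "('a::{t2_space, second_countable_topology}, 'm::{banach, heine_borel}) atlas"
    and E :: "('a, 'v::real_normed_vector) courant"
    and J :: "real \<Rightarrow> 'a \<Rightarrow> 'v \<Rightarrow> 'v"
    and J\<^sub>0 J\<^sub>1 :: "'a \<Rightarrow> 'v \<Rightarrow> 'v"
    and \<beta> :: "real \<Rightarrow> 'a \<Rightarrow> 'v \<times> 'v \<Rightarrow> complex"
  assumes "smooth_manifold A" and "compact (UNIV :: 'a set)"
    and "courant_algebroid A E"
    and "gen_complex A E J\<^sub>0" and "gen_complex A E J\<^sub>1"
    and "\<forall>t\<in>{0..1}. gen_complex A E (J t)"
    and "smooth_endo_path A E J"
    and "\<forall>p. \<forall>x\<in>fib E p. J 0 p x = J\<^sub>0 p x" and "\<forall>p. \<forall>x\<in>fib E p. J 1 p x = J\<^sub>1 p x"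
    and "smooth_dual_path A E J \<beta>"
    and "\<forall>t\<in>{0..1}. \<forall>v\<in>L_sections A E (J t). \<forall>w\<in>L_sections A E (J t). \<forall>p.
           omega_dot E J t v w p = d_L E (\<beta> t) v w p"
  shows "gen_complex_isomorphic A E J\<^sub>0 J\<^sub>1"
proof -
  have "fin_dim TYPE('m)" using assms(1) unfolding smooth_manifold_def fin_dim_def by blast
  then obtain B :: "'m set" and c where B: "finite B" "\<And>b. b \<in> B \<Longrightarrow> bounded_linear (c b)" "\<And>x. x = (\<Sum>b\<in>B. c b x *\<^sub>R b)"
    by (rule fin_dim_coordinates) blast
  have vbE: "vector_bundle A E" using assms(3) by (simp add: courant_algebroid_def)
  interpret M: courant_mfd A B c E
    by (intro courant_mfd.intro bundle_mfd.intro smooth_mfd.intro bundle_mfd_axioms.intro courant_mfd_axioms.intro)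
       (fact assms(1) B vbE assms(3))+
  obtain n gs gc where "courant_gen A B c E n gs gc"
  proof (rule M.generators_exist[OF assms(2)], goal_cases)
    case (1 n gs gc)
    show ?case by (rule 1(1), unfold_locales) (fact 1)+
  qed
  then interpret G: courant_gen A B c E n gs gc .
  interpret P: gen_complex_path A B c E n gs gc J \<beta>
    by unfold_locales (use assms(2,6,7,10,11) in blast)+
  obtain F \<phi> where F: "M.smooth_auto F \<phi>" "\<forall>p. \<forall>x\<in>fib E p. J 1 (F p) (\<phi> p x) = \<phi> p (J 0 p x)"
    using P.endpoints_isomorphic unfolding P.isomorphic_def by blast
  have "inv_into (fib E p) (\<phi> p) (J\<^sub>1 (F p) (\<phi> p x)) = J\<^sub>0 p x" if x: "x \<in> fib E p" for p x
  proof -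
    \<comment> \<open>\<open>J 0\<close> and \<open>J 1\<close> agree with \<open>J\<^sub>0\<close>
      and \<open>J\<^sub>1\<close> on the fibres only, so the transported vector has to be known to
      lie in its fibre.\<close>
    have "J\<^sub>1 (F p) (\<phi> p x) = \<phi> p (J\<^sub>0 p x)" using F(2) assms(8,9) M.smooth_auto_fib[OF F(1) x] x by metis
    moreover have "inj_on (\<phi> p) (fib E p)" using M.smooth_autoD(7)[OF F(1)] bij_betw_def by blast
    ultimately show ?thesis using M.gen_complexD(2)[OF assms(4) x] by (simp add: inv_into_f_f)
  qed
  then show ?thesis
    unfolding gen_complex_isomorphic_def using M.smooth_auto_courant[OF F(1)] by blast
qed

end
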